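(* Let $T>0$ and $\sigma\in L^\infty([0,T]\times\mathbb{T}^d)$. Suppose $u_1,u_2$ are vector fields on $[0,T]\times\mathbb{T}^d$ with $u_i(t,\cdot)=\nabla\phi_i(t,\cdot)$ for scalar $\phi_i$, $\int_{\mathbb{T}^d}u_i(t,x)dx=0$, $u_i,\operatorname{div}u_i\in L^\infty([0,T]\times\mathbb{T}^d)$, $\nabla u_i\in L^\infty(0,T;BMO(\mathbb{T}^d))$, and such that \[ \operatorname{div}u_i(t,x_i(t,y))=\sigma(t,y)\quad\text{for a.e. }(t,y), \] where $x_i$ is the regular Lagrangian flow of $u_i$ ($\dot x_i=u_i(t,x_i)$, $x_i(0,y)=y$). Then $u_1=u_2$ a.e. on $[0,T]\times\mathbb{T}^d$.
   Context: $BMO(\mathbb{T}^d)$: $f\in L^1$ with $\|f\|_{BMO}=\sup_Q\frac1{|Q|}\int_Q|f-\{f\}_Q|\,dx<\infty$ over cubes $Q$. Regular Lagrangian flow of $b$: a measurable $X:[0,T]\times\mathbb{T}^d\to\mathbb{T}^d$ with $t\mapsto X(t,y)$ absolutely continuous for a.e. $y$, $X(0,y)=y$, $\partial_tX=b(t,X)$ a.e., and $|\{y:X(t,y)\in A\}|\le L|A|$ for some $L$, all Borel $A$, all $t$; it exists and is unique for fields of the stated regularity. *)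

theory Defs
  imports "HOL-Analysis.Analysis"
begin

text \<open>The torus T^d is represented by Z^d-periodic functions on real^'d;
  the unit cube cbox 0 One is a fundamental domain.\<close>

definition periodic :: "(real^'d \<Rightarrow> 'b) \<Rightarrow> bool" where
  "periodic f \<longleftrightarrow> (\<forall>x k. (\<forall>j. k $ j \<in> \<int>) \<longrightarrow> f (x + k) = f x)"

definition loc_int :: "(real^'d \<Rightarrow> real) \<Rightarrow> bool" where
  "loc_int f \<longleftrightarrow> (\<forall>K. compact K \<longrightarrow> f absolutely_integrable_on K)"

definition dpart :: "(real^'d \<Rightarrow> real) \<Rightarrow> 'd \<Rightarrow> real^'d \<Rightarrow> real" where
  "dpart \<psi> j x = frechet_derivative \<psi> (at x) (axis j 1)"

definition test_fun :: "(real^'d \<Rightarrow> real) \<Rightarrow> bool" where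
  "test_fun \<psi> \<longleftrightarrow> (\<exists>K. compact K \<and> (\<forall>x. x \<notin> K \<longrightarrow> \<psi> x = 0))
     \<and> (\<forall>x. \<psi> differentiable (at x))
     \<and> (\<forall>j. continuous_on UNIV (dpart \<psi> j))"

definition weak_partial :: "(real^'d \<Rightarrow> real) \<Rightarrow> 'd \<Rightarrow> (real^'d \<Rightarrow> real) \<Rightarrow> bool" where
  "weak_partial f j g \<longleftrightarrow> loc_int f \<and> loc_int g \<and>
     (\<forall>\<psi>. test_fun \<psi> \<longrightarrow>
        integral UNIV (\<lambda>x. f x * dpart \<psi> j x) = - integral UNIV (\<lambda>x. g x * \<psi> x))"

definition weak_grad :: "(real^'d \<Rightarrow> real) \<Rightarrow> (real^'d \<Rightarrow> real^'d) \<Rightarrow> bool" where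
  "weak_grad \<phi> u \<longleftrightarrow> (\<forall>j. weak_partial \<phi> j (\<lambda>x. u x $ j))"

definition weak_jac :: "(real^'d \<Rightarrow> real^'d) \<Rightarrow> (real^'d \<Rightarrow> real^'d^'d) \<Rightarrow> bool" where
  "weak_jac u G \<longleftrightarrow> (\<forall>i j. weak_partial (\<lambda>x. u x $ i) j (\<lambda>x. G x $ i $ j))"

definition weak_div :: "(real^'d \<Rightarrow> real^'d) \<Rightarrow> (real^'d \<Rightarrow> real) \<Rightarrow> bool" where
  "weak_div u D \<longleftrightarrow> (\<forall>j. loc_int (\<lambda>x. u x $ j)) \<and> loc_int D \<and>
     (\<forall>\<psi>. test_fun \<psi> \<longrightarrow>
        integral UNIV (\<lambda>x. \<Sum>j\<in>UNIV. u x $ j * dpart \<psi> j x) = - integral UNIV (\<lambda>x. D x * \<psi> x))"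

definition bmo_le :: "(real^'d \<Rightarrow> real) \<Rightarrow> real \<Rightarrow> bool" where
  "bmo_le f C \<longleftrightarrow> f absolutely_integrable_on cbox 0 One \<and>
     (\<forall>a r. r > 0 \<longrightarrow>
        (let Q = cbox a (a + r *\<^sub>R One);
             avg = integral Q f / measure lborel Q
         in f absolutely_integrable_on Q \<and>
            integral Q (\<lambda>x. \<bar>f x - avg\<bar>) / measure lborel Q \<le> C))"

definition linf :: "real \<Rightarrow> (real^'d) set \<Rightarrow> (real \<Rightarrow> real^'d \<Rightarrow> 'b::euclidean_space) \<Rightarrow> bool" where
  "linf T S F \<longleftrightarrow> (\<lambda>z. F (fst z) (snd z)) \<in> borel_measurable (completion (lborel \<Otimes>\<^sub>M lborel)) \<and>
     (\<exists>M. AE z in lborel \<Otimes>\<^sub>M lborel. fst z \<in> {0..T} \<and> snd z \<in> S \<longrightarrow> norm (F (fst z) (snd z)) \<le> M)"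

definition abs_cont_on :: "real \<Rightarrow> real \<Rightarrow> (real \<Rightarrow> 'b::real_normed_vector) \<Rightarrow> bool" where
  "abs_cont_on a b f \<longleftrightarrow> (\<forall>\<epsilon>>0. \<exists>\<delta>>0. \<forall>(n::nat) (s::nat \<Rightarrow> real) t.
      (\<forall>i<n. a \<le> s i \<and> s i \<le> t i \<and> t i \<le> b) \<and>
      (\<forall>i<n. \<forall>j<n. i \<noteq> j \<longrightarrow> t i \<le> s j \<or> t j \<le> s i) \<and>
      (\<Sum>i<n. t i - s i) < \<delta> \<longrightarrow> (\<Sum>i<n. norm (f (t i) - f (s i))) < \<epsilon>)"

text \<open>Regular Lagrangian flow of b on [0,T] (lifted to real^'d).\<close>
definition RLF :: "real \<Rightarrow> (real \<Rightarrow> real^'d \<Rightarrow> real^'d) \<Rightarrow> (real \<Rightarrow> real^'d \<Rightarrow> real^'d) \<Rightarrow> bool" where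
  "RLF T b X \<longleftrightarrow>
     (\<lambda>z. X (fst z) (snd z)) \<in> borel_measurable (completion (lborel \<Otimes>\<^sub>M lborel)) \<and>
     (\<forall>t\<in>{0..T}. X t \<in> borel_measurable lebesgue) \<and>
     (\<forall>y. X 0 y = y) \<and>
     (AE y in lborel. abs_cont_on 0 T (\<lambda>t. X t y) \<and>
        (AE t in lborel. t \<in> {0..T} \<longrightarrow>
           ((\<lambda>s. X s y) has_vector_derivative b t (X t y)) (at t within {0..T}))) \<and>
     (\<exists>L. \<forall>t\<in>{0..T}. \<forall>A\<in>sets lborel.
        emeasure lebesgue {y. X t y \<in> A} \<le> ennreal L * emeasure lborel A)"

end

theory Submission
  imports Defs
begin

text \<open>
  A field with gradient in BMO has a log-Lipschitz representative, so its flow solves the ODE for a.e. initial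
  point, and an Euler scheme built from one-coordinate shears gives Liouville's formula
  X(t,.)_# (J dy) = dx with J = exp (int_0^t div u (s, X(s,y)) ds).  Under the hypothesis of the theorem the two
  flows have the same div u o X, hence the same J.  Writing u1 - u2 = w = grad psi with psi periodic and C^1,
  integration by parts and Liouville's formula give
    int |w|^2 = - int psi (div u1 - div u2) = - int (psi(X1) - psi(X2)) (div u1)(X1) J dy,
  and |psi(x1) - psi(x2)| <= r |w(x1)| + C r ll(r) for r = |x1 - x2|, where ll(s) = s (1 + ln (1 + 1/s)).
  With E = int |X1 - X2|^2, Cauchy-Schwarz and Jensen turn this into int |w|^2 <= C ll(E).  The ODEs then yield
  E(t) <= C int_0^t ll(E), so E = 0 by Osgood's lemma, and w = 0.
\<close>

text \<open>A log-Lipschitz field has a continuous flow without a Jacobian matrix in the classical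
  sense, so \<open>J\<close> cannot come from differentiating \<open>X\<close>. A shear x + w(x) e_j
  moves a single coordinate, and its change of variables reduces to the fact that a j-th partial
  derivative of a compactly supported function integrates to 0. A splitting scheme made of shears
  therefore has an exact density at every step, and only its limit has to be controlled. The error
  of the scheme obeys a recursion with the modulus \<open>ll\<close>, so the same function
  \<open>osgood\<close> serves for the convergence of the scheme, for the lattice equivariance of
  the flow and for the final uniqueness. The logarithm in \<open>ll\<close> reflects that averages
  of a BMO gradient over cubes shrinking by halves drift by a bounded amount per halving. The
  formula for \<open>ll\<close> is concave on the whole half-line, as Jensen's inequality demands.
  The divergence is merely bounded, so along the flow it is compared with continuous functions close
  to it in L^1; there the bounded compression of the flow enters.\<close>

abbreviation (input) ind :: "'a set => 'a => 'b::zero_neq_one" where "ind == indicator"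

abbreviation (input) bmb :: "('a::topological_space => 'b::topological_space) set" where "bmb == borel_measurable borel"

abbreviation (input) bxb :: "('a::topological_space * 'b::topological_space) measure" where "bxb == borel \<Otimes>\<^sub>M borel"

abbreviation (input) plb :: "('a::euclidean_space * 'b::euclidean_space) measure" where "plb == lborel \<Otimes>\<^sub>M lborel"

abbreviation (input) NNL :: "('a::euclidean_space => ennreal) => ennreal" (binder "NN " 10) where "NNL f == nn_integral lborel f"



section \<open>The log-Lipschitz modulus and Osgood's lemma\<close>

text \<open>Division by zero yields 0, so the value at 0 is the right limit 0. The function behaves
  like s log (1/s) near 0, grows like s at infinity, and is concave throughout.\<close>

definition ll :: "real => real" where
  "ll s = s * (1 + ln (1 + 1 / s))"

lemma ll_0 [simp]: "ll 0 = 0" by (simp add: ll_def)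

lemma ll_ge_self: "0 <= s ==> s <= ll s"
proof (cases "s = 0")
  case False
  assume "0 <= s"
  then have "0 <= ln (1 + 1 / s)" by (intro ln_ge_zero) auto
  then have "s * 1 <= s * (1 + ln (1 + 1 / s))" using \<open>0 <= s\<close> by (intro mult_left_mono) auto
  then show ?thesis by (simp add: ll_def)
qed simp

lemma ll_nonneg: "0 <= s ==> 0 <= ll s"
  using ll_ge_self[of s] by linarith

text \<open>Concavity in the form of the tangent line at \<open>a\<close>: apply ln q <= q - 1 to
  the quotient of the two arguments of the logarithm. Monotonicity and Jensen's inequality are both
  read off from it.\<close>

lemma ll_le_tangent:
  assumes "0 <= s" "0 < a"
  shows "ll s <= s * (1 + ln (1 + 1 / a)) + (a - s) / (a + 1)"
proof (cases "s = 0")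
  case False
  then have s: "0 < s" using assms by simp
  have "ln ((1 + 1/s) / (1 + 1/a)) <= (1 + 1/s) / (1 + 1/a) - 1"
    using s assms by (intro ln_le_minus_one) (auto intro!: divide_pos_pos add_pos_pos)
  then have "ln (1 + 1/s) <= ln (1 + 1/a) + ((1 + 1/s) / (1 + 1/a) - 1)"
    using add_pos_pos[of 1 "1/s"] add_pos_pos[of 1 "1/a"] s assms by (subst (asm) ln_div) auto
  then have "s * (1 + ln (1 + 1/s)) <= s * (1 + (ln (1 + 1/a) + ((1 + 1/s) / (1 + 1/a) - 1)))"
    using s by (intro mult_left_mono) auto
  also have "... = s * (1 + ln (1 + 1/a)) + s * ((1 + 1/s) / (1 + 1/a) - 1)"
    by (simp add: algebra_simps)
  also have "s * ((1 + 1/s) / (1 + 1/a) - 1) = (a - s) / (a + 1)"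
    using s assms by (simp add: divide_simps) (simp add: algebra_simps)
  finally show ?thesis by (simp add: ll_def)
qed (use assms in auto)

lemma ll_mono:
  assumes "0 <= s" "s <= a"
  shows "ll s <= ll a"
proof (cases "s = a")
  case False
  then have a: "0 < a" "s < a" using assms by auto
  have "1 / (a + 1) <= 1 + ln (1 + 1/a)"
  proof -
    have "1 / (a+1) <= 1" using a by simp
    moreover have "0 <= ln (1 + 1/a)" using a by (intro ln_ge_zero) auto
    ultimately show ?thesis by linarith
  qed
  then have "(a - s) * (1 / (a + 1)) <= (a - s) * (1 + ln (1 + 1/a))"
    using a by (intro mult_left_mono) auto
  with ll_le_tangent[OF assms(1) a(1)] show ?thesis
    by (simp add: ll_def algebra_simps)
qed simp

lemma ll_scale:
  assumes "0 <= s" "1 <= c"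
  shows "ll (c * s) <= c * ll s"
proof (cases "s = 0")
  case False
  then have s: "0 < s" using assms by simp
  have "1 / (c * s) <= 1 / s" using s assms by (intro divide_left_mono) auto
  then have "ln (1 + 1/(c * s)) <= ln (1 + 1/s)"
    using s assms by (subst ln_le_cancel_iff) (auto intro!: add_pos_pos)
  then have "c * s * (1 + ln (1 + 1/(c * s))) <= c * s * (1 + ln (1 + 1/s))"
    using s assms by (intro mult_left_mono) auto
  then show ?thesis by (simp add: ll_def mult.assoc)
qed simp

text \<open>The energy is a mean of r^2, while the fields produce terms r * \<open>ll\<close> r;
  this brings them to a concave function of r^2, to which Jensen applies. For r <= 1 the logarithm
  only grows when r is replaced by r^2, for r > 1 it is at most 1.\<close>

lemma mult_ll_le:
  assumes "0 <= r"
  shows "r * ll r <= 2 * ll (r\<^sup>2)"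
proof (cases "r <= 1")
  case True
  show ?thesis
  proof (cases "r = 0")
    case False
    then have r: "0 < r" using assms by simp
    have "r * r <= r" using r True by (simp add: mult_left_le_one_le)
    then have "1 / r <= 1 / r\<^sup>2" using r by (intro divide_left_mono) (auto simp: power2_eq_square)
    then have "ln (1 + 1/r) <= ln (1 + 1/r\<^sup>2)"
      using r by (subst ln_le_cancel_iff) (auto intro!: add_pos_pos)
    then have "r\<^sup>2 * (1 + ln (1 + 1/r)) <= r\<^sup>2 * (1 + ln (1 + 1/r\<^sup>2))"
      by (intro mult_left_mono) auto
    then have "r * ll r <= ll (r\<^sup>2)" by (simp add: ll_def power2_eq_square mult.assoc)
    then show ?thesis using ll_nonneg[of "r\<^sup>2"] by simp
  qed simp
next
  case False
  have "ln (1 + 1/r) <= 1/r" using False by (intro ln_add_one_self_le_self) auto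
  then have "ln (1 + 1/r) <= 1" using False by (smt (verit) divide_le_eq_1)
  then have "r\<^sup>2 * (1 + ln (1 + 1/r)) <= r\<^sup>2 * 2"
    by (intro mult_left_mono) auto
  then have "r * ll r <= 2 * r\<^sup>2" by (simp add: ll_def power2_eq_square mult.assoc)
  also have "... <= 2 * ll (r\<^sup>2)" using ll_ge_self[of "r\<^sup>2"] by simp
  finally show ?thesis .
qed

text \<open>1 + 1/s is at most the square of 1 + 1/sqrt s, and ln (1 + q) <= q. The bound yields
  continuity at 0 and integrability of \<open>ll\<close> composed with integrable functions.\<close>

lemma ll_le_sqrt:
  assumes "0 <= s" shows "ll s <= s + 2 * sqrt s"
proof (cases "s = 0")
  case False
  then have s: "0 < s" using assms by simp
  have "1 + 1/s <= (1 + 1 / sqrt s)\<^sup>2" using s by (simp add: power2_eq_square field_simps)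
  then have "ln (1 + 1/s) <= ln ((1 + 1 / sqrt s)\<^sup>2)"
    using add_pos_pos[of 1 "1 / sqrt s"] add_pos_pos[of 1 "1 / s"] s by (subst ln_le_cancel_iff) (auto intro!: zero_less_power)
  also have "... = 2 * ln (1 + 1 / sqrt s)" using add_pos_pos[of 1 "1 / sqrt s"] s by (subst ln_realpow) auto
  also have "... <= 2 * (1 / sqrt s)" using s ln_add_one_self_le_self[of "1 / sqrt s"] by simp
  finally have "s * (1 + ln (1+1/s)) <= s * (1 + 2 * (1 / sqrt s))" using s by (intro mult_left_mono) auto
  also have "... = s + 2 * sqrt s" using s by (simp add: field_simps real_sqrt_mult_self flip: power2_eq_square)
  finally show ?thesis by (simp add: ll_def)
qed simp

lemma continuous_on_ll: "continuous_on {0..} ll"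
proof (rule continuous_on_eq_continuous_within[THEN iffD2], rule ballI)
  fix x :: real assume "x : {0..}"
  show "continuous (at x within {0..}) ll"
  proof (cases "x = 0")
    case True
    have "((%s. s + 2 * sqrt s) \<longlongrightarrow> 0 + 2 * sqrt 0) (at 0 within {0..})"
      by (intro tendsto_intros)
    then have "((%s. s + 2 * sqrt s) \<longlongrightarrow> 0) (at 0 within {0..})" by simp
    then have "(ll \<longlongrightarrow> 0) (at 0 within {0..})"
      by (rule real_tendsto_sandwich[rotated 3, where f = "%_. 0"])
         (auto simp: eventually_at_filter ll_nonneg ll_le_sqrt)
    then show ?thesis using True by (simp add: continuous_within)
  next
    case False
    then have "0 < x" using \<open>x : {0..}\<close> by simp
    then have "isCont ll x" unfolding ll_def
      using add_pos_pos[of 1 "1 / x"] by (intro continuous_intros) auto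
    then show ?thesis by (rule continuous_at_imp_continuous_at_within)
  qed
qed

text \<open>A closed form that decreases no faster than a primitive of -1/\<open>ll\<close>: its
  derivative carries the extra factor 1/(s + 1) <= 1. Its divergence at 0 is Osgood's
  condition.\<close>

definition osgood :: "real => real" where
  "osgood s = ln (1 + ln (1 + 1 / s))"

lemma osgood_deriv:
  assumes "0 < s"
  shows "(osgood has_real_derivative - (1 / ((s + 1) * ll s))) (at s)"
proof -
  have l: "0 < ln (1 + 1/s)" using assms by (intro ln_gt_zero) auto
  have "(osgood has_real_derivative
      (1 / (1 + ln (1 + 1/s))) * ((1 / (1 + 1/s)) * (- (1 / s\<^sup>2)))) (at s)"
    unfolding osgood_def
    using assms l by (auto intro!: derivative_eq_intros add_pos_pos simp: power2_eq_square field_simps)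
  also have "(1 / (1 + ln (1 + 1/s))) * ((1 / (1 + 1/s)) * (- (1 / s\<^sup>2))) = - (1 / ((s + 1) * ll s))"
    using assms l by (simp add: ll_def power2_eq_square divide_simps) (simp add: algebra_simps)?
  finally show ?thesis .
qed

lemma osgood_antimono:
  assumes "0 < s" "s <= t" shows "osgood t <= osgood s"
proof -
  have "1 / t <= 1 / s" using assms by (intro divide_left_mono) auto
  then have "ln (1 + 1/t) <= ln (1 + 1/s)" using assms
    by (subst ln_le_cancel_iff) (auto intro!: add_pos_pos)
  moreover have "0 < ln (1 + 1/t)" using assms by (intro ln_gt_zero) auto
  ultimately show ?thesis unfolding osgood_def by (subst ln_le_cancel_iff) auto
qed

lemma osgood_less_cancel:
  assumes "0 < s" "0 < t" "osgood t > osgood s" shows "t < s"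
  using osgood_antimono[of s t] assms by linarith

lemma osgood_at_0: "filterlim osgood at_top (at_right 0)"
proof -
  have "filterlim (%s::real. 1 + 1 / s) at_top (at_right 0)"
    using filterlim_tendsto_add_at_top[OF tendsto_const filterlim_inverse_at_top_right, of 1]
    by (simp add: inverse_eq_divide)
  from filterlim_compose[OF ln_at_top this]
  have "filterlim (%s::real. 1 + ln (1 + 1 / s)) at_top (at_right 0)"
    by (intro filterlim_tendsto_add_at_top[OF tendsto_const])
  from filterlim_compose[OF ln_at_top this] show ?thesis
    by (simp add: osgood_def[abs_def])
qed

text \<open>By the mean value theorem the drop is (t - s) divided by (z + 1) * \<open>ll\<close> z
  with z > s, and that divisor is at least \<open>ll s\<close>; an Euler increment d *
  \<open>ll s\<close> thus costs at most d.\<close>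

lemma osgood_step:
  assumes s: "0 < s" and d: "0 <= d" and t: "0 < t" "t <= s + d * ll s"
  shows "osgood s - d <= osgood t"
proof (cases "t <= s")
  case True
  then show ?thesis using osgood_antimono[OF t(1)] d by fastforce
next
  case False
  then have "EX z>s. z < t & osgood t - osgood s = (t - s) * (- (1 / ((z + 1) * ll z)))"
    using s by (intro MVT2) (auto intro!: osgood_deriv)
  then obtain z where z: "s < z" "osgood t - osgood s = (t - s) * (- (1 / ((z + 1) * ll z)))" by blast
  have lls: "0 < ll s" using ll_ge_self[of s] s by linarith
  have "ll s <= (z + 1) * ll z"
    using ll_mono[of s z] s z(1) lls by (smt (verit) mult_le_cancel_right1)
  then have "(t - s) / ((z+1) * ll z) <= (d * ll s) / ll s"
    using t False lls d by (intro frac_le) auto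
  then have "(t - s) / ((z+1) * ll z) <= d" using lls by simp
  with z(2) show ?thesis by simp
qed

lemma osgood_discrete:
  assumes C: "0 <= C" and h: "0 <= h" and g0: "0 < g 0"
    and pos: "!!k. k <= n ==> 0 < g k"
    and step: "!!k. k < n ==> g (Suc k) <= g k + h * C * ll (g k)"
    and k: "k <= n"
  shows "osgood (g 0) - C * (h * real k) <= osgood (g k)"
  using k
proof (induction k)
  case (Suc k)
  have "osgood (g k) - h * C <= osgood (g (Suc k))"
    using Suc.prems by (intro osgood_step pos step mult_nonneg_nonneg C h) auto
  with Suc show ?case by (simp add: algebra_simps)
qed simp

text \<open>The Osgood function is unbounded near 0, so even after losing the fixed amount
  \<open>K\<close> a point that started close to 0 stays close to 0. The threshold depends on
  \<open>eta\<close> and \<open>K\<close> only, which makes the accuracy of the Euler scheme uniform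
  in the starting point.\<close>

lemma osgood_small:
  assumes "0 < eta"
  shows "EX e0>0. ALL e x. 0 < e & e <= e0 & 0 < x & osgood e - K <= osgood x --> x < eta"
proof -
  have "eventually (%e. osgood eta + K + 1 <= osgood e) (at_right 0)"
    using osgood_at_0 by (simp add: filterlim_at_top)
  then obtain b where b: "b > 0" "!!e. 0 < e ==> e < b ==> osgood eta + K + 1 <= osgood e"
    unfolding eventually_at_right_field by blast
  show ?thesis
  proof (intro exI[of _ "b/2"] conjI allI impI)
    fix e x :: real assume h: "0 < e & e <= b/2 & 0 < x & osgood e - K <= osgood x"
    then have "osgood eta + K + 1 <= osgood e" using b by simp
    then have "osgood eta < osgood x" using h by linarith
    then show "x < eta" by (intro osgood_less_cancel[OF assms]) (use h in auto)
  qed (use b in auto)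
qed

lemma deriv_nonneg_within_le:
  fixes f :: "real => real"
  assumes "a <= b"
    and d: "!!s. a <= s ==> s <= b ==> (f has_real_derivative f' s) (at s within {a..b})"
    and nn: "!!s. a <= s ==> s <= b ==> 0 <= f' s"
  shows "f a <= f b"
proof -
  have "EX x:{a..b}. f b - f a = f' x * (b - a)"
    by (rule mvt_very_simple[OF \<open>a <= b\<close>]) (use d in \<open>auto simp: has_field_derivative_def\<close>)
  then show ?thesis using nn assms(1)
    by (metis atLeastAtMost_iff diff_ge_0_iff_ge mult_nonneg_nonneg)
qed

text \<open>The majorant \<open>F\<close> starts at a positive value because the Osgood function
  blows up at 0. Its derivative is at most C * \<open>ll\<close> F, so
  \<open>osgood (F s) + C * s\<close> is nondecreasing and \<open>F\<close> remains small together
  with its initial value.\<close>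

lemma osgood_continuous:
  fixes f :: "real => real"
  assumes f: "continuous_on {0..T} f" and nn: "!!t. t : {0..T} ==> 0 <= f t"
    and C: "0 <= C"
    and le: "!!t. t : {0..T} ==> f t <= C * integral {0..t} (%s. ll (f s))"
    and t: "t : {0..T}"
  shows "f t = 0"
proof (rule ccontr)
  assume "f t ~= 0"
  then have ft: "0 < f t" using nn[OF t] by simp
  have cont: "continuous_on {0..T} (%s. ll (f s))"
    by (rule continuous_on_compose2[OF continuous_on_ll f]) (use nn in auto)
  \<comment> \<open>With \<open>f t\<close> itself as threshold, the bound on \<open>F t\<close>
    contradicts f < F.\<close>
  obtain e where e: "0 < e" "!!x. 0 < x ==> osgood e - C * T <= osgood x ==> x < f t"
    using osgood_small[OF ft, of "C * T"] by (meson order_refl)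
  define F where "F = (%t. e + C * integral {0..t} (%s. ll (f s)))"
  have fF: "f s < F s" if "s : {0..T}" for s using le[OF that] e by (simp add: F_def)
  have Fpos: "0 < F s" if "s : {0..T}" for s using fF[OF that] nn[OF that] by simp
  have dF: "(F has_real_derivative C * ll (f s)) (at s within {0..T})" if "s : {0..T}" for s
  proof -
    have "((%u. integral {0..u} (%s. ll (f s))) has_real_derivative ll (f s)) (at s within {0..T})"
      using integral_has_vector_derivative[OF cont that] by (simp add: has_real_derivative_iff_has_vector_derivative)
    then show ?thesis unfolding F_def by (auto intro!: derivative_eq_intros)
  qed
  have dG: "((%s. osgood (F s) + C * s) has_real_derivative 
      (- (1 / ((F s + 1) * ll (F s)))) * (C * ll (f s)) + C) (at s within {0..T})" if "s : {0..T}" for s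
  proof -
    have "((%s. osgood (F s)) has_real_derivative (- (1 / ((F s + 1) * ll (F s)))) * (C * ll (f s))) (at s within {0..T})"
      using DERIV_chain2[OF osgood_deriv[OF Fpos[OF that]] dF[OF that]] .
    then show ?thesis by (auto intro!: derivative_eq_intros)
  qed
  have "(%s. osgood (F s) + C * s) 0 <= (%s. osgood (F s) + C * s) t"
  proof (rule deriv_nonneg_within_le[where f = "%s. osgood (F s) + C * s" and f' = "%s. (- (1 / ((F s + 1) * ll (F s)))) * (C * ll (f s)) + C"])
    fix s assume s: "0 <= s" "s <= t"
    then have s': "s : {0..T}" using t by auto
    show "((%s. osgood (F s) + C * s) has_real_derivative 
      (- (1 / ((F s + 1) * ll (F s)))) * (C * ll (f s)) + C) (at s within {0..t})"
      by (rule DERIV_subset[OF dG[OF s']]) (use t in auto)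
    have "ll (f s) <= ll (F s)" using nn[OF s'] fF[OF s'] by (intro ll_mono) auto
    also have "... <= (F s + 1) * ll (F s)"
      using Fpos[OF s'] ll_nonneg[of "F s"] by (simp add: algebra_simps)
    finally have "ll (f s) <= (F s + 1) * ll (F s)" .
    moreover have "0 < (F s + 1) * ll (F s)" using Fpos[OF s'] ll_ge_self[of "F s"] by (intro mult_pos_pos) auto
    ultimately have "C * (ll (f s) / ((F s + 1) * ll (F s))) <= C * 1" by (intro mult_left_mono C) auto
    then show "0 <= (- (1 / ((F s + 1) * ll (F s)))) * (C * ll (f s)) + C" by simp
  qed (use t in auto)
  then have "osgood e - C * T <= osgood (F t)" using t C mult_left_mono[of t T C] by (simp add: F_def)
  then have "F t < f t" using e(2)[OF Fpos[OF t]] by simp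
  with fF[OF t] show False by simp
qed

section \<open>Absolutely continuous functions\<close>

text \<open>A set of pairs replaces the two sequences of \<open>abs_cont_on\<close>, so that the
  pieces of a tagged division can be inserted after reindexing.\<close>

definition nonoverlapping :: "real => real => (real \<times> real) set => bool" where
  "nonoverlapping a b D \<longleftrightarrow> finite D & (ALL z:D. a <= fst z & fst z < snd z & snd z <= b) &
     (ALL z:D. ALL z':D. z ~= z' --> snd z <= fst z' | snd z' <= fst z)"

lemma abs_cont_on_finite_family:
  assumes ac: "abs_cont_on a b f" and e: "0 < e"
  shows "EX d>0. ALL D. nonoverlapping a b D & (SUM z:D. snd z - fst z) < d --> (SUM z:D. norm (f (snd z) - f (fst z))) < e"
proof -
  obtain d where d: "0 < d" "!!(n::nat) (s::nat => real) t.
      (ALL i<n. a <= s i & s i <= t i & t i <= b) &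
      (ALL i<n. ALL j<n. i ~= j --> t i <= s j | t j <= s i) &
      (\<Sum>i<n. t i - s i) < d ==> (\<Sum>i<n. norm (f (t i) - f (s i))) < e"
    using ac[unfolded abs_cont_on_def, THEN spec, THEN mp, OF e] by auto
  show ?thesis
  proof (intro exI[of _ d] conjI allI impI, rule d(1))
    fix D assume "nonoverlapping a b D & (SUM z:D. snd z - fst z) < d"
    then have D: "finite D" "!!z. z : D ==> a <= fst z & fst z < snd z & snd z <= b"
       "!!z z'. z : D ==> z' : D ==> z ~= z' ==> snd z <= fst z' | snd z' <= fst z"
       "(SUM z:D. snd z - fst z) < d" by (auto simp: nonoverlapping_def)
    obtain h where h: "bij_betw h {..<card D} D"
      using ex_bij_betw_nat_finite[OF D(1)] by (auto simp: atLeast0LessThan)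
    have hD: "h i : D" if "i < card D" for i
      using h that by (auto simp: bij_betw_def)
    have "(\<Sum>i<card D. norm (f (snd (h i)) - f (fst (h i)))) < e"
    proof (rule d(2), intro conjI allI impI)
      fix i j assume ij: "i < card D" "j < card D" "i ~= j"
      then have "h i ~= h j" using h by (auto simp: bij_betw_def inj_on_def)
      then show "snd (h i) <= fst (h j) | snd (h j) <= fst (h i)"
        using D(3)[OF hD hD] ij by auto
    next
      show "(\<Sum>i<card D. snd (h i) - fst (h i)) < d"
        using D(4) sum.reindex_bij_betw[OF h, of "%x. snd x - fst x"] by simp
    qed (use D(2)[OF hD] in \<open>auto intro: less_imp_le\<close>)
    then show "(SUM z:D. norm (f (snd z) - f (fst z))) < e"
      using sum.reindex_bij_betw[OF h, of "%x. norm (f (snd x) - f (fst x))"] by simp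
  qed
qed

text \<open>Henstock's argument. Intervals tagged outside \<open>N\<close> are controlled by the
  derivative; intervals tagged in \<open>N\<close> lie in an open set of small measure, where
  absolute continuity makes the increments of \<open>f\<close> small.\<close>

lemma abs_cont_on_has_integral:
  fixes f :: "real => 'a::banach"
  assumes ac: "abs_cont_on a b f" and ab: "a <= b" and N: "negligible N"
    and der: "!!t. t : {a..b} - N ==> (f has_vector_derivative g t) (at t within {a..b})"
  shows "(g has_integral f b - f a) {a..b}"
proof -
  \<comment> \<open>Changing the integrand on the negligible set to 0 leaves, for tags in
    \<open>N\<close>, only the increment of \<open>f\<close> to be estimated.\<close>
  define h where "h = (%t. if t : N then 0 else g t)"
  have "(h has_integral f b - f a) (cbox a b)"
    unfolding has_integral
  proof (intro allI impI)
    fix e :: real assume e: "0 < e"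
    define e1 where "e1 = e / (2 * (b - a + 1))"
    have e1: "0 < e1" using e ab by (simp add: e1_def)
    have "EX d>0. ALL y:{a..b}. \<bar>y - x\<bar> < d --> norm (f y - f x - (y - x) *\<^sub>R g x) <= e1 * \<bar>y - x\<bar>"
      if x: "x : {a..b} - N" for x
    proof -
      have "ALL e>0. EX d>0. ALL y:{a..b}. norm (y - x) < d --> norm (f y - f x - (y - x) *\<^sub>R g x) <= e * norm (y - x)"
        using der[OF x] unfolding has_vector_derivative_def has_derivative_within_alt by (rule conjunct2)
      from this[THEN spec, THEN mp, OF e1] show ?thesis by (simp only: real_norm_def)
    qed
    then have "ALL x. EX d. x : {a..b} - N --> 0 < d & (ALL y:{a..b}. \<bar>y - x\<bar> < d -->
        norm (f y - f x - (y - x) *\<^sub>R g x) <= e1 * \<bar>y - x\<bar>)" by blast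
    from choice[OF this] obtain d where d: "!!x. x : {a..b} - N ==> 0 < d x"
      "!!x y. x : {a..b} - N ==> y : {a..b} ==> \<bar>y - x\<bar> < d x ==> norm (f y - f x - (y - x) *\<^sub>R g x) <= e1 * \<bar>y - x\<bar>"
      by blast
    obtain dl where dl: "0 < dl" "!!D. nonoverlapping a b D ==> (SUM z:D. snd z - fst z) < dl
       ==> (SUM z:D. norm (f (snd z) - f (fst z))) < e / 2"
      using abs_cont_on_finite_family[OF ac half_gt_zero[OF e]] by auto
    obtain U where U: "open U" "N \<subseteq> U" "U : lmeasurable" "measure lebesgue U < dl"
    proof -
      have N0: "N : lmeasurable" using N by (auto simp: negligible_iff_measure)
      obtain U where U: "open U" "N \<subseteq> U" "U - N : lmeasurable" "emeasure lebesgue (U - N) < ennreal dl"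
        using sets_lebesgue_outer_open[OF fmeasurableD[OF N0] dl(1)] by blast
      have eq: "(U - N) \<union> N = U" using U by auto
      have "U : lmeasurable" using fmeasurable.Un[OF U(3) N0] by (simp only: eq)
      moreover have "measure lebesgue U = measure lebesgue (U - N)"
        using measure_Un_null_set[OF fmeasurableD[OF U(3)], of N] N by (simp only: eq negligible_iff_null_sets)
      moreover have "measure lebesgue (U - N) < dl"
        using U(3,4) dl(1) by (simp add: emeasure_eq_measure2 ennreal_less_iff)
      ultimately show thesis using that U by auto
    qed
    \<comment> \<open>A tag in \<open>N\<close> forces its interval into \<open>U\<close>, a tag
      outside \<open>N\<close> into the range of the differentiability estimate; tags outside the
      interval do not occur.\<close>
    define ga where "ga = (%x. if x : N then U else if x : {a..b} then ball x (d x) else UNIV)"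
    show "EX ga. gauge ga & (ALL \<D>. \<D> tagged_division_of cbox a b & ga fine \<D> -->
       norm ((\<Sum>(x,k)\<in>\<D>. measure lborel k *\<^sub>R h x) - (f b - f a)) < e)"
    proof (intro exI conjI allI impI)
      show "gauge ga" using U d(1) by (auto simp: gauge_def ga_def)
      fix p assume "p tagged_division_of cbox a b & ga fine p"
      then have p: "p tagged_division_of {a..b}" and fine: "ga fine p" by auto
      note fin = tagged_division_of_finite[OF p]
      have K: "EX u v. K = {u..v} & u <= v & a <= u & v <= b & u <= x & x <= v" if xK: "(x,K) : p" for x K
      proof -
        obtain u v where "K = cbox u v" using tagged_division_ofD(4)[OF p xK] by blast
        moreover have "x : K" "K \<subseteq> {a..b}" using tagged_division_ofD(2,3)[OF p xK] by auto
        ultimately show ?thesis by (intro exI[of _ u] exI[of _ v]) auto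
      qed
      have tel: "f b - f a = (\<Sum>(x,K)\<in>p. f (Sup K) - f (Inf K))"
        using additive_tagged_division_1[OF ab p, of f] by simp
      let ?pN = "{(x,K) : p. x : N}"
      let ?T = "%(x,K). measure lborel K *\<^sub>R h x - (f (Sup K) - f (Inf K))"
      have dec: "(\<Sum>(x,k)\<in>p. measure lborel k *\<^sub>R h x) - (f b - f a) = (SUM z:p. ?T z)"
        unfolding tel by (simp add: sum_subtractf case_prod_beta)
      have "norm (SUM z:p. ?T z) <= (SUM z:p. norm (?T z))" by (rule norm_sum)
      also have "... = (SUM z:p - ?pN. norm (?T z)) + (SUM z:?pN. norm (?T z))"
        using fin by (intro sum.subset_diff) auto
      also have "... < e / 2 + e / 2"
      proof (rule add_le_less_mono)
        have "(SUM z:p - ?pN. norm (?T z)) <= (\<Sum>(x,K)\<in>p - ?pN. e1 * measure lborel K)"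
        proof (rule sum_mono)
          fix z assume z: "z : p - ?pN"
          obtain x K where zxK: "z = (x,K)" by (cases z)
          have xK: "(x,K) : p" and x: "x ~: N" using z zxK by auto
          obtain u v where uv: "K = {u..v}" "u <= v" "a <= u" "v <= b" "u <= x" "x <= v" using K[OF xK] by auto
          have xab: "x : {a..b} - N" using uv x by auto
          have "K \<subseteq> ball x (d x)" using fineD[OF fine xK] x uv by (auto simp: ga_def)
          then have "u : ball x (d x)" "v : ball x (d x)" using uv by (auto simp del: mem_ball)
          then have "\<bar>u - x\<bar> < d x" "\<bar>v - x\<bar> < d x" by (auto simp: dist_real_def abs_minus_commute)
          then have 1: "norm (f u - f x - (u - x) *\<^sub>R g x) <= e1 * \<bar>u - x\<bar>"
            and 2: "norm (f v - f x - (v - x) *\<^sub>R g x) <= e1 * \<bar>v - x\<bar>"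
            using d(2)[OF xab, of u] d(2)[OF xab, of v] uv by (simp_all only: atLeastAtMost_iff) auto
          have "measure lborel K *\<^sub>R h x - (f (Sup K) - f (Inf K)) =
             (f u - f x - (u - x) *\<^sub>R g x) - (f v - f x - (v - x) *\<^sub>R g x)"
            using uv x by (simp add: h_def algebra_simps)
          also have "norm ... <= e1 * \<bar>u - x\<bar> + e1 * \<bar>v - x\<bar>"
            by (intro order_trans[OF norm_triangle_ineq4] add_mono 1 2)
          also have "... = e1 * measure lborel K" using uv by (simp add: algebra_simps)
          finally show "norm (?T z) <= (case z of (x,K) => e1 * measure lborel K)" by (simp add: zxK)
        qed
        also have "... <= (\<Sum>(x,K)\<in>p. e1 * measure lborel K)"
          using fin e1 by (intro sum_mono2) auto
        also have "... = e1 * measure lborel (cbox a b)"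
          using additive_content_tagged_division[of p a b] p ab by (simp add: sum_distrib_left[symmetric] case_prod_beta)
        also have "... <= e / 2" using e ab by (simp add: e1_def field_simps)
        finally show "(SUM z:p - ?pN. norm (?T z)) <= e / 2" .
      next
        \<comment> \<open>Degenerate intervals carry no increment, and once they are removed the
          endpoints determine the tagged interval, which makes \<open>?i\<close> injective.\<close>
        let ?q = "{(x,K) : ?pN. measure lborel K ~= 0}"
        let ?i = "%z::real \<times> real set. (Inf (snd z), Sup (snd z))"
        have finq: "finite ?q" using fin by (auto intro: finite_subset[of _ p])
        have q: "EX u v. K = {u..v} & u < v & a <= u & v <= b & u <= x & x <= v" if "(x,K) : ?q" for x K
          using K[of x K] that by force
        have disj: "Sup K <= Inf K' | Sup K' <= Inf K" if hyp: "(x,K) : ?q" "(x',K') : ?q" "(x,K) ~= (x',K')" for x K x' K'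
        proof -
          obtain u v u' v' where uv: "K = {u..v}" "u < v" "K' = {u'..v'}" "u' < v'" using q[OF hyp(1)] q[OF hyp(2)] by auto
          have "interior K \<inter> interior K' = {}" using tagged_division_ofD(5)[OF p, of x K x' K'] hyp by auto
          then have "{u<..<v} \<inter> {u'<..<v'} = {}" using uv by simp
          \<comment> \<open>This midpoint would lie in both interiors if the two intervals
            overlapped.\<close>
          then have "(max u u' + min v v') / 2 ~: {u<..<v} \<inter> {u'<..<v'}" by blast
          then have "~ max u u' < min v v'" by (auto simp: field_simps)
          then show ?thesis using uv by auto
        qed
        have inj: "inj_on ?i ?q"
        proof (rule inj_onI, clarify, rule ccontr)
          fix x K x' K' assume a: "(x,K) : p" "x : N" "measure lborel K ~= 0" "(x',K') : p" "x' : N" "measure lborel K' ~= 0"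
            "Inf (snd (x,K)) = Inf (snd (x',K'))" "Sup (snd (x,K)) = Sup (snd (x',K'))" "~ (x = x' & K = K')"
          then have "Sup K <= Inf K' | Sup K' <= Inf K" by (intro disj) auto
          moreover have "Inf K < Sup K" using q[of x K] a by force
          ultimately show False using a by auto
        qed
        have "(SUM z:?pN. norm (?T z)) = (SUM z:?q. norm (?T z))"
        proof (rule sum.mono_neutral_right)
          show "ALL i:?pN - ?q. norm (?T i) = 0"
          proof
            fix z assume z: "z : ?pN - ?q"
            obtain x K where zxK: "z = (x,K)" by (cases z)
            have "(x,K) : p" "measure lborel K = 0" using z zxK by auto
            with K[of x K] obtain u where "K = {u..u}" by auto
            then show "norm (?T z) = 0" by (simp add: zxK)
          qed
        qed (use fin in \<open>auto intro: finite_subset[of _ p]\<close>)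
        also have "... = (SUM z:?q. norm (f (snd (?i z)) - f (fst (?i z))))"
          by (intro sum.cong) (auto simp: h_def norm_minus_commute)
        also have "... = (SUM z:?i ` ?q. norm (f (snd z) - f (fst z)))"
          by (subst sum.reindex[OF inj]) simp
        also have "... < e / 2"
        proof (rule dl(2))
          have "a <= fst (?i z) & fst (?i z) < snd (?i z) & snd (?i z) <= b" if "z : ?q" for z
            using q[of "fst z" "snd z"] that by (auto simp: case_prod_beta)
          moreover have "snd (?i z) <= fst (?i z') | snd (?i z') <= fst (?i z)" if "z : ?q" "z' : ?q" "?i z ~= ?i z'" for z z'
            using disj[of "fst z" "snd z" "fst z'" "snd z'"] that by auto
          ultimately show "nonoverlapping a b (?i ` ?q)" using finq unfolding nonoverlapping_def
            by (intro conjI ballI impI) (blast | fast)+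
          have "(SUM z:?i ` ?q. snd z - fst z) = (SUM z:?q. Sup (snd z) - Inf (snd z))"
            by (subst sum.reindex[OF inj]) simp
          also have "... = (SUM z:?q. measure lebesgue (snd z))"
          proof (rule sum.cong[OF refl], clarify)
            fix x K assume "(x,K) : p" "x : N" "measure lborel K ~= 0"
            with q[of x K] show "Sup (snd (x,K)) - Inf (snd (x,K)) = measure lebesgue (snd (x,K))" by force
          qed
          also have "... = measure lebesgue (\<Union>z\<in>?q. snd z)"
          proof (rule measure_negligible_finite_Union_image[symmetric, OF finq])
            show "snd z : lmeasurable" if "z : ?q" for z using q[of "fst z" "snd z"] that by (auto simp: case_prod_beta)
            show "pairwise (%y z. negligible (snd y \<inter> snd z)) ?q"
            proof (rule pairwiseI)
              fix z z' assume h: "z : ?q" "z' : ?q" "z ~= z'"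
              obtain x K x' K' where zz: "z = (x,K)" "z' = (x',K')" by (cases z, cases z')
              have "Sup K <= Inf K' | Sup K' <= Inf K" using h zz by (intro disj[of x K x' K']) auto
              moreover obtain u v u' v' where "K = {u..v}" "u < v" "K' = {u'..v'}" "u' < v'"
                using q[of x K] q[of x' K'] h zz by auto
              ultimately have "snd z \<inter> snd z' \<subseteq> {v, v'}" using zz by auto
              then show "negligible (snd z \<inter> snd z')" by (meson negligible_subset negligible_finite finite.emptyI finite.insertI)
            qed
          qed
          also have "... <= measure lebesgue U"
          proof (rule measure_mono_fmeasurable)
            show "(\<Union>z\<in>?q. snd z) \<subseteq> U"
            proof
              fix y assume "y : (\<Union>z\<in>?q. snd z)"
              then obtain x K where xK: "(x,K) : p" "x : N" "y : K" by auto
              then show "y : U" using fineD[OF fine xK(1)] by (auto simp: ga_def)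
            qed
            have "snd z : sets lebesgue" if "z : ?q" for z using q[of "fst z" "snd z"] that by (auto simp: case_prod_beta)
            then show "(\<Union>z\<in>?q. snd z) : sets lebesgue" using finq by (intro sets.finite_UN) auto
          qed (use U in auto)
          also have "... < dl" by fact
          finally show "(SUM z:?i ` ?q. snd z - fst z) < dl" .
        qed
        finally show "(SUM z:?pN. norm (?T z)) < e / 2" .
      qed
      finally show "norm ((\<Sum>(x,k)\<in>p. measure lborel k *\<^sub>R h x) - (f b - f a)) < e" unfolding dec by simp
    qed
  qed
  then show ?thesis
    using has_integral_spike[OF N, of "{a..b}" g h "f b - f a"] by (simp add: h_def)
qed

section \<open>Test functions, mollification, weak derivatives\<close>

text \<open>Borel rather than Lebesgue measurability, so that compositions, translations and Fubini
  on \<open>lborel\<close> work without completions.\<close>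

definition lloc :: "(real^'d => real) => bool" where
  "lloc f \<longleftrightarrow> f : bmb & (ALL a b. set_integrable lborel (cbox a b) f)"

lemma lloc_borel: "lloc f ==> f : bmb"
  by (simp add: lloc_def)

lemma lloc_set_integrable: "lloc f ==> set_integrable lborel (cbox a b) f"
  by (simp add: lloc_def)

lemma lborel_integral_translate:
  fixes f :: "'a::euclidean_space => 'b::{banach, second_countable_topology}"
  assumes "f : bmb"
  shows "(LBINT x. f (x + a)) = integral\<^sup>L lborel f"
proof -
  have "integral\<^sup>L lborel f = integral\<^sup>L (distr lborel borel ((+) a)) f"
    by (simp add: lborel_distr_plus)
  also have "... = (LBINT x. f (a + x))"
    using assms by (intro integral_distr) auto
  finally show ?thesis by (simp add: add.commute)
qed

lemma lborel_integrable_translate: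
  fixes f :: "'a::euclidean_space => 'b::{banach, second_countable_topology}"
  assumes "f : bmb"
  shows "integrable lborel (%x. f (x + a)) \<longleftrightarrow> integrable lborel f"
proof -
  have "integrable lborel f \<longleftrightarrow> integrable (distr lborel borel ((+) a)) f"
    by (simp add: lborel_distr_plus)
  also have "... \<longleftrightarrow> integrable lborel (%x. f (a + x))"
    using assms by (intro integrable_distr_eq) auto
  finally show ?thesis by (simp add: add.commute)
qed

lemma lborel_nn_integral_translate:
  fixes f :: "'a::euclidean_space => ennreal"
  assumes "f : bmb"
  shows "(NN x. f (x + a)) = integral\<^sup>N lborel f"
proof -
  have "integral\<^sup>N lborel f = integral\<^sup>N (distr lborel borel ((+) a)) f"
    by (simp add: lborel_distr_plus)
  also have "... = (NN x. f (a + x))"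
    using assms by (intro nn_integral_distr) auto
  finally show ?thesis by (simp add: add.commute)
qed

lemma AE_lborel_translate:
  fixes P :: "'a::euclidean_space => bool"
  assumes "AE x in lborel. P x"
  shows "AE x in lborel. P (x + a)"
proof -
  have "AE x in distr lborel borel ((+) a). P x" using assms by (subst lborel_distr_plus)
  then have "AE x in lborel. P (a + x)"
    by (rule AE_distrD[rotated]) simp
  then show ?thesis by (simp add: add.commute)
qed

lemma compact_in_cbox:
  fixes K :: "(real^'d) set"
  assumes "compact K" obtains a b where "K \<subseteq> cbox a b"
  using bounded_subset_cbox_symmetric[OF compact_imp_bounded[OF assms]] by metis

lemma continuous_compact_support_bounded:
  fixes psi :: "'a::euclidean_space => real"
  assumes "continuous_on UNIV psi" "compact K" "!!x. x ~: K ==> psi x = 0"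
  shows "EX B>=0. ALL x. \<bar>psi x\<bar> <= B"
proof -
  have "bounded (psi ` K)"
    using assms by (intro compact_imp_bounded compact_continuous_image) (auto intro: continuous_on_subset)
  then obtain B where "!!x. x : K ==> \<bar>psi x\<bar> <= B" by (auto simp: bounded_iff)
  then have "\<bar>psi x\<bar> <= max B 0" for x using assms(3)[of x] by (cases "x : K") force+
  then show ?thesis by (intro exI[of _ "max B 0"]) auto
qed

lemma lloc_mult_integrable:
  fixes f psi :: "real^'d => real"
  assumes f: "lloc f" and psi: "continuous_on UNIV psi" "compact K" "!!x. x ~: K ==> psi x = 0"
  shows "integrable lborel (%x. f x * psi x)"
proof -
  obtain a b where ab: "K \<subseteq> cbox a b" using compact_in_cbox[OF psi(2)] .
  obtain B where B: "!!x. \<bar>psi x\<bar> <= B" "0 <= B" using continuous_compact_support_bounded[OF psi] by blast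
  have [measurable]: "f : bmb" "psi : bmb"
    using f psi(1) by (auto simp: lloc_def intro: borel_measurable_continuous_onI)
  have "integrable lborel (%x. B * (ind (cbox a b) x *\<^sub>R f x))"
    using lloc_set_integrable[OF f] by (auto simp: set_integrable_def)
  then show ?thesis
  proof (rule Bochner_Integration.integrable_bound)
    show "AE x in lborel. norm (f x * psi x) <= norm (B * (ind (cbox a b) x *\<^sub>R f x))"
    proof (rule AE_I2)
      fix x show "norm (f x * psi x) <= norm (B * (ind (cbox a b) x *\<^sub>R f x))"
      proof (cases "x : K")
        case True
        then have "x : cbox a b" using ab by auto
        then show ?thesis using mult_right_mono[OF B(1)[of x], of "\<bar>f x\<bar>"] B(2)
          by (simp add: abs_mult mult.commute)
      qed (simp add: psi(3))
    qed
  qed simp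
qed

section \<open>Compactly supported C^1 functions and differentiation under the integral sign\<close>

lemma test_funE:
  assumes "test_fun psi"
  obtains K where "compact K" "!!x. x ~: K ==> psi x = 0" "!!x j. x ~: K ==> dpart psi j x = 0"
proof -
  obtain K where K: "compact K" "!!x. x ~: K ==> psi x = 0" using assms by (auto simp: test_fun_def)
  have "dpart psi j x = 0" if "x ~: K" for x j
  proof -
    have "open (- K)" using K(1) by (simp add: compact_imp_closed open_Compl)
    have "((%x. 0) has_derivative (%h. 0)) (at x)" by simp
    then have "(psi has_derivative (%h. 0)) (at x)"
      by (rule has_derivative_transform_within_open[OF _ \<open>open (- K)\<close>]) (use that K in auto)
    then show ?thesis by (simp add: dpart_def frechet_derivative_at[symmetric])
  qed
  then show thesis using K that by blast
qed

lemma test_fun_continuous: "test_fun psi ==> continuous_on UNIV psi"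
  unfolding test_fun_def
  by (auto intro!: differentiable_imp_continuous_on simp: differentiable_on_def)

lemma test_fun_dpart_continuous: "test_fun psi ==> continuous_on UNIV (dpart psi j)"
  by (simp add: test_fun_def)

lemma has_derivative_dpart:
  fixes psi :: "real^'d => real"
  assumes "psi differentiable (at x)"
  shows "(psi has_derivative (%h. SUM j:UNIV. h $ j * dpart psi j x)) (at x)"
proof -
  let ?D = "frechet_derivative psi (at x)"
  have D: "(psi has_derivative ?D) (at x)" using assms frechet_derivative_works by blast
  have lin: "linear ?D" using has_derivative_linear[OF D] .
  have "?D h = (SUM j:UNIV. h $ j * dpart psi j x)" for h
  proof -
    have "?D h = ?D (SUM j:UNIV. h $ j *\<^sub>R axis j 1)"
      using basis_expansion[of h] by (simp add: scalar_mult_eq_scaleR)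
    also have "... = (SUM j:UNIV. h $ j * dpart psi j x)"
      using lin by (simp add: linear_sum linear_scale dpart_def)
    finally show ?thesis .
  qed
  then have "?D = (%h. SUM j:UNIV. h $ j * dpart psi j x)" by (rule ext)
  with D show ?thesis by simp
qed

lemma test_fun_has_derivative:
  "test_fun psi ==> (psi has_derivative (%h. SUM j:UNIV. h $ j * dpart psi j x)) (at x)"
  by (rule has_derivative_dpart) (simp add: test_fun_def)

lemma has_derivative_imp_dpart:
  "(psi has_derivative D) (at x) ==> dpart psi j x = D (axis j 1)"
  by (simp add: dpart_def frechet_derivative_at[symmetric])

lemma test_funI:
  fixes psi :: "real^'d => real"
  assumes "compact K" "!!x. x ~: K ==> psi x = 0"
    and D: "!!x. (psi has_derivative D x) (at x)" and c: "!!j. continuous_on UNIV (%x. D x (axis j 1))"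
  shows "test_fun psi"
proof -
  have "dpart psi j = (%x. D x (axis j 1))" for j using has_derivative_imp_dpart[OF D] by auto
  then show ?thesis unfolding test_fun_def using assms by (auto simp: differentiable_def)
qed

lemma test_fun_shift:
  fixes psi :: "real^'d => real"
  assumes "test_fun psi"
  shows "test_fun (%p. psi (p - x))" and "dpart (%p. psi (p - x)) j p = dpart psi j (p - x)"
proof -
  have D: "((%p. psi (p - x)) has_derivative (%h. SUM j:UNIV. h $ j * dpart psi j (p - x))) (at p)" for p
    by (rule has_derivative_compose[of "%p. p - x" "%h. h" p UNIV psi, OF _ test_fun_has_derivative[OF assms]])
       (auto intro!: derivative_eq_intros)
  obtain K where K: "compact K" "!!x. x ~: K ==> psi x = 0" using test_funE[OF assms] by metis
  have e: "(SUM i:UNIV. axis j 1 $ i * dpart psi i y) = dpart psi j y" for j y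
  proof -
    have "(SUM i:UNIV. axis j 1 $ i * dpart psi i y) = (SUM i:UNIV. if i = j then dpart psi i y else 0)"
      by (intro sum.cong) (auto simp: axis_def)
    then show ?thesis by simp
  qed
  show "test_fun (%p. psi (p - x))"
  proof (rule test_funI[OF compact_translation[OF K(1), of x] _ D])
    show "psi (y - x) = 0" if "y ~: (+) x ` K" for y
      using K(2)[of "y - x"] that by (metis add.commute diff_add_cancel image_eqI)
    show "continuous_on UNIV (%y. SUM i:UNIV. axis j 1 $ i * dpart psi i (y - x))" for j
      unfolding e by (rule continuous_on_compose2[OF test_fun_dpart_continuous[OF assms]]) (auto intro!: continuous_intros)
  qed
  show "dpart (%p. psi (p - x)) j p = dpart psi j (p - x)"
    using has_derivative_imp_dpart[OF D] by (simp add: e)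
qed

lemma test_fun_cmult:
  fixes psi :: "real^'d => real"
  assumes "test_fun psi" shows "test_fun (%x. c * psi x)"
proof -
  obtain K where K: "compact K" "!!x. x ~: K ==> psi x = 0" using test_funE[OF assms] by metis
  show ?thesis
  proof (rule test_funI[OF K(1)])
    show "((%x. c * psi x) has_derivative (%h. c * (SUM j:UNIV. h $ j * dpart psi j x))) (at x)" for x
      by (intro has_derivative_mult_right test_fun_has_derivative assms)
    show "continuous_on UNIV (%x. c * (SUM i:UNIV. axis j 1 $ i * dpart psi i x))" for j
      by (intro continuous_intros test_fun_dpart_continuous assms)
  qed (use K in auto)
qed

lemma uniformly_continuous_compact_support:
  fixes g :: "'a::euclidean_space => real"
  assumes g: "continuous_on UNIV g" and K: "compact K" "!!x. x ~: K ==> g x = 0" and e: "0 < e"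
  shows "EX d>0. ALL x y. dist x y < d --> \<bar>g x - g y\<bar> < e"
proof -
  obtain R where R: "K \<subseteq> cball 0 R" using compact_imp_bounded[OF K(1)] unfolding bounded_iff by (auto simp: subset_eq dist_norm)
  have "uniformly_continuous_on (cball 0 (R + 1)) g"
    by (intro compact_uniformly_continuous continuous_on_subset[OF g]) auto
  then obtain d where d: "0 < d" "!!x y. x : cball 0 (R+1) ==> y : cball 0 (R+1) ==> dist y x < d ==> dist (g y) (g x) < e"
    using e unfolding uniformly_continuous_on_def by meson
  have "\<bar>g x - g y\<bar> < e" if xy: "dist x y < min d 1" for x y
  proof (cases "x : cball 0 (R+1) & y : cball 0 (R+1)")
    case True
    then show ?thesis using d(2)[of y x] xy by (simp add: dist_real_def)
  next
    case False
    have "norm x <= norm y + dist x y" "norm y <= norm x + dist x y"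
      by (metis dist_norm norm_triangle_sub add.commute, metis dist_norm dist_commute norm_triangle_sub add.commute)
    then have "x ~: cball 0 R" "y ~: cball 0 R" using False xy by auto
    then have "x ~: K" "y ~: K" using R by blast+
    then have "g x = 0" "g y = 0" using K(2) by blast+
    then show ?thesis using e by simp
  qed
  then show ?thesis using d(1) by (intro exI[of _ "min d 1"]) auto
qed

text \<open>Mean value theorem along a segment together with uniform continuity of the partial
  derivatives. Uniformity in x is what allows differentiation under the integral.\<close>

lemma test_fun_uniform_derivative:
  fixes psi :: "real^'d => real"
  assumes psi: "test_fun psi" and e: "0 < e"
  shows "EX d>0. ALL x h. norm h < d --> \<bar>psi (x + h) - psi x - (SUM j:UNIV. h $ j * dpart psi j x)\<bar> <= e * norm h"
proof -
  obtain K where K: "compact K" "!!x j. x ~: K ==> dpart psi j x = 0" using test_funE[OF psi] by metis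
  define e' where "e' = e / real CARD('d)"
  have e': "0 < e'" using e by (simp add: e'_def)
  have "ALL j. EX d>0. ALL x y. dist x y < d --> \<bar>dpart psi j x - dpart psi j y\<bar> < e'"
    using uniformly_continuous_compact_support[OF test_fun_dpart_continuous[OF psi] K e'] by blast
  then obtain d where d: "!!j. 0 < d j" "!!j x y. dist x y < d j ==> \<bar>dpart psi j x - dpart psi j y\<bar> < e'"
    by metis
  define d0 where "d0 = Min (range d)"
  have d0: "0 < d0" "!!j. d0 <= d j" using d(1) by (auto simp: d0_def)
  have "\<bar>psi (x + h) - psi x - (SUM j:UNIV. h $ j * dpart psi j x)\<bar> <= e * norm h" if h: "norm h < d0" for x h
  proof -
    have D: "((%s. psi (x + s *\<^sub>R h)) has_derivative (%r. SUM j:UNIV. (r *\<^sub>R h) $ j * dpart psi j (x + s *\<^sub>R h))) (at s within {0..1})" for s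
      by (rule has_derivative_compose[of "%s. x + s *\<^sub>R h" "%r. r *\<^sub>R h" s "{0..1}" psi, OF _ test_fun_has_derivative[OF psi]])
         (auto intro!: derivative_eq_intros)
    obtain s where s: "s : {0..1}" "psi (x + 1 *\<^sub>R h) - psi (x + 0 *\<^sub>R h) = (SUM j:UNIV. ((1 - 0) *\<^sub>R h) $ j * dpart psi j (x + s *\<^sub>R h))"
      using mvt_very_simple[of 0 1 "%s. psi (x + s *\<^sub>R h)" "%s r. SUM j:UNIV. (r *\<^sub>R h) $ j * dpart psi j (x + s *\<^sub>R h)"] D
      by auto
    have "psi (x + h) - psi x - (SUM j:UNIV. h $ j * dpart psi j x) = (SUM j:UNIV. h $ j * (dpart psi j (x + s *\<^sub>R h) - dpart psi j x))"
      using s(2) by (simp add: sum_subtractf algebra_simps)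
    also have "\<bar>...\<bar> <= (SUM j:UNIV. \<bar>h $ j * (dpart psi j (x + s *\<^sub>R h) - dpart psi j x)\<bar>)" by (rule sum_abs)
    also have "... <= (SUM j:(UNIV::'d set). norm h * e')"
    proof (rule sum_mono)
      fix j
      have "norm (s *\<^sub>R h) <= norm h" using s(1) by (simp add: mult_left_le_one_le)
      then have "dist (x + s *\<^sub>R h) x < d j" using h d0(2)[of j] by (simp add: dist_norm)
      then have "\<bar>dpart psi j (x + s *\<^sub>R h) - dpart psi j x\<bar> <= e'" using d(2) less_imp_le by blast
      then show "\<bar>h $ j * (dpart psi j (x + s *\<^sub>R h) - dpart psi j x)\<bar> <= norm h * e'"
        unfolding abs_mult by (intro mult_mono component_le_norm_cart) auto
    qed
    also have "... = e * norm h" by (simp add: e'_def)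
    finally show ?thesis .
  qed
  then show ?thesis using d0(1) by blast
qed

text \<open>A correlation: the kernel sits at p - x, so a derivative in x produces a minus sign,
  which cancels against the minus sign of a weak derivative.\<close>

definition conv :: "(real^'d => real) => (real^'d => real) => real^'d => real" where
  "conv psi f x = (LBINT p. f p * psi (p - x))"

lemma conv_integrable:
  fixes f psi :: "real^'d => real"
  assumes f: "lloc f" and psi: "continuous_on UNIV psi" "compact K" "!!x. x ~: K ==> psi x = 0"
  shows "integrable lborel (%p. f p * psi (p - x))"
proof (rule lloc_mult_integrable[OF f])
  show "continuous_on UNIV (%p. psi (p - x))"
    by (rule continuous_on_compose2[OF psi(1)]) (auto intro!: continuous_intros)
  show "compact ((+) x ` K)" using psi(2) by (rule compact_translation)
  show "psi (p - x) = 0" if "p ~: (+) x ` K" for p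
    using psi(3)[of "p - x"] that by (metis add.commute diff_add_cancel image_eqI)
qed

lemma conv_integrable_test: "lloc f ==> test_fun psi ==> integrable lborel (%p. f p * psi (p - x))"
  using conv_integrable[of f psi] test_fun_continuous test_funE by metis

lemma conv_integrable_dpart: "lloc f ==> test_fun psi ==> integrable lborel (%p. f p * dpart psi j (p - x))"
  using conv_integrable[of f "dpart psi j"] test_fun_dpart_continuous test_funE by metis

text \<open>The first order remainder of \<open>psi\<close> is uniformly small compared with the
  increment, and \<open>f\<close> has a finite mass \<open>I\<close> on a box that contains the
  shifted supports for all increments below 1.\<close>

lemma conv_has_derivative:
  fixes f psi :: "real^'d => real"
  assumes f: "lloc f" and psi: "test_fun psi"
  shows "(conv psi f has_derivative (%h. - (SUM j:UNIV. h $ j * conv (dpart psi j) f x))) (at x)"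
  unfolding has_derivative_at_alt
proof (intro conjI allI impI)
  show "bounded_linear (%h. - (SUM j:UNIV. h $ j * conv (dpart psi j) f x))"
    by (intro bounded_linear_minus bounded_linear_sum bounded_linear_mult_const bounded_linear_vec_nth)
  fix e :: real assume e: "0 < e"
  have [measurable]: "f : bmb" "psi : bmb" "dpart psi j : bmb" for j
    using f psi by (auto simp: lloc_def intro!: borel_measurable_continuous_onI test_fun_continuous test_fun_dpart_continuous)
  obtain K where K: "compact K" "!!x. x ~: K ==> psi x = 0" "!!x j. x ~: K ==> dpart psi j x = 0" using test_funE[OF psi] by metis
  obtain R where R: "K \<subseteq> cball 0 R" using compact_imp_bounded[OF K(1)] unfolding bounded_iff by (auto simp: subset_eq dist_norm)
  have "compact (cball x (R + 1))" by simp
  then obtain a b where ab: "cball x (R+1) \<subseteq> cbox a b" using compact_in_cbox by metis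
  define I where "I = (LBINT p. ind (cbox a b) p * \<bar>f p\<bar>)"
  have int: "integrable lborel (%p. ind (cbox a b) p * \<bar>f p\<bar>)"
    using integrable_norm[OF lloc_set_integrable[OF f, of a b, unfolded set_integrable_def]] by (simp add: abs_mult)
  have I: "0 <= I" unfolding I_def by (intro integral_nonneg_AE) auto
  obtain d where d: "0 < d" "!!x h. norm h < d ==> \<bar>psi (x + h) - psi x - (SUM j:UNIV. h $ j * dpart psi j x)\<bar> <= e / (I + 1) * norm h"
    using test_fun_uniform_derivative[OF psi, of "e / (I+1)"] e I by auto
  have "norm (conv psi f y - conv psi f x - - (SUM j:UNIV. (y - x) $ j * conv (dpart psi j) f x)) <= e * norm (y - x)"
    if y: "norm (y - x) < min d 1" for y
  proof -
    let ?r = "%p. psi (p - y) - psi (p - x) + (SUM j:UNIV. (y - x) $ j * dpart psi j (p - x))"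
    have eq: "conv psi f y - conv psi f x - - (SUM j:UNIV. (y - x) $ j * conv (dpart psi j) f x) = (LBINT p. f p * ?r p)"
    proof -
      have "(LBINT p. f p * ?r p) = (LBINT p. (f p * psi (p - y) - f p * psi (p - x)) + (SUM j:UNIV. (y - x) $ j * (f p * dpart psi j (p - x))))"
        by (intro Bochner_Integration.integral_cong) (auto simp: algebra_simps sum_distrib_left)
      also have "... = conv psi f y - conv psi f x + (SUM j:UNIV. (y - x) $ j * conv (dpart psi j) f x)"
        using conv_integrable_test[OF f psi] conv_integrable_dpart[OF f psi]
        by (simp add: conv_def)
      finally show ?thesis by simp
    qed
    have bd: "\<bar>f p * ?r p\<bar> <= (e / (I+1) * norm (y - x)) * (ind (cbox a b) p * \<bar>f p\<bar>)" for p
    proof (cases "p : cbox a b")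
      case True
      have "\<bar>?r p\<bar> <= e / (I+1) * norm (y - x)"
        using d(2)[of "x - y" "p - x"] y by (simp add: norm_minus_commute sum_negf[symmetric] algebra_simps sum_subtractf)
      then have "\<bar>f p\<bar> * \<bar>?r p\<bar> <= \<bar>f p\<bar> * (e / (I+1) * norm (y - x))" by (rule mult_left_mono) simp
      then show ?thesis using True by (simp add: abs_mult mult.commute)
    next
      case False
      then have "p ~: cball x (R + 1)" using ab by blast
      then have "dist x p > R + 1" by simp
      moreover have "dist x p <= dist y p + norm (y - x)"
        by (metis dist_commute dist_norm dist_triangle add.commute)
      ultimately have "norm (p - x) > R" "norm (p - y) > R" using y by (auto simp: dist_norm norm_minus_commute)
      then have "p - x ~: K" "p - y ~: K" using R by auto
      then show ?thesis using False K(2,3) by simp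
    qed
    have "\<bar>\<integral>p. f p * ?r p \<partial>lborel\<bar> <= (LBINT p. \<bar>f p * ?r p\<bar>)" by (rule integral_abs_bound)
    also have "... <= (LBINT p. (e / (I+1) * norm (y - x)) * (ind (cbox a b) p * \<bar>f p\<bar>))"
    proof (rule integral_mono)
      show i2: "integrable lborel (%p. (e / (I+1) * norm (y - x)) * (ind (cbox a b) p * \<bar>f p\<bar>))" using int by simp
      show "integrable lborel (%p. \<bar>f p * ?r p\<bar>)"
      proof (rule Bochner_Integration.integrable_bound[OF i2])
        show "AE p in lborel. norm \<bar>f p * ?r p\<bar> <= norm ((e / (I+1) * norm (y - x)) * (ind (cbox a b) p * \<bar>f p\<bar>))"
          by (rule AE_I2) (unfold real_norm_def abs_idempotent, rule order_trans[OF bd abs_ge_self])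
      qed simp
    qed (use bd in auto)
    also have "... = (e / (I+1) * I) * norm (y - x)" by (simp add: I_def)
    also have "... <= e * norm (y - x)" using e I by (intro mult_right_mono) (auto simp: field_simps)
    finally show ?thesis unfolding eq real_norm_def .
  qed
  then show "EX d>0. ALL y. norm (y - x) < d --> norm (conv psi f y - conv psi f x - - (SUM j:UNIV. (y - x) $ j * conv (dpart psi j) f x)) <= e * norm (y - x)"
    using d(1) by (intro exI[of _ "min d 1"]) auto
qed

text \<open>Weak derivative with Lebesgue integrals, meant for Borel representatives; the gauge
  integrals of \<open>weak_partial\<close> are converted to this form once.\<close>

definition bweak :: "(real^'d => real) => 'd => (real^'d => real) => bool" where
  "bweak f j g \<longleftrightarrow> (ALL psi. test_fun psi --> (LBINT x. f x * dpart psi j x) = - (LBINT x. g x * psi x))"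

lemma conv_bweak:
  assumes w: "bweak f j g" and psi: "test_fun psi"
  shows "conv (dpart psi j) f x = - conv psi g x"
proof -
  have "(LBINT p. f p * dpart (%p. psi (p - x)) j p) = - (LBINT p. g p * psi (p - x))"
    using w test_fun_shift(1)[OF psi] unfolding bweak_def by blast
  then show ?thesis by (simp add: test_fun_shift(2)[OF psi] conv_def)
qed

text \<open>A C^1 cutoff vanishing on the negative half-line. Test functions are C^1 here, so it
  takes the place of the usual exponential bump.\<close>

definition sqp :: "real => real" where "sqp s = (max 0 s)\<^sup>2"

lemma sqp_deriv: "(sqp has_real_derivative 2 * max 0 s) (at s)"
proof -
  have e: "\<bar>sqp y - sqp s - 2 * max 0 s * (y - s)\<bar> <= (y - s)\<^sup>2" for y
  proof (cases "s <= 0")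
    case s: True
    show ?thesis
    proof (cases "y <= 0")
      case False
      then have "y\<^sup>2 <= (y - s)\<^sup>2" using s by (intro power_mono) auto
      then show ?thesis using s False by (simp add: sqp_def)
    qed (use s in \<open>simp add: sqp_def\<close>)
  next
    case s: False
    show ?thesis
    proof (cases "y <= 0")
      case True
      have "\<bar>0 - s\<^sup>2 - 2 * s * (y - s)\<bar> = \<bar>(y - s)\<^sup>2 - y\<^sup>2\<bar>" by (simp add: power2_eq_square algebra_simps)
      also have "... <= (y - s)\<^sup>2"
      proof -
        have "(- y)\<^sup>2 <= (s - y)\<^sup>2" using s True by (intro power_mono) auto
        then show ?thesis by (simp add: power2_commute[of s y])
      qed
      finally show ?thesis using s True by (simp add: sqp_def)
    next
      case False
      have "y\<^sup>2 - s\<^sup>2 - 2 * s * (y - s) = (y - s)\<^sup>2" by (simp add: power2_eq_square algebra_simps)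
      then show ?thesis using s False by (simp add: sqp_def)
    qed
  qed
  have "(sqp has_derivative (%h. 2 * max 0 s * h)) (at s)"
    unfolding has_derivative_at_alt
  proof (intro conjI allI impI)
    fix e :: real assume "0 < e"
    show "EX d>0. ALL y. norm (y - s) < d --> norm (sqp y - sqp s - 2 * max 0 s * (y - s)) <= e * norm (y - s)"
    proof (intro exI[of _ e] conjI allI impI)
      fix y assume "norm (y - s) < e"
      then have "(y - s)\<^sup>2 <= e * \<bar>y - s\<bar>"
        using mult_right_mono[of "\<bar>y - s\<bar>" e "\<bar>y - s\<bar>"] by (simp add: power2_eq_square flip: abs_mult)
      then show "norm (sqp y - sqp s - 2 * max 0 s * (y - s)) <= e * norm (y - s)" using e[of y] by simp
    qed fact
  qed (rule bounded_linear_mult_right)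
  then show ?thesis by (simp add: has_field_derivative_def)
qed

text \<open>In each coordinate the product of the signed distances to the two faces is positive
  exactly between them; its truncated square is C^1, and the product of these squares is positive
  exactly on the open box.\<close>

definition boxhump :: "real^'d => real^'d => real^'d => real" where
  "boxhump a b x = (\<Prod>j\<in>UNIV. sqp ((x $ j - a $ j) * (b $ j - x $ j)))"

lemma boxhump_has_derivative:
  "(boxhump a b has_derivative (%h. SUM i:UNIV. (2 * max 0 ((x $ i - a $ i) * (b $ i - x $ i)) * ((b $ i - x $ i) - (x $ i - a $ i))) * h $ i *
      (\<Prod>j\<in>UNIV - {i}. sqp ((x $ j - a $ j) * (b $ j - x $ j))))) (at x)"
  unfolding boxhump_def[abs_def]
proof (rule has_derivative_prod)
  fix i :: 'a
  have "((%x. (x $ i - a $ i) * (b $ i - x $ i)) has_derivative (%h. ((b $ i - x $ i) - (x $ i - a $ i)) * h $ i)) (at x)"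
    by (auto intro!: derivative_eq_intros bounded_linear_imp_has_derivative bounded_linear_vec_nth simp: algebra_simps)
  from has_derivative_compose[OF this sqp_deriv[unfolded has_field_derivative_def]]
  show "((%x. sqp ((x $ i - a $ i) * (b $ i - x $ i))) has_derivative
     (%h. (2 * max 0 ((x $ i - a $ i) * (b $ i - x $ i)) * ((b $ i - x $ i) - (x $ i - a $ i))) * h $ i)) (at x)"
    by (simp add: mult.assoc)
qed

lemma boxhump_nonneg: "0 <= boxhump a b x"
  by (auto simp: boxhump_def sqp_def intro!: prod_nonneg)

lemma mem_box_cart_strict: "x : box a b \<longleftrightarrow> (ALL i. a $ i < x $ i & x $ i < b $ i)" for x :: "real^'d"
  by (simp add: mem_box_cart)

lemma boxhump_pos_iff:
  assumes ab: "!!j. a $ j < b $ j"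
  shows "0 < boxhump a b x \<longleftrightarrow> x : box a b"
proof
  assume x: "x : box a b"
  show "0 < boxhump a b x" unfolding boxhump_def
  proof (rule prod_pos)
    fix j :: 'a
    have "0 < (x $ j - a $ j) * (b $ j - x $ j)"
      using x by (intro mult_pos_pos) (auto simp: mem_box_cart_strict)
    then show "0 < sqp ((x $ j - a $ j) * (b $ j - x $ j))" unfolding sqp_def
      by (intro zero_less_power less_max_iff_disj[THEN iffD2] disjI2)
  qed
next
  assume p: "0 < boxhump a b x"
  show "x : box a b"
  proof (rule ccontr)
    assume "x ~: box a b"
    then obtain i where i: "~ (a $ i < x $ i & x $ i < b $ i)" by (auto simp: mem_box_cart_strict)
    have "(x $ i - a $ i) * (b $ i - x $ i) <= 0"
      using i ab[of i] by (cases "a $ i < x $ i") (auto simp: mult_le_0_iff)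
    then have "boxhump a b x = 0" unfolding boxhump_def
      by (intro prod_zero bexI[of _ i]) (auto simp: sqp_def max_absorb1)
    then show False using p by simp
  qed
qed

text \<open>The map s |-> 1 - \<open>sqp\<close> (1 - s) turns the hump into a C^1 function with
  values in [0,1] that equals 1 wherever n times the hump is at least 1. Hence the limit is the
  indicator of the open box.\<close>

definition boxbump :: "real^'d => real^'d => real => real^'d => real" where
  "boxbump a b n x = 1 - sqp (1 - n * boxhump a b x)"

lemma boxbump_test_fun:
  fixes a b :: "real^'d"
  assumes ab: "!!j. a $ j < b $ j"
  shows "test_fun (boxbump a b n)"
proof (rule test_funI[of "cbox a b"])
  show "compact (cbox a b)" by (rule compact_cbox)
  fix x :: "real^'d"
  show "boxbump a b n x = 0" if "x ~: cbox a b"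
  proof -
    have "x ~: box a b" using that box_subset_cbox by auto
    then have "boxhump a b x = 0" using boxhump_pos_iff[OF ab, of x] boxhump_nonneg[of a b x] by linarith
    then show ?thesis by (simp add: boxbump_def sqp_def)
  qed
  let ?H = "%x h. SUM i:UNIV. (2 * max 0 ((x $ i - a $ i) * (b $ i - x $ i)) * ((b $ i - x $ i) - (x $ i - a $ i))) * h $ i *
      (\<Prod>j\<in>UNIV - {i}. sqp ((x $ j - a $ j) * (b $ j - x $ j)))"
  have "((%x. 1 - n * boxhump a b x) has_derivative (%h. - (n * ?H x h))) (at x)"
    using has_derivative_diff[OF has_derivative_const[of "1::real"] has_derivative_mult_right[OF boxhump_has_derivative[of a b x], of n]]
    by (simp only: diff_0)
  from has_derivative_compose[OF this sqp_deriv[unfolded has_field_derivative_def]]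
  have "((%x. sqp (1 - n * boxhump a b x)) has_derivative (%h. 2 * max 0 (1 - n * boxhump a b x) * - (n * ?H x h))) (at x)" .
  from has_derivative_diff[OF has_derivative_const[of "1::real"] this]
  show "(boxbump a b n has_derivative (%h. 2 * max 0 (1 - n * boxhump a b x) * (n * ?H x h))) (at x)"
    by (simp add: boxbump_def[abs_def])
  show "continuous_on UNIV (%x. 2 * max 0 (1 - n * boxhump a b x) * (n * ?H x (axis j 1)))" for j
  proof -
    have [continuous_intros]: "continuous_on UNIV (boxhump a b)"
      using has_derivative_continuous[OF boxhump_has_derivative[of a b]] by (simp add: continuous_on_eq_continuous_within)
    have s: "continuous_on UNIV sqp" unfolding sqp_def[abs_def] by (intro continuous_intros)
    have [continuous_intros]: "continuous_on UNIV (%x. sqp ((x $ j - a $ j) * (b $ j - x $ j)))" for j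
      by (rule continuous_on_compose2[OF s]) (auto intro!: continuous_intros)
    show ?thesis by (intro continuous_intros)
  qed
qed

lemma boxbump_range: "0 <= n ==> 0 <= boxbump a b n x" "0 <= n ==> boxbump a b n x <= 1"
proof -
  assume "0 <= n"
  then have "max 0 (1 - n * boxhump a b x) <= 1" using mult_nonneg_nonneg[OF _ boxhump_nonneg[of a b x], of n] by simp
  then have "(max 0 (1 - n * boxhump a b x))\<^sup>2 <= 1" by (simp add: power_le_one)
  then show "0 <= boxbump a b n x" by (simp add: boxbump_def sqp_def)
  show "boxbump a b n x <= 1" by (simp add: boxbump_def sqp_def)
qed

lemma boxbump_outside:
  assumes "!!j. a $ j < b $ j" "x ~: box a b" shows "boxbump a b n x = 0"
proof -
  have "boxhump a b x = 0" using boxhump_pos_iff[OF assms(1), of x] assms(2) boxhump_nonneg[of a b x] by linarith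
  then show ?thesis by (simp add: boxbump_def sqp_def)
qed

lemma boxbump_tendsto:
  assumes "!!j. a $ j < b $ j"
  shows "(%n. boxbump a b (real n) x) \<longlonglongrightarrow> ind (box a b) x"
proof (cases "x : box a b")
  case True
  then have p: "0 < boxhump a b x" using boxhump_pos_iff[OF assms] by blast
  obtain N :: nat where N: "1 / boxhump a b x < real N" using reals_Archimedean2 by blast
  have "boxbump a b (real n) x = 1" if "N <= n" for n
  proof -
    have "1 / boxhump a b x < real n" using N that by (meson less_le_trans of_nat_le_iff)
    then have "1 < real n * boxhump a b x" using p by (simp add: field_simps)
    then show ?thesis by (simp add: boxbump_def sqp_def)
  qed
  then have "eventually (%n. boxbump a b (real n) x = 1) sequentially" by (auto simp: eventually_sequentially)
  then show ?thesis using True by (simp add: tendsto_eventually)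
next
  case False
  then show ?thesis using boxbump_outside[OF assms False] by simp
qed

lemma norm_le_card_sup:
  fixes x :: "real^'d"
  assumes "!!j. \<bar>x $ j\<bar> <= r" shows "norm x <= real CARD('d) * r"
proof -
  have "norm x <= (SUM i:UNIV. \<bar>x $ i\<bar>)" by (rule norm_le_l1_cart)
  also have "... <= (SUM i:(UNIV::'d set). r)" by (intro sum_mono assms)
  finally show ?thesis by simp
qed

text \<open>A normalised bump on a centred cube. Its half-side \<open>r\<close> is such that a sup
  norm below \<open>r\<close> forces a Euclidean norm of at most e/2.\<close>

lemma mollifier_exists:
  assumes "0 < e"
  shows "EX eta::real^'d => real. test_fun eta & (ALL x. 0 <= eta x) & (LBINT x. eta x) = 1 & (ALL x. e <= norm x --> eta x = 0)"
proof -
  define r where "r = e / (2 * real CARD('d))"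
  have r: "0 < r" using assms by (simp add: r_def)
  define a b where "a = (\<chi> j::'d. - r)" and "b = (\<chi> j::'d. r)"
  have ab: "a $ j < b $ j" for j using r by (simp add: a_def b_def)
  let ?psi = "boxbump a b 1"
  have t: "test_fun ?psi" by (rule boxbump_test_fun[OF ab])
  have int: "integrable lborel ?psi"
  proof -
    obtain K where K: "compact K" "!!x. x ~: K ==> ?psi x = 0" using test_funE[OF t] by metis
    have "lloc (%x::real^'d. 1)" unfolding lloc_def
      by (auto simp: set_integrable_def intro!: integrable_real_indicator emeasure_lborel_cbox_finite)
    from lloc_mult_integrable[OF this test_fun_continuous[OF t] K] show ?thesis by simp
  qed
  have pos: "0 < ?psi x" if "x : box a b" for x
  proof -
    have "0 < boxhump a b x" using boxhump_pos_iff[OF ab] that by blast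
    then have "max 0 (1 - 1 * boxhump a b x) < 1" by simp
    then have "(max 0 (1 - 1 * boxhump a b x))\<^sup>2 < 1\<^sup>2" by (intro power_strict_mono) auto
    then show ?thesis by (simp add: boxbump_def sqp_def)
  qed
  have I: "0 < (LBINT x. ?psi x)"
  proof -
    have "0 <= (LBINT x. ?psi x)" by (intro integral_nonneg_AE) (auto simp: boxbump_range)
    moreover have "(LBINT x. ?psi x) ~= 0"
    proof
      assume "(LBINT x. ?psi x) = 0"
      then have "AE x in lborel. ?psi x = 0" using integral_nonneg_eq_0_iff_AE[OF int] by (auto simp: boxbump_range)
      then have "AE x in lborel. x ~: box a b" by (rule AE_mp) (use pos in \<open>force intro!: AE_I2\<close>)
      then have "emeasure lborel (box a b) = 0" by (subst (asm) AE_iff_measurable[of "box a b"]) auto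
      moreover have "emeasure lborel (box a b) > 0"
        using ab by (simp add: emeasure_lborel_box_eq a_def b_def inner_diff_left) (auto simp: Basis_vec_def inner_axis prod_pos intro!: prod_pos)
      ultimately show False by simp
    qed
    ultimately show ?thesis by linarith
  qed
  define eta where "eta = (%x. (1 / (LBINT x. ?psi x)) * ?psi x)"
  show ?thesis
  proof (intro exI[of _ eta] conjI allI impI)
    show "test_fun eta" unfolding eta_def by (rule test_fun_cmult[OF t])
    show "0 <= eta x" for x unfolding eta_def using I by (intro mult_nonneg_nonneg) (auto simp: boxbump_range)
    show "(LBINT x. eta x) = 1" unfolding eta_def using I by simp
    fix x :: "real^'d" assume x: "e <= norm x"
    have "x ~: box a b"
    proof
      assume "x : box a b"
      then have "\<bar>x $ j\<bar> <= r" for j by (auto simp: mem_box_cart_strict a_def b_def abs_le_iff less_imp_le) (smt (verit))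
      then have "norm x <= real CARD('d) * r" by (rule norm_le_card_sup)
      also have "... = e / 2" by (simp add: r_def)
      finally show False using x assms by simp
    qed
    then show "eta x = 0" unfolding eta_def using boxbump_outside[OF ab] by simp
  qed
qed

text \<open>The positive and the negative part of \<open>f\<close> are densities of two measures
  that are finite and equal on open boxes, an intersection-stable generator. So the densities agree
  almost everywhere, and at most one of them is nonzero at a point.\<close>

lemma AE_eq_zero_if_box_integrals_zero:
  fixes f :: "real^'d => real"
  assumes f: "lloc f" and z: "!!a b. (!!j. a $ j < b $ j) ==> (LBINT x. ind (box a b) x * f x) = 0"
  shows "AE x in lborel. f x = 0"
proof -
  have [measurable]: "f : bmb" using f by (simp add: lloc_def)
  have intb: "integrable lborel (%x. ind (box a b) x * f x)" for a b
  proof (rule Bochner_Integration.integrable_bound[OF lloc_set_integrable[OF f, of a b, unfolded set_integrable_def]])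
    show "AE x in lborel. norm (ind (box a b) x * f x) <= norm (ind (cbox a b) x *\<^sub>R f x)"
      using box_subset_cbox[of a b] by (auto simp: indicator_def)
  qed simp
  let ?E = "range (%(a, b). box a b::(real^'d) set)"
  let ?p = "%x. ennreal (f x)" and ?n = "%x. ennreal (- f x)"
  have fin: "(NN x. ?p x * ind (box a b) x) < \<infinity>" for a b
  proof -
    have "(NN x. ?p x * ind (box a b) x) <= (NN x. ennreal (norm (ind (box a b) x * f x)))"
      by (intro nn_integral_mono) (auto simp: indicator_def intro!: ennreal_leI)
    also have "... < \<infinity>" using intb[of a b] by (simp add: integrable_iff_bounded)
    finally show ?thesis .
  qed
  have fin': "(NN x. ?n x * ind (box a b) x) < \<infinity>" for a b
  proof -
    have "(NN x. ?n x * ind (box a b) x) <= (NN x. ennreal (norm (ind (box a b) x * f x)))"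
      by (intro nn_integral_mono) (auto simp: indicator_def intro!: ennreal_leI)
    also have "... < \<infinity>" using intb[of a b] by (simp add: integrable_iff_bounded)
    finally show ?thesis .
  qed
  have eq: "(NN x. ?p x * ind (box a b) x) = (NN x. ?n x * ind (box a b) x)" for a b
  proof (cases "ALL j. a $ j < b $ j")
    case True
    have "0 = (LBINT x. ind (box a b) x * f x)" using z True by simp
    also have "... = enn2real (NN x. ennreal (ind (box a b) x * f x)) - enn2real (NN x. ennreal (- (ind (box a b) x * f x)))"
      by (rule real_lebesgue_integral_def[OF intb])
    also have "(NN x. ennreal (ind (box a b) x * f x)) = (NN x. ?p x * ind (box a b) x)"
      by (intro nn_integral_cong) (auto simp: indicator_def)
    also have "(NN x. ennreal (- (ind (box a b) x * f x))) = (NN x. ?n x * ind (box a b) x)"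
      by (intro nn_integral_cong) (auto simp: indicator_def)
    finally have "ennreal (enn2real (NN x. ?p x * ind (box a b) x)) =
      ennreal (enn2real (NN x. ?n x * ind (box a b) x))" by simp
    then show ?thesis
      by (simp only: ennreal_enn2real[OF fin[unfolded infinity_ennreal_def]] ennreal_enn2real[OF fin'[unfolded infinity_ennreal_def]])
  next
    case False
    then have "box a b = {}" by (metis mem_box_cart_strict equals0I less_trans)
    then show ?thesis by simp
  qed
  have "density lborel ?p = density lborel ?n"
  proof (rule measure_eqI_generator_eq[of ?E])
    show "Int_stable ?E" by (auto simp: Int_stable_def box_Int_box)
    show "?E \<subseteq> Pow UNIV" "sets (density lborel ?p) = sigma_sets UNIV ?E" "sets (density lborel ?n) = sigma_sets UNIV ?E"
      by (simp_all add: borel_eq_box)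
    let ?A = "%n::nat. box (- (real n *\<^sub>R One)) (real n *\<^sub>R One) :: (real^'d) set"
    show "range ?A \<subseteq> ?E" "(\<Union>i. ?A i) = UNIV" unfolding UN_box_eq_UNIV by auto
    show "emeasure (density lborel ?p) (?A i) ~= \<infinity>" for i
      using fin[of "- (real i *\<^sub>R One)" "real i *\<^sub>R One"] by (simp add: emeasure_density)
    show "emeasure (density lborel ?p) X = emeasure (density lborel ?n) X" if "X : ?E" for X
      using that eq by (auto simp: emeasure_density)
  qed
  then have "AE x in lborel. ?p x = ?n x" by (subst (asm) sigma_finite_measure.density_unique_iff[OF sigma_finite_lborel]) auto
  then show ?thesis
  proof eventually_elim
    case (elim x)
    then show ?case by (cases "0 <= f x") (auto simp: ennreal_neg ennreal_eq_0_iff dest: sym)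
  qed
qed

lemma bump_integral_tendsto:
  fixes f :: "real^'d => real"
  assumes f: "lloc f" and ab: "!!j. a $ j < b $ j"
  shows "(%n. conv (boxbump a b (real n)) f z) \<longlonglongrightarrow> (LBINT p. ind (box a b) p * f (p + z))"
proof -
  have [measurable]: "f : bmb" using f by (simp add: lloc_def)
  have [measurable]: "boxbump a b n : bmb" for n
    by (intro borel_measurable_continuous_onI test_fun_continuous boxbump_test_fun ab)
  have e: "(LBINT p. f p * ind (box a b) (p - z)) = (LBINT p. ind (box a b) p * f (p + z))"
    using lborel_integral_translate[of "%p. f p * ind (box a b) (p - z)" z]
    by (simp add: mult.commute)
  have sub: "p : cbox (a + z) (b + z)" if "p - z : box a b" for p
    using that by (auto simp: mem_box_cart algebra_simps) (smt (verit) mem_box_cart vector_add_component)+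
  have "(%n. \<integral>p. f p * boxbump a b (real n) (p - z) \<partial>lborel) \<longlonglongrightarrow> (LBINT p. f p * ind (box a b) (p - z))"
  proof (rule integral_dominated_convergence)
    show "integrable lborel (%p. norm (ind (cbox (a+z) (b+z)) p *\<^sub>R f p))"
      using lloc_set_integrable[OF f] unfolding set_integrable_def by (rule integrable_norm)
    show "AE p in lborel. (%n. f p * boxbump a b (real n) (p - z)) \<longlonglongrightarrow> f p * ind (box a b) (p - z)"
      by (intro AE_I2 tendsto_intros boxbump_tendsto ab)
    show "AE p in lborel. norm (f p * boxbump a b (real n) (p - z)) <= norm (ind (cbox (a+z) (b+z)) p *\<^sub>R f p)" for n
    proof (rule AE_I2)
      fix p
      show "norm (f p * boxbump a b (real n) (p - z)) <= norm (ind (cbox (a+z) (b+z)) p *\<^sub>R f p)"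
      proof (cases "p - z : box a b")
        case True
        then show ?thesis using sub[OF True] boxbump_range[of "real n" a b "p - z"] by (simp add: abs_mult mult_left_le)
      qed (simp add: boxbump_outside[OF ab])
    qed
  qed simp_all
  then show ?thesis unfolding e conv_def .
qed

lemma AE_eq_zero_if_test_integrals_zero:
  fixes f :: "real^'d => real"
  assumes f: "lloc f" and z: "!!psi. test_fun psi ==> (LBINT x. f x * psi x) = 0"
  shows "AE x in lborel. f x = 0"
proof (rule AE_eq_zero_if_box_integrals_zero[OF f])
  fix a b :: "real^'d" assume ab: "!!j. a $ j < b $ j"
  have "(%n. conv (boxbump a b (real n)) f 0) \<longlonglongrightarrow> (LBINT p. ind (box a b) p * f (p + 0))"
    by (rule bump_integral_tendsto[OF f ab])
  moreover have "conv (boxbump a b (real n)) f 0 = 0" for n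
    using z[OF boxbump_test_fun[OF ab]] by (simp add: conv_def)
  ultimately show "(LBINT x. ind (box a b) x * f x) = 0" by (simp add: LIMSEQ_const_iff)
qed

section \<open>Stability of local integrability, and increments of averages\<close>

lemma integrable_indicator_bounded:
  fixes S :: "'a::euclidean_space set"
  assumes "S : sets borel" "bounded S"
  shows "integrable lborel (ind S :: 'a => real)"
proof (rule integrable_real_indicator)
  show "emeasure lborel S < \<infinity>" by (rule emeasure_bounded_finite[OF assms(2)])
qed (use assms in simp)

lemma lloc_bounded:
  fixes f :: "real^'d => real"
  assumes [measurable]: "f : bmb" and B: "!!a b. EX B. ALL x:cbox a b. \<bar>f x\<bar> <= B"
  shows "lloc f"
  unfolding lloc_def
proof (intro conjI allI)
  fix a b :: "real^'d"
  obtain B where B: "!!x. x : cbox a b ==> \<bar>f x\<bar> <= B" using assms(2) by blast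
  have "integrable lborel (%x. B * ind (cbox a b) x)"
    by (intro integrable_mult_right integrable_indicator_bounded) (auto simp: bounded_cbox)
  then show "set_integrable lborel (cbox a b) f" unfolding set_integrable_def
    by (rule Bochner_Integration.integrable_bound) (use B in \<open>auto simp: indicator_def intro: order_trans[OF _ abs_ge_self]\<close>)
qed fact

lemma lloc_const: "lloc (%x. c)"
  by (rule lloc_bounded) auto

lemma lloc_diff: "lloc f ==> lloc g ==> lloc (%x. f x - g x)"
  unfolding lloc_def set_integrable_def by (auto simp: algebra_simps)

lemma lloc_abs: "lloc f ==> lloc (%x. \<bar>f x\<bar>)"
  unfolding lloc_def by (auto intro!: set_integrable_abs)

lemma lloc_integrable_cbox: "lloc f ==> integrable lborel (%x. ind (cbox a b) x * f x)"
  using lloc_set_integrable[of f a b] by (simp add: set_integrable_def)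

lemma lloc_integrable_subset:
  assumes f: "lloc f" and S: "S : sets borel" "S \<subseteq> cbox a b"
  shows "integrable lborel (%x. ind S x * f x)"
proof (rule Bochner_Integration.integrable_bound[OF lloc_integrable_cbox[OF f, of a b]])
  have [measurable]: "f : bmb" using f by (rule lloc_borel)
  show "(%x. ind S x * f x) : borel_measurable lborel" using S by measurable
  show "AE x in lborel. norm (ind S x * f x) <= norm (ind (cbox a b) x * f x)"
    using S(2) by (auto simp: indicator_def)
qed

lemma lloc_integrable_box: "lloc f ==> integrable lborel (%x. ind (box a b) x * f x)"
  by (rule lloc_integrable_subset[of _ _ a b]) (auto simp: box_subset_cbox)

lemma cbox_shift_mem: "p : cbox a b \<longleftrightarrow> p + z : cbox (a + z) (b + z)" for p z :: "real^'d"
  by (simp add: mem_box_cart)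

lemma box_shift_mem: "p : box a b \<longleftrightarrow> p + z : box (a + z) (b + z)" for p z :: "real^'d"
  by (simp add: mem_box_cart)

lemma lloc_translate: 
  fixes f :: "real^'d => real"
  assumes f: "lloc f" shows "lloc (%x. f (x + z))"
proof -
  have [measurable]: "f : bmb" using f by (rule lloc_borel)
  have "integrable lborel (%x. ind (cbox a b) x * f (x + z))" for a b
  proof -
    have "integrable lborel (%x. (%y. ind (cbox (a + z) (b + z)) y * f y) (x + z))"
      by (subst lborel_integrable_translate) (auto intro!: lloc_integrable_cbox f)
    then show ?thesis by (simp add: indicator_def cbox_shift_mem[symmetric])
  qed
  then show ?thesis by (auto simp: lloc_def set_integrable_def)
qed

lemma conv_bump_bound:
  fixes h :: "real^'d => real"
  assumes h: "lloc h" and ab: "!!j. a $ j < b $ j" and n: "0 <= n"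
  shows "\<bar>conv (boxbump a b n) h x\<bar> <= (LBINT p. ind (box a b) (p - x) * \<bar>h p\<bar>)"
proof -
  have [measurable]: "h : bmb" using h by (rule lloc_borel)
  have t: "test_fun (boxbump a b n)" by (rule boxbump_test_fun[OF ab])
  have "integrable lborel (%p. ind (box (a + x) (b + x)) p * \<bar>h p\<bar>)"
    by (rule lloc_integrable_box[OF lloc_abs[OF h]])
  moreover have "ind (box (a + x) (b + x)) p = (ind (box a b) (p - x) :: real)" for p
    using box_shift_mem[of "p - x" a b x] by (simp add: indicator_def)
  ultimately have i: "integrable lborel (%p. ind (box a b) (p - x) * \<bar>h p\<bar>)" by simp
  have "\<bar>conv (boxbump a b n) h x\<bar> <= (LBINT p. \<bar>h p * boxbump a b n (p - x)\<bar>)"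
    unfolding conv_def by (rule integral_abs_bound)
  also have "... <= (LBINT p. ind (box a b) (p - x) * \<bar>h p\<bar>)"
  proof (rule integral_mono[OF _ i])
    show "integrable lborel (%p. \<bar>h p * boxbump a b n (p - x)\<bar>)"
      using conv_integrable_test[OF h t] by (rule integrable_abs)
    fix p
    show "\<bar>h p * boxbump a b n (p - x)\<bar> <= ind (box a b) (p - x) * \<bar>h p\<bar>"
      using boxbump_range[OF n, of a b "p - x"] boxbump_outside[OF ab, of "p - x" n]
      by (cases "p - x : box a b") (auto simp: abs_mult mult_left_le)
  qed
  finally show ?thesis .
qed

lemma conv_const: "conv psi (%_. c) x = c * conv psi (%_. 1) 0" if "psi : bmb"
  unfolding conv_def using lborel_integral_translate[of "%p. psi p" "- x"] that by simp

lemma conv_diff: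
  "lloc f ==> lloc g ==> test_fun psi ==> conv psi (%p. f p - g p) x = conv psi f x - conv psi g x"
  unfolding conv_def using conv_integrable_test[of f psi x] conv_integrable_test[of g psi x]
  by (simp add: left_diff_distrib)

text \<open>Mean value theorem for the correlation with a bump along the segment s z, whose
  derivative is an average of the weak gradient; then the bumps tend to the box. The free constants
  \<open>A j\<close> permit subtraction of a mean, so that \<open>K j\<close> can be an oscillation
  instead of a size.\<close>

lemma box_translate_increment:
  fixes f :: "real^'d => real" and g :: "'d => real^'d => real"
  assumes f: "lloc f" and g: "!!j. lloc (g j)" and w: "!!j. bweak f j (g j)"
    and ab: "!!j. a $ j < b $ j"
    and K: "!!th j. 0 <= th ==> th <= 1 ==> (LBINT p. ind (box a b) (p - th *\<^sub>R z) * \<bar>g j p - A j\<bar>) <= K j"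
  shows "\<bar>(LBINT p. ind (box a b) p * (f (p + z) - f p)) - measure lborel (box a b) * (SUM j:UNIV. z $ j * A j)\<bar>
    <= (SUM j:UNIV. \<bar>z $ j\<bar> * K j)"
proof -
  have [measurable]: "f : bmb" using f by (rule lloc_borel)
  have main: "\<bar>conv (boxbump a b (real n)) f z - conv (boxbump a b (real n)) f 0 -
      conv (boxbump a b (real n)) (%_. 1) 0 * (SUM j:UNIV. z $ j * A j)\<bar> <= (SUM j:UNIV. \<bar>z $ j\<bar> * K j)" for n
  proof -
    let ?psi = "boxbump a b (real n)"
    have t: "test_fun ?psi" by (rule boxbump_test_fun[OF ab])
    have m: "?psi : bmb" by (rule borel_measurable_continuous_onI[OF test_fun_continuous[OF t]])
    have D: "((%s. conv ?psi f (s *\<^sub>R z)) has_derivative (%r. SUM j:UNIV. (r *\<^sub>R z) $ j * conv ?psi (g j) (s *\<^sub>R z))) (at s within {0..1})" for s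
    proof -
      have "((%s. conv ?psi f (s *\<^sub>R z)) has_derivative (%r. - (SUM j:UNIV. (r *\<^sub>R z) $ j * conv (dpart ?psi j) f (s *\<^sub>R z)))) (at s within {0..1})"
        by (rule has_derivative_compose[OF _ conv_has_derivative[OF f t]]) (auto intro!: derivative_eq_intros)
      then show ?thesis by (simp add: conv_bweak[OF w t] sum_negf)
    qed
    obtain s where s: "s : {0..1}" "conv ?psi f (1 *\<^sub>R z) - conv ?psi f (0 *\<^sub>R z) = (SUM j:UNIV. ((1 - 0) *\<^sub>R z) $ j * conv ?psi (g j) (s *\<^sub>R z))"
      using mvt_very_simple[of 0 1 "%s. conv ?psi f (s *\<^sub>R z)" "%s r. SUM j:UNIV. (r *\<^sub>R z) $ j * conv ?psi (g j) (s *\<^sub>R z)"] D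
      by auto
    have "conv ?psi f z - conv ?psi f 0 - conv ?psi (%_. 1) 0 * (SUM j:UNIV. z $ j * A j) =
       (SUM j:UNIV. z $ j * (conv ?psi (g j) (s *\<^sub>R z) - conv ?psi (%_. A j) (s *\<^sub>R z)))"
    proof -
      have "conv ?psi (%_. A j) (s *\<^sub>R z) = A j * conv ?psi (%_. 1) 0" for j by (rule conv_const[OF m])
      then show ?thesis using s(2) by (simp add: sum_subtractf right_diff_distrib sum_distrib_left sum_distrib_right ac_simps)
    qed
    also have "... = (SUM j:UNIV. z $ j * conv ?psi (%p. g j p - A j) (s *\<^sub>R z))"
      by (simp add: conv_diff[OF g lloc_const t])
    also have "\<bar>...\<bar> <= (SUM j:UNIV. \<bar>z $ j * conv ?psi (%p. g j p - A j) (s *\<^sub>R z)\<bar>)" by (rule sum_abs)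
    also have "... <= (SUM j:UNIV. \<bar>z $ j\<bar> * K j)"
    proof (rule sum_mono)
      fix j
      have "\<bar>conv ?psi (%p. g j p - A j) (s *\<^sub>R z)\<bar> <= K j"
        using conv_bump_bound[OF lloc_diff[OF g[of j] lloc_const[of "A j"]] ab, of "real n" "s *\<^sub>R z"] K[of s j] s(1) by auto
      then show "\<bar>z $ j * conv ?psi (%p. g j p - A j) (s *\<^sub>R z)\<bar> <= \<bar>z $ j\<bar> * K j"
        unfolding abs_mult by (intro mult_left_mono) auto
    qed
    finally show ?thesis .
  qed
  have l1: "(LBINT p. ind (box a b) p * (1::real)) = measure lborel (box a b)" by simp
  have l2: "(LBINT p. ind (box a b) p * (f (p + z) - f p)) = (LBINT p. ind (box a b) p * f (p + z)) - (LBINT p. ind (box a b) p * f p)"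
    using lloc_integrable_box[OF lloc_translate[OF f, of z], of a b] lloc_integrable_box[OF f, of a b]
    by (simp add: right_diff_distrib)
  let ?c = "%h z n. conv (boxbump a b (real n)) h z"
  have "?c f z \<longlonglongrightarrow> (LBINT p. ind (box a b) p * f (p + z))" by (rule bump_integral_tendsto[OF f ab])
  moreover have "?c f 0 \<longlonglongrightarrow> (LBINT p. ind (box a b) p * f p)"
    using bump_integral_tendsto[OF f ab, where z = 0] by (simp only: add_0_right)
  moreover have "?c (%_. 1) 0 \<longlonglongrightarrow> measure lborel (box a b)"
    using bump_integral_tendsto[OF lloc_const[of 1] ab, where z = 0] by (simp only: l1)
  ultimately have "(%n. \<bar>?c f z n - ?c f 0 n - ?c (%_. 1) 0 n * (SUM j:UNIV. z $ j * A j)\<bar>) \<longlonglongrightarrow>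
      \<bar>(LBINT p. ind (box a b) p * f (p + z)) - (LBINT p. ind (box a b) p * f p) - measure lborel (box a b) * (SUM j:UNIV. z $ j * A j)\<bar>"
    by (intro tendsto_rabs tendsto_diff tendsto_mult tendsto_const)
  then show ?thesis unfolding l2 by (rule LIMSEQ_le_const2) (use main in auto)
qed

text \<open>Both weights live in the ball of radius \<open>R\<close>, so p + x + v stays within 2 R
  of \<open>v\<close>, and |f| on a box around that ball provides the dominating function.\<close>

lemma conv_fubini:
  fixes f g h :: "real^'d => real"
  assumes f: "lloc f" and [measurable]: "g : bmb" "h : bmb"
    and B: "!!x. \<bar>g x\<bar> <= B" "!!x. \<bar>h x\<bar> <= B" and S: "!!x. R < norm x ==> g x = 0" "!!x. R < norm x ==> h x = 0"
  shows "(LBINT x. g x * (LBINT p. h p * f (p + x + v))) = (LBINT p. h p * (LBINT x. g x * f (p + x + v)))"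
proof -
  have [measurable]: "f : bmb" using f by (rule lloc_borel)
  obtain a b where ab: "cball v (2 * R) \<subseteq> cbox a b" using compact_in_cbox[OF compact_cball] by metis
  define phi where "phi = (%x. ind (cbox a b) x * \<bar>f x\<bar>)"
  have phi: "integrable lborel phi" unfolding phi_def by (rule lloc_integrable_cbox[OF lloc_abs[OF f]])
  have [measurable]: "phi : bmb" unfolding phi_def by measurable
  have B0: "0 <= B" using B(1)[of 0] by linarith
  define F where "F = (%z. (B * B * ind (cball 0 R) (fst z)) * phi (snd z + (fst z + v)))"
  have F: "integrable plb F"
  proof (rule lborel_pair.Fubini_integrable)
    have [measurable]: "cball (0::real^'d) R : sets borel" by simp
    have "F : borel_measurable bxb" unfolding F_def by measurable
    then show "F : borel_measurable plb"
      by (subst measurable_cong_sets[OF sets_pair_measure_cong[OF sets_lborel sets_lborel] refl])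
    have "integrable lborel (%x::real^'d. (B * B * integral\<^sup>L lborel phi) * ind (cball 0 R) x)"
      by (intro integrable_mult_right integrable_indicator_bounded) auto
    moreover have "(LBINT p. norm (F (x, p))) = (B * B * integral\<^sup>L lborel phi) * ind (cball 0 R) x" for x
    proof -
      have "(LBINT p. norm (F (x, p))) = (LBINT p. (B * B * ind (cball 0 R) x) * phi (p + (x + v)))"
        by (intro Bochner_Integration.integral_cong) (auto simp: F_def phi_def abs_mult B0 indicator_def)
      also have "... = (B * B * ind (cball 0 R) x) * integral\<^sup>L lborel phi"
        by (subst lborel_integral_translate[symmetric, of phi "x + v"]) simp_all
      finally show ?thesis by simp
    qed
    ultimately show "integrable lborel (%x. \<integral>p. norm (F (x, p)) \<partial>lborel)" by simp
    show "AE x in lborel. integrable lborel (%p. F (x, p))"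
      using phi lborel_integrable_translate[of phi] unfolding F_def by (auto intro!: AE_I2)
  qed
  have "integrable plb (%(x,p). g x * (h p * f (p + x + v)))"
  proof (rule Bochner_Integration.integrable_bound[OF F])
    show "AE z in plb. norm (case z of (x, p) => g x * (h p * f (p + x + v))) <= norm (F z)"
    proof (rule AE_I2, clarify)
      fix x p :: "real^'d"
      show "norm (g x * (h p * f (p + x + v))) <= norm (F (x, p))"
      proof (cases "norm x <= R & norm p <= R")
        case True
        have "norm (p + x) <= 2 * R" using norm_triangle_ineq[of p x] True by linarith
        moreover have "dist v (p + x + v) = norm (p + x)" by (metis add_diff_cancel_right' dist_commute dist_norm)
        ultimately have "p + x + v : cball v (2*R)" by simp
        then have "p + (x + v) : cbox a b" using ab by (auto simp: add.assoc)
        then have e: "norm (F (x,p)) = B * B * \<bar>f (p + x + v)\<bar>"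
          using True B0 by (simp add: F_def phi_def abs_mult add.assoc)
        have "\<bar>g x\<bar> * \<bar>h p\<bar> <= B * B" using B B0 by (intro mult_mono) auto
        then show ?thesis unfolding e by (simp add: abs_mult mult.assoc[symmetric] mult_right_mono)
      next
        case False
        then have "g x = 0 | h p = 0" using S by force
        then show ?thesis by auto
      qed
    qed
    have "(%(x,p). g x * (h p * f (p + x + v))) : borel_measurable bxb" by measurable
    then show "(%(x,p). g x * (h p * f (p + x + v))) : borel_measurable plb"
      by (subst measurable_cong_sets[OF sets_pair_measure_cong[OF sets_lborel sets_lborel] refl])
  qed
  from lborel_pair.Fubini_integral[OF this]
  have "(LBINT p. (LBINT x. g x * (h p * f (p + x + v)))) = (LBINT x. (LBINT p. g x * (h p * f (p + x + v))))"
    by simp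
  moreover have "(%p. \<integral>x. g x * (h p * f (p + x + v)) \<partial>lborel) = (%p. h p * (LBINT x. g x * f (p + x + v)))"
  proof
    fix p
    have "(LBINT x. g x * (h p * f (p + x + v))) = (LBINT x. h p * (g x * f (p + x + v)))"
      by (intro Bochner_Integration.integral_cong) auto
    then show "(LBINT x. g x * (h p * f (p + x + v))) = h p * (LBINT x. g x * f (p + x + v))" by simp
  qed
  ultimately show ?thesis by simp
qed

section \<open>Log-Lipschitz representatives of functions with BMO gradient\<close>

definition cu :: "real => (real^'d) set" where
  "cu r = box 0 (\<chi> j. r)"

definition cavg :: "real => (real^'d => real) => real^'d => real" where
  "cavg r f x = (LBINT p. ind (cu r) p * f (p + x)) / r ^ CARD('d)"

lemma mem_cu: "p : cu r \<longleftrightarrow> (ALL j. 0 < p $ j & p $ j < r)"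
  by (simp add: cu_def mem_box_cart)

lemma cu_borel [measurable, simp]: "cu r : sets borel"
  by (simp add: cu_def)

lemma measure_box_cart:
  fixes a b :: "real^'d"
  assumes "!!j. a $ j <= b $ j"
  shows "measure lborel (box a b) = (\<Prod>j\<in>UNIV. b $ j - a $ j)"
proof -
  have "cbox a b ~= {}" using assms by (simp add: interval_ne_empty_cart)
  then have "measure lborel (cbox a b) = (\<Prod>j\<in>UNIV. b $ j - a $ j)" by (rule content_cbox_cart)
  then show ?thesis by (simp add: measure_lborel_box_eq measure_lborel_cbox_eq)
qed

lemma measure_cu: "0 < r ==> measure lborel (cu r :: (real^'d) set) = r ^ CARD('d)"
  unfolding cu_def by (subst measure_box_cart) auto

lemma cu_norm: "p : cu r ==> norm p <= real CARD('d) * r" for p :: "real^'d"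
  by (rule norm_le_card_sup) (auto simp: mem_cu abs_le_iff less_imp_le intro: order_trans[of _ 0])

lemma cu_bounded: "bounded (cu r :: (real^'d) set)"
  by (simp add: cu_def bounded_box)

lemma integral_box_shift:
  fixes f :: "real^'d => real"
  assumes [measurable]: "f : bmb"
  shows "(LBINT p. ind (box a (a + (\<chi> j. r))) p * f p) = (LBINT p. ind (cu r) p * f (p + a))"
proof -
  have "(LBINT p. ind (cu r) p * f (p + a)) = (LBINT p. (%p. ind (box a (a + (\<chi> j. r))) p * f p) (p + a))"
    using box_shift_mem[of _ 0 "\<chi> j. r" a]
    by (intro Bochner_Integration.integral_cong) (auto simp: cu_def indicator_def add.commute)
  also have "... = (LBINT p. ind (box a (a + (\<chi> j. r))) p * f p)"
    by (rule lborel_integral_translate) measurable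
  finally show ?thesis by simp
qed

lemma cavg_near:
  fixes g :: "real^'d => real"
  assumes [measurable]: "g : bmb" and r: "0 < r"
    and B: "!!p. p : cu r ==> \<bar>g (p + x) - c\<bar> <= B"
  shows "\<bar>cavg r g x - c\<bar> <= B"
proof -
  have m: "(LBINT p. ind (cu r :: (real^'d) set) p) = r ^ CARD('d)" using measure_cu[OF r] by simp
  have ic: "integrable lborel (%p. ind (cu r :: (real^'d) set) p * C)" for C :: real
    by (intro integrable_mult_left integrable_indicator_bounded cu_bounded) simp
  have id: "integrable lborel (%p. ind (cu r) p * (g (p + x) - c))"
    by (rule Bochner_Integration.integrable_bound[OF ic[of B]])
       (use B in \<open>auto simp: indicator_def intro!: order_trans[OF _ abs_ge_self]\<close>)
  have e: "(LBINT p. ind (cu r) p * g (p + x)) = (LBINT p. ind (cu r) p * (g (p + x) - c)) + c * r ^ CARD('d)"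
  proof -
    have "(LBINT p. ind (cu r) p * g (p + x)) = (LBINT p. ind (cu r) p * (g (p + x) - c) + ind (cu r) p * c)"
      by (intro Bochner_Integration.integral_cong) (auto simp: algebra_simps)
    also have "... = (LBINT p. ind (cu r) p * (g (p + x) - c)) + (LBINT p. ind (cu r :: (real^'d) set) p * c)"
      by (rule Bochner_Integration.integral_add[OF id ic])
    finally show ?thesis using m by simp
  qed
  have "\<bar>\<integral>p. ind (cu r) p * (g (p + x) - c) \<partial>lborel\<bar> <= (LBINT p. \<bar>ind (cu r) p * (g (p + x) - c)\<bar>)"
    by (rule integral_abs_bound)
  also have "... <= (LBINT p. ind (cu r :: (real^'d) set) p * B)"
    by (rule integral_mono[OF integrable_abs[OF id] ic]) (use B in \<open>auto simp: indicator_def\<close>)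
  also have "... = B * r ^ CARD('d)" using m by simp
  finally have "\<bar>\<integral>p. ind (cu r) p * (g (p + x) - c) \<partial>lborel\<bar> <= B * r ^ CARD('d)" .
  then show ?thesis unfolding cavg_def e using r by (simp add: add_divide_distrib abs_divide divide_le_eq)
qed

lemma cavg_borel [measurable (raw)]:
  assumes [measurable]: "f : bmb"
  shows "cavg r f : bmb"
  unfolding cavg_def[abs_def] by measurable

text \<open>Either order averages \<open>f\<close> over x plus a point of each of the two cubes.
  Averages at two scales are compared through this common double average.\<close>

lemma cavg_comm:
  fixes f :: "real^'d => real"
  assumes f: "lloc f"
  shows "cavg r (cavg s f) x = cavg s (cavg r f) x"
proof -
  let ?R = "real CARD('d) * max r s"
  have "(LBINT q. ind (cu r) q * (LBINT p. ind (cu s) p * f (p + q + x))) =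
      (LBINT p. ind (cu s) p * (LBINT q. ind (cu r) q * f (p + q + x)))"
  proof (rule conv_fubini[OF f, where B = 1 and R = ?R])
    have le: "real CARD('d) * r <= ?R" "real CARD('d) * s <= ?R" by (auto intro: mult_left_mono)
    fix q :: "real^'d" assume "?R < norm q"
    then have "q ~: cu r" "q ~: cu s" using cu_norm[of q r] cu_norm[of q s] le by auto
    then show "ind (cu r) q = (0::real)" "ind (cu s) q = (0::real)" by auto
  qed (auto simp: indicator_def)
  then have *: "(LBINT q. ind (cu r) q * (LBINT p. ind (cu s) p * f (p + (q + x)))) =
      (LBINT p. ind (cu s) p * (LBINT q. ind (cu r) q * f (q + (p + x))))"
    by (simp add: ac_simps)
  have e: "cavg r (cavg s f) x = (LBINT q. ind (cu r) q * (LBINT p. ind (cu s) p * f (p + (q + x)))) / s ^ CARD('d) / r ^ CARD('d)" for r s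
    unfolding cavg_def by simp
  show ?thesis unfolding e[of r s] e[of s r] * by (simp add: mult.commute)
qed

text \<open>Moves the averaging onto the correlation with \<open>psi\<close>, which is continuous.
  This is how the limit of the averages gets identified almost everywhere.\<close>

lemma integral_cavg_test:
  fixes f :: "real^'d => real"
  assumes f: "lloc f" and psi: "test_fun psi"
  shows "(LBINT x. cavg r f x * psi x) = cavg r (conv psi f) 0"
proof -
  have [measurable]: "f : bmb" "psi : bmb"
    using f by (auto simp: lloc_def intro!: borel_measurable_continuous_onI test_fun_continuous psi)
  obtain K where K: "compact K" "!!x. x ~: K ==> psi x = 0" using test_funE[OF psi] by metis
  obtain R0 where R0: "!!x. x : K ==> norm x <= R0" using compact_imp_bounded[OF K(1)] unfolding bounded_iff by auto
  obtain B where B: "!!x. \<bar>psi x\<bar> <= B" using continuous_compact_support_bounded[OF test_fun_continuous[OF psi] K] by blast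
  let ?R = "max R0 (real CARD('d) * r)"
  have "(LBINT x. psi x * (LBINT p. ind (cu r) p * f (p + x + 0))) =
      (LBINT p. ind (cu r) p * (LBINT x. psi x * f (p + x + 0)))"
  proof (rule conv_fubini[OF f, where B = "max B 1" and R = ?R])
    show "\<bar>psi x\<bar> <= max B 1" for x using B[of x] by simp
    fix q :: "real^'d" assume q: "?R < norm q"
    show "psi q = 0" using K(2)[of q] R0[of q] q by fastforce
    have "q ~: cu r" using cu_norm[of q r] q by auto
    then show "ind (cu r) q = (0::real)" by simp
  qed (auto simp: indicator_def)
  moreover have "(LBINT x. psi x * f (p + x + 0)) = conv psi f (p + 0)" for p
    unfolding conv_def using lborel_integral_translate[of "%y. f y * psi (y - p)" p]
    by (simp add: ac_simps)
  ultimately show ?thesis unfolding cavg_def by (simp add: mult.commute)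
qed

text \<open>Oscillation of the average at scale 2^-k over a distance of the same scale. The factor 1
  + k is the logarithm of the modulus, and summability of (1 + k) 2^-k makes the dyadic averages
  converge at every point.\<close>

definition cdini :: "real => (real^'d => real) => bool" where
  "cdini c f \<longleftrightarrow> lloc f & 0 <= c & (ALL k x z. (ALL j. \<bar>z $ j\<bar> <= (1/2)^k) -->
     \<bar>cavg ((1/2)^k) f (x + z) - cavg ((1/2)^k) f x\<bar> <= c * (1 + real k) * (1/2)^k)"

definition crep :: "(real^'d => real) => real^'d => real" where
  "crep f x = lim (%k. cavg ((1/2)^k) f x)"

text \<open>Averaging an average once more only shifts its base point within a cube, so the double
  average is close to the average at each of the two scales. The two errors, proportional to 1 + k
  and 2 + k, add up to at most 3 (1 + k).\<close>

lemma cdini_step: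
  fixes f :: "real^'d => real"
  assumes "cdini c f"
  shows "\<bar>cavg ((1/2)^k) f x - cavg ((1/2)^Suc k) f x\<bar> <= 3 * c * (1 + real k) * (1/2)^k"
proof -
  have f: "lloc f" and c: "0 <= c" and D: "!!k x z. (!!j. \<bar>z $ j\<bar> <= (1/2)^k) ==>
     \<bar>cavg ((1/2)^k) f (x + z) - cavg ((1/2)^k) f x\<bar> <= c * (1 + real k) * (1/2)^k"
    using assms unfolding cdini_def by auto
  have [measurable]: "f : bmb" using f by (rule lloc_borel)
  let ?r = "(1/2::real)^k" and ?s = "(1/2::real)^Suc k"
  have 1: "\<bar>cavg ?s (cavg ?r f) x - cavg ?r f x\<bar> <= c * (1 + real k) * (1/2)^k"
  proof (rule cavg_near)
    fix p :: "real^'d" assume p: "p : cu ?s"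
    have sr: "?s <= ?r" by simp
    have "\<bar>p $ j\<bar> <= ?r" for j
    proof -
      have "0 < p $ j" "p $ j < ?s" using p unfolding mem_cu by blast+
      then show ?thesis using sr by linarith
    qed
    from D[OF this, of x] show "\<bar>cavg ?r f (p + x) - cavg ?r f x\<bar> <= c * (1 + real k) * (1/2)^k" by (simp add: add.commute)
  qed auto
  have 2: "\<bar>cavg ?r (cavg ?s f) x - cavg ?s f x\<bar> <= 2 * (c * (1 + real (Suc k)) * (1/2)^Suc k)"
  proof (rule cavg_near)
    \<comment> \<open>A shift from the larger cube is too long for the finer scale; it is performed
      as two shifts by p/2.\<close>
    fix p :: "real^'d" assume p: "p : cu ?r"
    have "\<bar>((1/2) *\<^sub>R p) $ j\<bar> <= ?s" for j
      using p unfolding mem_cu by (auto simp: abs_of_pos less_imp_le)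
    note D' = D[OF this]
    have "\<bar>cavg ?s f (x + (1/2) *\<^sub>R p + (1/2) *\<^sub>R p) - cavg ?s f (x + (1/2) *\<^sub>R p)\<bar> <= c * (1 + real (Suc k)) * (1/2)^Suc k"
      by (rule D')
    moreover have "\<bar>cavg ?s f (x + (1/2) *\<^sub>R p) - cavg ?s f x\<bar> <= c * (1 + real (Suc k)) * (1/2)^Suc k" by (rule D')
    moreover have e: "x + (1/2) *\<^sub>R p + (1/2) *\<^sub>R p = p + x" by (simp add: add.assoc scaleR_left.add[symmetric] add.commute)
    ultimately show "\<bar>cavg ?s f (p + x) - cavg ?s f x\<bar> <= 2 * (c * (1 + real (Suc k)) * (1/2)^Suc k)" unfolding e by linarith
  qed auto
  have "\<bar>cavg ?r f x - cavg ?s f x\<bar> <= c * (1 + real k) * (1/2)^k + 2 * (c * (1 + real (Suc k)) * (1/2)^Suc k)"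
    using 1 2 unfolding cavg_comm[OF f, of ?r ?s] by linarith
  also have "... = c * (1/2)^k * ((1 + real k) + (2 + real k))" by (simp add: algebra_simps)
  also have "... <= c * (1/2)^k * (3 * (1 + real k))" using c by (intro mult_left_mono) auto
  finally show ?thesis by (simp add: algebra_simps)
qed

lemma cdini_tail_tendsto: "(%k. 6 * c * (real k + 2) * (1/2)^k) \<longlonglongrightarrow> 0"
proof -
  have "(%k. real k * (1/2)^k) \<longlonglongrightarrow> (0::real)"
    using powser_times_n_limit_0[of "1/2::real"] by simp
  moreover have "(%k. (1/2::real)^k) \<longlonglongrightarrow> 0" by (intro LIMSEQ_realpow_zero) auto
  ultimately have "(%k. 6 * c * (real k * (1/2)^k + 2 * (1/2)^k)) \<longlonglongrightarrow> 6 * c * (0 + 2 * 0)"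
    by (intro tendsto_mult tendsto_add tendsto_const)
  then show ?thesis by (simp add: algebra_simps)
qed

text \<open>The series of 3 c (1 + j) 2^-j has the tail 6 c (k + 2) 2^-k from index k on, so the
  bound is a difference of two tails and telescopes.\<close>

lemma cdini_diff:
  assumes "cdini c f"
  shows "\<bar>cavg ((1/2)^k) f x - cavg ((1/2)^(k+n)) f x\<bar> <= 6 * c * (real k + 2) * (1/2)^k - 6 * c * (real (k+n) + 2) * (1/2)^(k+n)"
proof (induction n)
  case (Suc n)
  have "\<bar>cavg ((1/2)^(k+n)) f x - cavg ((1/2)^Suc (k+n)) f x\<bar> <= 3 * c * (1 + real (k+n)) * (1/2)^(k+n)"
    by (rule cdini_step[OF assms])
  also have "... = 6 * c * (real (k+n) + 2) * (1/2)^(k+n) - 6 * c * (real (Suc (k+n)) + 2) * (1/2)^Suc (k+n)"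
    by (simp add: field_simps)
  finally show ?case using Suc by simp
qed simp

lemma cdini_diff_le:
  assumes "cdini c f" "k <= n"
  shows "\<bar>cavg ((1/2)^k) f x - cavg ((1/2)^n) f x\<bar> <= 6 * c * (real k + 2) * (1/2)^k"
proof -
  have "0 <= c" using assms by (simp add: cdini_def)
  then have "0 <= 6 * c * (real n + 2) * (1/2)^n" by (intro mult_nonneg_nonneg) auto
  then show ?thesis using cdini_diff[OF assms(1), of k x "n - k"] assms(2) by simp
qed

lemma crep_tendsto:
  assumes "cdini c f"
  shows "(%k. cavg ((1/2)^k) f x) \<longlonglongrightarrow> crep f x"
proof -
  have "Cauchy (%k. cavg ((1/2)^k) f x)"
  proof (rule CauchyI')
    fix e :: real assume "0 < e"
    then have "eventually (%k. 6 * c * (real k + 2) * (1/2)^k < e) sequentially"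
      using order_tendstoD(2)[OF cdini_tail_tendsto] by blast
    then obtain N where N: "!!k. N <= k ==> 6 * c * (real k + 2) * (1/2)^k < e" by (auto simp: eventually_sequentially)
    show "EX M. ALL m>=M. ALL n>m. dist (cavg ((1/2)^m) f x) (cavg ((1/2)^n) f x) < e"
    proof (intro exI[of _ N] allI impI)
      fix m n assume "N <= m" "m < n"
      then show "dist (cavg ((1/2)^m) f x) (cavg ((1/2)^n) f x) < e"
        unfolding dist_real_def by (intro le_less_trans[OF cdini_diff_le[OF assms] N]) auto
    qed
  qed
  then show ?thesis unfolding crep_def by (simp add: Cauchy_convergent_iff convergent_LIMSEQ_iff)
qed

lemma crep_close:
  assumes "cdini c f"
  shows "\<bar>crep f x - cavg ((1/2)^k) f x\<bar> <= 6 * c * (real k + 2) * (1/2)^k"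
proof -
  have "(%n. \<bar>cavg ((1/2)^n) f x - cavg ((1/2)^k) f x\<bar>) \<longlonglongrightarrow> \<bar>crep f x - cavg ((1/2)^k) f x\<bar>"
    by (intro tendsto_intros crep_tendsto[OF assms])
  then show ?thesis
    by (rule LIMSEQ_le_const2) (use cdini_diff_le[OF assms, of k] in \<open>auto simp: abs_minus_commute intro!: exI[of _ k]\<close>)
qed

lemma crep_dyadic_modulus:
  assumes "cdini c f" "!!j. \<bar>z $ j\<bar> <= (1/2)^k"
  shows "\<bar>crep f (x + z) - crep f x\<bar> <= 25 * c * (1 + real k) * (1/2)^k"
proof -
  have c: "0 <= c" using assms by (simp add: cdini_def)
  have "\<bar>cavg ((1/2)^k) f (x + z) - cavg ((1/2)^k) f x\<bar> <= c * (1 + real k) * (1/2)^k"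
    using assms unfolding cdini_def by blast
  then have "\<bar>crep f (x + z) - crep f x\<bar> <= 2 * (6 * c * (real k + 2) * (1/2)^k) + c * (1 + real k) * (1/2)^k"
    using crep_close[OF assms(1), of "x + z" k] crep_close[OF assms(1), of x k] by linarith
  also have "... = c * (1/2)^k * (12 * (real k + 2) + (1 + real k))" by (simp add: algebra_simps)
  \<comment> \<open>12 (k + 2) + (1 + k) = 13 k + 25.\<close>
  also have "... <= c * (1/2)^k * (25 * (1 + real k))" using c by (intro mult_left_mono) auto
  finally show ?thesis by (simp add: algebra_simps)
qed

lemma crep_modulus:
  fixes z :: "real^'d"
  assumes f: "cdini c f" and z: "norm z <= 1"
  shows "\<bar>crep f (x + z) - crep f x\<bar> <= 100 * c * ll (norm z)"
proof (cases "z = 0")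
  case False
  have c: "0 <= c" using f by (simp add: cdini_def)
  let ?s = "norm z"
  have s: "0 < ?s" using False by simp
  \<comment> \<open>For this scale 2^-k lies between \<open>?s\<close> and twice \<open>?s\<close>,
    and k <= 2 ln (1 + 1/\<open>?s\<close>) because ln 2 >= 1/2. These two factors 2 turn 25 into
    100.\<close>
  define k where "k = nat \<lfloor>log 2 (1 / ?s)\<rfloor>"
  have l0: "0 <= log 2 (1 / ?s)" using s z by (subst zero_le_log_cancel_iff) auto
  have k1: "real k <= log 2 (1 / ?s)" using l0 by (simp add: k_def)
  have k2: "log 2 (1 / ?s) < real k + 1" using l0 by (simp add: k_def)
  have "2 powr real k <= 1 / ?s" using k1 s by (subst (asm) le_log_iff) auto
  then have a: "?s <= (1/2)^k" using s by (simp add: powr_realpow power_one_over field_simps)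
  have "1 / ?s < 2 powr (real k + 1)" using k2 s by (subst (asm) log_less_iff) auto
  then have b: "(1/2)^k <= 2 * ?s" using s by (simp add: powr_add powr_realpow power_one_over field_simps)
  have "log 2 (1 / ?s) = ln (1 / ?s) / ln 2" by (simp add: log_def)
  also have "... <= ln (1 / ?s) / (1/2)"
  proof -
    have "1/2 <= ln (2::real)" using ln_ge_iff[of 2 "1/2"] exp_half_le2 by simp
    moreover have "0 <= ln (1 / ?s)" using s z by (intro ln_ge_zero) auto
    ultimately show ?thesis by (intro divide_left_mono) auto
  qed
  also have "... <= 2 * ln (1 + 1 / ?s)" using s by (simp add: add_pos_pos)
  finally have k3: "real k <= 2 * ln (1 + 1 / ?s)" using k1 by simp
  have ln0: "0 <= ln (1 + 1 / ?s)" using s by (intro ln_ge_zero) auto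
  have "\<bar>crep f (x + z) - crep f x\<bar> <= 25 * c * (1 + real k) * (1/2)^k"
    by (rule crep_dyadic_modulus[OF f]) (use a component_le_norm_cart[of z] in \<open>auto intro: order_trans\<close>)
  also have "... <= 25 * c * (2 * (1 + ln (1 + 1 / ?s))) * (2 * ?s)"
    using c b k3 ln0 by (intro mult_mono mult_nonneg_nonneg) auto
  also have "... = 100 * c * ll ?s" by (simp add: ll_def algebra_simps)
  finally show ?thesis .
qed simp

lemma crep_borel:
  assumes [measurable]: "f : bmb" shows "crep f : bmb"
  unfolding crep_def[abs_def] by measurable

lemma cavg_bounded_local:
  fixes f :: "real^'d => real"
  assumes f: "lloc f"
  shows "EX B. ALL x:cbox a b. \<bar>cavg 1 f x\<bar> <= B"
proof -
  have [measurable]: "f : bmb" using f by (rule lloc_borel)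
  let ?b = "b + (\<chi> j. 1)"
  have "\<bar>cavg 1 f x\<bar> <= (LBINT p. ind (cbox a ?b) p * \<bar>f p\<bar>)" if x: "x : cbox a b" for x
  proof -
    have "cavg 1 f x = (LBINT p. ind (box x (x + (\<chi> j. 1))) p * f p)"
      unfolding cavg_def by (simp add: integral_box_shift)
    also have "\<bar>...\<bar> <= (LBINT p. \<bar>ind (box x (x + (\<chi> j. 1))) p * f p\<bar>)" by (rule integral_abs_bound)
    also have "... <= (LBINT p. ind (cbox a ?b) p * \<bar>f p\<bar>)"
    proof (rule integral_mono[OF _ lloc_integrable_cbox[OF lloc_abs[OF f]]])
      show "integrable lborel (%p. \<bar>ind (box x (x + (\<chi> j. 1))) p * f p\<bar>)"
        by (rule integrable_abs[OF lloc_integrable_box[OF f]])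
      fix p
      have "p : cbox a ?b" if p: "p : box x (x + (\<chi> j. 1))"
        unfolding mem_box_cart
      proof
        fix i
        have "x $ i < p $ i" "p $ i < x $ i + 1" using p by (auto simp: mem_box_cart)
        moreover have "a $ i <= x $ i" "x $ i <= b $ i" using x by (auto simp: mem_box_cart)
        ultimately show "a $ i <= p $ i & p $ i <= ?b $ i" by simp
      qed
      then show "\<bar>ind (box x (x + (\<chi> j. 1))) p * f p\<bar> <= ind (cbox a ?b) p * \<bar>f p\<bar>"
        by (auto simp: indicator_def)
    qed
    finally show ?thesis .
  qed
  then show ?thesis by blast
qed

lemma crep_lloc:
  assumes "cdini c f" shows "lloc (crep f)"
proof (rule lloc_bounded)
  have f: "lloc f" using assms by (simp add: cdini_def)
  show "crep f : bmb" by (rule crep_borel[OF lloc_borel[OF f]])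
  fix a b
  obtain B where B: "!!x. x : cbox a b ==> \<bar>cavg 1 f x\<bar> <= B" using cavg_bounded_local[OF f] by blast
  have "\<bar>crep f x\<bar> <= B + 12 * c" if "x : cbox a b" for x
    using crep_close[OF assms, of x 0] B[OF that] by simp
  then show "EX B. ALL x:cbox a b. \<bar>crep f x\<bar> <= B" by blast
qed

text \<open>Paired with \<open>psi\<close>, the averages of \<open>f\<close> tend to the integral of
  f psi, since the correlation with \<open>psi\<close> is continuous at 0; they also tend to the
  integral of \<open>crep f\<close> times psi, since they converge to \<open>crep f\<close>
  uniformly.\<close>

lemma crep_AE:
  fixes f :: "real^'d => real"
  assumes d: "cdini c f" shows "AE x in lborel. crep f x = f x"
proof -
  have f: "lloc f" using d by (simp add: cdini_def)
  have c: "0 <= c" using d by (simp add: cdini_def)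
  have [measurable]: "f : bmb" using f by (rule lloc_borel)
  note [measurable] = crep_borel
  have "AE x in lborel. crep f x - f x = 0"
  proof (rule AE_eq_zero_if_test_integrals_zero[OF lloc_diff[OF crep_lloc[OF d] f]])
    fix psi :: "real^'d => real" assume psi: "test_fun psi"
    have [measurable]: "psi : bmb" by (intro borel_measurable_continuous_onI test_fun_continuous psi)
    have i1: "integrable lborel (%x. f x * psi x)" using conv_integrable_test[OF f psi, of 0] by simp
    have i2: "integrable lborel (%x. crep f x * psi x)" using conv_integrable_test[OF crep_lloc[OF d] psi, of 0] by simp
    have i3: "integrable lborel (%x. \<bar>psi x\<bar>)" using conv_integrable_test[OF lloc_const[of 1] psi, of 0] by simp
    have lim1: "(%k. cavg ((1/2)^k) (conv psi f) 0) \<longlonglongrightarrow> conv psi f 0"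
    proof (rule LIMSEQ_I)
      fix e :: real assume e: "0 < e"
      have "isCont (conv psi f) 0" by (rule has_derivative_continuous[OF conv_has_derivative[OF f psi]])
      then obtain d where d: "0 < d" "!!p. dist p 0 < d ==> dist (conv psi f p) (conv psi f 0) < e/2"
        using e unfolding continuous_at_eps_delta by (metis half_gt_zero)
      have "(%k. real CARD('d) * (1/2)^k) \<longlonglongrightarrow> real CARD('d) * 0"
        by (intro tendsto_intros LIMSEQ_realpow_zero) auto
      then have "eventually (%k. real CARD('d) * (1/2)^k < d) sequentially" using d(1) by (intro order_tendstoD(2)) auto
      then obtain N where N: "!!k. N <= k ==> real CARD('d) * (1/2)^k < d" by (auto simp: eventually_sequentially)
      have "norm (cavg ((1/2)^k) (conv psi f) 0 - conv psi f 0) < e" if k: "N <= k" for k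
      proof -
        have m: "conv psi f : bmb"
          by (intro borel_measurable_continuous_onI continuous_at_imp_continuous_on ballI has_derivative_continuous[OF conv_has_derivative[OF f psi]])
        have "\<bar>cavg ((1/2)^k) (conv psi f) 0 - conv psi f 0\<bar> <= e/2"
        proof (rule cavg_near[OF m])
          fix p :: "real^'d" assume "p : cu ((1/2)^k)"
          then have "dist (p + 0) 0 < d" using cu_norm[of p] N[OF k] by fastforce
          then show "\<bar>conv psi f (p + 0) - conv psi f 0\<bar> <= e/2" using d(2)[of "p + 0"] by (simp add: dist_real_def)
        qed simp
        then show ?thesis using e by simp
      qed
      then show "EX N. ALL k>=N. norm (cavg ((1/2)^k) (conv psi f) 0 - conv psi f 0) < e" by blast
    qed
    have lim2: "(%k. cavg ((1/2)^k) (conv psi f) 0) \<longlonglongrightarrow> (LBINT x. crep f x * psi x)"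
    proof (rule Lim_transform_bound[THEN Lim_null[THEN iffD2]])
      show "(%k. 6 * c * (real k + 2) * (1/2)^k * (LBINT x. \<bar>psi x\<bar>)) \<longlonglongrightarrow> 0"
        using tendsto_mult[OF cdini_tail_tendsto[of c] tendsto_const] by simp
      show "\<forall>\<^sub>F k in sequentially. norm (cavg ((1/2)^k) (conv psi f) 0 - (LBINT x. crep f x * psi x)) <= norm (6 * c * (real k + 2) * (1/2)^k * (LBINT x. \<bar>psi x\<bar>))"
      proof (rule always_eventually, rule allI)
        fix k
        let ?b = "6 * c * (real k + 2) * (1/2)^k"
        have bnd: "\<bar>(crep f x - cavg ((1/2)^k) f x) * psi x\<bar> <= ?b * \<bar>psi x\<bar>" for x
          unfolding abs_mult by (intro mult_right_mono crep_close[OF d]) auto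
        have i4: "integrable lborel (%x. (crep f x - cavg ((1/2)^k) f x) * psi x)"
          by (rule Bochner_Integration.integrable_bound[OF integrable_mult_right[OF i3, of ?b]])
             (measurable, rule AE_I2, unfold real_norm_def, rule order_trans[OF bnd abs_ge_self])
        have i5: "integrable lborel (%x. cavg ((1/2)^k) f x * psi x)"
          using Bochner_Integration.integrable_diff[OF i2 i4] by (simp add: algebra_simps)
        have "cavg ((1/2)^k) (conv psi f) 0 - (LBINT x. crep f x * psi x) = - (LBINT x. (crep f x - cavg ((1/2)^k) f x) * psi x)"
          unfolding integral_cavg_test[OF f psi, symmetric] using i2 i5 by (simp add: left_diff_distrib)
        also have "\<bar>...\<bar> <= (LBINT x. \<bar>(crep f x - cavg ((1/2)^k) f x) * psi x\<bar>)" by (simp add: integral_abs_bound)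
        also have "... <= (LBINT x. ?b * \<bar>psi x\<bar>)"
          by (rule integral_mono[OF integrable_abs[OF i4] integrable_mult_right[OF i3]]) (rule bnd)
        also have "... = ?b * (LBINT x. \<bar>psi x\<bar>)" by simp
        finally show "norm (cavg ((1/2)^k) (conv psi f) 0 - (LBINT x. crep f x * psi x)) <= norm (?b * (LBINT x. \<bar>psi x\<bar>))"
          unfolding real_norm_def by (rule order_trans[OF _ abs_ge_self])
      qed
    qed
    have "(LBINT x. crep f x * psi x) = (LBINT x. f x * psi x)"
      using LIMSEQ_unique[OF lim2 lim1] by (simp add: conv_def)
    then show "(LBINT x. (crep f x - f x) * psi x) = 0" using i1 i2 by (simp add: left_diff_distrib)
  qed
  then show ?thesis by simp
qed

section \<open>Averages of a BMO gradient over shrinking cubes\<close>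

lemma cavg_increment:
  fixes f :: "real^'d => real"
  assumes f: "lloc f"
  shows "cavg r f (x + z) - cavg r f x = (LBINT p. ind (box x (x + (\<chi> j. r))) p * (f (p + z) - f p)) / r ^ CARD('d)"
proof -
  have [measurable]: "f : bmb" using f by (rule lloc_borel)
  have i: "integrable lborel (%p. ind (cu r) p * f (p + y))" for y
    unfolding cu_def by (rule lloc_integrable_box[OF lloc_translate[OF f]])
  have "(LBINT p. ind (box x (x + (\<chi> j. r))) p * (f (p + z) - f p)) = (LBINT p. ind (cu r) p * (f (p + x + z) - f (p + x)))"
    by (rule integral_box_shift) measurable
  also have "... = (LBINT p. ind (cu r) p * f (p + (x + z)) - ind (cu r) p * f (p + x))"
    by (intro Bochner_Integration.integral_cong) (auto simp: algebra_simps)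
  also have "... = (LBINT p. ind (cu r) p * f (p + (x + z))) - (LBINT p. ind (cu r) p * f (p + x))"
    by (rule Bochner_Integration.integral_diff[OF i i])
  finally show ?thesis by (simp add: cavg_def diff_divide_distrib)
qed

lemma integral_indicator_mult_bound:
  fixes h :: "real^'d => real"
  assumes [measurable]: "S : sets borel" and S: "bounded S" and h: "!!p. p : S ==> \<bar>h p\<bar> <= B"
  shows "\<bar>\<integral>p. ind S p * h p \<partial>lborel\<bar> <= B * measure lborel S"
proof -
  have i: "integrable lborel (%p. ind S p * B)"
    by (intro integrable_mult_left integrable_indicator_bounded S) simp
  have "\<bar>\<integral>p. ind S p * h p \<partial>lborel\<bar> <= (LBINT p. ind S p * B)"
  proof (cases "integrable lborel (%p. ind S p * h p)")
    case True
    have "\<bar>\<integral>p. ind S p * h p \<partial>lborel\<bar> <= (LBINT p. \<bar>ind S p * h p\<bar>)" by (rule integral_abs_bound)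
    also have "... <= (LBINT p. ind S p * B)"
      by (rule integral_mono[OF integrable_abs[OF True] i]) (use h in \<open>auto simp: indicator_def\<close>)
    finally show ?thesis .
  next
    case False
    \<comment> \<open>A non-integrable function has integral 0 by convention, so here only the sign
      of the bound matters.\<close>
    have "0 <= (LBINT p. ind S p * B)"
    proof (intro integral_nonneg_AE AE_I2)
      fix p show "0 <= ind S p * B" using h[of p] by (auto simp: indicator_def)
    qed
    then show ?thesis using False by (simp add: not_integrable_integral_eq)
  qed
  then show ?thesis by (simp add: mult.commute)
qed

definition bavg :: "(real^'d => real) => real^'d => real => real" where
  "bavg g a r = (LBINT p. ind (box a (a + (\<chi> j. r))) p * g p) / r ^ CARD('d)"

definition bmo_bound :: "real => (real^'d => real) => bool" where
  "bmo_bound C g \<longleftrightarrow> (ALL a r. 0 < r -->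
     (LBINT p. ind (box a (a + (\<chi> j. r))) p * \<bar>g p - bavg g a r\<bar>) <= C * r ^ CARD('d))"

lemma measure_box_side: "0 < r ==> measure lborel (box a (a + (\<chi> j. r))) = r ^ CARD('d)" for a :: "real^'d"
  by (subst measure_box_cart) auto

lemma bavg_minus:
  fixes g :: "real^'d => real"
  assumes g: "lloc g" and r: "0 < r"
  shows "bavg g a r - c = (LBINT p. ind (box a (a + (\<chi> j. r))) p * (g p - c)) / r ^ CARD('d)"
proof -
  have "(LBINT p. ind (box a (a + (\<chi> j. r))) p * (g p - c)) =
      (LBINT p. ind (box a (a + (\<chi> j. r))) p * g p) - (LBINT p. ind (box a (a + (\<chi> j. r))) p * c)"
    unfolding right_diff_distrib
    by (rule Bochner_Integration.integral_diff[OF lloc_integrable_box[OF g] lloc_integrable_box[OF lloc_const[of c]]])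
  also have "(LBINT p. ind (box a (a + (\<chi> j. r))) p * c) = c * r ^ CARD('d)"
    using measure_box_side[OF r, of a] by simp
  finally show ?thesis using r by (simp add: bavg_def diff_divide_distrib)
qed

lemma box_integral_mono:
  fixes h :: "real^'d => real"
  assumes h: "lloc h" and S: "S : sets borel" "S \<subseteq> box a b"
  shows "(LBINT p. ind S p * \<bar>h p\<bar>) <= (LBINT p. ind (box a b) p * \<bar>h p\<bar>)"
proof (rule integral_mono)
  show "integrable lborel (%p. ind S p * \<bar>h p\<bar>)"
    by (rule lloc_integrable_subset[OF lloc_abs[OF h] S(1)]) (use S(2) box_subset_cbox in blast)
  show "integrable lborel (%p. ind (box a b) p * \<bar>h p\<bar>)" by (rule lloc_integrable_box[OF lloc_abs[OF h]])
qed (use S(2) in \<open>auto simp: indicator_def\<close>)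

text \<open>The half cube with the same corner has the fraction 2^-d of the volume, so the
  oscillation over the large cube bounds the drift of the average up to the factor 2^d.\<close>

lemma bavg_halve:
  fixes g :: "real^'d => real"
  assumes g: "lloc g" and b: "bmo_bound C g" and r: "0 < r"
  shows "\<bar>bavg g a (r/2) - bavg g a r\<bar> <= 2 ^ CARD('d) * C"
proof -
  let ?c = "bavg g a r" and ?S = "box a (a + (\<chi> j. r/2))" and ?B = "box a (a + (\<chi> j. r))"
  have sub: "?S \<subseteq> ?B"
  proof
    fix p assume p: "p : ?S"
    show "p : ?B" unfolding mem_box_cart
    proof
      fix i have "a $ i < p $ i" "p $ i < a $ i + r/2" using p by (auto simp: mem_box_cart)
      then show "a $ i < p $ i & p $ i < (a + (\<chi> j. r)) $ i" using r by simp
    qed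
  qed
  have "\<bar>\<integral>p. ind ?S p * (g p - ?c) \<partial>lborel\<bar> <= (LBINT p. \<bar>ind ?S p * (g p - ?c)\<bar>)" by (rule integral_abs_bound)
  also have "... = (LBINT p. ind ?S p * \<bar>g p - ?c\<bar>)" by (simp add: abs_mult)
  also have "... <= (LBINT p. ind ?B p * \<bar>g p - ?c\<bar>)"
    by (rule box_integral_mono[OF lloc_diff[OF g lloc_const] _ sub]) simp
  also have "... <= C * r ^ CARD('d)" using b r unfolding bmo_bound_def by blast
  finally have "\<bar>\<integral>p. ind ?S p * (g p - ?c) \<partial>lborel\<bar> / (r/2) ^ CARD('d) <= C * r ^ CARD('d) / (r/2) ^ CARD('d)"
    using r by (intro divide_right_mono) auto
  also have "... = 2 ^ CARD('d) * C" using r by (simp add: power_divide)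
  finally show ?thesis using r by (simp add: bavg_minus[OF g] abs_divide)
qed

lemma bmo_bound_nonneg: "bmo_bound C g ==> 0 <= C"
proof -
  assume "bmo_bound C g"
  then have "(LBINT p. ind (box 0 (0 + (\<chi> j. 1))) p * \<bar>g p - bavg g 0 1\<bar>) <= C * 1 ^ CARD('a)"
    unfolding bmo_bound_def by (rule allE[of _ 0]) (auto dest: spec[of _ 1])
  moreover have "0 <= (LBINT p. ind (box 0 (0 + (\<chi> j. 1))) p * \<bar>g p - bavg g 0 1\<bar>)"
    by (intro integral_nonneg_AE) auto
  ultimately have "0 <= C * 1 ^ CARD('a)" by (rule order_trans[rotated])
  then show "0 <= C" by simp
qed

text \<open>Each halving moves the average by at most a multiple of \<open>C\<close>, whence linear
  growth in \<open>k\<close>. At the coarsest scale the mean gradient is controlled by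
  \<open>f\<close> itself: a translation by 2 in direction j changes \<open>f\<close> by at most 2
  M.\<close>

lemma bavg_dyadic_bound:
  fixes f :: "real^'d => real" and g :: "'d => real^'d => real"
  assumes f: "lloc f" and g: "!!j. lloc (g j)" and w: "!!j. bweak f j (g j)" and M: "!!x. \<bar>f x\<bar> <= M"
    and b: "!!j. bmo_bound C (g j)"
  shows "\<bar>bavg (g j) a (4 * (1/2)^k)\<bar> <= M + C * 4 ^ CARD('d) * (1 + real k)"
proof (induction k)
  case 0
  \<comment> \<open>A cube of side 2 shifted by at most 2 along an axis stays in the cube of side 4
    with the same corner, the one over which \<open>?A\<close> averages.\<close>
  let ?A = "%j. bavg (g j) a 4" and ?z = "axis j 2 :: real^'d" and ?b = "a + (\<chi> j. 2)"
  have C: "0 <= C" using bmo_bound_nonneg[OF b] .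
  have "\<bar>(LBINT p. ind (box a ?b) p * (f (p + ?z) - f p)) - measure lborel (box a ?b) * (SUM i:UNIV. ?z $ i * ?A i)\<bar>
     <= (SUM i:UNIV. \<bar>?z $ i\<bar> * (C * 4 ^ CARD('d)))"
  proof (rule box_translate_increment[OF f g w])
    fix th :: real and i assume th: "0 <= th" "th <= 1"
    have [measurable]: "g i : bmb" by (rule lloc_borel[OF g])
    have sub: "p : box a (a + (\<chi> j. 4))" if p: "p - th *\<^sub>R ?z : box a ?b" for p
      unfolding mem_box_cart
    proof
      fix k
      have "a $ k < p $ k - th * ?z $ k" "p $ k - th * ?z $ k < a $ k + 2" using p by (auto simp: mem_box_cart)
      moreover have "0 <= th * ?z $ k" "th * ?z $ k <= 2" using th by (auto simp: axis_def)
      ultimately show "a $ k < p $ k & p $ k < (a + (\<chi> j. 4)) $ k" by simp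
    qed
    have "(LBINT p. ind {p. p - th *\<^sub>R ?z : box a ?b} p * \<bar>g i p - ?A i\<bar>) <= (LBINT p. ind (box a (a + (\<chi> j. 4))) p * \<bar>g i p - ?A i\<bar>)"
      by (rule box_integral_mono[OF lloc_diff[OF g lloc_const]]) (use sub in auto)
    also have "... <= C * 4 ^ CARD('d)" using b[of i] unfolding bmo_bound_def by simp
    finally show "(LBINT p. ind (box a ?b) (p - th *\<^sub>R ?z) * \<bar>g i p - ?A i\<bar>) <= C * 4 ^ CARD('d)"
      by (simp add: indicator_def)
  qed simp
  moreover have "(SUM i:UNIV. ?z $ i * ?A i) = 2 * ?A j"
  proof -
    have "(SUM i:UNIV. ?z $ i * ?A i) = (SUM i:UNIV. if i = j then 2 * ?A i else 0)" by (intro sum.cong) (auto simp: axis_def)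
    then show ?thesis by simp
  qed
  moreover have "(SUM i:UNIV. \<bar>?z $ i\<bar> * (C * 4 ^ CARD('d))) = 2 * (C * 4 ^ CARD('d))"
  proof -
    have "(SUM i:UNIV. \<bar>?z $ i\<bar> * (C * 4 ^ CARD('d))) = (SUM i:UNIV. if i = j then 2 * (C * 4 ^ CARD('d)) else 0)" by (intro sum.cong) (auto simp: axis_def)
    then show ?thesis by simp
  qed
  moreover have m: "measure lborel (box a ?b) = 2 ^ CARD('d)" by (rule measure_box_side) simp
  moreover have "\<bar>\<integral>p. ind (box a ?b) p * (f (p + ?z) - f p) \<partial>lborel\<bar> <= (2 * M) * 2 ^ CARD('d)"
    unfolding m[symmetric]
  proof (rule integral_indicator_mult_bound)
    fix p show "\<bar>f (p + ?z) - f p\<bar> <= 2 * M" using M[of p] M[of "p + ?z"] by linarith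
  qed (auto simp: bounded_box)
  ultimately have "\<bar>2 ^ CARD('d) * (2 * ?A j)\<bar> <= 2 * M * 2 ^ CARD('d) + 2 * (C * 4 ^ CARD('d))" by simp
  then have "2 * 2 ^ CARD('d) * \<bar>?A j\<bar> <= 2 * 2 ^ CARD('d) * M + 2 * (C * 4 ^ CARD('d))" by (simp add: abs_mult mult.commute mult.left_commute)
  also have "... <= 2 * 2 ^ CARD('d) * (M + C * 4 ^ CARD('d))"
  proof -
    have "1 * (2 * (C * 4 ^ CARD('d))) <= 2 ^ CARD('d) * (2 * (C * 4 ^ CARD('d)))" using C by (intro mult_right_mono) auto
    then show ?thesis by (simp add: algebra_simps)
  qed
  finally have "\<bar>?A j\<bar> <= M + C * 4 ^ CARD('d)" by simp
  then show ?case by simp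
next
  case (Suc k)
  have C: "0 <= C" using bmo_bound_nonneg[OF b] .
  have "\<bar>bavg (g j) a (4 * (1/2)^k / 2) - bavg (g j) a (4 * (1/2)^k)\<bar> <= 2 ^ CARD('d) * C"
    by (rule bavg_halve[OF g b]) simp
  also have "... <= C * 4 ^ CARD('d)" using C by (subst mult.commute) (intro mult_left_mono power_mono, auto)
  finally show ?case using Suc by (simp add: algebra_simps)
qed

text \<open>An increment of averages of \<open>f\<close> is z times a mean gradient over a cube of
  comparable size, up to the oscillation of the gradient there. The mean grows linearly in k, the
  oscillation is bounded by \<open>C\<close>.\<close>

lemma bmo_cdini:
  fixes f :: "real^'d => real" and g :: "'d => real^'d => real"
  assumes f: "lloc f" and g: "!!j. lloc (g j)" and w: "!!j. bweak f j (g j)" and M: "!!x. \<bar>f x\<bar> <= M"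
    and b: "!!j. bmo_bound C (g j)"
  shows "cdini (real CARD('d) * (M + 2 * (C * 4 ^ CARD('d)))) f"
  unfolding cdini_def
proof (intro conjI allI impI)
  have C: "0 <= C" using bmo_bound_nonneg[OF b] .
  have M0: "0 <= M" using M[of 0] by linarith
  show "0 <= real CARD('d) * (M + 2 * (C * 4 ^ CARD('d)))" using C M0 by simp
  fix k and x z :: "real^'d" assume z: "ALL j. \<bar>z $ j\<bar> <= (1/2)^k"
  let ?r = "(1/2::real)^k"
  \<comment> \<open>Shifts by at most \<open>?r\<close> of the cube at x fit into side 3
    \<open>?r\<close> from this corner; side 4 \<open>?r\<close> is taken to match the dyadic scales
    of \<open>bavg_dyadic_bound\<close>.\<close>
  let ?a = "x - (\<chi> j. ?r)"
  let ?A = "%j. bavg (g j) ?a (4 * ?r)" and ?b = "x + (\<chi> j. ?r)"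
  let ?D = "4 ^ CARD('d) :: real"
  let ?I = "\<integral>p. ind (box x ?b) p * (f (p + z) - f p) \<partial>lborel"
  have "\<bar>?I - measure lborel (box x ?b) * (SUM i:UNIV. z $ i * ?A i)\<bar>
     <= (SUM i:UNIV. \<bar>z $ i\<bar> * (C * (4 * ?r) ^ CARD('d)))"
  proof (rule box_translate_increment[OF f g w])
    fix th :: real and i assume th: "0 <= th" "th <= 1"
    have [measurable]: "g i : bmb" by (rule lloc_borel[OF g])
    have sub: "p : box ?a (?a + (\<chi> j. 4 * ?r))" if p: "p - th *\<^sub>R z : box x ?b" for p
      unfolding mem_box_cart
    proof
      fix k
      have "x $ k < p $ k - th * z $ k" "p $ k - th * z $ k < x $ k + ?r" using p by (auto simp: mem_box_cart)
      moreover have "\<bar>th * z $ k\<bar> <= ?r"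
      proof -
        have "\<bar>th * z $ k\<bar> <= 1 * \<bar>z $ k\<bar>" unfolding abs_mult using th by (intro mult_right_mono) auto
        then show ?thesis using z[rule_format, of k] by linarith
      qed
      moreover have "0 < ?r" by simp
      ultimately have "x $ k - ?r < p $ k & p $ k < x $ k - ?r + 4 * ?r" by linarith
      then show "?a $ k < p $ k & p $ k < (?a + (\<chi> j. 4 * ?r)) $ k" by simp
    qed
    have "(LBINT p. ind {p. p - th *\<^sub>R z : box x ?b} p * \<bar>g i p - ?A i\<bar>) <= (LBINT p. ind (box ?a (?a + (\<chi> j. 4 * ?r))) p * \<bar>g i p - ?A i\<bar>)"
      by (rule box_integral_mono[OF lloc_diff[OF g lloc_const]]) (use sub in auto)
    also have "... <= C * (4 * ?r) ^ CARD('d)" by (rule b[of i, unfolded bmo_bound_def, rule_format]) simp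
    finally show "(LBINT p. ind (box x ?b) (p - th *\<^sub>R z) * \<bar>g i p - ?A i\<bar>) <= C * (4 * ?r) ^ CARD('d)"
      by (simp add: indicator_def)
  qed simp
  also have "(SUM i:UNIV. \<bar>z $ i\<bar> * (C * (4 * ?r) ^ CARD('d))) <= (SUM i:(UNIV::'d set). ?r * (C * (4 * ?r) ^ CARD('d)))"
    using z C by (intro sum_mono mult_right_mono) auto
  finally have 1: "\<bar>?I - measure lborel (box x ?b) * (SUM i:UNIV. z $ i * ?A i)\<bar> <= real CARD('d) * ?r * C * ?D * ?r ^ CARD('d)"
    by (simp add: power_mult_distrib)
  have "\<bar>SUM i:UNIV. z $ i * ?A i\<bar> <= (SUM i:(UNIV::'d set). ?r * (M + C * ?D * (1 + real k)))"
    using z bavg_dyadic_bound[OF f g w M b, of _ ?a k]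
    by (intro order_trans[OF sum_abs] sum_mono) (auto simp: abs_mult intro!: mult_mono)
  then have S: "\<bar>SUM i:UNIV. z $ i * ?A i\<bar> <= real CARD('d) * ?r * (M + C * ?D * (1 + real k))" by simp
  have m: "measure lborel (box x ?b) = ?r ^ CARD('d)" by (rule measure_box_side) simp
  have "\<bar>?I\<bar> <= \<bar>measure lborel (box x ?b) * (SUM i:UNIV. z $ i * ?A i)\<bar> + real CARD('d) * ?r * C * ?D * ?r ^ CARD('d)"
    using 1 by linarith
  also have "... <= ?r ^ CARD('d) * (real CARD('d) * ?r * (M + C * ?D * (1 + real k))) + real CARD('d) * ?r * C * ?D * ?r ^ CARD('d)"
    unfolding m abs_mult using S C by (intro add_mono mult_mono) auto
  also have "... = real CARD('d) * (M + C * ?D * (1 + real k) + C * ?D) * ?r * ?r ^ CARD('d)" by (simp add: algebra_simps)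
  also have "... <= real CARD('d) * ((M + 2 * (C * ?D)) * (1 + real k)) * ?r * ?r ^ CARD('d)"
  proof -
    have "0 <= M * real k" "0 <= C * ?D * real k" using M0 C by auto
    then have "M + C * ?D * (1 + real k) + C * ?D <= (M + 2 * (C * ?D)) * (1 + real k)" by (simp add: algebra_simps)
    then show ?thesis by (intro mult_right_mono mult_left_mono) auto
  qed
  finally have "\<bar>?I\<bar> / ?r ^ CARD('d) <= real CARD('d) * ((M + 2 * (C * ?D)) * (1 + real k)) * ?r" by (subst divide_le_eq) auto
  then show "\<bar>cavg ?r f (x + z) - cavg ?r f x\<bar> <= real CARD('d) * (M + 2 * (C * ?D)) * (1 + real k) * ?r"
    unfolding cavg_increment[OF f] by (simp add: abs_divide mult.assoc)
qed (rule f)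

text \<open>The Lipschitz case, with the constants \<open>A j\<close> equal to 0. It provides the
  potential of a bounded field with a representative defined at every point.\<close>

lemma bounded_gradient_cdini:
  fixes f :: "real^'d => real" and g :: "'d => real^'d => real"
  assumes f: "lloc f" and g: "!!j. lloc (g j)" and w: "!!j. bweak f j (g j)" and M: "!!j x. \<bar>g j x\<bar> <= M"
  shows "cdini (real CARD('d) * M) f"
  unfolding cdini_def
proof (intro conjI allI impI)
  have M0: "0 <= M" using M[of undefined 0] by linarith
  show "0 <= real CARD('d) * M" using M0 by simp
  fix k and x z :: "real^'d" assume z: "ALL j. \<bar>z $ j\<bar> <= (1/2)^k"
  let ?r = "(1/2::real)^k"
  let ?b = "x + (\<chi> j. ?r)"
  let ?I = "\<integral>p. ind (box x ?b) p * (f (p + z) - f p) \<partial>lborel"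
  have m: "measure lborel (box x ?b) = ?r ^ CARD('d)" by (rule measure_box_side) simp
  have "\<bar>?I - measure lborel (box x ?b) * (SUM i:UNIV. z $ i * 0)\<bar> <= (SUM i:UNIV. \<bar>z $ i\<bar> * (M * ?r ^ CARD('d)))"
  proof (rule box_translate_increment[OF f g w])
    fix th :: real and i
    have [measurable]: "g i : bmb" by (rule lloc_borel[OF g])
    have "(LBINT p. ind (box x ?b) (p - th *\<^sub>R z) * \<bar>g i p - 0\<bar>) = (LBINT p. ind (box x ?b) p * \<bar>g i (p + th *\<^sub>R z)\<bar>)"
      using lborel_integral_translate[of "%p. ind (box x ?b) (p - th *\<^sub>R z) * \<bar>g i p - 0\<bar>" "th *\<^sub>R z"] by simp
    also have "... <= M * measure lborel (box x ?b)"
      by (rule order_trans[OF abs_ge_self integral_indicator_mult_bound]) (auto simp: M bounded_box)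
    finally show "(LBINT p. ind (box x ?b) (p - th *\<^sub>R z) * \<bar>g i p - 0\<bar>) <= M * ?r ^ CARD('d)" using m by simp
  qed simp
  also have "... <= (SUM i:(UNIV::'d set). ?r * (M * ?r ^ CARD('d)))"
    using z M0 by (intro sum_mono mult_right_mono) auto
  finally have "\<bar>?I\<bar> <= real CARD('d) * M * ?r * ?r ^ CARD('d)" by (simp add: mult.commute mult.left_commute)
  then have "\<bar>?I\<bar> / ?r ^ CARD('d) <= real CARD('d) * M * ?r" by (subst divide_le_eq) auto
  then have "\<bar>cavg ?r f (x + z) - cavg ?r f x\<bar> <= real CARD('d) * M * ?r"
    unfolding cavg_increment[OF f] by (simp add: abs_divide)
  also have "... <= real CARD('d) * M * ?r * (1 + real k)"
    using M0 mult_left_mono[of 1 "1 + real k" "real CARD('d) * M * ?r"] by simp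
  finally show "\<bar>cavg ?r f (x + z) - cavg ?r f x\<bar> <= real CARD('d) * M * (1 + real k) * ?r" by (simp only: ac_simps)
qed (rule f)

text \<open>Before the limit, increments of averages are averages of the gradient over points near
  the segment from x to x + z, where \<open>W\<close> deviates from its value at x by at most
  \<open>kp\<close>. The slack \<open>rh\<close> leaves room for the cubes that are still
  shrinking.\<close>

lemma crep_taylor:
  fixes f :: "real^'d => real" and g W :: "'d => real^'d => real"
  assumes d: "cdini c f" and g: "!!j. lloc (g j)" and w: "!!j. bweak f j (g j)"
    and W: "!!j. AE p in lborel. g j p = W j p" and rh: "0 < rh"
    and kp: "!!j p. norm (p - x) <= norm z + rh ==> \<bar>W j p - W j x\<bar> <= kp j"
  shows "\<bar>crep f (x + z) - crep f x - (SUM j:UNIV. z $ j * W j x)\<bar> <= (SUM j:UNIV. \<bar>z $ j\<bar> * kp j)"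
proof -
  have f: "lloc f" using d by (simp add: cdini_def)
  have "(%k. \<bar>cavg ((1/2)^k) f (x + z) - cavg ((1/2)^k) f x - (SUM j:UNIV. z $ j * W j x)\<bar>) \<longlonglongrightarrow>
     \<bar>crep f (x + z) - crep f x - (SUM j:UNIV. z $ j * W j x)\<bar>"
    by (intro tendsto_rabs tendsto_diff crep_tendsto[OF d] tendsto_const)
  then show ?thesis
  proof (rule LIMSEQ_le_const2)
    have "(%k. real CARD('d) * (1/2)^k) \<longlonglongrightarrow> real CARD('d) * 0"
      by (intro tendsto_mult tendsto_const LIMSEQ_realpow_zero) auto
    then have "eventually (%k. real CARD('d) * (1/2)^k < rh) sequentially" using rh by (intro order_tendstoD(2)) auto
    then obtain N where N: "!!k. N <= k ==> real CARD('d) * (1/2)^k < rh" by (auto simp: eventually_sequentially)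
    show "EX N. ALL k>=N. \<bar>cavg ((1/2)^k) f (x + z) - cavg ((1/2)^k) f x - (SUM j:UNIV. z $ j * W j x)\<bar> <= (SUM j:UNIV. \<bar>z $ j\<bar> * kp j)"
    proof (intro exI[of _ N] allI impI)
      fix k assume k: "N <= k"
      let ?r = "(1/2::real)^k"
      let ?b = "x + (\<chi> j. ?r)"
      let ?I = "\<integral>p. ind (box x ?b) p * (f (p + z) - f p) \<partial>lborel"
      have m: "measure lborel (box x ?b) = ?r ^ CARD('d)" by (rule measure_box_side) simp
      have "\<bar>?I - measure lborel (box x ?b) * (SUM i:UNIV. z $ i * W i x)\<bar> <= (SUM i:UNIV. \<bar>z $ i\<bar> * (kp i * ?r ^ CARD('d)))"
      proof (rule box_translate_increment[OF f g w])
        fix th :: real and i assume th: "0 <= th" "th <= 1"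
        have [measurable]: "g i : bmb" by (rule lloc_borel[OF g])
        \<comment> \<open>The bound by \<open>kp\<close> holds for \<open>g\<close> only almost
          everywhere; the truncation makes it hold at every point and leaves the integral
          unchanged.\<close>
        define h where "h = (%p. min \<bar>g i p - W i x\<bar> (kp i))"
        have [measurable]: "h : bmb" unfolding h_def by measurable
        have near: "norm (p - x) <= norm z + rh" if p: "p - th *\<^sub>R z : box x ?b" for p
        proof -
          have "p - th *\<^sub>R z - x : cu ?r" using p by (simp add: mem_cu mem_box_cart algebra_simps)
          then have "norm (p - th *\<^sub>R z - x) <= rh" using cu_norm N[OF k] by fastforce
          moreover have "norm (th *\<^sub>R z) <= norm z" using th by (simp add: mult_left_le_one_le)
          moreover have "norm (p - x) <= norm (p - th *\<^sub>R z - x) + norm (th *\<^sub>R z)"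
            using norm_triangle_ineq[of "p - th *\<^sub>R z - x" "th *\<^sub>R z"] by simp
          ultimately show ?thesis by linarith
        qed
        have k0: "0 <= kp i" using kp[of x i] rh by simp
        have "(LBINT p. ind (box x ?b) (p - th *\<^sub>R z) * \<bar>g i p - W i x\<bar>) = (LBINT p. ind (box x ?b) (p - th *\<^sub>R z) * h p)"
        proof (rule integral_cong_AE)
          show "AE p in lborel. ind (box x ?b) (p - th *\<^sub>R z) * \<bar>g i p - W i x\<bar> = ind (box x ?b) (p - th *\<^sub>R z) * h p"
            using W[of i]
          proof eventually_elim
            case (elim p)
            show ?case using kp[OF near, of p i] by (auto simp: h_def elim indicator_def min_def)
          qed
        qed measurable
        also have "... = (LBINT p. ind (box x ?b) p * h (p + th *\<^sub>R z))"
          using lborel_integral_translate[of "%p. ind (box x ?b) (p - th *\<^sub>R z) * h p" "th *\<^sub>R z"] by simp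
        also have "... <= kp i * measure lborel (box x ?b)"
          by (rule order_trans[OF abs_ge_self integral_indicator_mult_bound]) (auto simp: h_def k0 bounded_box)
        finally show "(LBINT p. ind (box x ?b) (p - th *\<^sub>R z) * \<bar>g i p - W i x\<bar>) <= kp i * ?r ^ CARD('d)" using m by simp
      qed simp
      then have "\<bar>?I - ?r ^ CARD('d) * (SUM i:UNIV. z $ i * W i x)\<bar> <= (SUM i:UNIV. \<bar>z $ i\<bar> * kp i) * ?r ^ CARD('d)"
        unfolding m by (simp add: sum_distrib_right mult.assoc)
      then have "\<bar>?I - ?r ^ CARD('d) * (SUM i:UNIV. z $ i * W i x)\<bar> / ?r ^ CARD('d) <= (SUM i:UNIV. \<bar>z $ i\<bar> * kp i)"
        by (subst divide_le_eq) auto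
      moreover have "\<bar>?I - ?r ^ CARD('d) * (SUM i:UNIV. z $ i * W i x)\<bar> / ?r ^ CARD('d) = \<bar>?I / ?r ^ CARD('d) - (SUM i:UNIV. z $ i * W i x)\<bar>"
      proof -
        have "\<bar>A - r * B\<bar> / r = \<bar>A / r - B\<bar>" if "0 < r" for A B r :: real
        proof -
          have "A / r - B = (A - r * B) / r" using that by (simp add: field_simps)
          then show ?thesis using that by (simp add: abs_divide)
        qed
        then show ?thesis by simp
      qed
      ultimately show "\<bar>cavg ?r f (x + z) - cavg ?r f x - (SUM j:UNIV. z $ j * W j x)\<bar> <= (SUM j:UNIV. \<bar>z $ j\<bar> * kp j)"
        unfolding cavg_increment[OF f] by simp
    qed
  qed
qed

section \<open>Periodic functions and the unit cell\<close>

lemma loc_int_lebesgue_measurable: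
  fixes f :: "real^'d => real"
  assumes "loc_int f" shows "f : borel_measurable lebesgue"
proof (rule borel_measurable_LIMSEQ_real)
  fix n :: nat
  have "f absolutely_integrable_on cball 0 (real n)" using assms by (simp add: loc_int_def)
  then show "(%x. ind (cball 0 (real n)) x *\<^sub>R f x) : borel_measurable lebesgue"
    unfolding set_integrable_def by (rule borel_measurable_integrable)
next
  fix x :: "real^'d"
  obtain N :: nat where "norm x < real N" using reals_Archimedean2 by blast
  then have "eventually (%n. ind (cball 0 (real n)) x *\<^sub>R f x = f x) sequentially"
    unfolding eventually_sequentially by (intro exI[of _ N]) auto
  then show "(%n. ind (cball 0 (real n)) x *\<^sub>R f x) \<longlonglongrightarrow> f x" by (rule tendsto_eventually)
qed

lemma lloc_of_loc_int:
  fixes f :: "real^'d => real"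
  assumes f: "loc_int f" and f': "f' : bmb" and e: "AE x in lborel. f x = f' x"
  shows "lloc f'"
  unfolding lloc_def
proof (intro conjI allI)
  fix a b :: "real^'d"
  have "integrable lebesgue (%x. ind (cbox a b) x *\<^sub>R f x)"
    using f compact_cbox[of a b] by (simp add: loc_int_def set_integrable_def)
  moreover have "(%x. ind (cbox a b) x *\<^sub>R f' x) : borel_measurable lborel" using f' by measurable
  moreover have "AE x in lebesgue. ind (cbox a b) x *\<^sub>R f x = ind (cbox a b) x *\<^sub>R f' x"
    using AE_completion[OF e] by eventually_elim simp
  ultimately have "integrable lebesgue (%x. ind (cbox a b) x *\<^sub>R f' x)"
    by (subst integrable_cong_AE[symmetric]) (auto intro: measurable_completion)
  then show "set_integrable lborel (cbox a b) f'"
    using f' unfolding set_integrable_def by (subst (asm) integrable_completion) auto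
qed (rule f')

lemma loc_int_borel_version:
  fixes f :: "real^'d => real"
  assumes "loc_int f" shows "EX f'. lloc f' & (AE x in lborel. f x = f' x)"
proof -
  obtain f' where "f' : borel_measurable lborel" "AE x in lborel. f x = f' x"
    using completion_ex_borel_measurable_real[OF loc_int_lebesgue_measurable[OF assms]] by blast
  then show ?thesis using lloc_of_loc_int[OF assms, of f'] by auto
qed

lemma AE_lborel_negligible:
  fixes P :: "'a::euclidean_space => bool"
  assumes "AE x in lborel. P x" shows "negligible {x. ~ P x}"
proof -
  have "AE x in lebesgue. P x" using AE_completion[OF assms] .
  then obtain N where "negligible N" "{x. ~ P x} \<subseteq> N"
    unfolding eventually_ae_filter_negligible by blast
  then show ?thesis by (rule negligible_subset)
qed

lemma integral_HK_AE_cong: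
  fixes f g :: "'a::euclidean_space => real"
  assumes "AE x in lborel. f x = g x" shows "integral S f = integral S g"
  by (rule integral_spike[OF AE_lborel_negligible[OF assms]]) auto

text \<open>The given notion uses gauge integrals. For Borel representatives the integrands are
  Lebesgue integrable, where both integrals agree, and null sets do not affect the gauge
  integral.\<close>

lemma bweak_of_weak_partial:
  fixes f :: "real^'d => real"
  assumes w: "weak_partial f j g" and f': "lloc f'" "AE x in lborel. f x = f' x" and g': "lloc g'" "AE x in lborel. g x = g' x"
  shows "bweak f' j g'"
  unfolding bweak_def
proof (intro allI impI)
  fix psi :: "real^'d => real" assume psi: "test_fun psi"
  have "integral UNIV (%x. f x * dpart psi j x) = - integral UNIV (%x. g x * psi x)"
    using w psi by (simp add: weak_partial_def)
  moreover have "integral UNIV (%x. f x * dpart psi j x) = integral UNIV (%x. f' x * dpart psi j x)"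
    by (rule integral_HK_AE_cong) (use f'(2) in eventually_elim, simp)
  moreover have "integral UNIV (%x. g x * psi x) = integral UNIV (%x. g' x * psi x)"
    by (rule integral_HK_AE_cong) (use g'(2) in eventually_elim, simp)
  moreover have "integral UNIV (%x. f' x * dpart psi j x) = (LBINT x. f' x * dpart psi j x)"
    using conv_integrable_dpart[OF f'(1) psi, of j 0] by (intro integral_lborel) simp
  moreover have "integral UNIV (%x. g' x * psi x) = (LBINT x. g' x * psi x)"
    using conv_integrable_test[OF g'(1) psi, of 0] by (intro integral_lborel) simp
  ultimately show "(LBINT x. f' x * dpart psi j x) = - (LBINT x. g' x * psi x)" by simp
qed

definition bdiv :: "(real^'d => real^'d) => (real^'d => real) => bool" where
  "bdiv U D \<longleftrightarrow> (ALL psi. test_fun psi --> (LBINT x. (SUM j:UNIV. U x $ j * dpart psi j x)) = - (LBINT x. D x * psi x))"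

lemma bdiv_of_weak_div:
  fixes U :: "real^'d => real^'d"
  assumes w: "weak_div U D" and U': "!!j. lloc (%x. U' x $ j)" "AE x in lborel. U x = U' x" and D': "lloc D'" "AE x in lborel. D x = D' x"
  shows "bdiv U' D'"
  unfolding bdiv_def
proof (intro allI impI)
  fix psi :: "real^'d => real" assume psi: "test_fun psi"
  have "integral UNIV (%x. SUM j:UNIV. U x $ j * dpart psi j x) = - integral UNIV (%x. D x * psi x)"
    using w psi by (simp add: weak_div_def)
  moreover have "integral UNIV (%x. SUM j:UNIV. U x $ j * dpart psi j x) = integral UNIV (%x. SUM j:UNIV. U' x $ j * dpart psi j x)"
    by (rule integral_HK_AE_cong) (use U'(2) in eventually_elim, simp)
  moreover have "integral UNIV (%x. D x * psi x) = integral UNIV (%x. D' x * psi x)"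
    by (rule integral_HK_AE_cong) (use D'(2) in eventually_elim, simp)
  moreover have "integral UNIV (%x. SUM j:UNIV. U' x $ j * dpart psi j x) = (LBINT x. (SUM j:UNIV. U' x $ j * dpart psi j x))"
    using conv_integrable_dpart[OF U'(1) psi, of _ _ 0] by (intro integral_lborel Bochner_Integration.integrable_sum) simp
  moreover have "integral UNIV (%x. D' x * psi x) = (LBINT x. D' x * psi x)"
    using conv_integrable_test[OF D'(1) psi, of 0] by (intro integral_lborel) simp
  ultimately show "(LBINT x. (SUM j:UNIV. U' x $ j * dpart psi j x)) = - (LBINT x. D' x * psi x)" by simp
qed

lemma AE_cbox_box:
  fixes a b :: "'a::euclidean_space"
  shows "AE x in lborel. x : cbox a b \<longleftrightarrow> x : box a b"
proof (rule AE_I[where N = "cbox a b - box a b"])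
  show "{x : space lborel. (x : cbox a b) ~= (x : box a b)} \<subseteq> cbox a b - box a b" using box_subset_cbox by auto
  have "emeasure lborel (cbox a b - box a b) = emeasure lborel (cbox a b) - emeasure lborel (box a b)"
    by (rule emeasure_Diff) (use emeasure_lborel_box_finite[of a b] in \<open>auto simp: box_subset_cbox\<close>)
  also have "... = 0" by (simp add: emeasure_lborel_box_eq emeasure_lborel_cbox_eq)
  finally show "emeasure lborel (cbox a b - box a b) = 0" .
qed auto

lemma integral_cbox_lborel:
  fixes h :: "real^'d => real"
  assumes h': "lloc h'" "AE x in lborel. h x = h' x"
  shows "integral (cbox a b) h = (LBINT x. ind (box a b) x * h' x)"
proof -
  have [measurable]: "h' : bmb" using h' by (simp add: lloc_borel)
  have "integral (cbox a b) h = integral (cbox a b) h'" by (rule integral_HK_AE_cong[OF h'(2)])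
  also have "... = (LBINT x. ind (cbox a b) x *\<^sub>R h' x)"
    using set_borel_integral_eq_integral(2)[OF lloc_set_integrable[OF h'(1)], of a b] by (simp add: set_lebesgue_integral_def)
  also have "... = (LBINT x. ind (box a b) x * h' x)"
  proof (rule integral_cong_AE)
    show "AE x in lborel. ind (cbox a b) x *\<^sub>R h' x = ind (box a b) x * h' x"
      using AE_cbox_box[of a b] by eventually_elim (simp add: indicator_def)
  qed measurable
  finally show ?thesis .
qed

lemma One_cart: "(One :: real^'d) = (\<chi> j. 1)"
proof -
  have "(One :: real^'d) $ j = 1" for j
  proof -
    have "(One :: real^'d) $ j = (One :: real^'d) \<bullet> axis j 1" by (simp add: inner_axis)
    also have "... = 1" using inner_sum_left_Basis[of "axis j 1 :: real^'d" "%_. 1"] by (auto simp: Basis_vec_def)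
    finally show ?thesis .
  qed
  then show ?thesis by (simp add: vec_eq_iff)
qed

lemma bmo_bound_of_bmo_le:
  fixes g :: "real^'d => real"
  assumes b: "bmo_le g C" and g': "lloc g'" "AE x in lborel. g x = g' x"
  shows "bmo_bound C g'"
  unfolding bmo_bound_def
proof (intro allI impI)
  fix a :: "real^'d" and r :: real assume r: "0 < r"
  let ?b = "a + (\<chi> j. r)"
  have e: "a + r *\<^sub>R One = ?b" by (simp add: One_cart vec_eq_iff)
  have m: "measure lborel (cbox a ?b) = r ^ CARD('d)"
    using measure_box_side[OF r, of a] by (simp add: measure_lborel_box_eq measure_lborel_cbox_eq)
  have av: "integral (cbox a ?b) g / measure lborel (cbox a ?b) = bavg g' a r"
    unfolding m bavg_def integral_cbox_lborel[OF g'] ..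
  have "integral (cbox a ?b) (%x. \<bar>g x - bavg g' a r\<bar>) / measure lborel (cbox a ?b) <= C"
    using b r unfolding bmo_le_def Let_def e[symmetric] av[symmetric, folded e] by blast
  moreover have "integral (cbox a ?b) (%x. \<bar>g x - bavg g' a r\<bar>) = (LBINT x. ind (box a ?b) x * \<bar>g' x - bavg g' a r\<bar>)"
    by (rule integral_cbox_lborel[OF lloc_abs[OF lloc_diff[OF g'(1) lloc_const]]]) (use g'(2) in eventually_elim, simp)
  ultimately show "(LBINT p. ind (box a ?b) p * \<bar>g' p - bavg g' a r\<bar>) <= C * r ^ CARD('d)"
    using r unfolding m by (simp add: divide_le_eq)
qed

section \<open>The integer lattice and its fundamental cell\<close>

definition Lat :: "(real^'d) set" where "Lat = {k. ALL j. k $ j : \<int>}"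

text \<open>Half-open, so that each point has exactly one lattice translate in the cell; the closed
  cube would overlap with its neighbours.\<close>

definition hq :: "(real^'d) set" where "hq = {x. ALL j. 0 <= x $ j & x $ j < 1}"

lemma hq_borel [measurable, simp]: "(hq :: (real^'d) set) : sets borel"
  unfolding hq_def by measurable

lemma hq_cbox: "(hq :: (real^'d) set) \<subseteq> cbox 0 One"
  by (auto simp: hq_def mem_box_cart One_cart less_imp_le)

lemma box_hq: "box 0 One \<subseteq> (hq :: (real^'d) set)"
  by (auto simp: hq_def mem_box_cart One_cart less_imp_le)

lemma AE_hq_cbox: "AE x in lborel. x : (hq :: (real^'d) set) \<longleftrightarrow> x : cbox 0 One"
  using AE_cbox_box[of 0 "One :: real^'d"] by eventually_elim (use hq_cbox box_hq in blast)

lemma bounded_hq: "bounded (hq :: (real^'d) set)"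
  using bounded_cbox hq_cbox bounded_subset by blast

lemma measure_hq: "measure lborel (hq :: (real^'d) set) = 1" "emeasure lborel (hq :: (real^'d) set) = 1"
proof -
  have "emeasure lborel (hq :: (real^'d) set) = emeasure lborel (cbox 0 (One :: real^'d))"
    by (rule emeasure_eq_AE[OF AE_hq_cbox]) auto
  also have "... = 1" by (simp add: emeasure_lborel_cbox_eq)
  finally show "emeasure lborel (hq :: (real^'d) set) = 1" .
  then show "measure lborel (hq :: (real^'d) set) = 1" by (simp add: measure_def)
qed

lemma Lat_enum: "EX e::nat => real^'d. bij_betw e UNIV Lat"
proof -
  have "Lat = (%n::'d => int. (\<chi> j. of_int (n j)) :: real^'d) ` UNIV"
  proof (intro set_eqI iffI)
    fix k :: "real^'d" assume "k : Lat"
    then have "k = (\<chi> j. of_int \<lfloor>k $ j\<rfloor>)" by (auto simp: Lat_def vec_eq_iff elim: Ints_cases)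
    then show "k : (%n::'d => int. (\<chi> j. of_int (n j)) :: real^'d) ` UNIV"
      by (rule image_eqI[where x = "%j. \<lfloor>k $ j\<rfloor>"]) simp
  qed (auto simp: Lat_def)
  moreover have "countable (range (%n::'d => int. (\<chi> j. of_int (n j)) :: real^'d))"
    by (intro countable_image countableI_type)
  ultimately have "countable (Lat :: (real^'d) set)" by (simp only:)
  moreover have "infinite (Lat :: (real^'d) set)"
  proof -
    have "inj (%n::nat. (\<chi> j. real n) :: real^'d)" by (auto simp: inj_def vec_eq_iff)
    then have "infinite (range (%n::nat. (\<chi> j. real n) :: real^'d))" by (rule range_inj_infinite)
    moreover have "range (%n::nat. (\<chi> j. real n) :: real^'d) \<subseteq> Lat" by (auto simp: Lat_def)
    ultimately show ?thesis by (meson finite_subset)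
  qed
  ultimately obtain e :: "real^'d => nat" where "bij_betw e Lat UNIV" by (rule countableE_infinite)
  then show ?thesis using bij_betw_inv_into by blast
qed

text \<open>An enumeration by naturals: sums over the lattice become ordinary series, and statements
  almost everywhere for all lattice vectors are countable intersections.\<close>

definition lat :: "nat => real^'d" where "lat = (SOME e. bij_betw e UNIV Lat)"

lemma lat_bij: "bij_betw lat UNIV (Lat :: (real^'d) set)"
  unfolding lat_def by (rule someI_ex[OF Lat_enum])

lemma lat_in: "lat n : Lat" using lat_bij by (auto simp: bij_betw_def)

lemma hq_translate_unique:
  fixes x :: "real^'d"
  shows "EX! n. x - lat n : hq" "EX! n. x + lat n : hq"
proof -
  have un: "k = k'" if kk: "k : Lat" "k' : Lat" "x - k : hq" "x - k' : hq" for k k' :: "real^'d"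
  proof -
    have "k $ j = k' $ j" for j
    proof -
      have "k $ j : \<int>" "k' $ j : \<int>" using kk by (auto simp: Lat_def)
      then obtain m m' where m: "k $ j = of_int m" "k' $ j = of_int m'" by (auto elim!: Ints_cases)
      have "0 <= x $ j - of_int m" "x $ j - of_int m < 1" "0 <= x $ j - of_int m'" "x $ j - of_int m' < 1"
        using kk(3,4) m unfolding hq_def by (auto dest!: spec[of _ j])
      then have "m = \<lfloor>x $ j\<rfloor>" "m' = \<lfloor>x $ j\<rfloor>" by linarith+
      then show ?thesis using m by simp
    qed
    then show ?thesis by (simp add: vec_eq_iff)
  qed
  define k0 where "k0 = ((\<chi> j. of_int \<lfloor>x $ j\<rfloor>) :: real^'d)"
  have k0: "k0 : Lat" "x - k0 : hq"
  proof -
    have "0 <= x $ j - of_int \<lfloor>x $ j\<rfloor>" "x $ j - of_int \<lfloor>x $ j\<rfloor> < 1" for j by linarith+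
    then show "x - k0 : hq" by (simp add: k0_def hq_def)
    show "k0 : Lat" by (simp add: k0_def Lat_def)
  qed
  have neg: "- k : Lat" if "k : Lat" for k :: "real^'d" using that by (auto simp: Lat_def)
  have inj: "(lat n :: real^'d) = lat m ==> n = m" for n m using lat_bij[where 'd='d] by (auto simp: bij_betw_def inj_def)
  have ex: "k : Lat ==> EX n. lat n = k" for k :: "real^'d" using lat_bij[where 'd='d] unfolding bij_betw_def by (metis imageE)
  obtain n where n: "lat n = k0" using ex[OF k0(1)] by blast
  show "EX! n. x - lat n : hq"
  proof (rule ex1I[of _ n])
    show "x - lat n : hq" using n k0 by simp
    fix n' assume "x - lat n' : hq"
    then have "lat n' = k0" by (rule un[OF lat_in k0(1) _ k0(2)])
    then have "(lat n' :: real^'d) = lat n" using n by simp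
    then show "n' = n" by (rule inj)
  qed
  obtain m where m: "lat m = - k0" using ex[OF neg[OF k0(1)]] by blast
  show "EX! n. x + lat n : hq"
  proof (rule ex1I[of _ m])
    show "x + lat m : hq" using m k0 by simp
    fix n' assume "x + lat n' : hq"
    then have "x - (- lat n') : hq" by simp
    then have "- lat n' = k0" using un[OF neg[OF lat_in] k0(1) _ k0(2)] by blast
    then have "(lat n' :: real^'d) = lat m" using m by (metis add.inverse_inverse)
    then show "n' = m" by (rule inj)
  qed
qed

lemma suminf_indicator_ex1:
  fixes P :: "nat => bool"
  assumes "EX! n. P n" shows "(\<Sum>n. (if P n then c else 0)) = (c::ennreal)"
proof -
  define m where "m = (THE n. P n)"
  have m: "P m" unfolding m_def by (rule theI'[OF assms])
  have u: "n = m" if "P n" for n using the1_equality[OF assms that] unfolding m_def by (rule sym)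
  have e: "(if P n then c else 0) = (if n = m then c else 0)" for n
  proof (cases "n = m")
    case True
    then show ?thesis using m by (simp only: if_True simp_thms)
  next
    case False
    then have "~ P n" using u by blast
    then show ?thesis using False by (simp only: if_False simp_thms)
  qed
  have "(%n. if n = m then c else 0) sums c" by (rule sums_single)
  then show ?thesis unfolding e by (rule sums_unique[symmetric])
qed

text \<open>The space is cut into the lattice translates of the cell, and each piece is translated
  back.\<close>

lemma nn_integral_unfold:
  fixes g :: "real^'d => ennreal"
  assumes [measurable]: "g : bmb"
  shows "(NN x. g x) = (NN x. ind hq x * (\<Sum>n. g (x + lat n)))"
proof -
  have "(NN x. ind hq x * (\<Sum>n. g (x + lat n))) = (NN x. (\<Sum>n. ind hq x * g (x + lat n)))"
    by (intro nn_integral_cong ennreal_suminf_cmult[symmetric])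
  also have "... = (\<Sum>n. \<integral>\<^sup>+x. ind hq x * g (x + lat n) \<partial>lborel)"
    by (rule nn_integral_suminf) measurable
  also have "... = (\<Sum>n. \<integral>\<^sup>+x. ind hq (x - lat n) * g x \<partial>lborel)"
  proof (rule suminf_cong)
    fix n
    show "(NN x. ind hq x * g (x + lat n)) = (NN x. ind hq (x - lat n) * g x)"
      using lborel_nn_integral_translate[of "%x. ind hq (x - lat n) * g x" "lat n"] by simp
  qed
  also have "... = (NN x. (\<Sum>n. ind hq (x - lat n) * g x))"
    by (rule nn_integral_suminf[symmetric]) measurable
  also have "... = (NN x. g x)"
  proof (rule nn_integral_cong)
    fix x
    have "(\<Sum>n. ind hq (x - lat n) * g x) = (\<Sum>n. if x - lat n : hq then g x else 0)"
      by (rule suminf_cong) (simp add: indicator_def)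
    also have "... = g x" by (rule suminf_indicator_ex1[OF hq_translate_unique(1)])
    finally show "(\<Sum>n. ind hq (x - lat n) * g x) = g x" .
  qed
  finally show ?thesis by simp
qed

text \<open>For a lattice-equivariant \<open>Y\<close> the preimage of the cell is a fundamental
  domain as well: after unfolding, exactly one translate of a point has its image in the
  cell.\<close>

lemma nn_integral_periodic_change:
  fixes H :: "real^'d => ennreal" and Y :: "real^'d => real^'d"
  assumes [measurable]: "H : bmb" "Y : bmb"
    and H: "!!n. AE x in lborel. H (x + lat n) = H x" and Y: "!!n. AE x in lborel. Y (x + lat n) = Y x + lat n"
  shows "(NN x. ind hq (Y x) * H x) = (NN x. ind hq x * H x)"
proof -
  have "(NN x. ind hq (Y x) * H x) = (NN x. ind hq x * (\<Sum>n. ind hq (Y (x + lat n)) * H (x + lat n)))"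
    by (rule nn_integral_unfold) measurable
  also have "... = (NN x. ind hq x * H x)"
  proof (rule nn_integral_cong_AE)
    have "AE x in lborel. ALL n. H (x + lat n) = H x" "AE x in lborel. ALL n. Y (x + lat n) = Y x + lat n"
      using H Y by (simp_all add: AE_all_countable)
    then show "AE x in lborel. ind hq x * (\<Sum>n. ind hq (Y (x + lat n)) * H (x + lat n)) = ind hq x * H x"
    proof eventually_elim
      case (elim x)
      have "(\<Sum>n. ind hq (Y (x + lat n)) * H (x + lat n)) = (\<Sum>n. if Y x + lat n : hq then H x else 0)"
        using elim by (intro suminf_cong) (auto simp: indicator_def)
      then show ?case using suminf_indicator_ex1[OF hq_translate_unique(2), of "Y x" "H x"] by simp
    qed
  qed
  finally show ?thesis .
qed

text \<open>Adding \<open>B\<close> makes the integrand nonnegative, and the translation by -v is a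
  lattice-equivariant change of fundamental domain.\<close>

lemma integral_periodic_shift:
  fixes h :: "real^'d => real"
  assumes [measurable]: "h : bmb" and B: "!!x. \<bar>h x\<bar> <= B"
    and H: "!!n. AE x in lborel. h (x + lat n) = h x"
  shows "(LBINT x. ind hq x * h (x + v)) = (LBINT x. ind hq x * h x)"
proof -
  have iq: "integrable lborel (%x::real^'d. ind hq x * c)" for c :: real
    by (intro integrable_mult_left integrable_indicator_bounded bounded_hq) simp
  have nn: "(NN x. ind hq x * ennreal (h (x + v) + B)) = (NN x. ind hq x * ennreal (h x + B))"
  proof -
    have "(NN x. ind hq x * ennreal (h (x + v) + B)) = (NN x. ind hq (x - v) * ennreal (h x + B))"
      using lborel_nn_integral_translate[of "%x. ind hq (x - v) * ennreal (h x + B)" v] by simp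
    also have "... = (NN x. ind hq x * ennreal (h x + B))"
    proof (rule nn_integral_periodic_change)
      show "AE x in lborel. ennreal (h (x + lat n) + B) = ennreal (h x + B)" for n using H[of n] by eventually_elim simp
    qed (auto simp: algebra_simps)
    finally show ?thesis .
  qed
  have *: "(LBINT x. ind hq x * (g x + B)) = enn2real (NN x. ind hq x * ennreal (g x + B))"
    "(LBINT x. ind hq x * (g x + B)) = (LBINT x. ind hq x * g x) + B"
    if [measurable]: "g : bmb" and "!!x. \<bar>g x\<bar> <= B" for g :: "real^'d => real"
  proof -
    have g: "0 <= g x + B" for x using that(2)[of x] by linarith
    have "(LBINT x. ind hq x * (g x + B)) = enn2real (NN x. ennreal (ind hq x * (g x + B)))"
      by (intro integral_eq_nn_integral) (auto simp: g)
    also have "(NN x. ennreal (ind hq x * (g x + B))) = (NN x. ind hq x * ennreal (g x + B))"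
      by (intro nn_integral_cong) (auto simp: indicator_def)
    finally show "(LBINT x. ind hq x * (g x + B)) = enn2real (NN x. ind hq x * ennreal (g x + B))" .
    have "integrable lborel (%x. ind hq x * g x)"
      by (rule Bochner_Integration.integrable_bound[OF iq[of B]]) (use that(2) in \<open>auto simp: indicator_def intro: order_trans[OF _ abs_ge_self]\<close>)
    then show "(LBINT x. ind hq x * (g x + B)) = (LBINT x. ind hq x * g x) + B"
      unfolding distrib_left using iq[of B] measure_hq(1)[where 'd='d] by simp
  qed
  have mh [measurable]: "(%x. h (x + v)) : bmb" by measurable
  have "(LBINT x. ind hq x * h (x + v)) = enn2real (NN x. ind hq x * ennreal (h (x + v) + B)) - B"
    using *(1)[of "%x. h (x + v)", OF mh B] *(2)[of "%x. h (x + v)", OF mh B] by linarith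
  moreover have "(LBINT x. ind hq x * h x) = enn2real (NN x. ind hq x * ennreal (h x + B)) - B"
    using *(1)[of h, OF assms(1) B] *(2)[of h, OF assms(1) B] by linarith
  ultimately show ?thesis by (simp only: nn)
qed

section \<open>Transport of Lebesgue measure by shears\<close>

lemma has_derivative_const_unique:
  assumes "(f has_derivative D) (at x)" "!!y. f y = c" shows "D h = 0"
proof -
  have "f = (%y. c)" using assms(2) by auto
  then have "(f has_derivative (%_. 0)) (at x)" by simp
  then have "D = (%_. 0)" using has_derivative_unique[OF assms(1)] by blast
  then show ?thesis by simp
qed

text \<open>The correlation of \<open>psi\<close> with a constant does not depend on the base point;
  its derivative is, up to sign, the integral in question.\<close>

lemma integral_dpart_zero:
  fixes psi :: "real^'d => real"
  assumes psi: "test_fun psi" shows "(LBINT x. dpart psi j x) = 0"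
proof -
  have m: "psi : bmb" by (intro borel_measurable_continuous_onI test_fun_continuous psi)
  have "conv psi (%_. 1) y = 1 * conv psi (%_. 1) 0" for y by (rule conv_const[OF m])
  then have "- (SUM i:UNIV. axis j 1 $ i * conv (dpart psi i) (%_. 1) 0) = 0"
    using has_derivative_const_unique[OF conv_has_derivative[OF lloc_const[of 1] psi, of 0], of "conv psi (%_. 1) 0" "axis j 1"] by simp
  moreover have "(SUM i:UNIV. axis j 1 $ i * conv (dpart psi i) (%_. 1) 0) = (SUM i:UNIV. if i = j then conv (dpart psi i) (%_. 1) 0 else 0)"
    by (intro sum.cong) (auto simp: axis_def)
  ultimately show ?thesis by (simp add: conv_def)
qed

text \<open>The change of variables formula as a pushforward identity. In this form it is stable
  under composition and makes sense for maps without a derivative, such as the flow.\<close>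

definition trans :: "(real^'d => real^'d) => (real^'d => real) => bool" where
  "trans Phi a \<longleftrightarrow> Phi : bmb & a : bmb & (ALL x. 0 <= a x) &
     distr (density lborel (%x. ennreal (a x))) borel Phi = lborel"

lemma transD:
  assumes "trans Phi a"
  shows "Phi : bmb" "a : bmb" "0 <= a x"
  using assms by (auto simp: trans_def)

lemma trans_nn:
  assumes t: "trans Phi a" and [measurable]: "f : bmb"
  shows "(NN x. f (Phi x) * ennreal (a x)) = (NN x. f x)"
proof -
  note [measurable] = transD(1,2)[OF t]
  have "(NN x. f x) = (\<integral>\<^sup>+x. f x \<partial>distr (density lborel (%x. ennreal (a x))) borel Phi)"
    using t by (simp add: trans_def)
  also have "... = (\<integral>\<^sup>+x. f (Phi x) \<partial>density lborel (%x. ennreal (a x)))"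
    by (rule nn_integral_distr) auto
  also have "... = (NN x. ennreal (a x) * f (Phi x))"
    by (rule nn_integral_density) auto
  finally show ?thesis by (simp add: mult.commute)
qed

lemma trans_integral:
  fixes f :: "real^'d => real"
  assumes t: "trans Phi a" and [measurable]: "f : bmb"
  shows "(LBINT x. f (Phi x) * a x) = (LBINT x. f x)" 
proof -
  note [measurable] = transD(1,2)[OF t]
  have "(LBINT x. f x) = (\<integral>x. f x \<partial>distr (density lborel (%x. ennreal (a x))) borel Phi)"
    using t by (simp add: trans_def)
  also have "... = (\<integral>x. f (Phi x) \<partial>density lborel (%x. ennreal (a x)))"
    by (rule integral_distr) auto
  also have "... = (LBINT x. a x * f (Phi x))"
    using transD(3)[OF t] by (subst integral_density) auto
  finally show ?thesis by (simp add: mult.commute)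
qed

lemma trans_of_nn:
  assumes [measurable]: "Phi : bmb" "a : bmb" and a: "!!x. 0 <= a x"
    and nn: "!!A. A : sets borel ==> (NN x. ind A (Phi x) * ennreal (a x)) = emeasure lborel A"
  shows "trans Phi a"
  unfolding trans_def
proof (intro conjI allI a assms(1,2) measure_eqI)
  fix A assume "A : sets (distr (density lborel (%x. ennreal (a x))) borel Phi)"
  then have A[measurable]: "A : sets borel" by simp
  have "emeasure (distr (density lborel (%x. ennreal (a x))) borel Phi) A = emeasure (density lborel (%x. ennreal (a x))) (Phi -` A)"
    by (subst emeasure_distr) auto
  also have "... = (NN x. ennreal (a x) * ind (Phi -` A) x)"
    using measurable_sets[OF assms(1) A] by (subst emeasure_density) auto
  also have "... = (NN x. ind A (Phi x) * ennreal (a x))"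
    by (intro nn_integral_cong) (auto simp: indicator_def)
  finally show "emeasure (distr (density lborel (%x. ennreal (a x))) borel Phi) A = emeasure lborel A" using nn[OF A] by simp
qed simp

lemma trans_id: "trans (%x. x) (%x. 1)"
  by (rule trans_of_nn) auto

lemma trans_comp:
  assumes t: "trans Phi a" and t': "trans Phi' a'"
  shows "trans (%x. Phi' (Phi x)) (%x. a x * a' (Phi x))"
proof (rule trans_of_nn)
  note [measurable] = transD(1,2)[OF t] transD(1,2)[OF t']
  show "(%x. Phi' (Phi x)) : bmb" "(%x. a x * a' (Phi x)) : bmb" by measurable
  show "0 <= a x * a' (Phi x)" for x using transD(3)[OF t] transD(3)[OF t'] by simp
  fix A :: "(real^'a) set" assume [measurable]: "A : sets borel"
  have "(NN x. ind A (Phi' (Phi x)) * ennreal (a x * a' (Phi x))) =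
     (NN x. (%y. ind A (Phi' y) * ennreal (a' y)) (Phi x) * ennreal (a x))"
    using transD(3)[OF t] transD(3)[OF t'] by (intro nn_integral_cong) (simp add: ennreal_mult ac_simps)
  also have "... = (NN y. ind A (Phi' y) * ennreal (a' y))" by (rule trans_nn[OF t]) measurable
  also have "... = (NN y. ind A y)" by (rule trans_nn[OF t']) measurable
  also have "... = emeasure lborel A" by simp
  finally show "(NN x. ind A (Phi' (Phi x)) * ennreal (a x * a' (Phi x))) = emeasure lborel A" .
qed

text \<open>A measure is Lebesgue measure as soon as it has the right values on open boxes, and
  bumps approximate boxes. The displacement bound \<open>R\<close> confines the integrands to a
  ball, so dominated convergence applies.\<close>

lemma trans_of_boxbump:
  fixes Phi :: "real^'d => real^'d"
  assumes [measurable]: "Phi : bmb" "a : bmb" and a: "!!x. 0 <= a x" "!!x. a x <= B"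
    and R: "AE x in lborel. norm (Phi x - x) <= R"
    and bb: "!!l u n. (!!j. l $ j < u $ j) ==> (LBINT x. boxbump l u (real n) (Phi x) * a x) = (LBINT x. boxbump l u (real n) x)"
  shows "trans Phi a"
proof -
  let ?M = "distr (density lborel (%x. ennreal (a x))) borel Phi"
  have "lborel = ?M"
  proof (rule lborel_eqI)
    fix l u :: "real^'d" assume lu: "!!b. b : Basis ==> l \<bullet> b <= u \<bullet> b"
    have e: "emeasure ?M (box l u) = (NN x. ennreal (a x * ind (box l u) (Phi x)))"
    proof -
      have "emeasure ?M (box l u) = emeasure (density lborel (%x. ennreal (a x))) (Phi -` box l u)"
        by (subst emeasure_distr) auto
      also have "... = (NN x. ennreal (a x) * ind (Phi -` box l u) x)"
        using measurable_sets[OF assms(1), of "box l u"] by (subst emeasure_density) auto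
      also have "... = (NN x. ennreal (a x * ind (box l u) (Phi x)))"
        by (intro nn_integral_cong) (auto simp: indicator_def)
      finally show ?thesis .
    qed
    show "emeasure ?M (box l u) = (\<Prod>b\<in>Basis. (u - l) \<bullet> b)"
    proof (cases "ALL j. l $ j < u $ j")
      case True
      then have lu': "!!j. l $ j < u $ j" by blast
      have [measurable]: "boxbump l u n : bmb" for n
        by (intro borel_measurable_continuous_onI test_fun_continuous boxbump_test_fun lu')
      obtain R0 where R0: "!!x. x : box l u ==> norm x <= R0" using bounded_box[of l u] unfolding bounded_iff by blast
      have dom: "integrable lborel (%x::real^'d. ind (cball 0 (R0 + R)) x * B)"
        by (intro integrable_mult_left integrable_indicator_bounded) auto
      have B0: "0 <= B" using a(1)[of 0] a(2)[of 0] by linarith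
      have near: "AE x in lborel. Phi x : box l u --> x : cball 0 (R0 + R)"
        using R
      proof eventually_elim
        case (elim x)
        show ?case
        proof
          assume "Phi x : box l u"
          then have "norm (Phi x) <= R0" by (rule R0)
          moreover have "norm x <= norm (Phi x) + norm (Phi x - x)" by (metis norm_minus_commute norm_triangle_sub add.commute)
          ultimately show "x : cball 0 (R0 + R)" using elim by simp
        qed
      qed
      have bnd: "AE x in lborel. norm (c (Phi x) * a x) <= ind (cball 0 (R0 + R)) x * B"
        if "!!x. 0 <= c x" "!!x. c x <= 1" "!!x. x ~: box l u ==> c x = 0" for c
        using near
      proof eventually_elim
        case (elim x)
        show ?case
        proof (cases "Phi x : box l u")
          case True
          have "\<bar>c (Phi x)\<bar> * \<bar>a x\<bar> <= 1 * B" using that a by (intro mult_mono) auto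
          then show ?thesis using True elim by (simp add: abs_mult)
        qed (use that(3) B0 in \<open>simp add: indicator_def\<close>)
      qed
      have l1: "(%n. \<integral>x. boxbump l u (real n) (Phi x) * a x \<partial>lborel) \<longlonglongrightarrow> (LBINT x. ind (box l u) (Phi x) * a x)"
      proof (rule integral_dominated_convergence[OF _ _ dom])
        show "AE x in lborel. (%n. boxbump l u (real n) (Phi x) * a x) \<longlonglongrightarrow> ind (box l u) (Phi x) * a x"
          by (intro AE_I2 tendsto_mult boxbump_tendsto lu' tendsto_const)
        show "AE x in lborel. norm (boxbump l u (real n) (Phi x) * a x) <= ind (cball 0 (R0 + R)) x * B" for n
          by (rule bnd) (auto simp: boxbump_range boxbump_outside[OF lu'])
      qed measurable
      have "(%n. conv (boxbump l u (real n)) (%_. 1) 0) \<longlonglongrightarrow> (LBINT p. ind (box l u) p * 1)"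
        by (rule bump_integral_tendsto[OF lloc_const lu'])
      then have l2: "(%n. \<integral>x. boxbump l u (real n) x \<partial>lborel) \<longlonglongrightarrow> measure lborel (box l u)" by (simp add: conv_def)
      have eq: "(LBINT x. ind (box l u) (Phi x) * a x) = measure lborel (box l u)"
        using LIMSEQ_unique[OF l1] l2 bb[OF lu'] by simp
      have int: "integrable lborel (%x. a x * ind (box l u) (Phi x))"
      proof (rule Bochner_Integration.integrable_bound[OF dom])
        show "AE x in lborel. norm (a x * ind (box l u) (Phi x)) <= norm (ind (cball 0 (R0 + R)) x * B)"
          using bnd[of "ind (box l u)"] B0 by (auto simp: mult.commute indicator_def elim!: eventually_mono)
      qed measurable
      have "emeasure ?M (box l u) = ennreal (LBINT x. a x * ind (box l u) (Phi x))"
        unfolding e by (rule nn_integral_eq_integral[OF int]) (use a in auto)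
      also have "... = ennreal (measure lborel (box l u))" using eq by (simp add: mult.commute)
      also have "... = (\<Prod>b\<in>Basis. (u - l) \<bullet> b)" using lu by (simp add: measure_lborel_box_eq)
      finally show ?thesis .
    next
      case False
      then obtain j where j: "u $ j <= l $ j" by (auto simp: not_less)
      then have "box l u = {}" by (metis mem_box_cart_strict equals0I less_trans not_less)
      moreover have "(\<Prod>b\<in>Basis. (u - l) \<bullet> b) = 0"
      proof (rule prod_zero)
        have b: "(axis j 1 :: real^'d) : Basis" by (auto simp: Basis_vec_def)
        have "l \<bullet> axis j 1 <= u \<bullet> axis j 1" by (rule lu[OF b])
        then have "(u - l) \<bullet> axis j 1 = 0" using j by (simp add: inner_axis)
        then show "EX b:Basis. (u - l) \<bullet> b = 0" using b by blast
      qed simp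
      ultimately show ?thesis by (simp only: emeasure_empty ennreal_0)
    qed
  qed simp
  then show ?thesis unfolding trans_def using assms(1,2) a(1) by auto
qed

text \<open>Let P_s be the shear with s w in place of w. The s-derivative of f (P_s x) (1 + s w'_j
  x) is the j-th partial derivative of f (P_s x) w x, so its space integral vanishes; integrating
  over s compares s = 1 with s = 0. The bound on w'_j keeps the density nonnegative.\<close>

lemma shear_trans:
  fixes w :: "real^'d => real" and w' :: "'d => real^'d => real"
  assumes w: "!!x. (w has_derivative (%h. SUM i:UNIV. h $ i * w' i x)) (at x)"
    and c: "!!i. continuous_on UNIV (w' i)" and B: "!!x. \<bar>w x\<bar> <= B" and q: "!!x. \<bar>w' j x\<bar> <= 1"
  shows "trans (%x. x + w x *\<^sub>R axis j 1) (%x. 1 + w' j x)"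
proof (rule trans_of_boxbump)
  have cw: "continuous_on UNIV w"
    using w has_derivative_continuous by (auto simp: continuous_on_eq_continuous_within) blast
  have B0: "0 <= B" using B[of 0] by linarith
  show "(%x. x + w x *\<^sub>R axis j 1) : bmb"
    by (intro borel_measurable_continuous_onI continuous_intros cw)
  show "(%x. 1 + w' j x) : bmb" by (intro borel_measurable_continuous_onI continuous_intros c)
  show "0 <= 1 + w' j x" "1 + w' j x <= 2" for x using q[of x] by linarith+
  show "AE x in lborel. norm (x + w x *\<^sub>R axis j 1 - x) <= B" using B by (intro AE_I2) (simp add: norm_axis_1)
  fix l u :: "real^'d" and n :: nat assume lu: "!!j. l $ j < u $ j"
  define f where "f = boxbump l u (real n)"
  have f: "test_fun f" unfolding f_def by (rule boxbump_test_fun[OF lu])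
  obtain K where K: "compact K" "!!x. x ~: K ==> f x = 0" "!!x j. x ~: K ==> dpart f j x = 0" using test_funE[OF f] by metis
  obtain R0 where R0: "!!x. x : K ==> norm x <= R0" using compact_imp_bounded[OF K(1)] unfolding bounded_iff by blast
  let ?P = "%s x. x + (s * w x) *\<^sub>R axis j 1"
  have out: "?P s x ~: K" if "s : {0..1}" "x ~: cball 0 (R0 + B)" for s x
  proof
    assume "?P s x : K"
    then have "norm (?P s x) <= R0" by (rule R0)
    moreover have "norm x <= norm (?P s x) + norm ((s * w x) *\<^sub>R axis j (1::real))"
      using norm_triangle_ineq4[of "?P s x" "(s * w x) *\<^sub>R axis j (1::real)"] by simp
    moreover have "norm ((s * w x) *\<^sub>R axis j (1::real)) <= 1 * B"
      using that(1) B[of x] by (simp add: norm_axis_1 abs_mult) (intro mult_mono[of _ 1 _ B, simplified], auto)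
    ultimately show False using that(2) by simp
  qed
  define h where "h = (%s x. f (?P s x) * w x)"
  \<comment> \<open>\<open>G\<close> is read in two ways: as the j-th partial derivative of
    \<open>h s\<close> in \<open>hG\<close>, and as the s-derivative of the transported function
    times its density in \<open>ftc\<close>.\<close>
  define G where "G = (%s x. w x * ((1 + s * w' j x) * dpart f j (?P s x)) + f (?P s x) * w' j x)"
  have Pder: "(?P s has_derivative (%v. v + (s * (SUM i:UNIV. v $ i * w' i x)) *\<^sub>R axis j 1)) (at x)" for s x
    by (intro has_derivative_add has_derivative_ident has_derivative_scaleR_left has_derivative_mult_right w)
  have hder: "(h s has_derivative (%v. f (?P s x) * (SUM i:UNIV. v $ i * w' i x) +
      (SUM i:UNIV. (v + (s * (SUM i:UNIV. v $ i * w' i x)) *\<^sub>R axis j 1) $ i * dpart f i (?P s x)) * w x)) (at x)" for s x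
    unfolding h_def by (rule has_derivative_mult[OF has_derivative_compose[OF Pder test_fun_has_derivative[OF f]] w])
  have cP: "continuous_on UNIV (?P s)" for s by (intro continuous_intros cw)
  have ax: "(SUM i:UNIV. axis m 1 $ i * g i) = g m" for m :: 'd and g :: "'d => real"
  proof -
    have "(SUM i:UNIV. axis m 1 $ i * g i) = (SUM i:UNIV. if i = m then g i else 0)" by (intro sum.cong) (auto simp: axis_def)
    then show ?thesis by simp
  qed
  have htest: "test_fun (h s)" if s: "s : {0..1}" for s
  proof (rule test_funI[OF compact_cball _ hder])
    show "h s x = 0" if "x ~: cball 0 (R0 + B)" for x using out[OF s that] K(2) by (simp add: h_def)
    show "continuous_on UNIV (%x. f (?P s x) * (SUM i:UNIV. axis m 1 $ i * w' i x) +
      (SUM i:UNIV. (axis m 1 + (s * (SUM i:UNIV. axis m 1 $ i * w' i x)) *\<^sub>R axis j 1) $ i * dpart f i (?P s x)) * w x)" for m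
    proof -
      have [continuous_intros]: "continuous_on UNIV (%x. f (?P s x))" "continuous_on UNIV (%x. dpart f i (?P s x))" for i
        by (rule continuous_on_compose2[OF test_fun_continuous[OF f] cP], simp)
           (rule continuous_on_compose2[OF test_fun_dpart_continuous[OF f] cP], simp)
      show ?thesis by (intro continuous_intros c cw)
    qed
  qed
  have hG: "dpart (h s) j x = G s x" for s x
    unfolding has_derivative_imp_dpart[OF hder] ax
    by (simp add: distrib_right sum.distrib ax G_def sum_distrib_left[symmetric] mult.assoc algebra_simps)
  have Gint0: "(LBINT x. G s x) = 0" if "s : {0..1}" for s
    using integral_dpart_zero[OF htest[OF that], of j] by (simp add: hG)
  have cG: "continuous_on UNIV (%z. G (fst z) (snd z))"
  proof -
    have a: "continuous_on UNIV (%z::real \<times> (real^'d). ?P (fst z) (snd z))"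
      by (intro continuous_intros continuous_on_compose2[OF cw]) auto
    have b: "continuous_on UNIV (%z::real \<times> (real^'d). f (?P (fst z) (snd z)))" "continuous_on UNIV (%z::real \<times> (real^'d). dpart f j (?P (fst z) (snd z)))"
      by (rule continuous_on_compose2[OF test_fun_continuous[OF f] a], simp)
         (rule continuous_on_compose2[OF test_fun_dpart_continuous[OF f] a], simp)
    have d: "continuous_on UNIV (%z::real \<times> (real^'d). w (snd z))" "continuous_on UNIV (%z::real \<times> (real^'d). w' j (snd z))"
      by (rule continuous_on_compose2[OF cw], auto intro!: continuous_intros) (rule continuous_on_compose2[OF c], auto intro!: continuous_intros)
    show ?thesis unfolding G_def by (intro continuous_intros b d)
  qed
  have Gout: "G s x = 0" if "s : {0..1}" "x ~: cball 0 (R0 + B)" for s x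
    using out[OF that] K(2,3) by (simp add: G_def)
  obtain BG where BG: "!!s x. s : {0..1} ==> \<bar>G s x\<bar> <= BG" "0 <= BG"
  proof -
    have "compact ({0..1::real} \<times> cball (0::real^'d) (R0 + B))" by (intro compact_Times compact_cball compact_Icc)
    then have "bounded ((%z. G (fst z) (snd z)) ` ({0..1} \<times> cball 0 (R0 + B)))"
      by (intro compact_imp_bounded compact_continuous_image continuous_on_subset[OF cG]) auto
    then obtain b where "ALL v:(%z. G (fst z) (snd z)) ` ({0..1} \<times> cball 0 (R0 + B)). norm v <= b"
      unfolding bounded_iff by blast
    then have b: "\<bar>G s x\<bar> <= b" if "s : {0..1}" "x : cball 0 (R0 + B)" for s x
      using that by (auto simp del: mem_cball atLeastAtMost_iff)
    have "\<bar>G s x\<bar> <= max b 0" if "s : {0..1}" for s x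
      using b[OF that, of x] Gout[OF that, of x] by (cases "x : cball 0 (R0 + B)") (auto simp del: mem_cball)
    then show thesis using that[of "max b 0"] by simp
  qed
  have [measurable]: "(%z. G (fst z) (snd z)) : borel_measurable bxb"
    unfolding borel_prod by (rule borel_measurable_continuous_onI[OF cG])
  define H where "H = (%s x. ind {0..1} s * G s x)"
  have Hm: "(%z. H (fst z) (snd z)) : borel_measurable plb"
    unfolding H_def by (subst measurable_cong_sets[OF sets_pair_measure_cong[OF sets_lborel sets_lborel] refl]) measurable
  have "integrable plb (%z. H (fst z) (snd z))"
  proof (rule Bochner_Integration.integrable_bound[where f = "%z. ind ({0..1} \<times> cball 0 (R0 + B)) z * BG"])
    show "integrable plb (%z::real \<times> (real^'d). ind ({0..1} \<times> cball 0 (R0 + B)) z * BG)"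
      unfolding lborel_prod
      by (intro integrable_mult_left integrable_indicator_bounded bounded_Times borel_closed closed_Times) auto
    show "AE z in plb. norm (H (fst z) (snd z)) <= norm (ind ({0..1} \<times> cball 0 (R0 + B)) z * BG)"
    proof (rule AE_I2)
      fix z :: "real \<times> (real^'d)"
      show "norm (H (fst z) (snd z)) <= norm (ind ({0..1} \<times> cball 0 (R0 + B)) z * BG)"
        using BG(1)[of "fst z" "snd z"] BG(2) Gout[of "fst z" "snd z"]
        by (cases z) (auto simp: H_def indicator_def simp del: mem_cball)
    qed
  qed (rule Hm)
  then have "integrable plb (case_prod H)" by (simp add: case_prod_unfold)
  from lborel_pair.Fubini_integral[OF this]
  have "(LBINT x. (LBINT s. H s x)) = (LBINT s. (LBINT x. H s x))" .
  also have "... = (\<integral>s. 0 \<partial>(lborel :: real measure))"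
    by (intro Bochner_Integration.integral_cong) (auto simp: H_def Gint0 indicator_def)
  finally have FZ: "(LBINT x. (LBINT s. H s x)) = 0" by simp
  have ftc: "(LBINT s. H s x) = f (x + w x *\<^sub>R axis j 1) * (1 + w' j x) - f x" for x
  proof -
    have D: "((%s. f (?P s x) * (1 + s * w' j x)) has_vector_derivative G s x) (at s within {0..1})" for s
    proof -
      have p: "((%s. ?P s x) has_derivative (%r. (r * w x) *\<^sub>R axis j 1)) (at s within {0..1})"
        by (auto intro!: derivative_eq_intros)
      have "((%s. f (?P s x)) has_derivative (%r. SUM i:UNIV. ((r * w x) *\<^sub>R axis j 1) $ i * dpart f i (?P s x))) (at s within {0..1})"
        by (rule has_derivative_compose[OF p test_fun_has_derivative[OF f]])
      then have "((%s. f (?P s x)) has_derivative (%r. r * (w x * dpart f j (?P s x)))) (at s within {0..1})"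
        by (simp add: mult.assoc sum_distrib_left[symmetric] ax)
      then have 1: "((%s. f (?P s x)) has_real_derivative (w x * dpart f j (?P s x))) (at s within {0..1})"
        by (simp add: has_field_derivative_def mult.commute[of _ "w x * dpart f j (?P s x)"])
      have "((%s. f (?P s x) * (1 + s * w' j x)) has_real_derivative G s x) (at s within {0..1})"
        by (rule derivative_eq_intros 1 refl)+ (simp add: G_def algebra_simps)
      then show ?thesis by (simp add: has_real_derivative_iff_has_vector_derivative)
    qed
    have "continuous_on {0..1} (%s. (s, x))" by (intro continuous_intros)
    from continuous_on_compose2[OF cG this] have cGx: "continuous_on {0..1} (%s. G s x)" by simp
    have "(LBINT s. ind {0..1} s *\<^sub>R G s x) = f (?P 1 x) * (1 + 1 * w' j x) - f (?P 0 x) * (1 + 0 * w' j x)"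
      by (rule integral_FTC_Icc[where F = "%s. f (?P s x) * (1 + s * w' j x)", OF _ D cGx]) simp
    then show ?thesis by (simp add: H_def mult.commute)
  qed
  have [measurable]: "f : bmb" "w : bmb" "w' j : bmb"
    by (auto intro!: borel_measurable_continuous_onI test_fun_continuous f cw c)
  have i1: "integrable lborel f" using conv_integrable_test[OF lloc_const[of 1] f, of 0] by simp
  have i2: "integrable lborel (%x. f (x + w x *\<^sub>R axis j 1) * (1 + w' j x))"
  proof -
    have "integrable lborel (%x. (1 + w' j x) * f (x + w x *\<^sub>R axis j 1))"
    proof (rule lloc_mult_integrable[where K = "cball 0 (R0 + B)"])
      show "lloc (%x. 1 + w' j x)" by (rule lloc_bounded) (use q in \<open>auto intro!: exI[of _ 2] abs_triangle_ineq[THEN order_trans]\<close>)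
      show "continuous_on UNIV (%x. f (x + w x *\<^sub>R axis j 1))"
        using continuous_on_compose2[OF test_fun_continuous[OF f] cP[of 1]] by simp
      show "f (x + w x *\<^sub>R axis j 1) = 0" if "x ~: cball 0 (R0 + B)" for x using out[of 1 x] that K(2) by simp
    qed simp
    then show ?thesis by (simp add: mult.commute)
  qed
  have "(LBINT x. f (x + w x *\<^sub>R axis j 1) * (1 + w' j x)) - (LBINT x. f x) = 0"
    using FZ unfolding ftc Bochner_Integration.integral_diff[OF i2 i1] .
  then show "(LBINT x. boxbump l u (real n) (x + w x *\<^sub>R axis j 1) * (1 + w' j x)) = (LBINT x. boxbump l u (real n) x)"
    by (simp add: f_def)
qed

section \<open>Mollified displacements and one round of shears\<close>

lemma conv_bound:
  fixes ze f :: "real^'d => real"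
  assumes ze: "integrable lborel ze" and [measurable]: "f : bmb" and B: "!!x. \<bar>f x\<bar> <= B"
  shows "\<bar>conv ze f x\<bar> <= B * (LBINT p. \<bar>ze p\<bar>)"
proof -
  have [measurable]: "ze : bmb" using ze by auto
  have i: "integrable lborel (%p. B * \<bar>ze (p - x)\<bar>)"
    using ze lborel_integrable_translate[of "%p. \<bar>ze p\<bar>" "- x"] by simp
  have b: "\<bar>f p * ze (p - x)\<bar> <= B * \<bar>ze (p - x)\<bar>" for p unfolding abs_mult by (intro mult_right_mono B) auto
  have i2: "integrable lborel (%p. f p * ze (p - x))"
    by (rule Bochner_Integration.integrable_bound[OF i]) (use b in \<open>auto intro!: AE_I2 order_trans[OF b abs_ge_self, simplified]\<close>)
  have "\<bar>conv ze f x\<bar> <= (LBINT p. \<bar>f p * ze (p - x)\<bar>)" unfolding conv_def by (rule integral_abs_bound)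
  also have "... <= (LBINT p. B * \<bar>ze (p - x)\<bar>)" by (rule integral_mono[OF integrable_abs[OF i2] i b])
  also have "... = B * (LBINT p. \<bar>ze p\<bar>)"
    using lborel_integral_translate[of "%p. \<bar>ze p\<bar>" "- x"] by simp
  finally show ?thesis .
qed

text \<open>The radius comes from the kernel alone, and the bound is proportional to the size of
  \<open>f\<close>. For a time integral over a step of length h this is an arbitrarily small
  multiple of h, which can be summed over all steps.\<close>

lemma conv_equicontinuous:
  fixes ze :: "real^'d => real"
  assumes ze: "continuous_on UNIV ze" "compact K" "!!x. x ~: K ==> ze x = 0" and e: "0 < e"
  shows "EX dl>0. ALL f B x y. f : bmb & (ALL x. \<bar>f x\<bar> <= B) & dist x y < dl --> \<bar>conv ze f x - conv ze f y\<bar> <= B * e"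
proof -
  obtain R where R: "!!x. x : K ==> norm x <= R" using compact_imp_bounded[OF ze(2)] unfolding bounded_iff by blast
  define V where "V = measure lborel (cball (0::real^'d) (R + 1))"
  have V: "0 <= V" by (simp add: V_def)
  have "0 < e / (V + 1)" using e V by simp
  then obtain d where d: "0 < d" "!!x y. dist x y < d ==> \<bar>ze x - ze y\<bar> < e / (V + 1)"
    using uniformly_continuous_compact_support[OF ze] by blast
  have [measurable]: "ze : bmb" by (rule borel_measurable_continuous_onI[OF ze(1)])
  have "\<bar>conv ze f x - conv ze f y\<bar> <= B * e"
    if [measurable]: "f : bmb" and B: "!!x. \<bar>f x\<bar> <= B" and xy: "dist x y < min d 1" for f B x y
  proof -
    have B0: "0 <= B" using B[of 0] by linarith
    have lf: "lloc f" by (rule lloc_bounded) (use B in auto)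
    let ?h = "%p. f p * ze (p - x) - f p * ze (p - y)"
    have ih: "integrable lborel ?h" using conv_integrable[OF lf ze] by simp
    have bd: "\<bar>?h p\<bar> <= ind (cball x (R + 1)) p * (B * (e / (V + 1)))" for p
    proof (cases "p : cball x (R + 1)")
      case True
      have "dist (p - x) (p - y) < d" using xy by (simp add: dist_norm norm_minus_commute)
      then have "\<bar>ze (p - x) - ze (p - y)\<bar> <= e / (V + 1)" using d(2) by (simp add: less_imp_le)
      then have "\<bar>f p\<bar> * \<bar>ze (p - x) - ze (p - y)\<bar> <= B * (e / (V + 1))" using B B0 by (intro mult_mono) auto
      then show ?thesis using True by (simp add: right_diff_distrib[symmetric] abs_mult)
    next
      case False
      then have "dist x p > R + 1" by simp
      moreover have "dist x p <= dist y p + dist x y" by (metis dist_triangle add.commute dist_commute)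
      ultimately have "norm (p - x) > R" "norm (p - y) > R" using xy by (auto simp: dist_norm norm_minus_commute)
      then have "p - x ~: K" "p - y ~: K" using R by force+
      then show ?thesis using False ze(3) by simp
    qed
    have ii: "integrable lborel (%p. ind (cball x (R + 1)) p * (B * (e / (V + 1))))"
      by (intro integrable_mult_left integrable_indicator_bounded) auto
    have "conv ze f x - conv ze f y = (LBINT p. ?h p)"
      unfolding conv_def using conv_integrable[OF lf ze] by simp
    also have "\<bar>...\<bar> <= (LBINT p. \<bar>?h p\<bar>)" by (rule integral_abs_bound)
    also have "... <= (LBINT p. ind (cball x (R + 1)) p * (B * (e / (V + 1))))"
      by (rule integral_mono[OF integrable_abs[OF ih] ii bd])
    also have "... = measure lborel (cball x (R + 1)) * (B * (e / (V + 1)))" by simp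
    also have "measure lborel (cball x (R + 1)) = V"
    proof -
      have "(LBINT p. ind (cball x (R + 1)) (p + x)) = (\<integral>p. ind (cball x (R + 1)) p \<partial>lborel :: real)"
        by (rule lborel_integral_translate) (intro borel_measurable_indicator, simp)
      moreover have "ind (cball x (R + 1)) (p + x) = (ind (cball 0 (R + 1)) p :: real)" for p
        by (simp add: indicator_def dist_norm)
      ultimately show ?thesis by (simp add: V_def)
    qed
    also have "V * (B * (e / (V + 1))) = B * e * (V / (V + 1))" by simp
    also have "... <= B * e * 1" using B0 e V by (intro mult_left_mono) auto
    finally show ?thesis by simp
  qed
  then show ?thesis using d(1) by (intro exI[of _ "min d 1"]) auto
qed

text \<open>Passing to absolute values and using 1 + |c j| <= exp |c j| only enlarges the terms of
  order two and higher.\<close>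

lemma prod_one_plus_bound:
  fixes c :: "'a => real"
  assumes "finite S"
  shows "\<bar>(\<Prod>j\<in>S. 1 + c j) - 1 - (SUM j:S. c j)\<bar> <= exp (SUM j:S. \<bar>c j\<bar>) - 1 - (SUM j:S. \<bar>c j\<bar>)"
  using assms
proof (induction S)
  case (insert e S)
  let ?P = "\<Prod>j\<in>S. 1 + c j" and ?T = "SUM j:S. c j" and ?A = "SUM j:S. \<bar>c j\<bar>"
  have A: "0 <= ?A" by (simp add: sum_nonneg)
  have "(1 + c e) * ?P - 1 - (c e + ?T) = (?P - 1 - ?T) * (1 + c e) + c e * ?T" by (simp add: algebra_simps)
  also have "\<bar>...\<bar> <= \<bar>?P - 1 - ?T\<bar> * \<bar>1 + c e\<bar> + \<bar>c e\<bar> * \<bar>?T\<bar>" by (metis abs_mult abs_triangle_ineq)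
  also have "... <= (exp ?A - 1 - ?A) * (1 + \<bar>c e\<bar>) + \<bar>c e\<bar> * ?A"
    using insert.IH by (intro add_mono mult_mono mult_left_mono sum_abs) auto
  also have "... = exp ?A * (1 + \<bar>c e\<bar>) - 1 - (\<bar>c e\<bar> + ?A)" by (simp add: algebra_simps)
  also have "... <= exp ?A * exp \<bar>c e\<bar> - 1 - (\<bar>c e\<bar> + ?A)"
    using exp_ge_add_one_self[of "\<bar>c e\<bar>"] by (intro diff_right_mono mult_left_mono) auto
  finally show ?case using insert.hyps by (simp add: exp_add mult.commute)
qed simp

lemma prod_one_plus_quadratic:
  fixes c :: "'a => real"
  assumes "finite S" "(SUM j:S. \<bar>c j\<bar>) <= s" "s <= 1"
  shows "\<bar>(\<Prod>j\<in>S. 1 + c j) - 1 - (SUM j:S. c j)\<bar> <= s\<^sup>2"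
proof -
  let ?A = "SUM j:S. \<bar>c j\<bar>"
  have A: "0 <= ?A" by (simp add: sum_nonneg)
  have "exp ?A <= 1 + ?A + ?A\<^sup>2" using A assms by (intro exp_bound) auto
  moreover have "?A\<^sup>2 <= s\<^sup>2" using A assms by (intro power_mono) auto
  ultimately show ?thesis using prod_one_plus_bound[OF assms(1), of c] by linarith
qed

text \<open>The coordinates are sheared in turn. When the turn of j comes, the point has already
  moved, hence the intermediate points \<open>q j\<close>; each coordinate moves at most once and by
  at most \<open>b\<close>, so these points stay within d b of the start.\<close>

lemma shear_round:
  fixes w :: "'d => real^'d => real" and w' :: "'d => 'd => real^'d => real"
  assumes w: "!!j x. (w j has_derivative (%h. SUM i:UNIV. h $ i * w' j i x)) (at x)"
    and c: "!!j i. continuous_on UNIV (w' j i)" and b: "!!j x. \<bar>w j x\<bar> <= b" and q: "!!j x. \<bar>w' j j x\<bar> <= 1"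
    and S: "finite S"
  shows "EX Phi a. trans Phi a & (ALL x. EX q. (ALL j. norm (q j - x) <= real CARD('d) * b) &
     (ALL j. Phi x $ j = x $ j + (if j : S then w j (q j) else 0)) & a x = (\<Prod>j\<in>S. 1 + w' j j (q j)))"
  using S
proof (induction S)
  case empty
  have "0 <= b" using b[of undefined 0] by linarith
  then have "EX q. (ALL j. norm (q j - x) <= real CARD('d) * b) &
     (ALL j. x $ j = x $ j + (if j : {} then w j (q j) else 0)) & (1::real) = (\<Prod>j\<in>{}. 1 + w' j j (q j))" for x
    by (intro exI[of _ "%_. x"]) auto
  then have "trans (%x. x) (%x. 1) & (ALL x. EX q. (ALL j. norm (q j - x) <= real CARD('d) * b) &
     (ALL j. x $ j = x $ j + (if j : {} then w j (q j) else 0)) & (1::real) = (\<Prod>j\<in>{}. 1 + w' j j (q j)))"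
    using trans_id by blast
  then show ?case by blast
next
  case (insert e S)
  have b0: "0 <= b" using b[of undefined 0] by linarith
  obtain Phi a where t: "trans Phi a" and P: "!!x. EX q. (ALL j. norm (q j - x) <= real CARD('d) * b) &
     (ALL j. Phi x $ j = x $ j + (if j : S then w j (q j) else 0)) & a x = (\<Prod>j\<in>S. 1 + w' j j (q j))"
    using insert.IH by blast
  have t2: "trans (%x. x + w e x *\<^sub>R axis e 1) (%x. 1 + w' e e x)"
    by (rule shear_trans[OF w c b q])
  show ?case
  proof (rule exI, rule exI, rule conjI[OF _ allI])
    show "trans (%x. Phi x + w e (Phi x) *\<^sub>R axis e 1) (%x. a x * (1 + w' e e (Phi x)))"
      by (rule trans_comp[OF t t2])
    fix x
    obtain q where q1: "!!j. norm (q j - x) <= real CARD('d) * b" and q2: "!!j. Phi x $ j = x $ j + (if j : S then w j (q j) else 0)"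
      and q3: "a x = (\<Prod>j\<in>S. 1 + w' j j (q j))" using P[of x] by blast
    have n: "norm (Phi x - x) <= real CARD('d) * b"
      by (rule norm_le_card_sup) (use q2 b b0 in auto)
    show "EX q. (ALL j. norm (q j - x) <= real CARD('d) * b) &
     (ALL j. (Phi x + w e (Phi x) *\<^sub>R axis e 1) $ j = x $ j + (if j : insert e S then w j (q j) else 0)) &
      a x * (1 + w' e e (Phi x)) = (\<Prod>j\<in>insert e S. 1 + w' j j (q j))"
    \<comment> \<open>The new shear is evaluated at the point reached by the previous ones; the
      earlier intermediate points are kept.\<close>
    proof (intro exI[of _ "q(e := Phi x)"] conjI allI)
      fix j
      show "norm ((q(e := Phi x)) j - x) <= real CARD('d) * b" using q1 n by simp
      show "(Phi x + w e (Phi x) *\<^sub>R axis e 1) $ j = x $ j + (if j : insert e S then w j ((q(e := Phi x)) j) else 0)"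
        using insert.hyps by (auto simp: q2 axis_def)
    next
      have "(\<Prod>j\<in>S. 1 + w' j j ((q(e := Phi x)) j)) = (\<Prod>j\<in>S. 1 + w' j j (q j))"
        using insert.hyps by (intro prod.cong) auto
      then show "a x * (1 + w' e e (Phi x)) = (\<Prod>j\<in>insert e S. 1 + w' j j ((q(e := Phi x)) j))"
        using insert.hyps by (simp add: q3 mult.commute)
    qed
  qed
qed

section \<open>Integrals over a time interval\<close>

definition tint :: "real => real => (real => real^'d => real) => real^'d => real" where
  "tint al be F x = (LBINT s. ind {al..be} s * F s x)"

lemma indicator_Icc_integrable: "integrable lborel (%s. ind {al..be::real} s * (c::real))"
  by (intro integrable_mult_left integrable_indicator_bounded) auto

lemma indicator_Icc_integral: "al <= be ==> (LBINT s. ind {al..be::real} s * (c::real)) = (be - al) * c"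
  by simp

lemma indicator_Icc_bounded_integrable:
  fixes g :: "real => real"
  assumes [measurable]: "g : bmb" and B: "!!s. s : {al..be} ==> \<bar>g s\<bar> <= B"
  shows "integrable lborel (%s. ind {al..be} s * g s)"
proof (rule Bochner_Integration.integrable_bound[OF indicator_Icc_integrable[of al be B]])
  show "AE s in lborel. norm (ind {al..be} s * g s) <= norm (ind {al..be} s * B)"
  proof (rule AE_I2)
    fix s show "norm (ind {al..be} s * g s) <= norm (ind {al..be} s * B)"
      using B[of s] by (auto simp: indicator_def)
  qed
qed measurable

lemma indicator_Icc_integral_bound:
  fixes g :: "real => real"
  assumes "al <= be" and B: "!!s. s : {al..be} ==> \<bar>g s\<bar> <= B"
  shows "\<bar>\<integral>s. ind {al..be} s * g s \<partial>lborel\<bar> <= (be - al) * B"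
proof (cases "integrable lborel (%s. ind {al..be} s * g s)")
  case True
  have "\<bar>\<integral>s. ind {al..be} s * g s \<partial>lborel\<bar> <= (LBINT s. \<bar>ind {al..be} s * g s\<bar>)" by (rule integral_abs_bound)
  also have "... <= (LBINT s. ind {al..be} s * B)"
    by (rule integral_mono[OF integrable_abs[OF True] indicator_Icc_integrable]) (use B in \<open>auto simp: indicator_def\<close>)
  finally show ?thesis unfolding indicator_Icc_integral[OF assms(1)] .
next
  case False
  have "0 <= B" using B[of al] assms(1) by force
  then show ?thesis using False assms(1) by (simp add: not_integrable_integral_eq)
qed

lemma tint_borel:
  fixes F :: "real => real^'d => real"
  assumes [measurable]: "(%z. F (fst z) (snd z)) : borel_measurable bxb"
  shows "tint al be F : bmb"
proof -
  have [measurable]: "(%z. F (snd z) (fst z)) : borel_measurable bxb"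
    using measurable_compose[OF measurable_pair_swap' assms] by (simp add: split_beta')
  show ?thesis unfolding tint_def[abs_def]
    by (rule lborel.borel_measurable_lebesgue_integral) (simp add: case_prod_unfold)
qed

lemma tint_fubini:
  fixes F :: "real => real^'d => real"
  assumes Fm[measurable]: "(%z. F (fst z) (snd z)) : borel_measurable bxb" and M: "!!s x. \<bar>F s x\<bar> <= M"
    and ze: "integrable lborel ze"
  shows "(LBINT x. tint al be F x * ze x) = (LBINT s. ind {al..be} s * (LBINT x. F s x * ze x))"
proof -
  have [measurable]: "ze : bmb" using ze by auto
  let ?H = "%s x. ind {al..be} s * (F s x * ze x)"
  have dom: "integrable plb (%z. (ind {al..be} (fst z) * M) * \<bar>ze (snd z)\<bar>)"
  proof (rule lborel_pair.Fubini_integrable)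
    show "(%z. (ind {al..be} (fst z) * M) * \<bar>ze (snd z)\<bar>) : borel_measurable plb" by measurable
    have "integrable lborel (%s. ind {al..be} s * (\<bar>M\<bar> * (LBINT x. \<bar>ze x\<bar>)))" by (rule indicator_Icc_integrable)
    then show "integrable lborel (%x. \<integral>y. norm ((ind {al..be} (fst (x, y)) * M) * \<bar>ze (snd (x, y))\<bar>) \<partial>lborel)"
      by (simp add: abs_mult mult.assoc)
    show "AE x in lborel. integrable lborel (%y. ind {al..be} (fst (x, y)) * M * \<bar>ze (snd (x, y))\<bar>)"
      using ze by (intro AE_I2) auto
  qed
  have "integrable plb (%z. ?H (fst z) (snd z))"
  proof (rule Bochner_Integration.integrable_bound[OF dom])
    show "(%z. ?H (fst z) (snd z)) : borel_measurable plb"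
      by (subst measurable_cong_sets[OF sets_pair_measure_cong[OF sets_lborel sets_lborel] refl]) measurable
    have M0: "0 <= M" using M[of 0 0] by linarith
    show "AE z in plb. norm (?H (fst z) (snd z)) <= norm ((ind {al..be} (fst z) * M) * \<bar>ze (snd z)\<bar>)"
    proof (rule AE_I2)
      fix z :: "real \<times> (real^'d)"
      have "\<bar>F (fst z) (snd z)\<bar> * \<bar>ze (snd z)\<bar> <= M * \<bar>ze (snd z)\<bar>" by (intro mult_right_mono M) simp
      then show "norm (?H (fst z) (snd z)) <= norm ((ind {al..be} (fst z) * M) * \<bar>ze (snd z)\<bar>)"
        using M0 by (simp add: indicator_def abs_mult)
    qed
  qed
  then have "integrable plb (case_prod ?H)" by (simp add: case_prod_unfold)
  from lborel_pair.Fubini_integral[OF this]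
  have "(LBINT x. (LBINT s. ?H s x)) = (LBINT s. (LBINT x. ?H s x))" .
  moreover have "(LBINT s. ?H s x) = tint al be F x * ze x" for x
    unfolding tint_def by (simp add: mult.assoc[symmetric])
  ultimately show ?thesis by simp
qed

lemma conv_tint:
  fixes F :: "real => real^'d => real"
  assumes Fm: "(%z. F (fst z) (snd z)) : borel_measurable bxb" and M: "!!s x. \<bar>F s x\<bar> <= M"
    and ze: "integrable lborel ze"
  shows "conv ze (tint al be F) x = (LBINT s. ind {al..be} s * conv ze (F s) x)"
proof -
  have m: "ze : bmb" using ze by auto
  have "integrable lborel (%p. ze (p - x))" using ze lborel_integrable_translate[OF m, of "- x"] by simp
  from tint_fubini[OF Fm M this] show ?thesis unfolding conv_def .
qed

section \<open>Flows of log-Lipschitz fields\<close>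

lemma conv_near:
  fixes eta f :: "real^'d => real"
  assumes i: "integrable lborel eta" and nn: "!!x. 0 <= eta x" and I: "(LBINT x. eta x) = 1" and supp: "!!x. ep <= norm x ==> eta x = 0"
    and [measurable]: "f : bmb" and B: "!!p. norm (p - q) < ep ==> \<bar>f p - c\<bar> <= B"
  shows "\<bar>conv eta f q - c\<bar> <= B"
proof -
  have [measurable]: "eta : bmb" using i by auto
  have i': "integrable lborel (%p. eta (p - q))" using i lborel_integrable_translate[of eta "- q"] by simp
  have I': "(LBINT p. eta (p - q)) = 1" using I lborel_integral_translate[of eta "- q"] by simp
  have bd: "\<bar>(f p - c) * eta (p - q)\<bar> <= B * eta (p - q)" for p
  proof (cases "norm (p - q) < ep")
    case True
    then show ?thesis unfolding abs_mult using B[OF True] nn by (simp add: mult_right_mono)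
  qed (simp add: supp)
  have id: "integrable lborel (%p. (f p - c) * eta (p - q))"
    by (rule Bochner_Integration.integrable_bound[OF integrable_mult_right[OF i', of B]])
       (auto intro!: AE_I2 order_trans[OF bd abs_ge_self, simplified])
  have "conv eta f q = (LBINT p. (f p - c) * eta (p - q) + c * eta (p - q))"
    unfolding conv_def by (intro Bochner_Integration.integral_cong) (auto simp: algebra_simps)
  also have "... = (LBINT p. (f p - c) * eta (p - q)) + c" using id i' I' by simp
  finally have "\<bar>conv eta f q - c\<bar> = \<bar>\<integral>p. (f p - c) * eta (p - q) \<partial>lborel\<bar>" by simp
  also have "... <= (LBINT p. \<bar>(f p - c) * eta (p - q)\<bar>)" by (rule integral_abs_bound)
  also have "... <= (LBINT p. B * eta (p - q))" by (rule integral_mono[OF integrable_abs[OF id] integrable_mult_right[OF i'] bd])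
  also have "... = B" using I' by simp
  finally show ?thesis .
qed

lemma conv_continuous:
  fixes ze f :: "real^'d => real"
  assumes ze: "continuous_on UNIV ze" "compact K" "!!x. x ~: K ==> ze x = 0" and f: "f : bmb" and B: "!!x. \<bar>f x\<bar> <= B"
  shows "continuous_on UNIV (conv ze f)"
  unfolding continuous_on_iff
proof (intro ballI allI impI)
  fix x :: "real^'d" and e :: real assume e: "0 < e"
  have B0: "0 <= B" using B[of 0] by linarith
  have "0 < e / (B + 1)" using e B0 by simp
  from conv_equicontinuous[OF ze this] obtain dl where d: "0 < dl"
    "!!x y. dist x y < dl ==> \<bar>conv ze f x - conv ze f y\<bar> <= B * (e / (B + 1))" using f B by blast
  have "B * (e / (B + 1)) < e" using e B0 by (simp add: field_simps)
  then show "EX d>0. ALL x':UNIV. dist x' x < d --> dist (conv ze f x') (conv ze f x) < e"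
    using d by (intro exI[of _ dl]) (force simp: dist_real_def)
qed

definition mollifier :: "real => (real^'d => real) => bool" where
  "mollifier ep eta \<longleftrightarrow> test_fun eta & (ALL x. 0 <= eta x) & (LBINT x. eta x) = 1 & (ALL x. ep <= norm x --> eta x = 0)"

lemma mollifierD:
  assumes "mollifier ep eta"
  shows "test_fun eta" "0 <= eta x" "(LBINT x. eta x) = 1" "ep <= norm x ==> eta x = 0" "integrable lborel eta" "eta : bmb"
proof -
  show t: "test_fun eta" and "0 <= eta x" "(LBINT x. eta x) = 1" "ep <= norm x ==> eta x = 0" using assms by (auto simp: mollifier_def)
  show "integrable lborel eta" using conv_integrable_test[OF lloc_const[of 1] t, of 0] by simp
  then show "eta : bmb" by auto
qed

text \<open>All data are Borel functions defined everywhere, with bounds at every point and every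
  time; only the integrated ODE is restricted to almost every starting point. Such representatives
  are constructed from the original fields at the end.\<close>

locale flow =
  fixes T M C L :: real and u :: "real => real^'d => real^'d" and D :: "real => real^'d => real" and X :: "real => real^'d => real^'d"
  assumes T: "0 <= T" and M: "0 <= M" and C: "0 <= C" and L: "0 <= L"
    and um [measurable]: "(%z. u (fst z) (snd z)) : borel_measurable bxb"
    and ub: "!!s x. norm (u s x) <= M"
    and ul: "!!s x y. norm (u s x - u s y) <= C * ll (norm (x - y))"
    and Dm [measurable]: "(%z. D (fst z) (snd z)) : borel_measurable bxb"
    and Db: "!!s x. \<bar>D s x\<bar> <= M"
    and div: "!!s. bdiv (u s) (D s)"
    and Xm [measurable]: "(%z. X (fst z) (snd z)) : borel_measurable bxb"
    and Xode: "AE y in lborel. ALL t:{0..T}. ALL j. X t y $ j = y $ j + (LBINT s. ind {0..t} s * u s (X s y) $ j)"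
    and XL: "!!t A. t : {0..T} ==> A : sets borel ==> emeasure lborel {y. X t y : A} <= ennreal L * emeasure lborel A"
begin

section \<open>Slices of the field and measurability along trajectories\<close>

lemma ubj: "\<bar>u s x $ j\<bar> <= M"
  using component_le_norm_cart[of "u s x" j] ub[of s x] by linarith

lemma ulj: "\<bar>u s x $ j - u s y $ j\<bar> <= C * ll (norm (x - y))"
  using component_le_norm_cart[of "u s x - u s y" j] ul[of s x y] by simp

lemma umj [measurable]: "(%z. u (fst z) (snd z) $ j) : borel_measurable bxb"
proof -
  have "(%v::real^'d. v $ j) : bmb" by (intro borel_measurable_continuous_onI continuous_intros)
  from measurable_compose[OF um this] show ?thesis .
qed

lemma u_slice [measurable]: "(%x. u s x $ j) : bmb"
proof -
  have "(%x. (s, x)) : borel \<rightarrow>\<^sub>M bxb" by measurable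
  from measurable_compose[OF this umj] show ?thesis by simp
qed

lemma D_slice [measurable]: "D s : bmb"
proof -
  have "(%x. (s, x)) : borel \<rightarrow>\<^sub>M bxb" by measurable
  from measurable_compose[OF this Dm] show ?thesis by simp
qed

lemma u_along [measurable]:
  assumes "y : bmb" shows "(%s. u s (y s) $ j) : bmb"
proof -
  have "(%s. (s, y s)) : borel \<rightarrow>\<^sub>M bxb" using assms by measurable
  from measurable_compose[OF this umj] show ?thesis by simp
qed

lemma D_along [measurable]:
  assumes "y : bmb" shows "(%s. D s (y s)) : bmb"
proof -
  have "(%s. (s, y s)) : borel \<rightarrow>\<^sub>M bxb" using assms by measurable
  from measurable_compose[OF this Dm] show ?thesis by simp
qed

lemma X_time [measurable]: "(%s. X s y) : bmb"
proof -
  have "(%s. (s, y)) : borel \<rightarrow>\<^sub>M bxb" by measurable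
  from measurable_compose[OF this Xm] show ?thesis by simp
qed

lemma X_space [measurable]: "X s : bmb"
proof -
  have "(%y. (s, y)) : borel \<rightarrow>\<^sub>M bxb" by measurable
  from measurable_compose[OF this Xm] show ?thesis by simp
qed

lemma u_lloc: "lloc (%x. u s x $ j)"
  by (rule lloc_bounded) (use ubj in \<open>auto intro!: exI[of _ M]\<close>)

lemma D_lloc: "lloc (D s)"
  by (rule lloc_bounded) (use Db in \<open>auto intro!: exI[of _ M]\<close>)

text \<open>The bounds used for single partial derivatives of the mollified field depend on the
  kernel; their diagonal sum is, up to sign, the mollified divergence, which a mollifier keeps below
  \<open>M\<close>.\<close>

lemma conv_div:
  assumes eta: "test_fun eta"
  shows "(SUM j:UNIV. conv (dpart eta j) (%x. u s x $ j) x) = - conv eta (D s) x"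
proof -
  have "(LBINT p. (SUM j:UNIV. u s p $ j * dpart (%p. eta (p - x)) j p)) = - (LBINT p. D s p * eta (p - x))"
    using div[of s] test_fun_shift(1)[OF eta] unfolding bdiv_def by blast
  moreover have "(LBINT p. (SUM j:UNIV. u s p $ j * dpart eta j (p - x))) = (SUM j:UNIV. \<integral>p. u s p $ j * dpart eta j (p - x) \<partial>lborel)"
    by (rule Bochner_Integration.integral_sum[OF conv_integrable_dpart[OF u_lloc eta]])
  ultimately show ?thesis by (simp add: test_fun_shift(2)[OF eta] conv_def)
qed

lemma conv_time_measurable:
  fixes F :: "real => real^'d => real"
  assumes [measurable]: "(%z. F (fst z) (snd z)) : borel_measurable bxb" "ze : bmb"
  shows "(%s. conv ze (F s) q) : bmb"
  unfolding conv_def by (rule lborel.borel_measurable_lebesgue_integral) (simp add: case_prod_unfold)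

text \<open>One step of the scheme: integrate \<open>u\<close> over the step, mollify, and apply one
  round of shears. The displacement is compared with that of any path \<open>y\<close> within r of
  x. Of the 2 ep, one is the mollification radius and one the distance to the intermediate
  points.\<close>

lemma euler_round:
  assumes eta: "mollifier ep eta" and ep: "0 < ep" and rh: "0 < rh"
  shows "EX h0>0. ALL al be. al <= be & be - al <= h0 --> (EX Phi a. trans Phi a &
     (ALL x. \<bar>a x - 1 - (LBINT s. ind {al..be} s * conv eta (D s) x)\<bar> <= rh * (be - al)) &
     (ALL x y r. y : bmb & (ALL s:{al..be}. norm (y s - x) <= r) -->
        (ALL j. \<bar>Phi x $ j - x $ j - (LBINT s. ind {al..be} s * u s (y s) $ j)\<bar> <= (be - al) * (C * ll (2 * ep + r)))))"
proof -
  note etaD = mollifierD[OF eta]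
  let ?d = "real CARD('d)"
  obtain K where K: "compact K" "!!x. x ~: K ==> eta x = 0" "!!x j. x ~: K ==> dpart eta j x = 0" using test_funE[OF etaD(1)] by metis
  have idp: "integrable lborel (dpart eta j)" for j using conv_integrable_dpart[OF lloc_const[of 1] etaD(1), of j 0] by simp
  \<comment> \<open>An L^1 bound for the partial derivatives of the kernel. It depends on
    \<open>eta\<close>, which is why the step size is chosen after the mollifier.\<close>
  define N where "N = (SUM i:UNIV. \<integral>p. \<bar>dpart eta i p\<bar> \<partial>lborel)"
  have Nj: "(LBINT p. \<bar>dpart eta i p\<bar>) <= N" for i
    unfolding N_def by (rule member_le_sum) (auto intro!: integral_nonneg_AE)
  have N0: "0 <= N" unfolding N_def by (intro sum_nonneg integral_nonneg_AE) auto
  \<comment> \<open>The \<open>?d\<close> diagonal derivatives change by at most M h e each between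
    x and the intermediate points; this \<open>e\<close> makes the total at most rh h / 2.\<close>
  define e where "e = rh / (2 * (?d * M + 1))"
  have dM: "0 <= ?d * M" using M by simp
  have e: "0 < e" using rh dM by (simp add: e_def)
  have "ALL j. EX dl>0. ALL f B x y. f : bmb & (ALL x. \<bar>f x\<bar> <= B) & dist x y < dl --> \<bar>conv (dpart eta j) f x - conv (dpart eta j) f y\<bar> <= B * e"
    using conv_equicontinuous[OF test_fun_dpart_continuous[OF etaD(1)] K(1) K(3) e] by blast
  then obtain dl where dl: "!!j. 0 < dl j" "!!j f B x y. f : bmb ==> (!!x. \<bar>f x\<bar> <= B) ==> dist x y < dl j ==> \<bar>conv (dpart eta j) f x - conv (dpart eta j) f y\<bar> <= B * e"
    by metis
  define dl0 where "dl0 = Min (range dl)"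
  have dl0: "0 < dl0" "!!j. dl0 <= dl j" using dl(1) by (auto simp: dl0_def)
  \<comment> \<open>The four bounds place the intermediate points within \<open>ep\<close>, place
    them within the equicontinuity radius \<open>dl0\<close> (strictly, thanks to the 2), make the
    expansion of the product valid, and make its quadratic error at most rh h / 2.\<close>
  define h0 where "h0 = Min {ep / (?d * M + 1), dl0 / (2 * (?d * M + 1)), 1 / (?d * M * N + 1), rh / (2 * ((?d * M * N)\<^sup>2 + 1))}"
  have dMN: "0 <= ?d * M * N" using M N0 by simp
  have h0: "0 < h0" using ep rh dl0(1) dM dMN by (auto simp: h0_def intro!: divide_pos_pos add_nonneg_pos mult_pos_pos)
  show ?thesis
  proof (intro exI[of _ h0] conjI allI impI h0)
    fix al be :: real assume ab: "al <= be & be - al <= h0"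
    define h where "h = be - al"
    have h: "0 <= h" "h <= h0" using ab by (auto simp: h_def)
    have hle: "h <= ep / (?d * M + 1)" "h <= dl0 / (2 * (?d * M + 1))" "h <= 1 / (?d * M * N + 1)" "h <= rh / (2 * ((?d * M * N)\<^sup>2 + 1))"
      using h(2) by (auto simp: h0_def)
    have mul: "x * h <= c" if "h <= c / (x + 1)" "0 <= x" "0 <= c" for x c
    proof -
      have "x * h <= x * (c / (x + 1))" using that by (intro mult_left_mono) auto
      also have "... <= c" using that by (simp add: field_simps)
      finally show ?thesis .
    qed
    have h1: "?d * (M * h) <= ep" using mul[OF hle(1) dM] ep by (simp add: mult.assoc)
    have h2: "?d * (M * h) < dl0"
    proof -
      have "?d * M * h <= dl0 / 2" using mul[of "dl0/2" "?d * M"] hle(2) dM dl0 by (simp add: mult.commute)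
      then show ?thesis using dl0(1) by (simp add: mult.assoc)
    qed
    have h3: "?d * (M * h * N) <= 1" using mul[OF hle(3) dMN] by (simp add: mult.assoc mult.commute mult.left_commute)
    have h4: "(?d * M * N)\<^sup>2 * h <= rh / 2" using mul[of "rh/2" "(?d * M * N)\<^sup>2"] hle(4) rh by (simp add: mult.commute)
    define f where "f = (%j. tint al be (%s x. u s x $ j))"
    have fm [measurable]: "f j : bmb" for j unfolding f_def by (rule tint_borel[OF umj])
    have fb: "\<bar>f j x\<bar> <= M * h" for j x
      using indicator_Icc_integral_bound[of al be "%s. u s x $ j" M] ab ubj by (simp add: f_def tint_def h_def mult.commute)
    have Mh: "0 <= M * h" using M h by simp
    have fl: "lloc (f j)" for j by (rule lloc_bounded[OF fm]) (use fb in \<open>auto intro!: exI[of _ "M * h"]\<close>)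
    define w where "w = (%j. conv eta (f j))"
    define w' where "w' = (%j i x. - conv (dpart eta i) (f j) x)"
    have w'b: "\<bar>w' j i x\<bar> <= M * h * N" for j i x
    proof -
      have "\<bar>w' j i x\<bar> <= M * h * (LBINT p. \<bar>dpart eta i p\<bar>)" using conv_bound[OF idp fm fb] by (simp add: w'_def)
      also have "... <= M * h * N" by (intro mult_left_mono Nj Mh)
      finally show ?thesis .
    qed
    have "EX Phi a. trans Phi a & (ALL x. EX q. (ALL j. norm (q j - x) <= ?d * (M * h)) &
       (ALL j. Phi x $ j = x $ j + (if j : UNIV then w j (q j) else 0)) & a x = (\<Prod>j\<in>UNIV. 1 + w' j j (q j)))"
    proof (rule shear_round[where w = w and w' = w' and b = "M * h" and S = UNIV])
      show "(w j has_derivative (%h. SUM i:UNIV. h $ i * w' j i x)) (at x)" for j x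
        using conv_has_derivative[OF fl etaD(1), of j x] by (simp add: w_def w'_def sum_negf)
      show "continuous_on UNIV (w' j i)" for j i unfolding w'_def
        by (intro continuous_on_minus conv_continuous[OF test_fun_dpart_continuous[OF etaD(1)] K(1) K(3) fm fb])
      show "\<bar>w j x\<bar> <= M * h" for j x
        using conv_bound[OF etaD(5) fm fb, of j x] etaD(2,3) by (simp add: w_def)
      show "\<bar>w' j j x\<bar> <= 1" for j x
      proof -
        have "1 * (M * h * N) <= ?d * (M * h * N)" using Mh N0 by (intro mult_right_mono) (auto simp: Suc_leI)
        then show ?thesis using w'b[of j j x] h3 by linarith
      qed
    qed simp
    then obtain Phi a where t: "trans Phi a" and P: "!!x. EX q. (ALL j. norm (q j - x) <= ?d * (M * h)) &
       (ALL j. Phi x $ j = x $ j + w j (q j)) & a x = (\<Prod>j\<in>UNIV. 1 + w' j j (q j))" by auto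
    have divx: "(SUM j:UNIV. w' j j x) = (LBINT s. ind {al..be} s * conv eta (D s) x)" for x
    proof -
      have i: "integrable lborel (%s. ind {al..be} s * conv (dpart eta j) (%x. u s x $ j) x)" for j
        by (rule indicator_Icc_bounded_integrable[where B = "M * (LBINT p. \<bar>dpart eta j p\<bar>)"])
           (use idp[of j] in \<open>auto intro!: conv_time_measurable umj conv_bound ubj\<close>)
      have "(SUM j:UNIV. w' j j x) = (SUM j:UNIV. - (LBINT s. ind {al..be} s * conv (dpart eta j) (%x. u s x $ j) x))"
        unfolding w'_def f_def by (intro sum.cong refl arg_cong[where f = uminus] conv_tint[OF umj ubj idp])
      also have "... = - (LBINT s. (SUM j:UNIV. ind {al..be} s * conv (dpart eta j) (%x. u s x $ j) x))"
        by (subst Bochner_Integration.integral_sum[OF i]) (simp add: sum_negf)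
      also have "... = (LBINT s. ind {al..be} s * conv eta (D s) x)"
        by (simp add: sum_distrib_left[symmetric] conv_div[OF etaD(1)])
      finally show ?thesis .
    qed
    show "EX Phi a. trans Phi a &
     (ALL x. \<bar>a x - 1 - (LBINT s. ind {al..be} s * conv eta (D s) x)\<bar> <= rh * (be - al)) &
     (ALL x y r. y : bmb & (ALL s:{al..be}. norm (y s - x) <= r) -->
        (ALL j. \<bar>Phi x $ j - x $ j - (LBINT s. ind {al..be} s * u s (y s) $ j)\<bar> <= (be - al) * (C * ll (2 * ep + r))))"
    proof (intro exI[of _ Phi] exI[of _ a] conjI allI impI t)
      fix x
      obtain q where q1: "!!j. norm (q j - x) <= ?d * (M * h)" and q3: "a x = (\<Prod>j\<in>UNIV. 1 + w' j j (q j))" using P[of x] by blast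
      have "(SUM j:UNIV. \<bar>w' j j (q j)\<bar>) <= (SUM j:(UNIV::'d set). M * h * N)" by (intro sum_mono w'b)
      then have s1: "(SUM j:UNIV. \<bar>w' j j (q j)\<bar>) <= ?d * (M * h * N)" by simp
      have a1: "\<bar>a x - 1 - (SUM j:UNIV. w' j j (q j))\<bar> <= (?d * (M * h * N))\<^sup>2"
        unfolding q3 by (rule prod_one_plus_quadratic[OF _ s1 h3]) simp
      have "\<bar>(SUM j:UNIV. w' j j (q j)) - (SUM j:UNIV. w' j j x)\<bar> <= (SUM j:UNIV. \<bar>w' j j (q j) - w' j j x\<bar>)"
        unfolding sum_subtractf[symmetric] by (rule sum_abs)
      also have "... <= (SUM j:(UNIV::'d set). M * h * e)"
      proof (rule sum_mono)
        fix j
        have "dist x (q j) < dl j" using q1[of j] h2 dl0(2)[of j] by (simp add: dist_norm norm_minus_commute)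
        from dl(2)[OF fm fb this, of j] show "\<bar>w' j j (q j) - w' j j x\<bar> <= M * h * e" by (simp add: w'_def)
      qed
      finally have a2: "\<bar>(SUM j:UNIV. w' j j (q j)) - (SUM j:UNIV. w' j j x)\<bar> <= ?d * (M * h * e)" by simp
      have "(?d * (M * h * N))\<^sup>2 = (?d * M * N)\<^sup>2 * h * h" by (simp add: power2_eq_square algebra_simps)
      also have "... <= rh / 2 * h" using h4 h by (intro mult_right_mono) auto
      finally have a3: "(?d * (M * h * N))\<^sup>2 <= rh / 2 * h" .
      have "?d * (M * h * e) = (?d * M * e) * h" by (simp add: algebra_simps)
      also have "... <= rh / 2 * h"
      proof -
        have "?d * M * e <= (?d * M + 1) * e" using e by (intro mult_right_mono) auto
        also have "... = rh / 2"
        proof -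
          have "y * (rh / (2 * y)) = rh / 2" if "0 < y" for y using that by simp
          from this[of "?d * M + 1"] show ?thesis unfolding e_def using dM by simp
        qed
        finally show ?thesis using h by (intro mult_right_mono) auto
      qed
      finally have a4: "?d * (M * h * e) <= rh / 2 * h" .
      show "\<bar>a x - 1 - (LBINT s. ind {al..be} s * conv eta (D s) x)\<bar> <= rh * (be - al)"
        using a1 a2 a3 a4 unfolding divx h_def by linarith
    next
      fix x :: "real^'d" and y r j assume yr: "y : bmb & (ALL s:{al..be}. norm (y s - x) <= r)"
      then have [measurable]: "y : bmb" by simp
      obtain q where q1: "!!j. norm (q j - x) <= ?d * (M * h)" and q2: "!!j. Phi x $ j = x $ j + w j (q j)" using P[of x] by blast
      have 1: "Phi x $ j - x $ j = (LBINT s. ind {al..be} s * conv eta (%x. u s x $ j) (q j))"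
        using q2[of j] conv_tint[OF umj ubj etaD(5), of al be j "q j"] by (simp add: w_def f_def)
      have i1: "integrable lborel (%s. ind {al..be} s * conv eta (%x. u s x $ j) (q j))"
        by (rule indicator_Icc_bounded_integrable[where B = "M * (LBINT p. \<bar>eta p\<bar>)"])
           (auto intro!: conv_time_measurable umj conv_bound ubj etaD(5,6))
      have i2: "integrable lborel (%s. ind {al..be} s * u s (y s) $ j)"
        by (rule indicator_Icc_bounded_integrable[where B = M]) (auto intro!: u_along ubj)
      have "Phi x $ j - x $ j - (LBINT s. ind {al..be} s * u s (y s) $ j) =
         (LBINT s. ind {al..be} s * (conv eta (%x. u s x $ j) (q j) - u s (y s) $ j))"
        unfolding 1 right_diff_distrib by (rule Bochner_Integration.integral_diff[OF i1 i2, symmetric])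
      also have "\<bar>...\<bar> <= (be - al) * (C * ll (2 * ep + r))"
      proof (rule indicator_Icc_integral_bound)
        fix s assume s: "s : {al..be}"
        show "\<bar>conv eta (%x. u s x $ j) (q j) - u s (y s) $ j\<bar> <= C * ll (2 * ep + r)"
        proof (rule conv_near[OF etaD(5,2,3,4) u_slice])
          fix p assume p: "norm (p - q j) < ep"
          have "norm (p - y s) <= norm (p - q j) + norm (q j - x) + norm (x - y s)"
            using norm_triangle_ineq[of "p - q j" "q j - x"] norm_triangle_ineq[of "p - x" "x - y s"] by simp
          also have "... <= ep + ep + r" using p q1[of j] h1 yr s by (intro add_mono) (auto simp: norm_minus_commute)
          finally have "ll (norm (p - y s)) <= ll (2 * ep + r)" by (intro ll_mono) auto
          then have "C * ll (norm (p - y s)) <= C * ll (2 * ep + r)" using C by (rule mult_left_mono)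
          then show "\<bar>u s p $ j - u s (y s) $ j\<bar> <= C * ll (2 * ep + r)" using ulj[of s p j "y s"] by linarith
        qed
      qed (use ab in auto)
      finally show "\<bar>Phi x $ j - x $ j - (LBINT s. ind {al..be} s * u s (y s) $ j)\<bar> <= (be - al) * (C * ll (2 * ep + r))" .
    qed
  qed
qed

definition good :: "real^'d => bool" where
  "good y \<longleftrightarrow> (ALL t:{0..T}. ALL j. X t y $ j = y $ j + (LBINT s. ind {0..t} s * u s (X s y) $ j))"

lemma AE_good: "AE y in lborel. good y"
  using Xode by (simp add: good_def)

lemma u_X_integrable: "integrable lborel (%s. ind {a..b} s * u s (X s y) $ j)"
  by (rule indicator_Icc_bounded_integrable[where B = M]) (auto intro!: u_along ubj)

lemma X_increment:
  assumes y: "good y" and ab: "0 <= a" "a <= b" "b <= T"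
  shows "X b y $ j - X a y $ j = (LBINT s. ind {a..b} s * u s (X s y) $ j)"
proof -
  let ?f = "%s. u s (X s y) $ j"
  have "X b y $ j - X a y $ j = (LBINT s. ind {0..b} s * ?f s) - (LBINT s. ind {0..a} s * ?f s)"
    using y ab by (simp add: good_def)
  also have "... = (LBINT s. ind {0..b} s * ?f s - ind {0..a} s * ?f s)"
    by (rule Bochner_Integration.integral_diff[OF u_X_integrable u_X_integrable, symmetric])
  also have "... = (LBINT s. ind {a..b} s * ?f s)"
  proof (rule integral_cong_AE)
    have [measurable]: "?f : bmb" by (rule u_along[OF X_time])
    show "(%s. ind {0..b} s * ?f s - ind {0..a} s * ?f s) : borel_measurable lborel" by measurable
    show "(%s. ind {a..b} s * ?f s) : borel_measurable lborel" by measurable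
    show "AE s in lborel. ind {0..b} s * ?f s - ind {0..a} s * ?f s = ind {a..b} s * ?f s"
      using AE_lborel_singleton[of a] by eventually_elim (use ab in \<open>auto simp: indicator_def\<close>)
  qed
  finally show ?thesis .
qed

lemma X_lip:
  assumes y: "good y" and ab: "0 <= a" "a <= b" "b <= T"
  shows "norm (X b y - X a y) <= real CARD('d) * (M * (b - a))"
proof (rule norm_le_card_sup)
  fix j
  have "\<bar>\<integral>s. ind {a..b} s * u s (X s y) $ j \<partial>lborel\<bar> <= (b - a) * M"
    by (rule indicator_Icc_integral_bound) (use ab ubj in auto)
  then show "\<bar>(X b y - X a y) $ j\<bar> <= M * (b - a)" using X_increment[OF y ab, of j] by (simp add: mult.commute)
qed

lemma X_0:
  assumes "good y" shows "X 0 y = y"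
proof -
  have "X 0 y $ j = y $ j" for j
  proof -
    have "(LBINT s. ind {0..0} s * u s (X s y) $ j) = (\<integral>s. 0 \<partial>(lborel :: real measure))"
    proof (rule integral_cong_AE)
      have [measurable]: "(%s. u s (X s y) $ j) : bmb" by (rule u_along[OF X_time])
      show "(%s. ind {0..0} s * u s (X s y) $ j) : borel_measurable lborel" by measurable
      show "AE s in lborel. ind {0..0} s * u s (X s y) $ j = 0"
        using AE_lborel_singleton[of 0] by eventually_elim auto
    qed simp
    then show ?thesis using assms T by (simp add: good_def)
  qed
  then show ?thesis by (simp add: vec_eq_iff)
qed

text \<open>The distance to the exact trajectory, increased by 3 ep, satisfies the recursion of the
  discrete Osgood estimate and so stays below \<open>kp\<close>. The threshold \<open>ep0\<close> is
  fixed before the kernel, the density tolerance and the mesh, all of which can be chosen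
  afterwards.\<close>

lemma euler:
  assumes kp: "0 < kp"
  shows "EX ep0>0. ALL ep eta rh t h1. 0 < ep & ep <= ep0 & mollifier ep eta & 0 < rh & t : {0..T} & 0 < h1 -->
    (EX n Psi A. 0 < n & t / real n <= h1 & (ALL k<=n. trans (Psi k) (A k)) & (ALL y. Psi 0 y = y) & (ALL y. A 0 y = 1) &
      (ALL k<n. ALL y. EX r. A (Suc k) y = A k y * r &
         \<bar>r - 1 - (LBINT s. ind {real k * (t / real n)..real (Suc k) * (t / real n)} s * conv eta (D s) (Psi k y))\<bar> <= rh * (t / real n)) &
      (ALL y. good y --> (ALL k<=n. norm (Psi k y - X (real k * (t / real n)) y) <= kp)))"
proof -
  let ?d = "real CARD('d)"
  obtain e0 where e0: "0 < e0" "!!e x. 0 < e ==> e <= e0 ==> 0 < x ==> osgood e - ?d * C * T <= osgood x ==> x < kp"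
    using osgood_small[OF kp, of "?d * C * T"] by blast
  show ?thesis
  proof (intro exI[of _ "e0 / 3"] conjI allI impI)
    show "0 < e0 / 3" using e0 by simp
    fix ep rh t h1 :: real and eta :: "real^'d => real" assume "0 < ep & ep <= e0 / 3 & mollifier ep eta & 0 < rh & t : {0..T} & 0 < h1"
    then have ep: "0 < ep" "ep <= e0 / 3" and eta: "mollifier ep eta" and rh: "0 < rh" and t: "t : {0..T}" and h1: "0 < h1" by auto
    obtain h0 where h0: "0 < h0" "!!al be. al <= be & be - al <= h0 ==> (EX Phi a. trans Phi a &
     (ALL x. \<bar>a x - 1 - (LBINT s. ind {al..be} s * conv eta (D s) x)\<bar> <= rh * (be - al)) &
     (ALL x y r. y : bmb & (ALL s:{al..be}. norm (y s - x) <= r) -->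
        (ALL j. \<bar>Phi x $ j - x $ j - (LBINT s. ind {al..be} s * u s (y s) $ j)\<bar> <= (be - al) * (C * ll (2 * ep + r)))))"
      using euler_round[OF eta ep(1) rh] by blast
    define h2 where "h2 = Min {h0, h1, ep / (?d * M + 1)}"
    have dM: "0 <= ?d * M" using M by simp
    have h2: "0 < h2" using h0(1) h1 ep(1) dM by (simp add: h2_def)
    obtain n0 :: nat where n0: "t / h2 < real n0" using reals_Archimedean2 by blast
    define n where "n = Suc n0"
    define h where "h = t / real n"
    have n: "0 < n" by (simp add: n_def)
    have t0: "0 <= t" "t <= T" using t by auto
    have hnn: "0 <= h" using t0 by (simp add: h_def)
    have hh: "h <= h2"
    proof -
      have "t / h2 <= real n" using n0 by (simp add: n_def)
      then have "t <= real n * h2" using h2 by (simp add: divide_le_eq)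
      then show ?thesis using n by (simp add: h_def divide_le_eq mult.commute)
    qed
    then have hle: "h <= h0" "h <= h1" "h <= ep / (?d * M + 1)" by (auto simp: h2_def)
    have dMh: "?d * (M * h) <= ep"
    proof -
      have "(?d * M) * h <= (?d * M) * (ep / (?d * M + 1))" using hle(3) dM by (rule mult_left_mono)
      also have "... <= ep" using dM ep(1) by (simp add: field_simps)
      finally show ?thesis by (simp add: mult.assoc)
    qed
    have "ALL k. EX Phi a. trans Phi a &
     (ALL x. \<bar>a x - 1 - (LBINT s. ind {real k * h..real (Suc k) * h} s * conv eta (D s) x)\<bar> <= rh * h) &
     (ALL x y r. y : bmb & (ALL s:{real k * h..real (Suc k) * h}. norm (y s - x) <= r) -->
        (ALL j. \<bar>Phi x $ j - x $ j - (LBINT s. ind {real k * h..real (Suc k) * h} s * u s (y s) $ j)\<bar> <= h * (C * ll (2 * ep + r))))"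
    proof
      fix k :: nat
      have e: "real (Suc k) * h - real k * h = h" by (simp add: algebra_simps)
      have "real k * h <= real (Suc k) * h & real (Suc k) * h - real k * h <= h0" using hnn hle(1) unfolding e by (simp add: mult_right_mono)
      from h0(2)[OF this] show "EX Phi a. trans Phi a &
     (ALL x. \<bar>a x - 1 - (LBINT s. ind {real k * h..real (Suc k) * h} s * conv eta (D s) x)\<bar> <= rh * h) &
     (ALL x y r. y : bmb & (ALL s:{real k * h..real (Suc k) * h}. norm (y s - x) <= r) -->
        (ALL j. \<bar>Phi x $ j - x $ j - (LBINT s. ind {real k * h..real (Suc k) * h} s * u s (y s) $ j)\<bar> <= h * (C * ll (2 * ep + r))))"
        unfolding e .
    qed
    from choice[OF this] obtain Phi where "ALL k. EX a. trans (Phi k) a &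
     (ALL x. \<bar>a x - 1 - (LBINT s. ind {real k * h..real (Suc k) * h} s * conv eta (D s) x)\<bar> <= rh * h) &
     (ALL x y r. y : bmb & (ALL s:{real k * h..real (Suc k) * h}. norm (y s - x) <= r) -->
        (ALL j. \<bar>Phi k x $ j - x $ j - (LBINT s. ind {real k * h..real (Suc k) * h} s * u s (y s) $ j)\<bar> <= h * (C * ll (2 * ep + r))))" ..
    from choice[OF this] obtain a where ta: "!!k. trans (Phi k) (a k)"
      and aa: "!!k x. \<bar>a k x - 1 - (LBINT s. ind {real k * h..real (Suc k) * h} s * conv eta (D s) x)\<bar> <= rh * h"
      and Phia: "!!k x y r j. y : bmb ==> (!!s. s : {real k * h..real (Suc k) * h} ==> norm (y s - x) <= r) ==>
         \<bar>Phi k x $ j - x $ j - (LBINT s. ind {real k * h..real (Suc k) * h} s * u s (y s) $ j)\<bar> <= h * (C * ll (2 * ep + r))"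
      by blast
    define Psi where "Psi = rec_nat (%y. y) (%k f y. Phi k (f y))"
    have Psi0: "Psi 0 y = y" and PsiS: "Psi (Suc k) y = Phi k (Psi k y)" for k y by (auto simp: Psi_def)
    define A where "A = rec_nat (%y. 1) (%k g y. g y * a k (Psi k y))"
    have A0: "A 0 y = 1" and AS: "A (Suc k) y = A k y * a k (Psi k y)" for k y by (auto simp: A_def)
    have tr: "trans (Psi k) (A k)" for k
    proof (induction k)
      case 0
      have "Psi 0 = (%y. y)" "A 0 = (%y. 1)" using Psi0 A0 by auto
      then show ?case using trans_id by simp
    next
      case (Suc k)
      have "Psi (Suc k) = (%y. Phi k (Psi k y))" "A (Suc k) = (%y. A k y * a k (Psi k y))" using PsiS AS by auto
      then show ?case using trans_comp[OF Suc ta[of k]] by simp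
    qed
    have conv: "norm (Psi k y - X (real k * h) y) <= kp" if y: "good y" and k: "k <= n" for k y
    proof -
      \<comment> \<open>Two of the three \<open>ep\<close> are the error of a round of shears, the
        third is the distance travelled by the trajectory within one step. They also keep
        \<open>g\<close> positive at k = 0, where the distance vanishes.\<close>
      define g where "g = (%k. norm (Psi k y - X (real k * h) y) + 3 * ep)"
      have gpos: "0 < g k" for k using ep(1) by (simp add: g_def add_nonneg_pos)
      have g0: "g 0 = 3 * ep" using X_0[OF y] by (simp add: g_def Psi0)
      have kT: "real k * h <= T" if "k <= n" for k
      proof -
        have "real k * h <= real n * h" using that hnn by (intro mult_right_mono) auto
        then show ?thesis using n t0 by (simp add: h_def)
      qed
      have step: "g (Suc k) <= g k + h * (?d * C) * ll (g k)" if k: "k < n" for k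
      proof -
        let ?s0 = "real k * h" and ?s1 = "real (Suc k) * h"
        have s01: "0 <= ?s0" "?s0 <= ?s1" "?s1 <= T" using hnn kT[of "Suc k"] k by (auto intro: mult_right_mono)
        have e: "?s1 - ?s0 = h" by (simp add: algebra_simps)
        have near: "norm (X s y - Psi k y) <= norm (Psi k y - X ?s0 y) + ep" if s: "s : {?s0..?s1}" for s
        proof -
          have "norm (X s y - X ?s0 y) <= ?d * (M * (s - ?s0))" using s s01 by (intro X_lip[OF y]) auto
          also have "... <= ?d * (M * h)" using s e M by (intro mult_left_mono) auto
          finally have "norm (X s y - X ?s0 y) <= ep" using dMh by simp
          then show ?thesis using norm_triangle_ineq[of "X s y - X ?s0 y" "X ?s0 y - Psi k y"] by (simp add: norm_minus_commute)
        qed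
        have "norm ((Psi (Suc k) y - X ?s1 y) - (Psi k y - X ?s0 y)) <= ?d * (h * (C * ll (2 * ep + (norm (Psi k y - X ?s0 y) + ep))))"
        proof (rule norm_le_card_sup)
          fix j
          have "\<bar>Phi k (Psi k y) $ j - Psi k y $ j - (X ?s1 y $ j - X ?s0 y $ j)\<bar> <= h * (C * ll (2 * ep + (norm (Psi k y - X ?s0 y) + ep)))"
            unfolding X_increment[OF y s01] by (rule Phia[OF X_time near])
          then show "\<bar>((Psi (Suc k) y - X ?s1 y) - (Psi k y - X ?s0 y)) $ j\<bar> <= h * (C * ll (2 * ep + (norm (Psi k y - X ?s0 y) + ep)))"
            by (simp add: PsiS algebra_simps)
        qed
        moreover have "2 * ep + (norm (Psi k y - X ?s0 y) + ep) = g k" by (simp add: g_def)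
        ultimately have "norm ((Psi (Suc k) y - X ?s1 y) - (Psi k y - X ?s0 y)) <= h * (?d * C) * ll (g k)"
          by (simp add: mult.commute mult.left_commute)
        then show ?thesis using norm_triangle_sub[of "Psi (Suc k) y - X ?s1 y" "Psi k y - X ?s0 y"] by (simp add: g_def)
      qed
      have "osgood (g 0) - (?d * C) * (h * real k) <= osgood (g k)"
        by (rule osgood_discrete[where g = g and n = n and h = h and C = "?d * C"]) (use C hnn gpos step k in auto)
      moreover have "(?d * C) * (h * real k) <= ?d * C * T" using kT[OF k] C by (intro mult_left_mono) (auto simp: mult.commute)
      ultimately have "osgood (3 * ep) - ?d * C * T <= osgood (g k)" unfolding g0 by linarith
      then have "g k < kp" using ep by (intro e0(2)[of "3 * ep"] gpos) auto
      then show ?thesis using ep(1) by (simp add: g_def)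
    qed
    show "EX n Psi A. 0 < n & t / real n <= h1 & (ALL k<=n. trans (Psi k) (A k)) & (ALL y. Psi 0 y = y) & (ALL y. A 0 y = 1) &
      (ALL k<n. ALL y. EX r. A (Suc k) y = A k y * r &
         \<bar>r - 1 - (LBINT s. ind {real k * (t / real n)..real (Suc k) * (t / real n)} s * conv eta (D s) (Psi k y))\<bar> <= rh * (t / real n)) &
      (ALL y. good y --> (ALL k<=n. norm (Psi k y - X (real k * (t / real n)) y) <= kp))"
    proof (rule exI[of _ n], rule exI[of _ Psi], rule exI[of _ A], unfold h_def[symmetric], intro conjI allI impI)
      fix k y
      show "EX r. A (Suc k) y = A k y * r & \<bar>r - 1 - (LBINT s. ind {real k * h..real (Suc k) * h} s * conv eta (D s) (Psi k y))\<bar> <= rh * h"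
        using AS aa by (intro exI[of _ "a k (Psi k y)"]) auto
    qed (use n tr Psi0 A0 hle conv in auto)
  qed
qed

end

section \<open>Products of densities over the steps\<close>

lemma exp_quadratic:
  fixes x :: real assumes "\<bar>x\<bar> <= 1" shows "\<bar>exp x - 1 - x\<bar> <= x\<^sup>2"
proof (cases "0 <= x")
  case True
  have "exp x <= 1 + x + x\<^sup>2" using True assms by (intro exp_bound) auto
  then show ?thesis using exp_ge_add_one_self[of x] zero_le_power2[of x] by linarith
next
  case False
  have "1 - x <= exp (- x)" using exp_ge_add_one_self[of "- x"] by simp
  then have "exp x <= 1 / (1 - x)" using False by (simp add: exp_minus field_simps)
  moreover have "1 / (1 - x) <= 1 + x + x\<^sup>2"
  proof -
    have "x ^ 3 <= 0" using False by (simp add: power_le_zero_eq)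
    then have "1 <= (1 + x + x\<^sup>2) * (1 - x)" by (simp add: power2_eq_square power3_eq_cube algebra_simps)
    then show ?thesis using False by (simp add: divide_le_eq)
  qed
  ultimately show ?thesis using exp_ge_add_one_self[of x] zero_le_power2[of x] by linarith
qed

text \<open>Discrete Gronwall: at each step the difference of the products is multiplied by
  \<open>r k\<close> and receives \<open>B k\<close> times the difference of the factors.\<close>

lemma product_compare:
  fixes A B r b :: "nat => real"
  assumes A: "A 0 = 1" "!!k. k < n ==> A (Suc k) = A k * r k" and B: "B 0 = 1" "!!k. k < n ==> B (Suc k) = B k * b k"
    and r: "!!k. k < n ==> \<bar>r k\<bar> <= exp c" and c: "0 <= c" and E: "!!k. k < n ==> \<bar>B k\<bar> <= E" "0 <= E" and k: "k <= n"
  shows "\<bar>A k - B k\<bar> <= exp (c * real k) * (E * (\<Sum>i<k. \<bar>r i - b i\<bar>))"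
  using k
proof (induction k)
  case (Suc k)
  let ?S = "\<Sum>i<k. \<bar>r i - b i\<bar>"
  have S: "0 <= ?S" by (simp add: sum_nonneg)
  have k: "k < n" using Suc by simp
  have "A (Suc k) - B (Suc k) = r k * (A k - B k) + B k * (r k - b k)" using A(2)[OF k] B(2)[OF k] by (simp add: algebra_simps)
  also have "\<bar>...\<bar> <= \<bar>r k\<bar> * \<bar>A k - B k\<bar> + \<bar>B k\<bar> * \<bar>r k - b k\<bar>" by (metis abs_mult abs_triangle_ineq)
  also have "... <= exp c * (exp (c * real k) * (E * ?S)) + E * \<bar>r k - b k\<bar>"
    using Suc k r[OF k] E(1)[OF k] by (intro add_mono mult_mono mult_right_mono) auto
  also have "... <= exp (c * real (Suc k)) * (E * ?S) + exp (c * real (Suc k)) * (E * \<bar>r k - b k\<bar>)"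
  proof (rule add_mono)
    show "exp c * (exp (c * real k) * (E * ?S)) <= exp (c * real (Suc k)) * (E * ?S)"
    proof -
      have "exp c * exp (c * real k) = exp (c * real (Suc k))"
        by (subst exp_add[symmetric]) (simp add: distrib_left)
      then show ?thesis by (simp only: mult.assoc[symmetric] order_refl)
    qed
    have "1 <= exp (c * real (Suc k))" using c by simp
    then show "E * \<bar>r k - b k\<bar> <= exp (c * real (Suc k)) * (E * \<bar>r k - b k\<bar>)"
      using E(2) mult_right_mono[of 1 "exp (c * real (Suc k))" "E * \<bar>r k - b k\<bar>"] by simp
  qed
  finally show ?case by (simp add: distrib_left)
qed (simp add: A B)

lemma product_bounds:
  fixes A r :: "nat => real"
  assumes A: "A 0 = 1" "!!k. k < n ==> A (Suc k) = A k * r k" and r: "!!k. k < n ==> \<bar>r k - 1\<bar> <= x" and x: "0 <= x" "x <= 1/2" and k: "k <= n"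
  shows "exp (- 2 * x * real k) <= A k & A k <= exp (x * real k)"
  using k
proof (induction k)
  case (Suc k)
  then have k: "k < n" by simp
  have "- x - 2 * x\<^sup>2 <= ln (1 - x)" using x by (intro ln_one_minus_pos_lower_bound) auto
  moreover have "2 * x\<^sup>2 <= x" using x mult_left_mono[of x "1/2" x] by (simp add: power2_eq_square)
  ultimately have "exp (- 2 * x) <= exp (ln (1 - x))" by (subst exp_le_cancel_iff) linarith
  then have e: "exp (- 2 * x) <= 1 - x" using x by simp
  have r1: "exp (- 2 * x) <= r k" using r[OF k] e by linarith
  have r2: "r k <= exp x" using r[OF k] exp_ge_add_one_self[of x] by linarith
  have "exp (- 2 * x * real k) * exp (- 2 * x) <= A k * r k" using Suc k r1 by (intro mult_mono) (auto intro: order_trans[OF exp_ge_zero])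
  moreover have "A k * r k <= exp (x * real k) * exp x" using Suc k r1 r2 by (intro mult_mono) (auto intro: order_trans[OF exp_ge_zero])
  moreover have "exp (- 2 * x * real k) * exp (- 2 * x) = exp (- 2 * x * real (Suc k))"
    "exp (x * real k) * exp x = exp (x * real (Suc k))"
    by (subst exp_add[symmetric], simp add: algebra_simps)+
  ultimately show ?case using A(2)[OF k] by simp
qed (simp add: A)

text \<open>Adjacent closed intervals share one point, a null set.\<close>

lemma nn_integral_Icc_sum:
  fixes G :: "real => ennreal"
  assumes [measurable]: "G : bmb" and h: "0 <= h"
  shows "(\<Sum>k<n. \<integral>\<^sup>+s. ind {real k * h..real (Suc k) * h} s * G s \<partial>lborel) = (NN s. ind {0..real n * h} s * G s)"
proof (induction n)
  case 0
  have "(NN s. ind {0..real 0 * h} s * G s) = (\<integral>\<^sup>+s. 0 \<partial>(lborel :: real measure))"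
    by (rule nn_integral_cong_AE) (use AE_lborel_singleton[of "0::real"] in eventually_elim, auto simp: indicator_def)
  then show ?case by simp
next
  case (Suc n)
  have "(\<Sum>k<Suc n. \<integral>\<^sup>+s. ind {real k * h..real (Suc k) * h} s * G s \<partial>lborel) =
     (NN s. ind {0..real n * h} s * G s) + (NN s. ind {real n * h..real (Suc n) * h} s * G s)"
    using Suc by simp
  also have "... = (NN s. ind {0..real n * h} s * G s + ind {real n * h..real (Suc n) * h} s * G s)"
    by (rule nn_integral_add[symmetric]) measurable
  also have "... = (NN s. ind {0..real (Suc n) * h} s * G s)"
  proof (rule nn_integral_cong_AE)
    have l: "0 <= real n * h" "real n * h <= real (Suc n) * h" using h by (auto intro: mult_right_mono)
    show "AE s in lborel. ind {0..real n * h} s * G s + ind {real n * h..real (Suc n) * h} s * G s = ind {0..real (Suc n) * h} s * G s"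
      using AE_lborel_singleton[of "real n * h"] by eventually_elim (use l in \<open>auto simp: indicator_def simp del: of_nat_Suc\<close>)
  qed
  finally show ?case .
qed

context flow
begin

lemma X_nn:
  assumes s: "s : {0..T}" and [measurable]: "e : bmb"
  shows "(NN y. e (X s y)) <= ennreal L * (NN x. e x)"
proof -
  have "distr lborel borel (X s) <= density lborel (%_. ennreal L)"
  proof (subst le_measure, simp, intro ballI)
    fix A assume "A : sets (distr lborel borel (X s))"
    then have A[measurable]: "A : sets borel" by simp
    have "emeasure (distr lborel borel (X s)) A = emeasure lborel {y. X s y : A}"
      by (subst emeasure_distr) (auto simp: vimage_def)
    also have "... <= ennreal L * emeasure lborel A" by (rule XL[OF s A])
    finally show "emeasure (distr lborel borel (X s)) A <= emeasure (density lborel (%_. ennreal L)) A"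
      by (simp add: emeasure_density nn_integral_cmult_indicator)
  qed
  then have "(\<integral>\<^sup>+x. e x \<partial>distr lborel borel (X s)) <= (\<integral>\<^sup>+x. e x \<partial>density lborel (%_. ennreal L))"
    by (intro nn_integral_mono_measure) auto
  then show ?thesis by (simp add: nn_integral_distr nn_integral_density nn_integral_cmult)
qed

text \<open>Measurability gives continuous functions converging to \<open>D\<close> almost
  everywhere; truncation at \<open>M\<close> bounds them uniformly, and dominated convergence on a
  bounded set yields convergence in L^1.\<close>

lemma D_approx:
  assumes th: "0 < th"
  shows "EX g. continuous_on UNIV g &
    (NN s. ind {0..T} s * (NN x. ind (cball 0 R) x * ennreal \<bar>D s x - g (s, x)\<bar>)) <= ennreal th"
proof -
  let ?D = "%z. D (fst z) (snd z)"
  have Dm': "?D : bmb" using Dm by (simp add: borel_prod)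
  then have "?D : borel_measurable lebesgue" by (simp add: measurable_completion)
  then have "?D measurable_on UNIV" by (subst measurable_on_iff_borel_measurable) (auto simp: lebesgue_on_UNIV_eq)
  then obtain N and G :: "nat => real \<times> (real^'d) => real" where N: "negligible N" and Gc: "!!n. continuous_on UNIV (G n)"
    and Gl': "!!z. z ~: N ==> (%n. G n z) \<longlonglongrightarrow> (if z : UNIV then ?D z else 0)"
    unfolding measurable_on_def by blast
  have Gl: "(%n. G n z) \<longlonglongrightarrow> ?D z" if "z ~: N" for z using Gl'[OF that] by (simp only: UNIV_I if_True)
  define H where "H = (%n z. max (- M) (min M (G n z)))"
  have Hc: "continuous_on UNIV (H n)" for n unfolding H_def by (intro continuous_intros Gc)
  have [measurable]: "H n : bmb" "?D : bmb" for n using borel_measurable_continuous_onI[OF Hc] Dm' by auto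
  let ?S = "{0..T} \<times> cball (0::real^'d) R"
  have S [measurable]: "?S : sets borel" by (intro borel_closed closed_Times) auto
  have Sb: "bounded ?S" by (intro bounded_Times) auto
  have AEN: "AE z in lborel. z ~: N"
  proof -
    have "AE z in lebesgue. z ~: N" using N by (simp add: negligible_iff_null_sets AE_not_in)
    then show ?thesis by (simp add: AE_completion_iff)
  qed
  have "(%n. \<integral>z. ind ?S z * \<bar>?D z - H n z\<bar> \<partial>lborel) \<longlonglongrightarrow> (\<integral>z. 0 \<partial>(lborel :: (real \<times> (real^'d)) measure))"
  proof (rule integral_dominated_convergence)
    show "integrable lborel (%z. ind ?S z * (2 * M))"
      by (intro integrable_mult_left integrable_indicator_bounded S Sb)
    show "AE z in lborel. (%n. ind ?S z * \<bar>?D z - H n z\<bar>) \<longlonglongrightarrow> 0"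
      using AEN
    proof eventually_elim
      case (elim z)
      have "(%n. H n z) \<longlonglongrightarrow> max (- M) (min M (?D z))" unfolding H_def by (intro tendsto_intros Gl elim)
      also have "max (- M) (min M (?D z)) = ?D z" using Db[of "fst z" "snd z"] by auto
      finally have "(%n. ind ?S z * \<bar>?D z - H n z\<bar>) \<longlonglongrightarrow> ind ?S z * \<bar>?D z - ?D z\<bar>" by (intro tendsto_intros)
      then show ?case by simp
    qed
    show "AE z in lborel. norm (ind ?S z * \<bar>?D z - H n z\<bar>) <= ind ?S z * (2 * M)" for n
    proof (rule AE_I2)
      fix z :: "real \<times> (real^'d)"
      have "\<bar>H n z\<bar> <= M" using M by (auto simp: H_def)
      then have "\<bar>?D z - H n z\<bar> <= 2 * M" using Db[of "fst z" "snd z"] by linarith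
      then show "norm (ind ?S z * \<bar>?D z - H n z\<bar>) <= ind ?S z * (2 * M)" by (simp add: indicator_def)
    qed
  qed measurable
  then have "(%n. \<integral>z. ind ?S z * \<bar>?D z - H n z\<bar> \<partial>lborel) \<longlonglongrightarrow> 0" by simp
  then have "eventually (%n. (LBINT z. ind ?S z * \<bar>?D z - H n z\<bar>) < th) sequentially"
    using th by (rule order_tendstoD(2))
  then obtain n where n: "(LBINT z. ind ?S z * \<bar>?D z - H n z\<bar>) < th" by (auto simp: eventually_sequentially)
  have int: "integrable lborel (%z. ind ?S z * \<bar>?D z - H n z\<bar>)"
  proof (rule Bochner_Integration.integrable_bound[where f = "%z. ind ?S z * (2 * M)"])
    show "integrable lborel (%z. ind ?S z * (2 * M))"
      by (intro integrable_mult_left integrable_indicator_bounded S Sb)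
    show "AE z in lborel. norm (ind ?S z * \<bar>?D z - H n z\<bar>) <= norm (ind ?S z * (2 * M))"
    proof (rule AE_I2)
      fix z :: "real \<times> (real^'d)"
      have "\<bar>H n z\<bar> <= M" using M by (auto simp: H_def)
      then have "\<bar>?D z - H n z\<bar> <= 2 * M" using Db[of "fst z" "snd z"] by linarith
      then show "norm (ind ?S z * \<bar>?D z - H n z\<bar>) <= norm (ind ?S z * (2 * M))" by (simp add: indicator_def)
    qed
  qed measurable
  have "(NN z. ennreal (ind ?S z * \<bar>?D z - H n z\<bar>)) = ennreal (LBINT z. ind ?S z * \<bar>?D z - H n z\<bar>)"
    by (rule nn_integral_eq_integral[OF int]) auto
  also have "... <= ennreal th" using n by (intro ennreal_leI) auto
  finally have le: "(\<integral>\<^sup>+z. ennreal (ind ?S z * \<bar>?D z - H n z\<bar>) \<partial>plb) <= ennreal th" by (simp add: lborel_prod)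
  have mm: "(%z. ennreal (ind ?S z * \<bar>?D z - H n z\<bar>)) : borel_measurable plb"
    unfolding lborel_prod by measurable
  have "(NN s. (NN x. ennreal (ind ?S (s,x) * \<bar>?D (s,x) - H n (s,x)\<bar>))) <= ennreal th"
    using le unfolding lborel.nn_integral_fst[OF mm, symmetric] .
  moreover have "(NN x. ennreal (ind ?S (s,x) * \<bar>?D (s,x) - H n (s,x)\<bar>)) =
     ind {0..T} s * (NN x. ind (cball 0 R) x * ennreal \<bar>D s x - H n (s, x)\<bar>)" for s
  proof (cases "s : {0..T}")
    case True
    then show ?thesis by (auto intro!: nn_integral_cong simp: indicator_def)
  next
    case False
    have "(s, x) ~: ?S" for x using False by blast
    then have "ind ?S (s, x) = (0::real)" for x by (rule indicator_simps(2))
    moreover have "ind {0..T} s = (0::ennreal)" using False by (rule indicator_simps(2))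
    ultimately show ?thesis by (simp only: mult_zero_left ennreal_0 nn_integral_const)
  qed
  ultimately show ?thesis using Hc by (intro exI[of _ "H n"] conjI) auto
qed

definition J :: "real => real^'d => real" where
  "J t y = exp (LBINT s. ind {0..t} s * D s (X s y))"

lemma D_X_measurable [measurable]: "(%z. D (fst z) (X (fst z) (snd z))) : borel_measurable bxb"
proof -
  have "(%z. (fst z, X (fst z) (snd z))) : bxb \<rightarrow>\<^sub>M bxb" by measurable
  from measurable_compose[OF this Dm] show ?thesis by simp
qed

lemma J_measurable [measurable]: "J t : bmb"
proof -
  have "(%y. \<integral>s. ind {0..t} s * D s (X s y) \<partial>lborel) : bmb"
    using tint_borel[OF D_X_measurable, of 0 t] by (simp add: tint_def[abs_def])
  then show ?thesis unfolding J_def[abs_def] by measurable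
qed

lemma D_X_integrable: "integrable lborel (%s. ind {a..b} s * D s (X s y))"
  by (rule indicator_Icc_bounded_integrable[where B = M]) (auto intro!: D_along Db)

lemma J_bounds:
  assumes "0 <= t" shows "exp (- M * t) <= J t y" "J t y <= exp (M * t)" "0 < J t y"
proof -
  have "\<bar>\<integral>s. ind {0..t} s * D s (X s y) \<partial>lborel\<bar> <= (t - 0) * M"
    by (rule indicator_Icc_integral_bound[OF assms]) (rule Db)
  then show "exp (- M * t) <= J t y" "J t y <= exp (M * t)" by (auto simp: J_def abs_le_iff mult.commute)
  show "0 < J t y" by (simp add: J_def)
qed

end

section \<open>Mollification of nonnegative functions\<close>

lemma lborel_nn_integral_reflect:
  fixes f :: "real^'d => ennreal"
  assumes [measurable]: "f : bmb"
  shows "(NN x. f (a - x)) = (NN x. f x)"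
proof -
  from lborel_affine[of "-1::real" a]
  have e: "lborel = distr lborel borel (%x::real^'d. a - x)" by (simp add: density_1)
  have "(NN x. f x) = (\<integral>\<^sup>+x. f x \<partial>distr lborel borel (%x::real^'d. a - x))" using e by simp
  also have "... = (NN x. f (a - x))" by (rule nn_integral_distr) auto
  finally show ?thesis by simp
qed

lemma conv_nonneg: "(!!x. 0 <= eta x) ==> (!!x. 0 <= e x) ==> 0 <= conv eta e q"
  unfolding conv_def by (intro integral_nonneg_AE) auto

lemma nn_integral_conv:
  fixes eta e :: "real^'d => real"
  assumes eta: "mollifier ep eta" and e: "lloc e" "!!x. 0 <= e x"
  shows "(NN x. ennreal (conv eta e x)) = (NN x. ennreal (e x))"
proof -
  note etaD = mollifierD[OF eta]
  have [measurable]: "e : bmb" "eta : bmb" using lloc_borel[OF e(1)] etaD(6) by auto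
  have "ennreal (conv eta e x) = (NN p. ennreal (e p) * ennreal (eta (p - x)))" for x
  proof -
    have "ennreal (conv eta e x) = (NN p. ennreal (e p * eta (p - x)))"
      unfolding conv_def by (rule nn_integral_eq_integral[symmetric, OF conv_integrable_test[OF e(1) etaD(1)]]) (use e etaD in auto)
    then show ?thesis using e etaD by (simp add: ennreal_mult)
  qed
  then have "(NN x. ennreal (conv eta e x)) = (NN x. (NN p. ennreal (e p) * ennreal (eta (p - x))))" by simp
  also have "... = (NN p. (NN x. ennreal (e p) * ennreal (eta (p - x))))"
    by (rule lborel_pair.Fubini') measurable
  also have "... = (NN p. ennreal (e p))"
  proof (rule nn_integral_cong)
    fix p
    have "(NN x. ennreal (eta (p - x))) = (NN x. ennreal (eta x))" by (rule lborel_nn_integral_reflect) measurable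
    also have "... = ennreal (LBINT x. eta x)" by (rule nn_integral_eq_integral[OF etaD(5)]) (use etaD in auto)
    finally show "(NN x. ennreal (e p) * ennreal (eta (p - x))) = ennreal (e p)"
      using etaD(3) by (simp add: nn_integral_cmult)
  qed
  finally show ?thesis .
qed

text \<open>\<open>F\<close> is close to \<open>c\<close> only up to a part \<open>e\<close> that is
  small in the mean but not pointwise; that part is kept, as its own mollification.\<close>

lemma conv_split_bound:
  fixes eta F e :: "real^'d => real"
  assumes eta: "mollifier ep eta" and F: "lloc F" and e: "lloc e" and b: "!!p. norm (p - q) < ep ==> \<bar>F p - c\<bar> <= e p + th"
  shows "\<bar>conv eta F q - c\<bar> <= conv eta e q + th"
proof -
  note etaD = mollifierD[OF eta]
  note m = etaD(6)
  have one: "conv eta (%_. k) q = k" for k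
  proof -
    have "conv eta (%_. k) q = k * conv eta (%_. 1) 0" by (rule conv_const[OF m])
    then show ?thesis using etaD(3) by (simp add: conv_def)
  qed
  have i: "integrable lborel (%p. (F p - c) * eta (p - q))" by (rule conv_integrable_test[OF lloc_diff[OF F lloc_const] etaD(1)])
  have i2: "integrable lborel (%p. e p * eta (p - q))" by (rule conv_integrable_test[OF e etaD(1)])
  have i3: "integrable lborel (%p. th * eta (p - q))" by (rule conv_integrable_test[OF lloc_const etaD(1)])
  have "conv eta F q - c = conv eta F q - conv eta (%_. c) q" by (simp only: one)
  also have "... = conv eta (%p. F p - c) q" by (rule conv_diff[OF F lloc_const etaD(1), symmetric])
  also have "\<bar>...\<bar> <= (LBINT p. \<bar>(F p - c) * eta (p - q)\<bar>)" unfolding conv_def by (rule integral_abs_bound)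
  also have "... <= (LBINT p. e p * eta (p - q) + th * eta (p - q))"
  proof (rule integral_mono[OF integrable_abs[OF i]])
    show "integrable lborel (%p. e p * eta (p - q) + th * eta (p - q))" using i2 i3 by simp
    fix p
    show "\<bar>(F p - c) * eta (p - q)\<bar> <= e p * eta (p - q) + th * eta (p - q)"
    proof (cases "norm (p - q) < ep")
      case True
      have "\<bar>F p - c\<bar> * eta (p - q) <= (e p + th) * eta (p - q)" by (rule mult_right_mono[OF b[OF True] etaD(2)])
      then show ?thesis using etaD(2) by (simp add: abs_mult distrib_right)
    qed (simp add: etaD(4))
  qed
  also have "... = conv eta e q + conv eta (%_. th) q" unfolding conv_def using i2 i3 by simp
  finally show ?thesis by (simp only: one)
qed

lemma abs_integral_le_nn:
  fixes f :: "'a => real"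
  shows "ennreal \<bar>\<integral>x. f x \<partial>M\<bar> <= (\<integral>\<^sup>+x. ennreal \<bar>f x\<bar> \<partial>M)"
  using integral_norm_bound_ennreal[of M f] by (cases "integrable M f") (auto simp: not_integrable_integral_eq)

context flow
begin

lemma D_X_add:
  assumes "0 <= a" "a <= b"
  shows "(LBINT s. ind {0..b} s * D s (X s y)) = (LBINT s. ind {0..a} s * D s (X s y)) + (LBINT s. ind {a..b} s * D s (X s y))"
proof -
  let ?f = "%s. D s (X s y)"
  have [measurable]: "?f : bmb" by (rule D_along[OF X_time])
  have "(LBINT s. ind {0..a} s * ?f s) + (LBINT s. ind {a..b} s * ?f s) = (LBINT s. ind {0..a} s * ?f s + ind {a..b} s * ?f s)"
    by (rule Bochner_Integration.integral_add[OF D_X_integrable D_X_integrable, symmetric])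
  also have "... = (LBINT s. ind {0..b} s * ?f s)"
  proof (rule integral_cong_AE)
    show "AE s in lborel. ind {0..a} s * ?f s + ind {a..b} s * ?f s = ind {0..b} s * ?f s"
      using AE_lborel_singleton[of a] by eventually_elim (use assms in \<open>auto simp: indicator_def\<close>)
  qed measurable
  finally show ?thesis by simp
qed

text \<open>The Euler map has an exact density \<open>A\<close>, so what remains is that
  \<open>A\<close> is close to \<open>J\<close> in the mean. Both are products over the steps, built
  from the mollified divergence along \<open>Psi\<close> and from the divergence along
  \<open>X\<close>. As \<open>D\<close> lacks continuity, both are compared with a continuous
  \<open>g\<close>. The defect |D - g| is transported along \<open>X\<close> by the compression
  bound \<open>L\<close> and along \<open>Psi\<close> by a density that is at least 1/E; hence the
  factor E + L.\<close>

lemma flow_approx: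
  assumes fc: "continuous_on UNIV f" and f01: "!!x. 0 <= f x" "!!x. f x <= 1" and fs: "!!x. R0 < norm x ==> f x = 0"
    and t: "t : {0..T}" and th: "0 < th" "th <= 1"
    and R1: "R1 = R0 + real CARD('d) * (M * T) + 1" and E: "E = exp (2 * ((M + 1) * T))"
  shows "EX Psi A. trans Psi A & (NN y. ennreal \<bar>f (X t y) * J t y - f (Psi y) * A y\<bar>) <=
     ennreal (th * (exp (M * T) + E * E * (3 * T))) * emeasure lborel (cball (0::real^'d) R1) + ennreal (E * E) * (ennreal (E + L) * ennreal th)"
proof -
  let ?d = "real CARD('d)"
  define dM where "dM = ?d * (M * T)"
  \<comment> \<open>Contains the trajectories starting in the ball of radius \<open>R1\<close>, with
    a margin of 3 for the points at which \<open>D\<close> and \<open>g\<close> are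
    compared.\<close>
  define R2 where "R2 = R1 + dM + 3"
  have dM0: "0 <= dM" using M T by (simp add: dM_def)
  have E1: "1 <= E" using M T by (simp add: E)
  obtain g where gc: "continuous_on UNIV g" and gD: "(NN s. ind {0..T} s * (NN x. ind (cball 0 R2) x * ennreal \<bar>D s x - g (s, x)\<bar>)) <= ennreal th"
    using D_approx[OF th(1), of R2] by blast
  have "uniformly_continuous_on ({0..T} \<times> cball 0 R2) g"
    by (intro compact_uniformly_continuous continuous_on_subset[OF gc] compact_Times) auto
  from this[unfolded uniformly_continuous_on_def, THEN spec, THEN mp, OF th(1)]
  obtain dl1 where dl1: "0 < dl1" "!!z z'. z : {0..T} \<times> cball 0 R2 ==> z' : {0..T} \<times> cball 0 R2 ==> dist z' z < dl1 ==> dist (g z') (g z) < th"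
    by blast
  have "EX d>0. ALL x y. dist x y < d --> \<bar>f x - f y\<bar> < th"
    by (rule uniformly_continuous_compact_support[OF fc compact_cball[of 0 R0] _ th(1)]) (use fs in auto)
  then obtain dl2 where dl2: "0 < dl2" "!!x y. dist x y < dl2 ==> \<bar>f x - f y\<bar> < th" by blast
  \<comment> \<open>The arguments at which \<open>g\<close> is compared are at most 3 kp apart,
    which a quarter of \<open>dl1\<close> accommodates.\<close>
  define kp where "kp = Min {1, dl1 / 4, dl2 / 2}"
  have kp: "0 < kp" "kp <= 1" "kp <= dl1 / 4" "kp <= dl2 / 2" using dl1 dl2 by (auto simp: kp_def)
  obtain ep0 where ep0: "0 < ep0" and eul: "ALL ep eta rh t h1. 0 < ep & ep <= ep0 & mollifier ep eta & 0 < rh & t : {0..T} & 0 < h1 -->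
    (EX n Psi A. 0 < n & t / real n <= h1 & (ALL k<=n. trans (Psi k) (A k)) & (ALL y. Psi 0 y = y) & (ALL y. A 0 y = 1) &
      (ALL k<n. ALL y. EX r. A (Suc k) y = A k y * r &
         \<bar>r - 1 - (LBINT s. ind {real k * (t / real n)..real (Suc k) * (t / real n)} s * conv eta (D s) (Psi k y))\<bar> <= rh * (t / real n)) &
      (ALL y. good y --> (ALL k<=n. norm (Psi k y - X (real k * (t / real n)) y) <= kp)))"
    using euler[OF kp(1)] by (elim exE conjE) (rule that)
  define ep where "ep = min ep0 kp"
  have ep: "0 < ep" "ep <= ep0" "ep <= kp" using ep0 kp by (auto simp: ep_def)
  obtain eta :: "real^'d => real" where eta: "mollifier ep eta" using mollifier_exists[OF ep(1)] unfolding mollifier_def by blast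
  note etaD = mollifierD[OF eta]
  \<comment> \<open>The bounds serve, in this order, \<open>product_bounds\<close>, the motion of
    the trajectory within one step, and the quadratic error of the exponential.\<close>
  define h1 where "h1 = Min {1 / (2 * (M + 1)), kp / (?d * M + 1), th / (M * M + 1)}"
  have h1: "0 < h1" using M kp(1) th(1) by (auto simp: h1_def intro!: divide_pos_pos add_nonneg_pos)
  obtain n Psi A where n: "0 < n" and hh1: "t / real n <= h1" and tr: "!!k. k <= n ==> trans (Psi k) (A k)" and Psi0: "!!y. Psi 0 y = y" and A0: "!!y. A 0 y = 1"
    and rr: "!!k y. k < n ==> EX r. A (Suc k) y = A k y * r &
         \<bar>r - 1 - (LBINT s. ind {real k * (t / real n)..real (Suc k) * (t / real n)} s * conv eta (D s) (Psi k y))\<bar> <= th * (t / real n)"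
    and near0: "!!y k. good y ==> k <= n ==> norm (Psi k y - X (real k * (t / real n)) y) <= kp"
    using eul[rule_format, of ep eta th t h1] ep eta th t h1 by blast
  define h where "h = t / real n"
  have t0: "0 <= t" "t <= T" using t by auto
  have h0: "0 <= h" using t0 by (simp add: h_def)
  have nh: "real n * h = t" using n by (simp add: h_def)
  have hle: "h <= 1 / (2 * (M + 1))" "h <= kp / (?d * M + 1)" "h <= th / (M * M + 1)" using hh1 by (auto simp: h1_def h_def)
  have mul: "x * h <= c" if "h <= c / (x + 1)" "0 <= x" "0 <= c" for x c
  proof -
    have "x * h <= x * (c / (x + 1))" using that by (intro mult_left_mono) auto
    also have "... <= c" using that by (simp add: field_simps)
    finally show ?thesis .
  qed
  have x: "(M + 1) * h <= 1/2" using hle(1) M by (simp add: field_simps)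
  have dMh: "?d * (M * h) <= kp" using mul[OF hle(2)] M kp(1) by (simp add: mult.assoc)
  have MMh: "M * M * h <= th" using mul[OF hle(3)] th(1) by simp
  have Mh: "0 <= M * h" "M * h <= 1" using M h0 x by (auto simp: distrib_right)
  have kh: "0 <= real k * h" "real k * h <= t" if "k <= n" for k
    using that h0 nh mult_right_mono[of "real k" "real n" h] by auto
  let ?I = "%k. {real k * h..real (Suc k) * h}"
  have Ik: "real k * h <= real (Suc k) * h" "real (Suc k) * h - real k * h = h" for k using h0 by (auto simp: algebra_simps)
  define c where "c = (%k y. \<integral>s. ind (?I k) s * conv eta (D s) (Psi k y) \<partial>lborel)"
  have cb: "\<bar>c k y\<bar> <= M * h" for k y
  proof -
    have "\<bar>c k y\<bar> <= (real (Suc k) * h - real k * h) * M" unfolding c_def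
    proof (rule indicator_Icc_integral_bound[OF Ik(1)])
      fix s
      have "\<bar>conv eta (D s) (Psi k y)\<bar> <= M * (LBINT p. \<bar>eta p\<bar>)" by (rule conv_bound[OF etaD(5) D_slice Db])
      then show "\<bar>conv eta (D s) (Psi k y)\<bar> <= M" using etaD(2,3) by simp
    qed
    then show ?thesis unfolding Ik(2) by (simp add: mult.commute)
  qed
  have "EX r. ALL k. k < n --> A (Suc k) y = A k y * r k & \<bar>r k - 1 - c k y\<bar> <= th * h" for y
  proof -
    have "ALL k. EX rh. k < n --> A (Suc k) y = A k y * rh & \<bar>rh - 1 - c k y\<bar> <= th * h"
      using rr[of _ y] unfolding h_def[symmetric] c_def by blast
    from choice[OF this] show ?thesis .
  qed
  then have "ALL y. EX r. ALL k. k < n --> A (Suc k) y = A k y * r k & \<bar>r k - 1 - c k y\<bar> <= th * h" by blast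
  from choice[OF this] obtain r where r: "!!k y. k < n ==> A (Suc k) y = A k y * r y k" "!!k y. k < n ==> \<bar>r y k - 1 - c k y\<bar> <= th * h" by blast
  have r1: "\<bar>r y k - 1\<bar> <= (M + 1) * h" if "k < n" for k y
  proof -
    have "th * h <= 1 * h" using th h0 by (intro mult_right_mono) auto
    then show ?thesis using r(2)[OF that, of y] cb[of k y] by (simp add: distrib_right)
  qed
  have Ab: "1 / E <= A k y" "A k y <= E" if k: "k <= n" for k y
  proof -
    have pb: "exp (- 2 * ((M + 1) * h) * real k) <= A k y & A k y <= exp ((M + 1) * h * real k)"
      by (rule product_bounds[where r = "r y" and n = n and A = "%k. A k y"]) (use A0 r r1 x M h0 k in auto)
    have le: "(M + 1) * h * real k <= (M + 1) * T"
      using kh[OF k] t0 M by (simp add: mult.assoc mult.commute[of h] mult_left_mono)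
    have "1 / E = exp (- 2 * ((M + 1) * T))" using exp_minus[of "2 * ((M + 1) * T)"] by (simp add: E inverse_eq_divide)
    also have "... <= exp (- 2 * ((M + 1) * h) * real k)" using le by (simp add: mult.assoc)
    finally show "1 / E <= A k y" using pb by simp
    have "exp ((M + 1) * h * real k) <= E" unfolding E using le M T by (subst exp_le_cancel_iff) (smt (verit) mult_nonneg_nonneg)
    then show "A k y <= E" using pb by simp
  qed
  define e where "e = (%s x. ind (cball 0 R2) x * \<bar>D s x - g (s, x)\<bar>)"
  have gm [measurable]: "g : borel_measurable bxb" unfolding borel_prod by (rule borel_measurable_continuous_onI[OF gc])
  have gz: "(%z. g (fst z, snd z)) : borel_measurable bxb" using gm by simp
  have em: "(%z. e (fst z) (snd z)) : borel_measurable bxb"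
    unfolding e_def
  proof (rule borel_measurable_times)
    have [measurable]: "cball (0::real^'d) R2 : sets borel" by simp
    show "(%z. ind (cball 0 R2) (snd z :: real^'d) :: real) : borel_measurable bxb" by measurable
    show "(%z. \<bar>D (fst z) (snd z) - g (fst z, snd z)\<bar>) : borel_measurable bxb"
      by (intro borel_measurable_abs borel_measurable_diff Dm gz)
  qed
  have es: "e s : bmb" for s
  proof -
    have "(%x. (s, x)) : borel \<rightarrow>\<^sub>M bxb" by measurable
    from measurable_compose[OF this em] show ?thesis by simp
  qed
  have e0: "0 <= e s x" for s x by (simp add: e_def)
  have cn: "0 <= conv eta (e s) p" for s p by (rule conv_nonneg, rule etaD(2), rule e0)
  have el: "lloc (e s)" for s
  proof (rule lloc_bounded[OF es])
    have "compact ((%x. (s, x)) ` cball (0::real^'d) R2)" by (intro compact_continuous_image continuous_intros) auto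
    then have "bounded (g ` ((%x. (s, x)) ` cball 0 R2))"
      by (rule compact_imp_bounded[OF compact_continuous_image[OF continuous_on_subset[OF gc subset_UNIV]]])
    then obtain G where G: "!!x. x : cball 0 R2 ==> \<bar>g (s, x)\<bar> <= G" unfolding bounded_iff by (fastforce simp del: mem_cball)
    have "\<bar>e s x\<bar> <= M + \<bar>G\<bar>" for x
    proof (cases "x : cball 0 R2")
      case True
      then have "\<bar>e s x\<bar> = \<bar>D s x - g (s,x)\<bar>" by (simp add: e_def)
      then show ?thesis using Db[of s x] G[OF True] by linarith
    next
      case False
      then show ?thesis using M by (simp add: e_def)
    qed
    then show "EX B. ALL x:cbox a b. \<bar>e s x\<bar> <= B" for a b by blast
  qed
  have cem: "(%z. conv eta (e (fst z)) (snd z)) : borel_measurable bxb"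
  proof -
    note [measurable] = etaD(6)
    have a: "(%w. (fst (fst w), snd w)) : bxb \<Otimes>\<^sub>M lborel \<rightarrow>\<^sub>M bxb" by measurable
    have [measurable]: "(%w. e (fst (fst w)) (snd w)) : borel_measurable (bxb \<Otimes>\<^sub>M lborel)"
      using measurable_compose[OF a em] by simp
    show ?thesis unfolding conv_def
      by (rule lborel.borel_measurable_lebesgue_integral) (simp add: case_prod_unfold)
  qed
  have XT: "norm (X s y - y) <= dM" if "good y" "s : {0..T}" for s y
  proof -
    have "norm (X s y - X 0 y) <= ?d * (M * (s - 0))" using that by (intro X_lip) auto
    also have "... <= dM" unfolding dM_def using that M by (intro mult_left_mono) auto
    finally show ?thesis using X_0[OF that(1)] by simp
  qed
  have nearI: "norm (Psi k y - X s y) <= 2 * kp" if y: "good y" and k: "k < n" and s: "s : ?I k" for y k s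
  proof -
    have sk: "real (Suc k) * h <= T" using kh(2)[of "Suc k"] k t0 by linarith
    have "norm (X s y - X (real k * h) y) <= ?d * (M * (s - real k * h))"
      using s sk kh(1)[of k] k by (intro X_lip[OF y]) auto
    also have "... <= ?d * (M * h)" using s Ik(2)[of k] M by (intro mult_left_mono) auto
    finally have "norm (X s y - X (real k * h) y) <= kp" using dMh by simp
    moreover have "norm (Psi k y - X (real k * h) y) <= kp" using near0[OF y, of k] k by (simp add: h_def)
    ultimately show ?thesis
      using norm_triangle_ineq4[of "Psi k y - X (real k * h) y" "X s y - X (real k * h) y"] by simp
  qed
  \<comment> \<open>Under the mollifier \<open>D\<close> is replaced by \<open>g\<close>, which
    leaves the mollified defect; moving the argument of \<open>g\<close> to \<open>X s y\<close>
    costs \<open>th\<close>; going back from \<open>g\<close> to \<open>D\<close> there leaves the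
    defect itself.\<close>
  have claim1: "\<bar>conv eta (D s) (Psi k y) - D s (X s y)\<bar> <= conv eta (e s) (Psi k y) + th + e s (X s y)"
    if y: "good y" and k: "k < n" and s: "s : ?I k" and yB: "y : cball 0 R1" for y k s
  proof -
    have sT: "s : {0..T}" using s kh(1)[of k] kh(2)[of "Suc k"] k t0 by auto
    have nX: "norm (X s y) <= R1 + dM" using XT[OF y sT] yB norm_triangle_sub[of "X s y" y] by simp
    then have XR2: "X s y : cball 0 R2" by (simp add: R2_def)
    have "\<bar>conv eta (D s) (Psi k y) - g (s, X s y)\<bar> <= conv eta (e s) (Psi k y) + th"
    proof (rule conv_split_bound[OF eta D_lloc el])
      fix p assume p: "norm (p - Psi k y) < ep"
      have pX: "norm (p - X s y) <= 3 * kp"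
        using norm_triangle_ineq[of "p - Psi k y" "Psi k y - X s y"] p nearI[OF y k s] ep(3) by simp
      then have "norm p <= R1 + dM + 3" using nX norm_triangle_sub[of p "X s y"] kp(2) by simp
      then have pR2: "p : cball 0 R2" by (simp add: R2_def)
      have "dist (s, p) (s, X s y) = norm (p - X s y)" by (simp add: dist_Pair_Pair dist_norm)
      then have "dist (s, p) (s, X s y) < dl1" using pX kp(1,3) by linarith
      then have "dist (g (s, p)) (g (s, X s y)) < th" using dl1(2) sT XR2 pR2 by blast
      then have "\<bar>D s p - g (s, X s y)\<bar> <= \<bar>D s p - g (s, p)\<bar> + th" by (simp add: dist_real_def)
      then show "\<bar>D s p - g (s, X s y)\<bar> <= e s p + th" using pR2 by (simp add: e_def)
    qed
    moreover have "e s (X s y) = \<bar>D s (X s y) - g (s, X s y)\<bar>" using XR2 by (simp add: e_def)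
    ultimately show ?thesis by linarith
  qed
  \<comment> \<open>The logarithm of the factor by which \<open>J\<close> grows over step k;
    \<open>c k y\<close> is its first order counterpart in the scheme.\<close>
  define dd where "dd = (%k y. \<integral>s. ind (?I k) s * D s (X s y) \<partial>lborel)"
  have ddb: "\<bar>dd k y\<bar> <= M * h" for k y
    using indicator_Icc_integral_bound[OF Ik(1), of k "%s. D s (X s y)" M] Db unfolding dd_def Ik(2) by (simp add: mult.commute)
  \<comment> \<open>Factor by factor, the products differ by the Euler tolerance th h, by the
    quadratic error of the exponential, and by c - dd. The first two sum to at most 2 T th.\<close>
  have claim2: "\<bar>A n y - J t y\<bar> <= E * E * (2 * T * th + (\<Sum>k<n. \<bar>c k y - dd k y\<bar>))" for y
  proof -
    let ?B = "%k. J (real k * h) y" and ?b = "%k. exp (dd k y)"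
    have J0: "?B 0 = 1"
    proof -
      have [measurable]: "(%s. D s (X s y)) : bmb" by (rule D_along[OF X_time])
      have "(LBINT s. ind {0..0} s * D s (X s y)) = (\<integral>s. 0 \<partial>(lborel :: real measure))"
        by (rule integral_cong_AE) (measurable, use AE_lborel_singleton[of "0::real"] in eventually_elim, auto)
      then show ?thesis by (simp add: J_def)
    qed
    have JS: "?B (Suc k) = ?B k * ?b k" for k
      unfolding J_def dd_def exp_add[symmetric] using D_X_add[of "real k * h" "real (Suc k) * h" y] Ik(1)[of k] h0 by simp
    have "\<bar>A n y - ?B n\<bar> <= exp ((M + 1) * h * real n) * (exp (M * T) * (\<Sum>i<n. \<bar>r y i - ?b i\<bar>))"
    proof (rule product_compare[where A = "%k. A k y" and B = ?B and r = "r y" and b = ?b and n = n])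
      show "\<bar>r y k\<bar> <= exp ((M + 1) * h)" if "k < n" for k
        using r1[OF that, of y] exp_ge_add_one_self[of "(M + 1) * h"] by linarith
      show "\<bar>?B k\<bar> <= exp (M * T)" if "k < n" for k
      proof -
        have "J (real k * h) y <= exp (M * (real k * h))" using h0 by (intro J_bounds) auto
        also have "... <= exp (M * T)" using kh(2)[of k] that t0 M by (subst exp_le_cancel_iff) (intro mult_left_mono, auto)
        finally show ?thesis using J_bounds(3)[of "real k * h" y] h0 by simp
      qed
    qed (use A0 r JS J0 M h0 in auto)
    also have "?B n = J t y" by (simp add: nh)
    also have "exp ((M + 1) * h * real n) * (exp (M * T) * (\<Sum>i<n. \<bar>r y i - ?b i\<bar>)) <= E * (E * (\<Sum>i<n. th * h + M * M * h * h + \<bar>c i y - dd i y\<bar>))"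
    proof (intro mult_mono sum_mono)
      have le: "(M + 1) * t <= (M + 1) * T" using t0 M by (intro mult_left_mono) auto
      have "(M + 1) * h * real n = (M + 1) * t" using nh by (simp add: mult.assoc mult.commute[of h])
      then show "exp ((M + 1) * h * real n) <= E" using le M T t0 by (simp add: E)
      have "0 <= M * T" using M T by simp
      then show "exp (M * T) <= E" using M T by (simp add: E algebra_simps)
      fix i assume "i : {..<n}"
      then have i: "i < n" by simp
      have "\<bar>?b i - 1 - dd i y\<bar> <= (dd i y)\<^sup>2" using ddb[of i y] Mh by (intro exp_quadratic) linarith
      also have "... <= (M * h)\<^sup>2" using ddb[of i y] Mh by (intro power2_le_iff_abs_le[THEN iffD2]) auto
      finally have "\<bar>?b i - 1 - dd i y\<bar> <= M * M * h * h" by (simp add: power2_eq_square algebra_simps)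
      then show "\<bar>r y i - ?b i\<bar> <= th * h + M * M * h * h + \<bar>c i y - dd i y\<bar>" using r(2)[OF i, of y] by linarith
    qed (auto simp: sum_nonneg E)
    also have "(\<Sum>i<n. th * h + M * M * h * h + \<bar>c i y - dd i y\<bar>) = th * t + M * M * h * t + (\<Sum>i<n. \<bar>c i y - dd i y\<bar>)"
      by (simp add: sum.distrib nh[symmetric] algebra_simps)
    also have "E * (E * (th * t + M * M * h * t + (\<Sum>i<n. \<bar>c i y - dd i y\<bar>))) <= E * (E * (2 * T * th + (\<Sum>k<n. \<bar>c k y - dd k y\<bar>)))"
    proof -
      have "th * t + M * M * h * t <= th * T + th * T"
        by (intro add_mono mult_mono) (use MMh t0 th M h0 in auto)
      also have "... = 2 * T * th" by simp
      finally have "th * t + M * M * h * t <= 2 * T * th" .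
      then show ?thesis using E1 by (intro mult_left_mono) auto
    qed
    finally show ?thesis by (simp add: mult.assoc)
  qed
  define q where "q = (%k y s. ennreal (conv eta (e s) (Psi k y)) + ennreal (e s (X s y)))"
  define Q where "Q = (%y. \<Sum>k<n. \<integral>\<^sup>+s. ind (?I k) s * q k y s \<partial>lborel)"
  have Psim: "Psi k : bmb" if "k <= n" for k using transD(1)[OF tr[OF that]] .
  have qm: "(%z. q k (fst z) (snd z)) : borel_measurable bxb" if k: "k <= n" for k
  proof -
    note [measurable] = Psim[OF k]
    have a: "(%z. (snd z, Psi k (fst z))) : bxb \<rightarrow>\<^sub>M bxb" by measurable
    have [measurable]: "(%z. conv eta (e (snd z)) (Psi k (fst z))) : borel_measurable bxb"
      using measurable_compose[OF a cem] by simp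
    have sw: "(%z::(real^'d) \<times> real. (snd z, fst z)) : bxb \<rightarrow>\<^sub>M bxb" by measurable
    have [measurable]: "(%z. X (snd z) (fst z)) : borel_measurable bxb" using measurable_compose[OF sw Xm] by simp
    have b: "(%z. (snd z, X (snd z) (fst z))) : bxb \<rightarrow>\<^sub>M bxb" by measurable
    have [measurable]: "(%z. e (snd z) (X (snd z) (fst z))) : borel_measurable bxb"
      using measurable_compose[OF b em] by simp
    show ?thesis unfolding q_def by measurable
  qed
  have cd: "ennreal \<bar>c k y - dd k y\<bar> <= (NN s. ind (?I k) s * q k y s) + ennreal (th * h)"
    if y: "good y" and k: "k < n" and yB: "y : cball 0 R1" for y k
  proof -
    have i1: "integrable lborel (%s. ind (?I k) s * conv eta (D s) (Psi k y))"
      by (rule indicator_Icc_bounded_integrable[where B = "M * (LBINT p. \<bar>eta p\<bar>)"])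
         (auto intro!: conv_time_measurable Dm conv_bound Db etaD(5,6))
    have "c k y - dd k y = (LBINT s. ind (?I k) s * conv eta (D s) (Psi k y) - ind (?I k) s * D s (X s y))"
      unfolding c_def dd_def by (rule Bochner_Integration.integral_diff[OF i1 D_X_integrable, symmetric])
    then have "ennreal \<bar>c k y - dd k y\<bar> <= (NN s. ennreal \<bar>ind (?I k) s * conv eta (D s) (Psi k y) - ind (?I k) s * D s (X s y)\<bar>)"
      by (simp only: abs_integral_le_nn)
    also have "... <= (NN s. ind (?I k) s * q k y s + ind (?I k) s * ennreal th)"
    proof (rule nn_integral_mono)
      fix s
      show "ennreal \<bar>ind (?I k) s * conv eta (D s) (Psi k y) - ind (?I k) s * D s (X s y)\<bar> <= ind (?I k) s * q k y s + ind (?I k) s * ennreal th"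
      proof (cases "s : ?I k")
        case True
        have "ennreal \<bar>conv eta (D s) (Psi k y) - D s (X s y)\<bar> <= ennreal (conv eta (e s) (Psi k y) + th + e s (X s y))"
          by (rule ennreal_leI[OF claim1[OF y k True yB]])
        also have "... = q k y s + ennreal th" unfolding q_def
          using cn[of s "Psi k y"] e0[of s "X s y"] th(1)
          by (simp add: ennreal_plus[symmetric] ac_simps del: ennreal_plus)
        finally show ?thesis using True by simp
      next
        case False
        then have "ind (?I k) s = (0::real)" "ind (?I k) s = (0::ennreal)" by auto
        then show ?thesis by simp
      qed
    qed
    also have "... = (NN s. ind (?I k) s * q k y s) + (NN s. ind (?I k) s * ennreal th)"
    proof (rule nn_integral_add)
      have "(%s. (y, s)) : borel \<rightarrow>\<^sub>M bxb" by measurable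
      from measurable_compose[OF this qm[of k]] k have [measurable]: "q k y : bmb" by simp
      show "(%s. ind (?I k) s * q k y s) : borel_measurable lborel" by measurable
    qed measurable
    also have "(NN s. ind (?I k) s * ennreal th) = ennreal (th * h)"
    proof -
      have "(NN s. ind (?I k) s * ennreal th) = emeasure lborel (?I k) * ennreal th"
        by (subst nn_integral_multc) auto
      also have "emeasure lborel (?I k) = ennreal h" using emeasure_lborel_Icc[OF Ik(1)[of k]] Ik(2)[of k] by simp
      finally show ?thesis using h0 th(1) by (simp add: ennreal_mult mult.commute)
    qed
    finally show ?thesis .
  qed
  let ?K1 = "th * (exp (M * T) + E * E * (3 * T))"
  have point: "AE y in lborel. ennreal \<bar>f (X t y) * J t y - f (Psi n y) * A n y\<bar> <= ennreal ?K1 * ind (cball 0 R1) y + ennreal (E * E) * Q y"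
    using AE_good
  proof eventually_elim
    case (elim y)
    have near: "norm (Psi n y - X t y) <= kp" using near0[OF elim, of n] nh by (simp add: h_def)
    show ?case
    proof (cases "y : cball 0 R1")
      case True
      have "dist (X t y) (Psi n y) < dl2" using near kp(1,4) by (simp add: dist_norm norm_minus_commute)
      then have a: "\<bar>f (X t y) - f (Psi n y)\<bar> <= th" using dl2(2) less_imp_le by blast
      have Jb: "J t y <= exp (M * T)" "0 < J t y"
        using J_bounds[of t y] t0 M by (auto intro: order_trans mult_left_mono)
      let ?S = "\<Sum>k<n. \<bar>c k y - dd k y\<bar>"
      have S0: "0 <= ?S" by (simp add: sum_nonneg)
      have "f (X t y) * J t y - f (Psi n y) * A n y = (f (X t y) - f (Psi n y)) * J t y - f (Psi n y) * (A n y - J t y)" by (simp add: algebra_simps)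
      also have "\<bar>...\<bar> <= \<bar>f (X t y) - f (Psi n y)\<bar> * \<bar>J t y\<bar> + \<bar>f (Psi n y)\<bar> * \<bar>A n y - J t y\<bar>" by (metis abs_mult abs_triangle_ineq4)
      also have "... <= th * exp (M * T) + 1 * (E * E * (2 * T * th + ?S))"
        using a Jb f01[of "Psi n y"] claim2[of y] th(1) by (intro add_mono mult_mono) auto
      finally have "ennreal \<bar>f (X t y) * J t y - f (Psi n y) * A n y\<bar> <= ennreal (th * exp (M * T) + E * E * (2 * T * th) + E * E * ?S)"
        by (intro ennreal_leI) (simp add: algebra_simps)
      also have "... = ennreal (th * exp (M * T) + E * E * (2 * T * th)) + ennreal (E * E) * ennreal ?S"
        using S0 E1 T th(1) by (simp add: ennreal_plus[symmetric] ennreal_mult[symmetric] del: ennreal_plus)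
      also have "ennreal ?S <= Q y + ennreal (th * T)"
      proof -
        have "ennreal ?S = (\<Sum>k<n. ennreal \<bar>c k y - dd k y\<bar>)" by (simp add: sum_ennreal)
        also have "... <= (\<Sum>k<n. (NN s. ind (?I k) s * q k y s) + ennreal (th * h))"
          by (intro sum_mono cd elim True) auto
        also have "... = Q y + (\<Sum>k<n. ennreal (th * h))" by (simp add: sum.distrib Q_def)
        also have "(\<Sum>k<n. ennreal (th * h)) = ennreal (th * t)"
          using th(1) h0 nh by (simp add: sum_ennreal[symmetric] ennreal_of_nat_eq_real_of_nat ennreal_mult'[symmetric] mult.left_commute)
        also have "Q y + ennreal (th * t) <= Q y + ennreal (th * T)"
          using t0 th(1) by (intro add_left_mono ennreal_leI mult_left_mono) auto
        finally show ?thesis .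
      qed
      also have "ennreal (th * exp (M * T) + E * E * (2 * T * th)) + ennreal (E * E) * (Q y + ennreal (th * T)) = ennreal ?K1 + ennreal (E * E) * Q y"
      proof -
        have "ennreal (th * exp (M * T) + E * E * (2 * T * th)) + ennreal (E * E) * ennreal (th * T) = ennreal ?K1"
          using E1 T th(1) by (simp add: ennreal_plus[symmetric] ennreal_mult[symmetric] algebra_simps del: ennreal_plus)
        then show ?thesis by (simp add: distrib_left)
      qed
      finally show ?thesis using True by (simp add: mult_left_mono add_left_mono)
    next
      case False
      \<comment> \<open>From outside the ball of radius \<open>R1\<close> neither \<open>X t\<close>
        nor \<open>Psi n\<close> reaches the support of \<open>f\<close>; the 1 in \<open>R1\<close>
        covers the distance \<open>kp\<close> between them.\<close>
      have "norm (X t y - y) <= dM" by (rule XT[OF elim t])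
      then have "norm y <= norm (X t y) + dM" using norm_triangle_sub[of y "X t y"] by (simp add: norm_minus_commute)
      then have X: "R0 + 1 < norm (X t y)" using False by (simp add: R1 dM_def)
      moreover have "norm (X t y) <= norm (Psi n y) + 1" using near kp(2) norm_triangle_sub[of "X t y" "Psi n y"] by (simp add: norm_minus_commute)
      ultimately have "f (X t y) = 0" "f (Psi n y) = 0" by (auto intro!: fs)
      then show ?thesis by simp
    qed
  qed
  have Qm [measurable]: "Q : bmb"
    unfolding Q_def
  proof (rule borel_measurable_sum)
    fix k assume "k : {..<n}"
    then have k: "k <= n" by simp
    note [measurable] = qm[OF k]
    show "(%y. \<integral>\<^sup>+s. ind (?I k) s * q k y s \<partial>lborel) : bmb"
      by (rule lborel.borel_measurable_nn_integral) (simp add: case_prod_unfold)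
  qed
  have QI: "(NN y. Q y) <= ennreal (E + L) * ennreal th"
  proof -
    define G where "G = (%s. \<integral>\<^sup>+x. ennreal (e s x) \<partial>lborel)"
    have Gm [measurable]: "G : bmb" unfolding G_def
      by (rule lborel.borel_measurable_nn_integral) (use em in \<open>simp add: case_prod_unfold\<close>)
    have each: "(NN y. (NN s. ind (?I k) s * q k y s)) <= (NN s. ind (?I k) s * (ennreal (E + L) * G s))" if k: "k < n" for k
    proof -
      have k': "k <= n" using k by simp
      note [measurable] = qm[OF k'] transD(1,2)[OF tr[OF k']]
      have sw: "(%z::real \<times> (real^'d). (snd z, fst z)) : bxb \<rightarrow>\<^sub>M bxb" by measurable
      have qm' [measurable]: "(%z. q k (snd z) (fst z)) : borel_measurable bxb" using measurable_compose[OF sw qm[OF k']] by simp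
      have "(NN y. (NN s. ind (?I k) s * q k y s)) = (NN s. (NN y. ind (?I k) s * q k y s))"
        by (rule lborel_pair.Fubini') (simp add: case_prod_unfold)
      also have "... <= (NN s. ind (?I k) s * (ennreal (E + L) * G s))"
      proof (rule nn_integral_mono)
        fix s
        show "(NN y. ind (?I k) s * q k y s) <= ind (?I k) s * (ennreal (E + L) * G s)"
        proof (cases "s : ?I k")
          case True
          have sT: "s : {0..T}" using True kh(1)[of k] kh(2)[of "Suc k"] k t0 by auto
          have [measurable]: "(%x. conv eta (e s) x) : bmb" "e s : bmb"
          proof -
            have "(%x. (s, x)) : borel \<rightarrow>\<^sub>M bxb" by measurable
            from measurable_compose[OF this cem] show "(%x. conv eta (e s) x) : bmb" by simp
            show "e s : bmb" by (rule es)
          qed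
          have "(NN y. q k y s) = (NN y. ennreal (conv eta (e s) (Psi k y))) + (NN y. ennreal (e s (X s y)))"
            unfolding q_def by (rule nn_integral_add) measurable
          also have "... <= ennreal E * G s + ennreal L * G s"
          proof (rule add_mono)
            have "(NN y. ennreal (conv eta (e s) (Psi k y))) <= (NN y. ennreal E * (ennreal (conv eta (e s) (Psi k y)) * ennreal (A k y)))"
            proof (rule nn_integral_mono)
              fix y
              \<comment> \<open>Inserting E times the density can only increase the integrand, and
                then the exact change of variables for \<open>Psi k\<close> is available.\<close>
              have "1 <= E * A k y" using Ab(1)[OF k', of y] E1 by (simp add: divide_le_eq mult.commute)
              then have "1 * conv eta (e s) (Psi k y) <= (E * A k y) * conv eta (e s) (Psi k y)"
                using cn by (intro mult_right_mono) auto
              then have "ennreal (conv eta (e s) (Psi k y)) <= ennreal (E * (conv eta (e s) (Psi k y) * A k y))" by (intro ennreal_leI) (simp add: ac_simps)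
              also have "... = ennreal E * (ennreal (conv eta (e s) (Psi k y)) * ennreal (A k y))"
                using E1 cn transD(3)[OF tr[OF k']] by (simp add: ennreal_mult)
              finally show "ennreal (conv eta (e s) (Psi k y)) <= ennreal E * (ennreal (conv eta (e s) (Psi k y)) * ennreal (A k y))" .
            qed
            also have "... = ennreal E * (NN y. ennreal (conv eta (e s) (Psi k y)) * ennreal (A k y))" by (rule nn_integral_cmult) measurable
            also have "(NN y. ennreal (conv eta (e s) (Psi k y)) * ennreal (A k y)) = (NN x. ennreal (conv eta (e s) x))"
              by (rule trans_nn[OF tr[OF k'], of "%x. ennreal (conv eta (e s) x)"]) measurable
            also have "... = G s" unfolding G_def by (rule nn_integral_conv[OF eta el e0])
            finally show "(NN y. ennreal (conv eta (e s) (Psi k y))) <= ennreal E * G s" .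
            show "(NN y. ennreal (e s (X s y))) <= ennreal L * G s" unfolding G_def by (rule X_nn[OF sT]) measurable
          qed
          also have "... = ennreal (E + L) * G s" using E1 L by (simp add: ennreal_plus distrib_right)
          finally show ?thesis using True by simp
        next
          case False
          then have "ind (?I k) s = (0::ennreal)" by (rule indicator_simps(2))
          then show ?thesis by (simp only: mult_zero_left nn_integral_const order_refl)
        qed
      qed
      finally show ?thesis .
    qed
    have "(NN y. Q y) = (\<Sum>k<n. \<integral>\<^sup>+y. (NN s. ind (?I k) s * q k y s) \<partial>lborel)"
      unfolding Q_def
    proof (rule nn_integral_sum)
      fix k assume "k : {..<n}"
      then have k: "k <= n" by simp
      note [measurable] = qm[OF k]
      show "(%y. \<integral>\<^sup>+s. ind (?I k) s * q k y s \<partial>lborel) : borel_measurable lborel"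
        unfolding measurable_lborel1 by (rule lborel.borel_measurable_nn_integral) (simp add: case_prod_unfold)
    qed
    also have "... <= (\<Sum>k<n. \<integral>\<^sup>+s. ind (?I k) s * (ennreal (E + L) * G s) \<partial>lborel)" by (intro sum_mono each) auto
    also have "... = (NN s. ind {0..real n * h} s * (ennreal (E + L) * G s))" by (rule nn_integral_Icc_sum[OF _ h0]) measurable
    also have "... <= (NN s. ennreal (E + L) * (ind {0..T} s * G s))"
      using t0 unfolding nh by (intro nn_integral_mono) (auto simp: indicator_def)
    also have "... = ennreal (E + L) * (NN s. ind {0..T} s * G s)" by (rule nn_integral_cmult) measurable
    also have "... <= ennreal (E + L) * ennreal th"
    proof (rule mult_left_mono)
      have "G s = (NN x. ind (cball 0 R2) x * ennreal \<bar>D s x - g (s, x)\<bar>)" for s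
        unfolding G_def e_def by (intro nn_integral_cong) (auto simp: indicator_def)
      then show "(NN s. ind {0..T} s * G s) <= ennreal th" using gD by simp
    qed simp
    finally show ?thesis .
  qed
  have "(NN y. ennreal \<bar>f (X t y) * J t y - f (Psi n y) * A n y\<bar>) <= (NN y. ennreal ?K1 * ind (cball 0 R1) y + ennreal (E * E) * Q y)"
    by (rule nn_integral_mono_AE[OF point])
  also have "... = (NN y. ennreal ?K1 * ind (cball (0::real^'d) R1) y) + (NN y. ennreal (E * E) * Q y)"
  proof (rule nn_integral_add)
    have [measurable]: "cball (0::real^'d) R1 : sets borel" by simp
    show "(%y. ennreal ?K1 * ind (cball 0 R1) (y::real^'d)) : borel_measurable lborel" by measurable
    show "(%y. ennreal (E * E) * Q y) : borel_measurable lborel" using Qm by measurable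
  qed
  also have "... = ennreal ?K1 * emeasure lborel (cball (0::real^'d) R1) + ennreal (E * E) * (NN y. Q y)"
    by (simp add: nn_integral_cmult_indicator nn_integral_cmult)
  also have "... <= ennreal ?K1 * emeasure lborel (cball (0::real^'d) R1) + ennreal (E * E) * (ennreal (E + L) * ennreal th)"
    by (intro add_left_mono mult_left_mono QI) simp
  finally show ?thesis using tr[of n] by blast
qed

end

section \<open>Liouville's formula on the torus\<close>

context flow
begin

lemma X_slice [measurable]: "X t : bmb"
proof -
  have "(%x. (t, x)) : borel \<rightarrow>\<^sub>M bxb" by measurable
  from measurable_compose[OF this Xm] show ?thesis by simp
qed

text \<open>The densities of the scheme are exact, so for a bump the two integrals differ by at most
  th K with K independent of the accuracy th; letting th shrink gives equality.\<close>

theorem liouville: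
  assumes t: "t : {0..T}"
  shows "trans (X t) (J t)"
proof (rule trans_of_boxbump[where B = "exp (M * t)" and R = "real CARD('d) * (M * t)"])
  show "X t : bmb" "J t : bmb" by measurable
  show "0 <= J t x" "J t x <= exp (M * t)" for x using J_bounds[of t x] t by auto
  show "AE x in lborel. norm (X t x - x) <= real CARD('d) * (M * t)"
    using AE_good
  proof eventually_elim
    case (elim x)
    show ?case using X_lip[OF elim, of 0 t] X_0[OF elim] t by simp
  qed
  fix l u :: "real^'d" and n :: nat assume lu: "!!j. l $ j < u $ j"
  let ?f = "boxbump l u (real n)"
  have fc: "continuous_on UNIV ?f" by (rule test_fun_continuous[OF boxbump_test_fun[OF lu]])
  have [measurable]: "?f : bmb" by (rule borel_measurable_continuous_onI[OF fc])
  have f01: "0 <= ?f x" "?f x <= 1" for x using boxbump_range[of "real n" l u x] by auto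
  obtain R0 where "!!x. x : box l u ==> norm x <= R0" using bounded_box[of l u] unfolding bounded_iff by blast
  then have fs: "?f x = 0" if "R0 < norm x" for x using boxbump_outside[OF lu, of x] that by fastforce
  have fi: "integrable lborel ?f"
  proof (rule Bochner_Integration.integrable_bound[OF integrable_indicator_bounded[of "box l u"]])
    show "AE x in lborel. norm (?f x) <= norm (ind (box l u) x :: real)"
      using f01 boxbump_outside[OF lu] by (intro AE_I2) (auto simp: indicator_def)
  qed auto
  define E where "E = exp (2 * ((M + 1) * T))"
  define R1 where "R1 = R0 + real CARD('d) * (M * T) + 1"
  define m where "m = measure lborel (cball (0::real^'d) R1)"
  define K where "K = (exp (M * T) + E * E * (3 * T)) * m + E * E * (E + L)"
  have E0: "0 <= E" by (simp add: E_def)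
  have K0: "0 <= K" using E0 L T by (auto simp: K_def m_def intro!: add_nonneg_nonneg mult_nonneg_nonneg)
  have em: "emeasure lborel (cball (0::real^'d) R1) = ennreal m"
    unfolding m_def using emeasure_lborel_cball_finite[of "0::real^'d" R1] by (intro emeasure_eq_ennreal_measure) (simp add: less_top)
  have key: "\<bar>(LBINT x. ?f (X t x) * J t x) - (LBINT x. ?f x)\<bar> <= th * K" if th: "0 < th" "th <= 1" for th
  proof -
    obtain Psi A where tr: "trans Psi A" and b: "(NN y. ennreal \<bar>?f (X t y) * J t y - ?f (Psi y) * A y\<bar>) <=
       ennreal (th * (exp (M * T) + E * E * (3 * T))) * emeasure lborel (cball (0::real^'d) R1) + ennreal (E * E) * (ennreal (E + L) * ennreal th)"
      using flow_approx[OF fc f01 fs t th R1_def E_def] by blast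
    note [measurable] = transD(1,2)[OF tr]
    have "ennreal (th * (exp (M * T) + E * E * (3 * T))) * ennreal m + ennreal (E * E) * (ennreal (E + L) * ennreal th) = ennreal (th * K)"
      using th E0 L T by (simp add: m_def K_def ennreal_mult[symmetric] ennreal_plus[symmetric] algebra_simps del: ennreal_plus)
    with b em have b2: "(NN y. ennreal \<bar>?f (X t y) * J t y - ?f (Psi y) * A y\<bar>) <= ennreal (th * K)" by simp
    have d: "integrable lborel (%y. ?f (X t y) * J t y - ?f (Psi y) * A y)"
    proof (rule integrableI_bounded)
      show "(NN y. ennreal (norm (?f (X t y) * J t y - ?f (Psi y) * A y))) < \<infinity>"
        using le_less_trans[OF b2, of \<infinity>] by simp
    qed measurable
    have g: "integrable lborel (%y. ?f (Psi y) * A y)"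
    proof (rule integrableI_bounded)
      have "(NN y. ennreal (norm (?f (Psi y) * A y))) = (NN y. ennreal (?f (Psi y)) * ennreal (A y))"
        using f01 transD(3)[OF tr] by (intro nn_integral_cong) (simp add: ennreal_mult[symmetric])
      also have "... = (NN x. ennreal (?f x))" by (rule trans_nn[OF tr, of "%x. ennreal (?f x)"]) measurable
      also have "... = ennreal (LBINT x. ?f x)" by (rule nn_integral_eq_integral[OF fi]) (simp add: f01)
      finally show "(NN y. ennreal (norm (?f (Psi y) * A y))) < \<infinity>" by simp
    qed measurable
    have "(LBINT x. ?f (X t x) * J t x) = (LBINT x. (?f (X t x) * J t x - ?f (Psi x) * A x) + ?f (Psi x) * A x)" by simp
    also have "... = (LBINT x. ?f (X t x) * J t x - ?f (Psi x) * A x) + (LBINT x. ?f (Psi x) * A x)"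
      by (rule Bochner_Integration.integral_add[OF d g])
    also have "(LBINT x. ?f (Psi x) * A x) = (LBINT x. ?f x)" by (rule trans_integral[OF tr]) measurable
    finally have e: "(LBINT x. ?f (X t x) * J t x) - (LBINT x. ?f x) = (LBINT x. ?f (X t x) * J t x - ?f (Psi x) * A x)" by simp
    have "ennreal \<bar>\<integral>x. ?f (X t x) * J t x - ?f (Psi x) * A x \<partial>lborel\<bar> <= ennreal (th * K)"
      by (rule order_trans[OF abs_integral_le_nn b2])
    then show ?thesis unfolding e using th K0 by (simp add: ennreal_le_iff)
  qed
  show "(LBINT x. ?f (X t x) * J t x) = (LBINT x. ?f x)"
  proof (rule ccontr)
    let ?r = "\<bar>(LBINT x. ?f (X t x) * J t x) - (LBINT x. ?f x)\<bar>"
    assume "~ ?thesis"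
    then have r: "0 < ?r" by simp
    \<comment> \<open>Makes th K at most half of the alleged difference.\<close>
    define th where "th = min 1 (?r / (2 * (K + 1)))"
    have th: "0 < th" "th <= 1" using r K0 by (auto simp: th_def)
    have "th * K <= ?r / (2 * (K + 1)) * K" using K0 by (intro mult_right_mono) (auto simp: th_def)
    also have "... = ?r * (K / (2 * (K + 1)))" by simp
    also have "... <= ?r * (1 / 2)" using K0 by (intro mult_left_mono) (auto simp: divide_simps)
    finally have "th * K <= ?r * (1 / 2)" .
    with key[OF th] have "?r <= ?r * (1 / 2)" by (rule order_trans)
    then show False using r by simp
  qed
qed

end

section \<open>Equivariance under the lattice\<close>

lemma Icc_integral_continuous:
  fixes g :: "real => real"
  assumes c: "continuous_on {a..b} g"
  shows "integrable lborel (%s. ind {a..b} s * g s)" "(LBINT s. ind {a..b} s * g s) = integral {a..b} g"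
proof -
  have i: "set_integrable lborel {a..b} g"
    unfolding set_integrable_def by (rule borel_integrable_compact[OF compact_Icc c])
  then show "integrable lborel (%s. ind {a..b} s * g s)" by (simp add: set_integrable_def)
  show "(LBINT s. ind {a..b} s * g s) = integral {a..b} g"
    using set_borel_integral_eq_integral(2)[OF i] by (simp add: set_lebesgue_integral_def)
qed

context flow
begin

lemma X_AE:
  assumes s: "s : {0..T}" and P: "AE x in lborel. P x"
  shows "AE y in lborel. P (X s y)"
proof -
  obtain N where N: "{x : space lborel. ~ P x} \<subseteq> N" "emeasure lborel N = 0" "N : sets lborel" using AE_E[OF P] by blast
  have N': "N : sets borel" using N(3) by simp
  show ?thesis
  proof (rule AE_I)
    show "{y : space lborel. ~ P (X s y)} \<subseteq> {y. X s y : N}" using N(1) by auto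
    show "emeasure lborel {y. X s y : N} = 0" using XL[OF s N'] N(2) by simp
    have "X s -` N \<inter> space borel : sets borel" by (rule measurable_sets[OF X_slice N'])
    then show "{y. X s y : N} : sets lborel" by (simp add: vimage_def)
  qed
qed

lemma X_continuous:
  assumes y: "good y"
  shows "continuous_on {0..T} (%t. X t y)"
proof (rule lipschitz_on_continuous_on[where L = "real CARD('d) * M"], rule lipschitz_onI)
  fix a b assume ab: "a : {0..T}" "b : {0..T}"
  show "dist (X a y) (X b y) <= real CARD('d) * M * dist a b"
  proof (cases "a <= b")
    case True
    then show ?thesis using X_lip[OF y, of a b] ab by (simp add: dist_norm norm_minus_commute mult.assoc)
  next
    case False
    then show ?thesis using X_lip[OF y, of b a] ab by (simp add: dist_norm norm_minus_commute mult.assoc)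
  qed
qed (use M in simp)

end

text \<open>Only \<open>u\<close> is assumed periodic, at every point. For \<open>D\<close>,
  \<open>X\<close> and \<open>J\<close> periodicity or equivariance follows almost
  everywhere.\<close>

locale pflow = flow T M C L u D X
  for T M C L :: real and u :: "real => real^'d => real^'d" and D :: "real => real^'d => real" and X :: "real => real^'d => real^'d" +
  assumes up: "!!s x n. u s (x + lat n) = u s x"
begin

text \<open>The field determines its divergence through the pairings with test functions, so the
  divergence inherits the periods.\<close>

lemma D_periodic: "AE x in lborel. D s (x + lat n) = D s x"
proof -
  have l: "lloc (%x. D s (x + lat n) - D s x)" by (intro lloc_diff lloc_translate D_lloc)
  have "AE x in lborel. D s (x + lat n) - D s x = 0"
  proof (rule AE_eq_zero_if_test_integrals_zero[OF l])
    fix psi :: "real^'d => real" assume psi: "test_fun psi"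
    have [measurable]: "psi : bmb" "dpart psi j : bmb" for j
      by (intro borel_measurable_continuous_onI test_fun_continuous test_fun_dpart_continuous psi)+
    note sh = test_fun_shift[OF psi, of "lat n"]
    have "(LBINT x. D s (x + lat n) * psi x) = (LBINT x. D s x * psi (x - lat n))"
      using lborel_integral_translate[of "%x. D s x * psi (x - lat n)" "lat n"] by simp
    also have "... = - (LBINT x. (SUM j:UNIV. u s x $ j * dpart psi j (x - lat n)))"
      using div[of s, unfolded bdiv_def, rule_format, OF sh(1)] by (simp add: sh(2))
    also have "(LBINT x. (SUM j:UNIV. u s x $ j * dpart psi j (x - lat n))) = (LBINT x. (SUM j:UNIV. u s x $ j * dpart psi j x))"
      using lborel_integral_translate[of "%x. SUM j:UNIV. u s x $ j * dpart psi j (x - lat n)" "lat n"] by (simp add: up)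
    also have "- ... = (LBINT x. D s x * psi x)" using div[of s] psi unfolding bdiv_def by simp
    finally have e: "(LBINT x. D s (x + lat n) * psi x) = (LBINT x. D s x * psi x)" .
    have "integrable lborel (%x. D s (x + lat n) * psi x)" "integrable lborel (%x. D s x * psi x)"
      using conv_integrable_test[OF lloc_translate[OF D_lloc] psi, of s "lat n" 0] conv_integrable_test[OF D_lloc psi, of s 0] by auto
    then show "(LBINT x. (D s (x + lat n) - D s x) * psi x) = 0" using e by (simp add: left_diff_distrib)
  qed
  then show ?thesis by simp
qed

text \<open>Uniqueness of trajectories under an Osgood modulus: by periodicity of \<open>u\<close>,
  the translate of a trajectory solves the same equation, and the distance \<open>f\<close>
  satisfies the integral inequality of Osgood's lemma.\<close>

lemma X_periodic: "AE y in lborel. ALL t:{0..T}. X t (y + lat n) = X t y + lat n"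
  using AE_good AE_lborel_translate[OF AE_good, of "lat n"]
proof eventually_elim
  case (elim y)
  let ?d = "real CARD('d)"
  define f where "f = (%t. norm (X t (y + lat n) - X t y - lat n))"
  have fc: "continuous_on {0..T} f" unfolding f_def
    by (intro continuous_intros X_continuous elim)
  have f0: "0 <= f t" for t by (simp add: f_def)
  have lc: "continuous_on {0..t} (%s. ll (f s))" if "t : {0..T}" for t
    by (rule continuous_on_compose2[OF continuous_on_ll continuous_on_subset[OF fc]]) (use that f0 in auto)
  show ?case
  proof
    fix t assume t: "t : {0..T}"
    have "f t = 0"
    proof (rule osgood_continuous[OF fc f0 _ _ t, of "?d * C"])
      show "0 <= ?d * C" using C by simp
      fix t assume t: "t : {0..T}"
      have m: "(%s. u s (X s (y + lat n)) $ j) : bmb" "(%s. u s (X s y) $ j) : bmb" for j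
        by (intro u_along X_time)+
      have ub': "\<bar>u s x $ j\<bar> <= M" for s x j using component_le_norm_cart[of "u s x" j] ub[of s x] by linarith
      have i1: "integrable lborel (%s. ind {0..t} s * u s (X s (y + lat n)) $ j)" "integrable lborel (%s. ind {0..t} s * u s (X s y) $ j)" for j
        using ub' by (auto intro!: indicator_Icc_bounded_integrable[where B = M, OF m(1)] indicator_Icc_bounded_integrable[where B = M, OF m(2)])
      have "\<bar>(X t (y + lat n) - X t y - lat n) $ j\<bar> <= C * integral {0..t} (%s. ll (f s))" for j
      proof -
        have "(X t (y + lat n) - X t y - lat n) $ j = (LBINT s. ind {0..t} s * u s (X s (y + lat n)) $ j) - (LBINT s. ind {0..t} s * u s (X s y) $ j)"
          using elim t by (simp add: good_def)
        also have "... = (LBINT s. ind {0..t} s * u s (X s (y + lat n)) $ j - ind {0..t} s * u s (X s y) $ j)"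
          by (rule Bochner_Integration.integral_diff[OF i1, symmetric])
        also have "\<bar>...\<bar> <= (LBINT s. \<bar>ind {0..t} s * u s (X s (y + lat n)) $ j - ind {0..t} s * u s (X s y) $ j\<bar>)"
          by (rule integral_abs_bound)
        also have "... <= (LBINT s. C * (ind {0..t} s * ll (f s)))"
        proof (rule integral_mono)
          show "integrable lborel (%s. \<bar>ind {0..t} s * u s (X s (y + lat n)) $ j - ind {0..t} s * u s (X s y) $ j\<bar>)"
            by (intro integrable_abs Bochner_Integration.integrable_diff i1)
          show "integrable lborel (%s. C * (ind {0..t} s * ll (f s)))"
            by (intro integrable_mult_right Icc_integral_continuous lc t)
          fix s
          have "\<bar>u s (X s (y + lat n)) $ j - u s (X s y) $ j\<bar> = \<bar>(u s (X s (y + lat n)) - u s (X s y + lat n)) $ j\<bar>" by (simp add: up)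
          also have "... <= norm (u s (X s (y + lat n)) - u s (X s y + lat n))" by (rule component_le_norm_cart)
          also have "... <= C * ll (f s)" using ul[of s "X s (y + lat n)" "X s y + lat n"] by (simp add: f_def diff_diff_eq)
          finally show "\<bar>ind {0..t} s * u s (X s (y + lat n)) $ j - ind {0..t} s * u s (X s y) $ j\<bar> <= C * (ind {0..t} s * ll (f s))"
            by (cases "s : {0..t}") auto
        qed
        also have "... = C * integral {0..t} (%s. ll (f s))" by (simp add: Icc_integral_continuous(2)[OF lc[OF t]])
        finally show ?thesis .
      qed
      from norm_le_card_sup[OF this] show "f t <= ?d * C * integral {0..t} (%s. ll (f s))" by (simp add: f_def mult.assoc)
    qed
    then show "X t (y + lat n) = X t y + lat n" by (simp add: f_def algebra_simps)
  qed
qed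

text \<open>At each time \<open>D\<close> is periodic off a null set, whose preimage under the flow
  is null by bounded compression; Fubini then exchanges the roles of time and starting
  point.\<close>

lemma D_X_periodic: "AE y in lborel. AE s in lborel. s : {0..T} --> D s (X s y + lat n) = D s (X s y)"
proof -
  have sw: "(%z::real \<times> (real^'d). (fst z, X (fst z) (snd z) + lat n)) : bxb \<rightarrow>\<^sub>M bxb" by measurable
  have [measurable]: "(%z. D (fst z) (X (fst z) (snd z) + lat n)) : borel_measurable bxb"
    using measurable_compose[OF sw Dm] by simp
  have s: "{z : space plb. fst z : {0..T} --> D (fst z) (X (fst z) (snd z) + lat n) = D (fst z) (X (fst z) (snd z))} : sets plb"
  proof -
    have "{z : space bxb. fst z : {0..T} --> D (fst z) (X (fst z) (snd z) + lat n) = D (fst z) (X (fst z) (snd z))} : sets bxb"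
      by measurable
    then show ?thesis using sets_pair_measure_cong[OF sets_lborel sets_lborel] by (simp add: space_pair_measure)
  qed
  have "AE s in lborel. AE y in lborel. s : {0..T} --> D s (X s y + lat n) = D s (X s y)"
  proof (rule AE_I2)
    fix s
    show "AE y in lborel. s : {0..T} --> D s (X s y + lat n) = D s (X s y)"
      using X_AE[OF _ D_periodic[of s n], of s] by (cases "s : {0..T}") auto
  qed
  then show ?thesis using lborel_pair.AE_commute[OF s] by simp
qed

lemma J_periodic:
  assumes t: "t : {0..T}"
  shows "AE y in lborel. J t (y + lat n) = J t y"
  using X_periodic[of n] D_X_periodic[of n]
proof eventually_elim
  case (elim y)
  have "(LBINT s. ind {0..t} s * D s (X s (y + lat n))) = (LBINT s. ind {0..t} s * D s (X s y))"
  proof (rule integral_cong_AE)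
    have [measurable]: "(%s. D s (X s z)) : bmb" for z by (rule D_along[OF X_time])
    show "(%s. ind {0..t} s * D s (X s (y + lat n))) : borel_measurable lborel" "(%s. ind {0..t} s * D s (X s y)) : borel_measurable lborel"
      by measurable
    show "AE s in lborel. ind {0..t} s * D s (X s (y + lat n)) = ind {0..t} s * D s (X s y)"
      using elim(2)
    proof eventually_elim
      case (elim s)
      then show ?case using \<open>ALL t:{0..T}. X t (y + lat n) = X t y + lat n\<close> t by (cases "s : {0..t}") auto
    qed
  qed
  then show ?case by (simp add: J_def)
qed

text \<open>The formula on the whole space, applied to a function cut off to the cell, involves the
  preimage of the cell under \<open>X t\<close>; equivariance replaces this preimage by the cell
  itself.\<close>

lemma liouville_hq_nn:
  fixes h :: "real^'d => ennreal"
  assumes t: "t : {0..T}" and [measurable]: "h : bmb" and hp: "!!n. AE x in lborel. h (x + lat n) = h x"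
  shows "(NN y. ind hq y * (h (X t y) * ennreal (J t y))) = (NN x. ind hq x * h x)"
proof -
  have "(NN x. ind hq x * h x) = (NN y. (ind hq (X t y) * h (X t y)) * ennreal (J t y))"
    by (rule trans_nn[OF liouville[OF t], of "%x. ind hq x * h x", symmetric]) measurable
  also have "... = (NN y. ind hq (X t y) * (h (X t y) * ennreal (J t y)))" by (simp add: mult.assoc)
  also have "... = (NN y. ind hq y * (h (X t y) * ennreal (J t y)))"
  proof (rule nn_integral_periodic_change)
    fix n
    show "AE x in lborel. X t (x + lat n) = X t x + lat n" using X_periodic[of n] by eventually_elim (use t in auto)
    show "AE x in lborel. h (X t (x + lat n)) * ennreal (J t (x + lat n)) = h (X t x) * ennreal (J t x)"
      using X_periodic[of n] J_periodic[OF t, of n] X_AE[OF t hp[of n]] by eventually_elim (use t in auto)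
  qed measurable
  finally show ?thesis by simp
qed

lemma liouville_hq:
  fixes h :: "real^'d => real"
  assumes t: "t : {0..T}" and [measurable]: "h : bmb" and B: "!!x. \<bar>h x\<bar> <= B"
    and hp: "!!n. AE x in lborel. h (x + lat n) = h x"
  shows "(LBINT y. ind hq y * (h (X t y) * J t y)) = (LBINT x. ind hq x * h x)"
proof -
  have J: "0 <= J t y" "J t y <= exp (M * t)" for y using J_bounds[of t y] t by auto
  have B0: "0 <= B" using B[of 0] by linarith
  have hqi: "integrable lborel (%x::real^'d. ind hq x * c)" for c :: real
    by (intro integrable_mult_left integrable_indicator_bounded hq_borel bounded_hq)
  have i1: "integrable lborel (%y. ind hq y * (f (X t y) * J t y))" if [measurable]: "f : bmb" and f: "!!x. \<bar>f x\<bar> <= K" for f K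
  proof (rule Bochner_Integration.integrable_bound[OF hqi[of "K * exp (M * t)"]])
    have "\<bar>f (X t y) * J t y\<bar> <= \<bar>K * exp (M * t)\<bar>" for y
    proof -
      have "\<bar>f (X t y) * J t y\<bar> <= K * exp (M * t)" unfolding abs_mult
        using J[of y] f[of "X t y"] by (intro mult_mono) auto
      then show ?thesis by linarith
    qed
    then show "AE y in lborel. norm (ind hq y * (f (X t y) * J t y)) <= norm (ind hq y * (K * exp (M * t)))"
      by (intro AE_I2) (auto simp: indicator_def)
  qed measurable
  have i2: "integrable lborel (%y. ind hq y * f y)" if [measurable]: "f : bmb" and f: "!!x. \<bar>f x\<bar> <= K" for f :: "real^'d => real" and K
  proof (rule Bochner_Integration.integrable_bound[OF hqi[of K]])
    show "AE y in lborel. norm (ind hq y * f y) <= norm (ind hq y * K)"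
      using f order_trans[OF f abs_ge_self] by (intro AE_I2) (auto simp: indicator_def)
  qed measurable
  have pos: "(LBINT y. ind hq y * (f (X t y) * J t y)) = (LBINT x. ind hq x * f x)"
    if [measurable]: "f : bmb" and f: "!!x. 0 <= f x" "!!x. f x <= K" and fp: "!!n. AE x in lborel. f (x + lat n) = f x" for f :: "real^'d => real" and K
  proof -
    have fK: "\<bar>f x\<bar> <= K" for x using f[of x] by simp
    have "ennreal (LBINT y. ind hq y * (f (X t y) * J t y)) = (NN y. ennreal (ind hq y * (f (X t y) * J t y)))"
      by (rule nn_integral_eq_integral[OF i1[OF that(1) fK], symmetric]) (use f J in auto)
    also have "... = (NN y. ind hq y * (ennreal (f (X t y)) * ennreal (J t y)))"
      using f J by (intro nn_integral_cong) (auto simp: indicator_def ennreal_mult)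
    also have "... = (NN x. ind hq x * ennreal (f x))"
    proof (rule liouville_hq_nn[OF t, of "%x. ennreal (f x)"])
      show "AE x in lborel. ennreal (f (x + lat n)) = ennreal (f x)" for n using fp[of n] by eventually_elim simp
    qed measurable
    also have "... = (NN x. ennreal (ind hq x * f x))"
      by (intro nn_integral_cong) (auto simp: indicator_def)
    also have "... = ennreal (LBINT x. ind hq x * f x)"
      by (rule nn_integral_eq_integral[OF i2[OF that(1) fK]]) (use f in auto)
    finally have "ennreal (LBINT y. ind hq y * (f (X t y) * J t y)) = ennreal (LBINT x. ind hq x * f x)" .
    then show ?thesis
      by (subst (asm) ennreal_inj) (auto intro!: integral_nonneg_AE simp: f J)
  qed
  have p1: "(LBINT y. ind hq y * ((h (X t y) + B) * J t y)) = (LBINT x. ind hq x * (h x + B))"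
  proof (rule pos[of "%x. h x + B" "2 * B"])
    show "0 <= h x + B" "h x + B <= 2 * B" for x using B[of x] by auto
    show "AE x in lborel. h (x + lat n) + B = h x + B" for n using hp[of n] by eventually_elim simp
  qed measurable
  have p2: "(LBINT y. ind hq y * (B * J t y)) = (LBINT x. ind (hq :: (real^'d) set) x * B)"
    by (rule pos[of "%x. B" B]) (use B0 in auto)
  have "(LBINT y. ind hq y * ((h (X t y) + B) * J t y)) = (LBINT y. ind hq y * (h (X t y) * J t y) + ind hq y * (B * J t y))"
    by (simp add: algebra_simps)
  also have "... = (LBINT y. ind hq y * (h (X t y) * J t y)) + (LBINT y. ind hq y * (B * J t y))"
    using i1[OF assms(2) B] i1[of "%x. B" B] B0 by (intro Bochner_Integration.integral_add) auto
  finally have q1: "(LBINT y. ind hq y * (h (X t y) * J t y)) = (LBINT x. ind hq x * (h x + B)) - (LBINT x. ind (hq :: (real^'d) set) x * B)"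
    using p1 p2 by simp
  have "(LBINT x. ind hq x * (h x + B)) = (LBINT x. ind hq x * h x + ind hq x * B)" by (simp add: algebra_simps)
  also have "... = (LBINT x. ind hq x * h x) + (LBINT x. ind (hq :: (real^'d) set) x * B)"
    by (intro Bochner_Integration.integral_add i2[OF assms(2) B] hqi)
  finally show ?thesis using q1 by simp
qed

end

text \<open>The mean of a periodic function over a cell is translation invariant, so a correlation
  only multiplies it by the mass of the kernel. That mass is 1 for a mollifier and 0 for its partial
  derivatives.\<close>

lemma conv_hq_integral:
  fixes f h :: "real^'d => real"
  assumes f [measurable]: "f : bmb" and fB: "!!x. \<bar>f x\<bar> <= B" and fp: "!!n. AE x in lborel. f (x + lat n) = f x"
    and h [measurable]: "h : bmb" and hB: "!!x. \<bar>h x\<bar> <= K" and hR: "!!x. R < norm x ==> h x = 0"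
  shows "integrable lborel (%p. ind hq p * conv h f p)"
    and "(LBINT p. ind hq p * conv h f p) = (LBINT q. h q) * (LBINT x. ind hq x * f x)"
proof -
  have hi: "integrable lborel h"
  proof (rule Bochner_Integration.integrable_bound)
    show "integrable lborel (%x::real^'d. ind (cball 0 R) x * K)"
      by (intro integrable_mult_left integrable_indicator_bounded) auto
    show "AE x in lborel. norm (h x) <= norm (ind (cball 0 R) x * K)"
      using hB hR order_trans[OF hB abs_ge_self] by (intro AE_I2) (auto simp: indicator_def)
  qed measurable
  have cm [measurable]: "conv h f : bmb" unfolding conv_def
    by (rule lborel.borel_measurable_lebesgue_integral) (simp add: case_prod_unfold)
  let ?c = "B * (LBINT p. \<bar>h p\<bar>)"
  show "integrable lborel (%p. ind hq p * conv h f p)"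
  proof (rule Bochner_Integration.integrable_bound)
    show "integrable lborel (%x::real^'d. ind hq x * ?c)"
      by (intro integrable_mult_left integrable_indicator_bounded hq_borel bounded_hq)
    show "AE p in lborel. norm (ind hq p * conv h f p) <= norm (ind hq p * ?c)"
      using order_trans[OF conv_bound[OF hi f fB] abs_ge_self] by (intro AE_I2) (auto simp: indicator_def)
  qed measurable
  have cv: "conv h f p = (LBINT q. h q * f (q + p))" for p
    using lborel_integral_translate[of "%x. f x * h (x - p)" p] by (simp add: conv_def mult.commute)
  obtain R' where R': "!!x. x : (hq :: (real^'d) set) ==> norm x <= R'" using bounded_hq unfolding bounded_iff by blast
  have fl: "lloc f" using fB by (intro lloc_bounded[OF f]) blast
  have "(LBINT p. ind hq p * conv h f p) = (LBINT p. ind hq p * (LBINT q. h q * f (q + p + 0)))" by (simp add: cv)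
  also have "... = (LBINT q. h q * (LBINT p. ind hq p * f (q + p + 0)))"
  proof (rule conv_fubini[OF fl, where B = "max 1 K" and R = "max R R'"])
    show "\<bar>ind hq x\<bar> <= max 1 K" for x :: "real^'d" by (simp add: indicator_def le_max_iff_disj)
    show "\<bar>h x\<bar> <= max 1 K" for x using hB[of x] by (simp add: le_max_iff_disj)
    show "ind hq x = (0::real)" if "max R R' < norm x" for x :: "real^'d" using R'[of x] that by (auto simp: indicator_def)
    show "h x = 0" if "max R R' < norm x" for x using hR[of x] that by simp
  qed measurable
  also have "... = (LBINT q. h q * (LBINT x. ind hq x * f x))"
    using integral_periodic_shift[OF f fB fp] by (simp add: add.commute)
  finally show "(LBINT p. ind hq p * conv h f p) = (LBINT q. h q) * (LBINT x. ind hq x * f x)" by simp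
qed

section \<open>Integration by parts for periodic functions\<close>

lemma test_fun_bounded_support:
  fixes psi :: "real^'d => real"
  assumes psi: "test_fun psi"
  shows "EX K R. (ALL x. \<bar>psi x\<bar> <= K) & (ALL x j. \<bar>dpart psi j x\<bar> <= K) & (ALL x. R < norm x --> psi x = 0) & (ALL x j. R < norm x --> dpart psi j x = 0)"
proof -
  obtain S where S: "compact S" "!!x. x ~: S ==> psi x = 0" "!!x j. x ~: S ==> dpart psi j x = 0" using test_funE[OF psi] by blast
  obtain R where R: "!!x. x : S ==> norm x <= R" using compact_imp_bounded[OF S(1)] unfolding bounded_iff by blast
  have b: "EX K. ALL x. \<bar>f x\<bar> <= K" if c: "continuous_on UNIV f" and z: "!!x. x ~: S ==> f x = 0" for f :: "real^'d => real"
  proof -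
    have "bounded (f ` S)" by (rule compact_imp_bounded[OF compact_continuous_image[OF continuous_on_subset[OF c subset_UNIV] S(1)]])
    then obtain K where K: "!!x. x : S ==> \<bar>f x\<bar> <= K" unfolding bounded_iff by auto
    have "\<bar>f x\<bar> <= max K 0" for x using K[of x] z[of x] by (cases "x : S") auto
    then show ?thesis by blast
  qed
  obtain K0 where K0: "!!x. \<bar>psi x\<bar> <= K0" using b[OF test_fun_continuous[OF psi] S(2)] by blast
  have "ALL j. EX K. ALL x. \<bar>dpart psi j x\<bar> <= K" using b[OF test_fun_dpart_continuous[OF psi] S(3)] by blast
  then obtain K1 where K1: "!!j x. \<bar>dpart psi j x\<bar> <= K1 j" by metis
  have K1p: "0 <= K1 j" for j using K1[of j 0] by linarith
  have K00: "0 <= K0" using K0[of 0] by linarith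
  define K where "K = K0 + (SUM j:UNIV. K1 j)"
  have "K1 j <= K" for j
  proof -
    have "K1 j <= (SUM j:UNIV. K1 j)" by (rule member_le_sum) (auto simp: K1p)
    then show ?thesis using K00 by (simp add: K_def)
  qed
  moreover have "K0 <= K" using sum_nonneg[of UNIV K1] K1p by (simp add: K_def)
  ultimately have "(ALL x. \<bar>psi x\<bar> <= K) & (ALL x j. \<bar>dpart psi j x\<bar> <= K)" using K0 K1 order_trans by blast
  moreover have "x ~: S" if "R < norm x" for x using R[of x] that by auto
  ultimately show ?thesis using S(2,3) by blast
qed

lemma sum_axis: "(SUM i:UNIV. axis j (1::real) $ i * a i) = a j"
proof -
  have "axis j (1::real) $ i * a i = (if i = j then a i else 0)" for i by (simp add: axis_def)
  then show ?thesis by simp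
qed

text \<open>The weak divergence is tested with compact supports, while \<open>psi\<close> is
  periodic. So \<open>psi\<close> is localised by a mollifier around p, and the resulting identity
  is averaged over p in the cell; the terms created by the localisation disappear because the
  derivatives of the mollifier have integral 0.\<close>

lemma torus_integration_by_parts:
  fixes U :: "real^'d => real^'d" and D psi :: "real^'d => real" and W :: "'d => real^'d => real"
  assumes U [measurable]: "!!j. (%x. U x $ j) : bmb" and Ub: "!!x j. \<bar>U x $ j\<bar> <= B" and Up: "!!x n. U (x + lat n) = U x"
    and D [measurable]: "D : bmb" and Db: "!!x. \<bar>D x\<bar> <= B" and Dp: "!!n. AE x in lborel. D (x + lat n) = D x"
    and div: "bdiv U D"
    and der: "!!x. (psi has_derivative (%h. SUM j:UNIV. h $ j * W j x)) (at x)" and Wc: "!!j. continuous_on UNIV (W j)"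
    and Wb: "!!j x. \<bar>W j x\<bar> <= B" and Wp: "!!j x n. W j (x + lat n) = W j x"
    and psib: "!!x. \<bar>psi x\<bar> <= B" and psip: "!!x n. psi (x + lat n) = psi x"
  shows "(LBINT x. ind hq x * (SUM j:UNIV. U x $ j * W j x)) = - (LBINT x. ind hq x * (D x * psi x))"
proof -
  have psic: "continuous_on UNIV psi" using der by (meson continuous_at_imp_continuous_on has_derivative_continuous)
  have [measurable]: "psi : bmb" "W j : bmb" for j
    by (intro borel_measurable_continuous_onI psic Wc)+
  obtain eta :: "real^'d => real" where eta: "mollifier 1 eta" using mollifier_exists[of 1] unfolding mollifier_def by auto
  note etaD = mollifierD[OF eta]
  obtain K R where KR0: "ALL x. \<bar>eta x\<bar> <= K" "ALL x j. \<bar>dpart eta j x\<bar> <= K" "ALL x. R < norm x --> eta x = 0" "ALL x j. R < norm x --> dpart eta j x = 0"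
    using test_fun_bounded_support[OF etaD(1)] by (elim exE conjE) (rule that)
  note KR = KR0[rule_format]
  have etam [measurable]: "eta : bmb" "dpart eta j : bmb" for j
    by (intro borel_measurable_continuous_onI test_fun_continuous test_fun_dpart_continuous etaD(1))+
  have B0: "0 <= B" using psib[of 0] by linarith
  define F1 where "F1 = (%x. SUM j:UNIV. U x $ j * W j x)"
  define F2 where "F2 = (%j x. U x $ j * psi x)"
  define F3 where "F3 = (%x. D x * psi x)"
  have m: "F1 : bmb" "F2 j : bmb" "F3 : bmb" for j
    unfolding F1_def F2_def F3_def by measurable
  let ?B = "real CARD('d) * (B * B)"
  have b2: "\<bar>F2 j x\<bar> <= B * B" "\<bar>F3 x\<bar> <= B * B" for j x
    unfolding F2_def F3_def abs_mult using Ub psib Db B0 by (intro mult_mono; auto)+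
  have b1: "\<bar>F1 x\<bar> <= ?B" for x
  proof -
    have "\<bar>F1 x\<bar> <= (SUM j:UNIV. \<bar>U x $ j * W j x\<bar>)" unfolding F1_def by (rule sum_abs)
    also have "... <= (SUM j:(UNIV::'d set). B * B)" unfolding abs_mult using Ub Wb B0 by (intro sum_mono mult_mono) auto
    finally show ?thesis by simp
  qed
  have p: "AE x in lborel. F1 (x + lat n) = F1 x" "AE x in lborel. F2 j (x + lat n) = F2 j x" for n j
    by (simp_all add: F1_def F2_def Up Wp psip)
  have p3: "AE x in lborel. F3 (x + lat n) = F3 x" for n using Dp[of n] by eventually_elim (simp add: F3_def psip)
  have l: "lloc F1" "lloc (F2 j)" "lloc F3" for j
    using b1 b2 by (intro lloc_bounded m; blast)+
  have eq: "conv eta F1 p + (SUM j:UNIV. conv (dpart eta j) (F2 j) p) = - conv eta F3 p" for p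
  proof -
    let ?\<chi> = "%x. eta (x - p) * psi x"
    let ?D = "%x h. eta (x - p) * (SUM j:UNIV. h $ j * W j x) + (SUM j:UNIV. h $ j * dpart eta j (x - p)) * psi x"
    have d: "(?\<chi> has_derivative ?D x) (at x)" for x
      using has_derivative_mult[OF test_fun_has_derivative[OF test_fun_shift(1)[OF etaD(1)]] der, of p x]
      by (simp add: test_fun_shift(2)[OF etaD(1)])
    have ax: "?D x (axis j 1) = eta (x - p) * W j x + dpart eta j (x - p) * psi x" for x j by (simp only: sum_axis)
    have t: "test_fun ?\<chi>"
    proof (rule test_funI[OF compact_cball[of p R] _ d])
      show "eta (x - p) * psi x = 0" if "x ~: cball p R" for x
        using KR(3)[of "x - p"] that by (simp add: dist_norm norm_minus_commute)
      show "continuous_on UNIV (%x. ?D x (axis j 1))" for j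
        unfolding ax by (intro continuous_intros continuous_on_compose2[OF test_fun_continuous[OF etaD(1)]] continuous_on_compose2[OF test_fun_dpart_continuous[OF etaD(1)]] psic Wc) auto
    qed
    have dp: "dpart ?\<chi> j x = eta (x - p) * W j x + dpart eta j (x - p) * psi x" for j x
      using has_derivative_imp_dpart[OF d] ax by simp
    have "(LBINT x. (SUM j:UNIV. U x $ j * dpart ?\<chi> j x)) = - (LBINT x. D x * ?\<chi> x)"
      using div t unfolding bdiv_def by blast
    also have "(LBINT x. D x * ?\<chi> x) = conv eta F3 p" unfolding conv_def F3_def by (simp add: ac_simps)
    also have "(%x. SUM j:UNIV. U x $ j * dpart ?\<chi> j x) = (%x. F1 x * eta (x - p) + (SUM j:UNIV. F2 j x * dpart eta j (x - p)))"
      unfolding dp F1_def F2_def by (rule ext) (simp add: sum.distrib sum_distrib_left sum_distrib_right distrib_left ac_simps)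
    also have "(LBINT x. F1 x * eta (x - p) + (SUM j:UNIV. F2 j x * dpart eta j (x - p))) = conv eta F1 p + (SUM j:UNIV. conv (dpart eta j) (F2 j) p)"
      unfolding conv_def using conv_integrable_test[OF l(1) etaD(1)] conv_integrable_dpart[OF l(2) etaD(1)] by simp
    finally show ?thesis .
  qed
  have c1: "integrable lborel (%p. ind hq p * conv eta F1 p)" "(LBINT p. ind hq p * conv eta F1 p) = (LBINT q. eta q) * (LBINT x. ind hq x * F1 x)"
    by (rule conv_hq_integral[where R = R, OF m(1) b1 p(1) etam(1) KR(1) KR(3)], assumption)+
  have c2: "integrable lborel (%p. ind hq p * conv (dpart eta j) (F2 j) p)" "(LBINT p. ind hq p * conv (dpart eta j) (F2 j) p) = (LBINT q. (dpart eta j) q) * (LBINT x. ind hq x * (F2 j) x)" for j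
    by (rule conv_hq_integral[where R = R, OF m(2) b2(1) p(2) etam(2) KR(2) KR(4)], assumption)+
  have c3: "integrable lborel (%p. ind hq p * conv eta F3 p)" "(LBINT p. ind hq p * conv eta F3 p) = (LBINT q. eta q) * (LBINT x. ind hq x * F3 x)"
    by (rule conv_hq_integral[where R = R, OF m(3) b2(2) p3 etam(1) KR(1) KR(3)], assumption)+
  have c2s: "integrable lborel (%p. SUM j:UNIV. ind hq p * conv (dpart eta j) (F2 j) p)"
    by (intro Bochner_Integration.integrable_sum c2(1))
  have "(LBINT x. ind hq x * F1 x) = (LBINT p. ind hq p * conv eta F1 p) + (SUM j:UNIV. \<integral>p. ind hq p * conv (dpart eta j) (F2 j) p \<partial>lborel)"
    unfolding c1(2) c2(2) by (simp add: etaD(3) integral_dpart_zero[OF etaD(1)])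
  also have "... = (LBINT p. ind hq p * conv eta F1 p + (SUM j:UNIV. ind hq p * conv (dpart eta j) (F2 j) p))"
    by (simp only: Bochner_Integration.integral_add[OF c1(1) c2s] Bochner_Integration.integral_sum[OF c2(1)])
  also have "... = (LBINT p. - (ind hq p * conv eta F3 p))"
    by (rule arg_cong[where f = "integral\<^sup>L lborel"], rule ext) (simp add: sum_distrib_left[symmetric] distrib_left[symmetric] eq)
  also have "... = - (LBINT x. ind hq x * F3 x)" using c3(2) by (simp add: etaD(3))
  finally show ?thesis by (simp add: F1_def F3_def)
qed

section \<open>The energy estimate\<close>

lemma crep_periodic:
  fixes f :: "real^'d => real"
  assumes [measurable]: "f : bmb" and p: "AE x in lborel. f (x + k) = f x"
  shows "crep f (x + k) = crep f x"
proof -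
  have "(LBINT p. ind (cu rh) p * f (p + (x + k))) = (LBINT p. ind (cu rh) p * f (p + x))" for rh
  proof (rule integral_cong_AE)
    have [measurable]: "(cu rh :: (real^'d) set) : sets borel" by (simp add: cu_def)
    show "(%p. ind (cu rh) p * f (p + (x + k))) : borel_measurable lborel" "(%p. ind (cu rh) p * f (p + x)) : borel_measurable lborel"
      by measurable
    show "AE p in lborel. ind (cu rh) p * f (p + (x + k)) = ind (cu rh) p * f (p + x)"
      using AE_lborel_translate[OF p, of x] by eventually_elim (simp add: add.assoc)
  qed
  then show ?thesis by (simp add: crep_def cavg_def)
qed

lemma lat_periodic_bounded:
  fixes psi :: "real^'d => real"
  assumes c: "continuous_on UNIV psi" and p: "!!x n. psi (x + lat n) = psi x"
  shows "EX B. ALL x. \<bar>psi x\<bar> <= B"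
proof -
  have "compact (closure (hq :: (real^'d) set))" using bounded_hq by (simp add: compact_closure)
  then have "bounded (psi ` closure hq)"
    by (intro compact_imp_bounded compact_continuous_image[OF continuous_on_subset[OF c subset_UNIV]])
  then obtain B where B: "!!x. x : hq ==> \<bar>psi x\<bar> <= B" using closure_subset[of hq] unfolding bounded_iff by fastforce
  have "\<bar>psi x\<bar> <= B" for x
  proof -
    obtain n where "x + lat n : hq" using hq_translate_unique(2)[of x] by blast
    then show ?thesis using B[of "x + lat n"] p by simp
  qed
  then show ?thesis by blast
qed

lemma ll_tendsto_0: "((%h::'a::real_normed_vector. K * ll (norm h)) \<longlongrightarrow> 0) (at 0)"
proof (rule Lim_null_comparison)
  show "eventually (%h::'a. norm (K * ll (norm h)) <= \<bar>K\<bar> * (norm h + 2 * sqrt (norm h))) (at 0)"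
  proof (rule always_eventually, rule allI)
    fix h :: 'a
    have "\<bar>ll (norm h)\<bar> <= norm h + 2 * sqrt (norm h)" using ll_le_sqrt[of "norm h"] ll_nonneg[of "norm h"] by simp
    then have "\<bar>K\<bar> * \<bar>ll (norm h)\<bar> <= \<bar>K\<bar> * (norm h + 2 * sqrt (norm h))" by (rule mult_left_mono) simp
    then show "norm (K * ll (norm h)) <= \<bar>K\<bar> * (norm h + 2 * sqrt (norm h))" by (simp add: abs_mult)
  qed
  have "((%h::'a. \<bar>K\<bar> * (norm h + 2 * sqrt (norm h))) \<longlongrightarrow> \<bar>K\<bar> * (norm (0::'a) + 2 * sqrt (norm (0::'a)))) (at 0)"
    by (intro tendsto_intros)
  then show "((%h::'a. \<bar>K\<bar> * (norm h + 2 * sqrt (norm h))) \<longlongrightarrow> 0) (at 0)" by simp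
qed

lemma log_lipschitz_continuous:
  fixes f :: "'a::real_normed_vector => 'b::real_normed_vector"
  assumes l: "!!x y. norm (f x - f y) <= K * ll (norm (x - y))"
  shows "continuous_on UNIV f"
proof (intro continuous_at_imp_continuous_on ballI)
  fix x :: 'a
  have "((%h. f (x + h) - f x) \<longlongrightarrow> 0) (at 0)"
    by (rule Lim_null_comparison[OF _ ll_tendsto_0[of K]]) (use l[of "x + _" x] in \<open>auto intro!: always_eventually\<close>)
  then have "((%h. f (x + h)) \<longlongrightarrow> f x) (at 0)" by (simp add: LIM_zero_iff)
  then show "isCont f x" by (simp add: isCont_iff)
qed

lemma ll_measurable [measurable]: "ll : bmb"
  unfolding ll_def[abs_def] by measurable

lemma hq_integrable:
  fixes f :: "real^'d => real"
  assumes [measurable]: "f : bmb" and b: "AE x in lborel. \<bar>f x\<bar> <= K"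
  shows "integrable lborel (%x. ind hq x * f x)"
proof (rule Bochner_Integration.integrable_bound)
  show "integrable lborel (%x::real^'d. ind hq x * K)"
    by (intro integrable_mult_left integrable_indicator_bounded hq_borel bounded_hq)
  show "AE x in lborel. norm (ind hq x * f x) <= norm (ind hq x * K)"
    using b by eventually_elim (auto simp: indicator_def)
qed measurable

lemma hq_integral_const: "(LBINT x. ind (hq :: (real^'d) set) x * c) = (c::real)"
  by (simp add: measure_hq)

text \<open>The tangent line at the mean \<open>?E\<close> lies above \<open>ll\<close> and is
  integrated over the cell, which has measure 1. If the mean is 0 there is no tangent line, but then
  \<open>g\<close> vanishes almost everywhere on the cell.\<close>

lemma jensen_ll_hq:
  fixes g :: "real^'d => real"
  assumes [measurable]: "g : bmb" and g0: "!!x. 0 <= g x" and gi: "integrable lborel (%x. ind hq x * g x)"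
  shows "integrable lborel (%x. ind hq x * ll (g x))"
    and "(LBINT x. ind hq x * ll (g x)) <= ll (LBINT x. ind hq x * g x)"
proof -
  let ?E = "\<integral>x. ind hq x * g x \<partial>lborel"
  have hqi: "integrable lborel (%x::real^'d. ind hq x * c)" for c :: real
    by (intro integrable_mult_left integrable_indicator_bounded hq_borel bounded_hq)
  show i: "integrable lborel (%x. ind hq x * ll (g x))"
  proof (rule Bochner_Integration.integrable_bound)
    show "integrable lborel (%x. 2 * (ind hq x * g x) + ind hq x * 1)"
      by (intro Bochner_Integration.integrable_add integrable_mult_right gi hqi)
    have "ll (g x) <= 2 * g x + 1" for x
    proof -
      have "0 <= (sqrt (g x) - 1)\<^sup>2" by simp
      then have "2 * sqrt (g x) <= g x + 1" using g0[of x] by (simp add: power2_diff)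
      then show ?thesis using ll_le_sqrt[OF g0[of x]] by linarith
    qed
    then show "AE x in lborel. norm (ind hq x * ll (g x)) <= norm (2 * (ind hq x * g x) + ind hq x * 1)"
      using ll_nonneg[OF g0] g0 by (intro AE_I2) (auto simp: indicator_def)
  qed measurable
  have E0: "0 <= ?E" by (rule integral_nonneg_AE) (simp add: g0)
  show "(LBINT x. ind hq x * ll (g x)) <= ll ?E"
  proof (cases "?E = 0")
    case True
    then have "AE x in lborel. ind hq x * g x = 0"
      using integral_nonneg_eq_0_iff_AE[OF gi] g0 by simp
    then have "AE x in lborel. ind hq x * ll (g x) = 0" by eventually_elim auto
    then have "(LBINT x. ind hq x * ll (g x)) = (\<integral>x. 0 \<partial>(lborel :: (real^'d) measure))" by (intro integral_cong_AE) auto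
    then show ?thesis using True by simp
  next
    case False
    then have E: "0 < ?E" using E0 by simp
    let ?c = "1 + ln (1 + 1 / ?E)" and ?q = "1 / (?E + 1)"
    have "(LBINT x. ind hq x * ll (g x)) <= (LBINT x. (?c - ?q) * (ind hq x * g x) + ind hq x * (?E * ?q))"
    proof (rule integral_mono[OF i])
      show "integrable lborel (%x. (?c - ?q) * (ind hq x * g x) + ind hq x * (?E * ?q))"
        by (intro Bochner_Integration.integrable_add integrable_mult_right gi hqi)
      fix x
      have "ll (g x) <= (?c - ?q) * g x + ?E * ?q" using ll_le_tangent[OF g0[of x] E] by (simp add: algebra_simps diff_divide_distrib)
      then show "ind hq x * ll (g x) <= (?c - ?q) * (ind hq x * g x) + ind hq x * (?E * ?q)"
        by (cases "x : hq") auto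
    qed
    also have "... = (?c - ?q) * ?E + ?E * ?q"
      by (subst Bochner_Integration.integral_add[OF integrable_mult_right[OF gi] hqi]) (simp only: integral_mult_right_zero hq_integral_const)
    also have "... = ll ?E" by (simp add: ll_def algebra_simps)
    finally show ?thesis .
  qed
qed

text \<open>A bounded gradient gives the potential a pointwise representative, and the modulus of
  the gradient makes it C^1 with a remainder of order |z| \<open>ll\<close> |z|. The 2 in 2 C comes
  from \<open>ll_scale\<close>: the gradient is compared within distance 2 |z|, the slack of
  \<open>crep_taylor\<close> being |z|.\<close>

lemma potential_representative:
  fixes phi :: "real^'d => real" and w :: "real^'d => real^'d"
  assumes phi: "lloc phi" and phip: "!!n. AE x in lborel. phi (x + lat n) = phi x" and phiw: "!!j. bweak phi j (%x. w x $ j)"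
    and wm: "!!j. (%x. w x $ j) : bmb" and wb: "!!x. norm (w x) <= B" and C: "0 <= C"
    and wl: "!!x y. norm (w x - w y) <= C * ll (norm (x - y))"
  shows "EX psi. (ALL x z. \<bar>psi (x + z) - psi x - (SUM j:UNIV. z $ j * w x $ j)\<bar> <= real CARD('d) * (2 * C * (norm z * ll (norm z)))) &
    (ALL x. (psi has_derivative (%h. SUM j:UNIV. h $ j * w x $ j)) (at x)) & (ALL x n. psi (x + lat n) = psi x)"
proof -
  let ?d = "real CARD('d)"
  have wb': "\<bar>w x $ j\<bar> <= B" for x j using component_le_norm_cart[of "w x" j] wb[of x] by linarith
  have wll: "lloc (%x. w x $ j)" for j using wb' by (intro lloc_bounded wm) blast
  have d: "cdini (?d * B) phi" by (rule bounded_gradient_cdini[OF phi wll phiw wb'])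
  have T: "\<bar>crep phi (x + z) - crep phi x - (SUM j:UNIV. z $ j * w x $ j)\<bar> <= ?d * (2 * C * (norm z * ll (norm z)))" for x z
  proof (cases "z = 0")
    case False
    then have z: "0 < norm z" by simp
    have "\<bar>crep phi (x + z) - crep phi x - (SUM j:UNIV. z $ j * w x $ j)\<bar> <= (SUM j:UNIV. \<bar>z $ j\<bar> * (C * (2 * ll (norm z))))"
    proof (rule crep_taylor[OF d wll phiw _ z, where W = "%j x. w x $ j"])
      fix j p assume p: "norm (p - x) <= norm z + norm z"
      have "\<bar>w p $ j - w x $ j\<bar> <= norm (w p - w x)" using component_le_norm_cart[of "w p - w x" j] by simp
      also have "... <= C * ll (norm (p - x))" by (rule wl)
      also have "... <= C * ll (2 * norm z)" using p C by (intro mult_left_mono ll_mono) auto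
      also have "... <= C * (2 * ll (norm z))" using C by (intro mult_left_mono ll_scale) auto
      finally show "\<bar>w p $ j - w x $ j\<bar> <= C * (2 * ll (norm z))" .
    qed simp
    also have "... <= (SUM j:(UNIV::'d set). norm z * (C * (2 * ll (norm z))))"
      using C ll_nonneg[of "norm z"] by (intro sum_mono mult_right_mono component_le_norm_cart) auto
    finally show ?thesis by (simp add: algebra_simps)
  qed simp
  have "(crep phi has_derivative (%h. SUM j:UNIV. h $ j * w x $ j)) (at x)" for x
    unfolding has_derivative_at
  proof
    show "bounded_linear (%h. SUM j:UNIV. h $ j * w x $ j)"
      by (intro bounded_linear_sum bounded_linear_mult_const bounded_linear_vec_nth)
    show "(%h. norm (crep phi (x + h) - crep phi x - (SUM j:UNIV. h $ j * w x $ j)) / norm h) \<midarrow>0\<rightarrow> 0"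
    proof (rule Lim_null_comparison[OF _ ll_tendsto_0[of "?d * (2 * C)"]])
      have "norm (norm (crep phi (x + h) - crep phi x - (SUM j:UNIV. h $ j * w x $ j)) / norm h) <= ?d * (2 * C) * ll (norm h)" for h
        using T[of x h] C ll_nonneg[of "norm h"] by (cases "h = 0") (auto simp: divide_le_eq algebra_simps)
      then show "\<forall>\<^sub>F h in at 0. norm (norm (crep phi (x + h) - crep phi x - (SUM j:UNIV. h $ j * w x $ j)) / norm h) <= ?d * (2 * C) * ll (norm h)"
        by (rule always_eventually[OF allI])
    qed
  qed
  moreover have "crep phi (x + lat n) = crep phi x" for x n by (rule crep_periodic[OF lloc_borel[OF phi] phip])
  ultimately show ?thesis using T by blast
qed

text \<open>Both flows use the same constants, which is achieved by enlarging bounds.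
  \<open>DX\<close> is the coupling through the common \<open>\<sigma>\<close>, and
  \<open>pot\<close> records that the difference of the fields is a gradient.\<close>

locale flow_pair = F1: pflow T M C L u1 D1 X1 + F2: pflow T M C L u2 D2 X2
  for T M C L :: real and u1 u2 :: "real => real^'d => real^'d" and D1 D2 :: "real => real^'d => real" and X1 X2 :: "real => real^'d => real^'d" +
  assumes DX: "AE s in lborel. AE y in lborel. s : {0..T} --> y : hq --> D1 s (X1 s y) = D2 s (X2 s y)"
    and pot: "AE s in lborel. s : {0..T} --> (EX phi. lloc phi & (ALL n. AE x in lborel. phi (x + lat n) = phi x) & (ALL j. bweak phi j (%x. (u1 s x - u2 s x) $ j)))"
begin

definition nw :: "real => real^'d => real" where "nw s x = norm (u1 s x - u2 s x)"
definition r :: "real => real^'d => real" where "r s y = norm (X1 s y - X2 s y)"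
definition W2 :: "real => real" where "W2 s = (LBINT x. ind hq x * (nw s x)\<^sup>2)"
definition E :: "real => real" where "E s = (LBINT y. ind hq y * (r s y)\<^sup>2)"

lemma pair_slice: "(%x. (s, x)) : borel \<rightarrow>\<^sub>M bxb" by measurable

lemma u_slices [measurable]: "u1 s : bmb" "u2 s : bmb"
  using measurable_compose[OF pair_slice F1.um] measurable_compose[OF pair_slice F2.um] by simp_all

lemma nw_measurable [measurable]: "nw s : bmb"
  unfolding nw_def[abs_def] by measurable

lemma r_joint [measurable]: "(%z. r (fst z) (snd z)) : borel_measurable bxb"
  unfolding r_def by measurable

lemma r_measurable [measurable]: "r s : bmb"
  using measurable_compose[OF pair_slice r_joint] by simp

lemma nw_X1_joint [measurable]: "(%z. nw (fst z) (X1 (fst z) (snd z))) : borel_measurable bxb"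
proof -
  have a: "(%z. (fst z, X1 (fst z) (snd z))) : bxb \<rightarrow>\<^sub>M bxb" by measurable
  have [measurable]: "(%z. u1 (fst z) (X1 (fst z) (snd z))) : borel_measurable bxb" "(%z. u2 (fst z) (X1 (fst z) (snd z))) : borel_measurable bxb"
    using measurable_compose[OF a F1.um] measurable_compose[OF a F2.um] by simp_all
  show ?thesis unfolding nw_def by measurable
qed

lemma nw_bound: "0 <= nw s x" "nw s x <= 2 * M"
  using norm_triangle_ineq4[of "u1 s x" "u2 s x"] F1.ub[of s x] F2.ub[of s x] by (auto simp: nw_def)

lemma w_lip: "norm ((u1 s x - u2 s x) - (u1 s y - u2 s y)) <= 2 * C * ll (norm (x - y))"
proof -
  have "norm ((u1 s x - u2 s x) - (u1 s y - u2 s y)) = norm ((u1 s x - u1 s y) - (u2 s x - u2 s y))" by (simp add: algebra_simps)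
  also have "... <= norm (u1 s x - u1 s y) + norm (u2 s x - u2 s y)" by (rule norm_triangle_ineq4)
  finally show ?thesis using F1.ul[of s x y] F2.ul[of s x y] by simp
qed

lemma AE_good2: "AE y in lborel. F1.good y & F2.good y"
  using F1.AE_good F2.AE_good by eventually_elim simp

lemma r_lip:
  assumes y: "F1.good y & F2.good y" and ab: "0 <= a" "a <= b" "b <= T"
  shows "\<bar>r b y - r a y\<bar> <= 2 * (real CARD('d) * (M * (b - a)))"
proof -
  have "\<bar>r b y - r a y\<bar> <= norm ((X1 b y - X2 b y) - (X1 a y - X2 a y))" unfolding r_def by (rule norm_triangle_ineq3)
  also have "... = norm ((X1 b y - X1 a y) - (X2 b y - X2 a y))" by (simp add: algebra_simps)
  also have "... <= norm (X1 b y - X1 a y) + norm (X2 b y - X2 a y)" by (rule norm_triangle_ineq4)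
  finally show ?thesis using F1.X_lip[of y a b] F2.X_lip[of y a b] y ab by simp
qed

definition Rm :: real where "Rm = 2 * (real CARD('d) * (M * T))"

lemma r_bound:
  assumes y: "F1.good y & F2.good y" and s: "s : {0..T}"
  shows "0 <= r s y" "r s y <= Rm"
proof -
  show "0 <= r s y" by (simp add: r_def)
  have "r 0 y = 0" using y F1.X_0[of y] F2.X_0[of y] by (simp add: r_def)
  then have "r s y <= 2 * (real CARD('d) * (M * s))" using r_lip[OF y, of 0 s] s by simp
  also have "... <= Rm" unfolding Rm_def using s F1.M by (intro mult_left_mono) auto
  finally show "r s y <= Rm" .
qed

lemma r2_AE: "s : {0..T} ==> AE y in lborel. \<bar>(r s y)\<^sup>2\<bar> <= Rm\<^sup>2"
  using AE_good2 by eventually_elim (use r_bound in \<open>auto intro!: power_mono\<close>)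

lemma r2_integrable: "s : {0..T} ==> integrable lborel (%y. ind hq y * (r s y)\<^sup>2)"
  by (rule hq_integrable[OF _ r2_AE]) auto

lemma E_nonneg: "0 <= E s"
  unfolding E_def by (rule integral_nonneg_AE) simp

lemma ll_r2:
  assumes s: "s : {0..T}"
  shows "integrable lborel (%y. ind hq y * ll ((r s y)\<^sup>2))" "(LBINT y. ind hq y * ll ((r s y)\<^sup>2)) <= ll (E s)"
  unfolding E_def by (rule jensen_ll_hq; use r2_integrable[OF s] in simp)+

lemma nw2_integrable: "integrable lborel (%y. ind hq y * (nw s (X1 s y))\<^sup>2)" "integrable lborel (%x. ind hq x * (nw s x)\<^sup>2)"
proof -
  have "\<bar>(nw s x)\<^sup>2\<bar> <= (2 * M)\<^sup>2" for x using nw_bound[of s x] power_mono[of "nw s x" "2 * M" 2] by simp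
  then show "integrable lborel (%y. ind hq y * (nw s (X1 s y))\<^sup>2)" "integrable lborel (%x. ind hq x * (nw s x)\<^sup>2)"
    by (auto intro!: hq_integrable[where K = "(2 * M)\<^sup>2"])
qed

lemma J_lower:
  assumes s: "s : {0..T}"
  shows "1 <= exp (M * T) * F1.J s y" "F1.J s y <= exp (M * T)" "0 < F1.J s y"
proof -
  have ms: "M * s <= M * T" using s F1.M by (intro mult_left_mono) auto
  have "1 = exp (M * s) * exp (- M * s)" by (simp add: exp_minus)
  also have "... <= exp (M * T) * F1.J s y" using ms F1.J_bounds(1)[of s y] s by (intro mult_mono) auto
  finally show "1 <= exp (M * T) * F1.J s y" .
  show "F1.J s y <= exp (M * T)" using F1.J_bounds(2)[of s y] s ms by (meson atLeastAtMost_iff exp_le_cancel_iff order_trans)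
  show "0 < F1.J s y" using F1.J_bounds(3)[of s y] s by simp
qed

text \<open>\<open>J\<close> is at least exp (-M T), so it can be inserted at the cost of the factor
  exp (M T), after which Liouville's formula for \<open>X1\<close> applies.\<close>

lemma nw_X1_integral:
  assumes s: "s : {0..T}"
  shows "(LBINT y. ind hq y * (nw s (X1 s y))\<^sup>2) <= exp (M * T) * W2 s"
proof -
  have b: "\<bar>(nw s x)\<^sup>2\<bar> <= (2 * M)\<^sup>2" for x using nw_bound[of s x] power_mono[of "nw s x" "2 * M" 2] by simp
  have "AE y in lborel. \<bar>(nw s (X1 s y))\<^sup>2 * F1.J s y\<bar> <= (2 * M)\<^sup>2 * exp (M * T)"
  proof (rule AE_I2)
    fix y show "\<bar>(nw s (X1 s y))\<^sup>2 * F1.J s y\<bar> <= (2 * M)\<^sup>2 * exp (M * T)"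
      unfolding abs_mult using b[of "X1 s y"] J_lower[OF s, of y] by (intro mult_mono) auto
  qed
  then have i: "integrable lborel (%y. ind hq y * ((nw s (X1 s y))\<^sup>2 * F1.J s y))" by (intro hq_integrable) auto
  have "(LBINT y. ind hq y * (nw s (X1 s y))\<^sup>2) <= (LBINT y. exp (M * T) * (ind hq y * ((nw s (X1 s y))\<^sup>2 * F1.J s y)))"
  proof (rule integral_mono[OF nw2_integrable(1) integrable_mult_right[OF i]])
    fix y
    have "(nw s (X1 s y))\<^sup>2 * 1 <= (nw s (X1 s y))\<^sup>2 * (exp (M * T) * F1.J s y)" by (rule mult_left_mono[OF J_lower(1)[OF s]]) simp
    then show "ind hq y * (nw s (X1 s y))\<^sup>2 <= exp (M * T) * (ind hq y * ((nw s (X1 s y))\<^sup>2 * F1.J s y))"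
      by (cases "y : hq") (auto simp: ac_simps)
  qed
  also have "... = exp (M * T) * (LBINT x. ind hq x * (nw s x)\<^sup>2)"
  proof -
    have m: "(%x. (nw s x)\<^sup>2) : bmb" by measurable
    have p: "AE x in lborel. (nw s (x + lat n))\<^sup>2 = (nw s x)\<^sup>2" for n by (simp add: nw_def F1.up F2.up)
    show ?thesis using F1.liouville_hq[OF s m b p] by simp
  qed
  finally show ?thesis by (simp add: W2_def)
qed

lemma J_eq: "AE y in lborel. y : hq --> (ALL t:{0..T}. F1.J t y = F2.J t y)"
proof -
  have s: "{z : space plb. fst z : {0..T} --> snd z : hq --> D1 (fst z) (X1 (fst z) (snd z)) = D2 (fst z) (X2 (fst z) (snd z))} : sets plb"
  proof -
    note [measurable] = F1.D_X_measurable F2.D_X_measurable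
    have "{z : space bxb. fst z : {0..T} --> snd z : hq --> D1 (fst z) (X1 (fst z) (snd z)) = D2 (fst z) (X2 (fst z) (snd z))} : sets bxb"
      by measurable
    then show ?thesis using sets_pair_measure_cong[OF sets_lborel sets_lborel] by (simp add: space_pair_measure)
  qed
  have "AE y in lborel. AE s in lborel. s : {0..T} --> y : hq --> D1 s (X1 s y) = D2 s (X2 s y)"
    using lborel_pair.AE_commute[OF s] DX by simp
  then show ?thesis
  proof eventually_elim
    case (elim y)
    show ?case
    proof (intro impI ballI)
      fix t assume y: "y : hq" and t: "t : {0..T}"
      have "(LBINT s. ind {0..t} s * D1 s (X1 s y)) = (LBINT s. ind {0..t} s * D2 s (X2 s y))"
      proof (rule integral_cong_AE)
        have [measurable]: "(%s. D1 s (X1 s y)) : bmb" "(%s. D2 s (X2 s y)) : bmb"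
          by (rule F1.D_along[OF F1.X_time], rule F2.D_along[OF F2.X_time])
        show "(%s. ind {0..t} s * D1 s (X1 s y)) : borel_measurable lborel" "(%s. ind {0..t} s * D2 s (X2 s y)) : borel_measurable lborel"
          by measurable
        show "AE s in lborel. ind {0..t} s * D1 s (X1 s y) = ind {0..t} s * D2 s (X2 s y)"
          using elim by eventually_elim (use y t in \<open>auto simp: indicator_def\<close>)
      qed
      then show "F1.J t y = F2.J t y" by (simp add: F1.J_def F2.J_def)
    qed
  qed
qed

lemma energy_estimate: "EX K>=0. AE s in lborel. s : {0..T} --> W2 s <= K * ll (E s)"
proof -
  let ?d = "real CARD('d)"
  define e where "e = exp (M * T)"
  define K0 where "K0 = M * e"
  \<comment> \<open>Weight in Young's inequality. The velocity term returns as K0 e / (4 b) times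
    \<open>W2 s\<close>, and this weight makes the factor at most 1/2, so that it can be absorbed on
    the left.\<close>
  define b where "b = K0 * e + 1"
  have e0: "0 < e" by (simp add: e_def)
  have K0: "0 <= K0" using F1.M e0 by (simp add: K0_def)
  have b1: "1 <= b" using K0 e0 by (simp add: b_def)
  let ?K = "2 * (K0 * (b + 8 * ?d * C))"
  have "AE s in lborel. s : {0..T} --> W2 s <= ?K * ll (E s)"
    using DX pot
  proof eventually_elim
    case (elim s)
    show ?case
    proof
      assume s: "s : {0..T}"
      obtain phi where phi: "lloc phi" "!!n. AE x in lborel. phi (x + lat n) = phi x" "!!j. bweak phi j (%x. (u1 s x - u2 s x) $ j)"
        using elim(2) s by blast
      have wc: "\<bar>(u1 s x - u2 s x) $ j\<bar> <= 2 * M" for x j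
        using component_le_norm_cart[of "u1 s x - u2 s x" j] nw_bound(2)[of s x] by (simp add: nw_def)
      have wm: "(%x. (u1 s x - u2 s x) $ j) : bmb" for j
        unfolding vector_minus_component by (intro borel_measurable_diff F1.u_slice F2.u_slice)
      have wb: "norm (u1 s x - u2 s x) <= 2 * M" for x using nw_bound(2)[of s x] by (simp add: nw_def)
      obtain psi where taylor: "!!x z. \<bar>psi (x + z) - psi x - (SUM j:UNIV. z $ j * (u1 s x - u2 s x) $ j)\<bar> <= ?d * (2 * (2 * C) * (norm z * ll (norm z)))"
        and der: "!!x. (psi has_derivative (%h. SUM j:UNIV. h $ j * (u1 s x - u2 s x) $ j)) (at x)" and psip: "!!x n. psi (x + lat n) = psi x"
        using potential_representative[OF phi wm wb _ w_lip] F1.C by auto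
      have psic: "continuous_on UNIV psi" using der by (meson continuous_at_imp_continuous_on has_derivative_continuous)
      have psim [measurable]: "psi : bmb" by (rule borel_measurable_continuous_onI[OF psic])
      obtain B0 where B0: "!!x. \<bar>psi x\<bar> <= B0" using lat_periodic_bounded[OF psic psip] by blast
      \<comment> \<open>The integration by parts asks for a single bound on all functions
        involved.\<close>
      define B where "B = max B0 (2 * M)"
      have MB: "M <= B" "2 * M <= B" "B0 <= B" using F1.M by (auto simp: B_def)
      have psib: "\<bar>psi x\<bar> <= B" for x using B0[of x] MB by simp
      have Bp: "0 <= B" using psib[of 0] by linarith
      have Wc: "continuous_on UNIV (%x. (u1 s x - u2 s x) $ j)" for j
        by (rule bounded_linear.continuous_on[OF bounded_linear_vec_nth log_lipschitz_continuous[OF w_lip]])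
      have Wb: "\<bar>(u1 s x - u2 s x) $ j\<bar> <= B" for x j using wc[of x j] MB by simp
      have u1b: "\<bar>u1 s x $ j\<bar> <= B" for x j using component_le_norm_cart[of "u1 s x" j] F1.ub[of s x] MB by linarith
      have u2b: "\<bar>u2 s x $ j\<bar> <= B" for x j using component_le_norm_cart[of "u2 s x" j] F2.ub[of s x] MB by linarith
      have D1b: "\<bar>D1 s x\<bar> <= B" and D2b: "\<bar>D2 s x\<bar> <= B" for x using F1.Db[of s x] F2.Db[of s x] MB by auto
      have ibp1: "(LBINT x. ind hq x * (SUM j:UNIV. u1 s x $ j * (u1 s x - u2 s x) $ j)) = - (LBINT x. ind hq x * (D1 s x * psi x))"
        by (rule torus_integration_by_parts[where W = "%j x. (u1 s x - u2 s x) $ j", OF F1.u_slice u1b F1.up F1.D_slice D1b F1.D_periodic F1.div der Wc Wb _ psib psip])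
           (simp add: F1.up F2.up)
      have ibp2: "(LBINT x. ind hq x * (SUM j:UNIV. u2 s x $ j * (u1 s x - u2 s x) $ j)) = - (LBINT x. ind hq x * (D2 s x * psi x))"
        by (rule torus_integration_by_parts[where W = "%j x. (u1 s x - u2 s x) $ j", OF F2.u_slice u2b F2.up F2.D_slice D2b F2.D_periodic F2.div der Wc Wb _ psib psip])
           (simp add: F1.up F2.up)
      have sb: "\<bar>SUM j:UNIV. v x $ j * (u1 s x - u2 s x) $ j\<bar> <= ?d * (B * B)" if "!!x j. \<bar>v x $ j\<bar> <= B" for v :: "real^'d => real^'d" and x
      proof -
        have "\<bar>SUM j:UNIV. v x $ j * (u1 s x - u2 s x) $ j\<bar> <= (SUM j:(UNIV::'d set). B * B)"
          by (rule order_trans[OF sum_abs], rule sum_mono, unfold abs_mult, intro mult_mono that Wb Bp abs_ge_zero)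
        then show ?thesis by simp
      qed
      have si: "integrable lborel (%x. ind hq x * (SUM j:UNIV. v x $ j * (u1 s x - u2 s x) $ j))"
        if "!!j. (%x. v x $ j) : bmb" and "!!x j. \<bar>v x $ j\<bar> <= B" for v :: "real^'d => real^'d"
        by (rule hq_integrable[where K = "?d * (B * B)"], intro borel_measurable_sum borel_measurable_times that wm, rule AE_I2, rule sb, rule that)
      \<comment> \<open>Only one factor of the square is split into the two fields; the other one is
        the gradient of \<open>psi\<close>, so each piece can be integrated by parts.\<close>
      have "W2 s = (LBINT x. ind hq x * (SUM j:UNIV. u1 s x $ j * (u1 s x - u2 s x) $ j) - ind hq x * (SUM j:UNIV. u2 s x $ j * (u1 s x - u2 s x) $ j))"
        unfolding W2_def nw_def power2_norm_eq_inner inner_vec_def inner_real_def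
        by (rule arg_cong[where f = "integral\<^sup>L lborel"], rule ext) (simp add: sum_subtractf[symmetric] right_diff_distrib[symmetric] left_diff_distrib[symmetric] del: vector_minus_component, simp add: left_diff_distrib)
      also have "... = (LBINT x. ind hq x * (D2 s x * psi x)) - (LBINT x. ind hq x * (D1 s x * psi x))"
        by (simp add: Bochner_Integration.integral_diff[OF si[OF F1.u_slice u1b] si[OF F2.u_slice u2b]] ibp1 ibp2 del: vector_minus_component)
      also have "... = (LBINT y. ind hq y * (D2 s (X2 s y) * psi (X2 s y) * F2.J s y)) - (LBINT y. ind hq y * (D1 s (X1 s y) * psi (X1 s y) * F1.J s y))"
      proof -
        have p1: "AE x in lborel. D1 s (x + lat n) * psi (x + lat n) = D1 s x * psi x" for n using F1.D_periodic[of s n] by eventually_elim (simp add: psip)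
        have p2: "AE x in lborel. D2 s (x + lat n) * psi (x + lat n) = D2 s x * psi x" for n using F2.D_periodic[of s n] by eventually_elim (simp add: psip)
        have q1: "\<bar>D1 s x * psi x\<bar> <= B * B" for x unfolding abs_mult by (intro mult_mono D1b psib Bp abs_ge_zero)
        have q2: "\<bar>D2 s x * psi x\<bar> <= B * B" for x unfolding abs_mult by (intro mult_mono D2b psib Bp abs_ge_zero)
        have m1: "(%x. D1 s x * psi x) : bmb" "(%x. D2 s x * psi x) : bmb" by measurable
        show ?thesis using F1.liouville_hq[OF s m1(1) q1 p1] F2.liouville_hq[OF s m1(2) q2 p2] by simp
      qed
      \<comment> \<open>The divergences along the two flows agree, and so do the densities;
        afterwards the two integrals differ only in the argument of \<open>psi\<close>.\<close>
      also have "(LBINT y. ind hq y * (D2 s (X2 s y) * psi (X2 s y) * F2.J s y)) = (LBINT y. ind hq y * (D1 s (X1 s y) * psi (X2 s y) * F1.J s y))"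
      proof (rule integral_cong_AE)
        show "AE y in lborel. ind hq y * (D2 s (X2 s y) * psi (X2 s y) * F2.J s y) = ind hq y * (D1 s (X1 s y) * psi (X2 s y) * F1.J s y)"
          using elim(1) J_eq by eventually_elim (use s in \<open>auto simp: indicator_def\<close>)
      qed measurable
      also have "(LBINT y. ind hq y * (D1 s (X1 s y) * psi (X2 s y) * F1.J s y)) - (LBINT y. ind hq y * (D1 s (X1 s y) * psi (X1 s y) * F1.J s y))
         = (LBINT y. ind hq y * (D1 s (X1 s y) * psi (X2 s y) * F1.J s y) - ind hq y * (D1 s (X1 s y) * psi (X1 s y) * F1.J s y))"
      proof (rule Bochner_Integration.integral_diff[symmetric])
        have k: "\<bar>D1 s (X1 s y) * psi x * F1.J s y\<bar> <= B * B * e" for x y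
          unfolding abs_mult e_def using J_lower(2,3)[OF s, of y] by (intro mult_mono D1b psib Bp abs_ge_zero mult_nonneg_nonneg) auto
        show "integrable lborel (%y. ind hq y * (D1 s (X1 s y) * psi (X2 s y) * F1.J s y))" "integrable lborel (%y. ind hq y * (D1 s (X1 s y) * psi (X1 s y) * F1.J s y))"
          by (auto intro!: hq_integrable[where K = "B * B * e"] k)
      qed
      also have "... <= (LBINT y. K0 * (b * (ind hq y * (r s y)\<^sup>2) + 1 / (4 * b) * (ind hq y * (nw s (X1 s y))\<^sup>2) + 8 * ?d * C * (ind hq y * ll ((r s y)\<^sup>2))))"
      proof (rule integral_mono)
        have k: "\<bar>D1 s (X1 s y) * psi x * F1.J s y\<bar> <= B * B * e" for x y
          unfolding abs_mult e_def using J_lower(2,3)[OF s, of y] by (intro mult_mono D1b psib Bp abs_ge_zero mult_nonneg_nonneg) auto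
        show "integrable lborel (%y. ind hq y * (D1 s (X1 s y) * psi (X2 s y) * F1.J s y) - ind hq y * (D1 s (X1 s y) * psi (X1 s y) * F1.J s y))"
          by (intro Bochner_Integration.integrable_diff) (auto intro!: hq_integrable[where K = "B * B * e"] k)
        show "integrable lborel (%y. K0 * (b * (ind hq y * (r s y)\<^sup>2) + 1 / (4 * b) * (ind hq y * (nw s (X1 s y))\<^sup>2) + 8 * ?d * C * (ind hq y * ll ((r s y)\<^sup>2))))"
          by (intro integrable_mult_right Bochner_Integration.integrable_add r2_integrable s nw2_integrable ll_r2)
        fix y
        let ?z = "X2 s y - X1 s y"
        have nz: "norm ?z = r s y" by (simp add: r_def norm_minus_commute)
        have r0: "0 <= r s y" by (simp add: r_def)
        have "\<bar>SUM j:UNIV. ?z $ j * (u1 s (X1 s y) - u2 s (X1 s y)) $ j\<bar> <= r s y * nw s (X1 s y)"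
          using Cauchy_Schwarz_ineq2[of ?z "u1 s (X1 s y) - u2 s (X1 s y)"] unfolding nz nw_def inner_vec_def inner_real_def .
        moreover have "r s y * nw s (X1 s y) <= b * (r s y)\<^sup>2 + 1 / (4 * b) * (nw s (X1 s y))\<^sup>2"
        proof -
          have "0 <= (2 * b * r s y - nw s (X1 s y))\<^sup>2 / (4 * b)" using b1 by simp
          also have "... = b * (r s y)\<^sup>2 + 1 / (4 * b) * (nw s (X1 s y))\<^sup>2 - r s y * nw s (X1 s y)"
            using b1 by (simp add: power2_eq_square field_simps)
          finally show ?thesis by simp
        qed
        moreover have "\<bar>psi (X2 s y) - psi (X1 s y) - (SUM j:UNIV. ?z $ j * (u1 s (X1 s y) - u2 s (X1 s y)) $ j)\<bar> <= ?d * (2 * (2 * C) * (r s y * ll (r s y)))"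
          using taylor[of "X1 s y" ?z] unfolding nz by simp
        \<comment> \<open>The difference of the fields has modulus 2 C \<open>ll\<close>, which
          contributes a 4 through the Taylor remainder; \<open>mult_ll_le\<close> contributes the
          last 2 of the 8.\<close>
        moreover have "?d * (2 * (2 * C) * (r s y * ll (r s y))) <= ?d * (2 * (2 * C) * (2 * ll ((r s y)\<^sup>2)))"
          using F1.C by (intro mult_left_mono mult_ll_le r0) auto
        ultimately have "\<bar>psi (X2 s y) - psi (X1 s y)\<bar> <= b * (r s y)\<^sup>2 + 1 / (4 * b) * (nw s (X1 s y))\<^sup>2 + 8 * ?d * C * ll ((r s y)\<^sup>2)" (is "_ <= ?G")
          by (simp add: algebra_simps)
        then have "\<bar>D1 s (X1 s y)\<bar> * \<bar>F1.J s y\<bar> * \<bar>psi (X2 s y) - psi (X1 s y)\<bar> <= M * e * ?G"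
          unfolding e_def using F1.Db[of s "X1 s y"] J_lower(2,3)[OF s, of y] F1.M by (intro mult_mono) auto
        then have "\<bar>D1 s (X1 s y) * F1.J s y * (psi (X2 s y) - psi (X1 s y))\<bar> <= K0 * ?G" by (simp add: K0_def abs_mult)
        then have "D1 s (X1 s y) * psi (X2 s y) * F1.J s y - D1 s (X1 s y) * psi (X1 s y) * F1.J s y <= K0 * ?G" by (simp add: algebra_simps abs_le_iff)
        then show "ind hq y * (D1 s (X1 s y) * psi (X2 s y) * F1.J s y) - ind hq y * (D1 s (X1 s y) * psi (X1 s y) * F1.J s y)
           <= K0 * (b * (ind hq y * (r s y)\<^sup>2) + 1 / (4 * b) * (ind hq y * (nw s (X1 s y))\<^sup>2) + 8 * ?d * C * (ind hq y * ll ((r s y)\<^sup>2)))"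
          by (cases "y : hq") auto
      qed
      also have "... = K0 * (b * E s + 1 / (4 * b) * (LBINT y. ind hq y * (nw s (X1 s y))\<^sup>2) + 8 * ?d * C * (LBINT y. ind hq y * ll ((r s y)\<^sup>2)))"
        unfolding E_def
        by (simp only: integral_mult_right_zero Bochner_Integration.integral_add[OF Bochner_Integration.integrable_add[OF integrable_mult_right[OF r2_integrable[OF s]] integrable_mult_right[OF nw2_integrable(1)]] integrable_mult_right[OF ll_r2(1)[OF s]]]
          Bochner_Integration.integral_add[OF integrable_mult_right[OF r2_integrable[OF s]] integrable_mult_right[OF nw2_integrable(1)]])
      also have "... <= K0 * (b * ll (E s) + 1 / (4 * b) * (e * W2 s) + 8 * ?d * C * ll (E s))"
        unfolding e_def using nw_X1_integral[OF s] ll_r2(2)[OF s] ll_ge_self[OF E_nonneg, of s] K0 b1 F1.C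
        by (intro mult_left_mono add_mono) auto
      finally have fin: "W2 s <= K0 * (b * ll (E s) + 1 / (4 * b) * (e * W2 s) + 8 * ?d * C * ll (E s))" .
      have W0: "0 <= W2 s" unfolding W2_def by (rule integral_nonneg_AE) simp
      have "K0 * (1 / (4 * b) * (e * W2 s)) = (K0 * e / (4 * b)) * W2 s" by simp
      also have "... <= (1 / 2) * W2 s"
      proof (rule mult_right_mono[OF _ W0])
        have "K0 * e <= b" by (simp add: b_def)
        then show "K0 * e / (4 * b) <= 1 / 2" using b1 by (simp add: divide_le_eq)
      qed
      finally have "K0 * (1 / (4 * b) * (e * W2 s)) <= (1 / 2) * W2 s" .
      moreover have "K0 * (b * ll (E s) + 1 / (4 * b) * (e * W2 s) + 8 * ?d * C * ll (E s)) = K0 * (b + 8 * ?d * C) * ll (E s) + K0 * (1 / (4 * b) * (e * W2 s))"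
        by (simp add: algebra_simps)
      ultimately show "W2 s <= ?K * ll (E s)" using fin by simp
    qed
  qed
  moreover have "0 <= ?K" using K0 b1 F1.C by simp
  ultimately show ?thesis by blast
qed

end

section \<open>Uniqueness for a pair of flows\<close>

lemma Icc_integral_split:
  fixes g :: "real => real"
  assumes [measurable]: "g : bmb" and B: "!!s. s : {a..c} ==> \<bar>g s\<bar> <= B" and ab: "a <= b" "b <= c"
  shows "(LBINT s. ind {a..c} s * g s) = (LBINT s. ind {a..b} s * g s) + (LBINT s. ind {b..c} s * g s)"
proof -
  have "integrable lborel (%s. ind {a..b} s * g s)" "integrable lborel (%s. ind {b..c} s * g s)"
    by (rule indicator_Icc_bounded_integrable[where B = B, OF assms(1)], use B ab in auto)+
  then have "(LBINT s. ind {a..b} s * g s) + (LBINT s. ind {b..c} s * g s) = (LBINT s. ind {a..b} s * g s + ind {b..c} s * g s)"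
    by simp
  also have "... = (LBINT s. ind {a..c} s * g s)"
  proof (rule integral_cong_AE)
    show "AE s in lborel. ind {a..b} s * g s + ind {b..c} s * g s = ind {a..c} s * g s"
      using AE_lborel_singleton[of b] by eventually_elim (use ab in \<open>auto simp: indicator_def\<close>)
  qed measurable
  finally show ?thesis by simp
qed

text \<open>A chain rule for a function known only as an integral of the bounded \<open>v\<close>.
  The defect \<open>A\<close> changes by at most N^2 (b - a)^2 over [a, b], so it has derivative 0
  at every point and is constant.\<close>

lemma square_integral:
  fixes f v :: "real => real"
  assumes f [measurable]: "f : bmb" and v [measurable]: "v : bmb" and N: "!!s. \<bar>v s\<bar> <= N"
    and inc: "!!a b. 0 <= a ==> a <= b ==> b <= T ==> f b - f a = (LBINT s. ind {a..b} s * v s)"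
    and f0: "f 0 = 0" and t: "t : {0..T}"
  shows "(f t)\<^sup>2 = (LBINT s. ind {0..t} s * (2 * (f s * v s)))"
proof -
  have N0: "0 <= N" using N[of 0] by linarith
  have fL: "\<bar>f b - f a\<bar> <= (b - a) * N" if "0 <= a" "a <= b" "b <= T" for a b
    unfolding inc[OF that] by (rule indicator_Icc_integral_bound) (use that N in auto)
  have fb: "\<bar>f s\<bar> <= T * N" if "s : {0..T}" for s
  proof -
    have "\<bar>f s\<bar> <= s * N" using fL[of 0 s] that f0 by simp
    also have "... <= T * N" using that N0 by (intro mult_right_mono) auto
    finally show ?thesis .
  qed
  have hb: "\<bar>2 * (f s * v s)\<bar> <= 2 * (T * N * N)" if "s : {0..T}" for s
  proof -
    have "\<bar>f s\<bar> * \<bar>v s\<bar> <= T * N * N" using fb[OF that] N[of s] N0 that by (intro mult_mono) auto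
    then show ?thesis by (simp add: abs_mult)
  qed
  have hm: "(%s. 2 * (f s * v s)) : bmb" by measurable
  define A where "A = (%t. (f t)\<^sup>2 - (LBINT s. ind {0..t} s * (2 * (f s * v s))))"
  have AA: "\<bar>A b - A a\<bar> <= N * N * (b - a)\<^sup>2" if ab: "0 <= a" "a <= b" "b <= T" for a b
  proof -
    have sp: "(LBINT s. ind {0..b} s * (2 * (f s * v s))) = (LBINT s. ind {0..a} s * (2 * (f s * v s))) + (LBINT s. ind {a..b} s * (2 * (f s * v s)))"
      by (rule Icc_integral_split[OF hm hb ab(1,2)]) (use ab in auto)
    have i1: "integrable lborel (%s. ind {a..b} s * v s)" by (rule indicator_Icc_bounded_integrable[OF v N])
    have i2: "integrable lborel (%s. ind {a..b} s * (2 * (f s * v s)))"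
      by (rule indicator_Icc_bounded_integrable[OF hm hb]) (use ab in auto)
    have "A b - A a = (f b - f a) * (f b + f a) - (LBINT s. ind {a..b} s * (2 * (f s * v s)))"
      unfolding A_def sp by (simp add: power2_eq_square algebra_simps)
    also have "... = (LBINT s. (ind {a..b} s * v s) * (f b + f a) - ind {a..b} s * (2 * (f s * v s)))"
      unfolding inc[OF ab] using i1 i2 by simp
    also have "... = (LBINT s. ind {a..b} s * (v s * (f b + f a - 2 * f s)))"
      by (rule arg_cong[where f = "integral\<^sup>L lborel"], rule ext) (simp add: algebra_simps)
    finally have e: "A b - A a = (LBINT s. ind {a..b} s * (v s * (f b + f a - 2 * f s)))" .
    have "\<bar>A b - A a\<bar> <= (b - a) * (N * (N * (b - a)))" unfolding e
    proof (rule indicator_Icc_integral_bound[OF ab(2)])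
      fix s assume s: "s : {a..b}"
      have "\<bar>f b + f a - 2 * f s\<bar> <= (b - s) * N + (s - a) * N" using fL[of s b] fL[of a s] s ab by auto
      then have "\<bar>f b + f a - 2 * f s\<bar> <= N * (b - a)" by (simp add: algebra_simps)
      then show "\<bar>v s * (f b + f a - 2 * f s)\<bar> <= N * (N * (b - a))" unfolding abs_mult using N[of s] N0 by (intro mult_mono) auto
    qed
    then show ?thesis by (simp add: power2_eq_square ac_simps)
  qed
  have AA': "\<bar>A y - A x\<bar> <= N * N * (y - x)\<^sup>2" if "x : {0..T}" "y : {0..T}" for x y
    using AA[of x y] AA[of y x] that by (cases "x <= y") (auto simp: abs_minus_commute power2_commute)
  have der: "(A has_field_derivative 0) (at x within {0..T})" if x: "x : {0..T}" for x
    unfolding has_field_derivative_iff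
  proof (rule Lim_null_comparison[where g = "%y. N * N * \<bar>y - x\<bar>"])
    have "norm ((A y - A x) / (y - x)) <= N * N * \<bar>y - x\<bar>" if "y : {0..T}" "y ~= x" for y
    proof -
      have "\<bar>A y - A x\<bar> <= N * N * (\<bar>y - x\<bar> * \<bar>y - x\<bar>)" using AA'[OF x that(1)] by (simp add: power2_eq_square)
      then show ?thesis using that(2) by (simp add: abs_divide divide_le_eq mult.assoc)
    qed
    then show "\<forall>\<^sub>F y in at x within {0..T}. norm ((A y - A x) / (y - x)) <= N * N * \<bar>y - x\<bar>"
      unfolding eventually_at_filter by (intro always_eventually) auto
    have "((%y. N * N * \<bar>y - x\<bar>) \<longlongrightarrow> N * N * \<bar>x - x\<bar>) (at x within {0..T})" by (intro tendsto_intros)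
    then show "((%y. N * N * \<bar>y - x\<bar>) \<longlongrightarrow> 0) (at x within {0..T})" by simp
  qed
  have "EX c. ALL x:{0..T}. A x = c" by (rule has_field_derivative_zero_constant[OF convex_real_interval(5) der])
  then obtain c where c: "!!x. x : {0..T} ==> A x = c" by blast
  have "\<bar>\<integral>s. ind {0..0} s * (2 * (f s * v s)) \<partial>lborel\<bar> <= (0 - 0) * (2 * (T * N * N))"
    by (rule indicator_Icc_integral_bound) (use hb t in auto)
  then have "A 0 = 0" by (simp add: A_def f0)
  then have "A t = 0" using c[OF t] c[of 0] t by simp
  then show ?thesis by (simp add: A_def)
qed

context flow_pair
begin

text \<open>A bound for the rate of change of r^2. The difference of velocities is split at the
  point \<open>X1 s y\<close>, where \<open>nw\<close> can be transported by Liouville's formula for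
  \<open>X1\<close>; Young's inequality and \<open>mult_ll_le\<close> give the three terms.\<close>

definition G :: "real => real^'d => real" where
  "G s y = (r s y)\<^sup>2 + (nw s (X1 s y))\<^sup>2 + 4 * C * ll ((r s y)\<^sup>2)"

lemma G_joint [measurable]: "(%z. G (fst z) (snd z)) : borel_measurable bxb"
  unfolding G_def by measurable

lemma G_nonneg: "0 <= G s y"
  using F1.C ll_nonneg[of "(r s y)\<^sup>2"] by (simp add: G_def)

lemma time_slice: "(%s. (s, y)) : borel \<rightarrow>\<^sub>M bxb" by measurable

lemma G_time [measurable]: "(%s. G s y) : bmb"
  using measurable_compose[OF time_slice G_joint] by simp

lemma G_time_integrable:
  assumes y: "F1.good y & F2.good y" and t: "t : {0..T}"
  shows "integrable lborel (%s. ind {0..t} s * G s y)"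
proof (rule indicator_Icc_bounded_integrable[OF G_time])
  fix s assume "s : {0..t}"
  then have s: "s : {0..T}" using t by auto
  have "(r s y)\<^sup>2 <= Rm\<^sup>2" using r_bound[OF y s] by (intro power_mono)
  moreover from this have "4 * C * ll ((r s y)\<^sup>2) <= 4 * C * ll (Rm\<^sup>2)" using F1.C by (intro mult_left_mono ll_mono) auto
  moreover have "(nw s (X1 s y))\<^sup>2 <= (2 * M)\<^sup>2" using nw_bound[of s "X1 s y"] by (intro power_mono)
  ultimately show "\<bar>G s y\<bar> <= Rm\<^sup>2 + (2 * M)\<^sup>2 + 4 * C * ll (Rm\<^sup>2)" using G_nonneg[of s y] by (simp add: G_def)
qed

lemma r2_growth:
  assumes y: "F1.good y & F2.good y" and t: "t : {0..T}"
  shows "(r t y)\<^sup>2 <= (LBINT s. ind {0..t} s * G s y)"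
proof -
  define dl where "dl = (%j s. X1 s y $ j - X2 s y $ j)"
  define v where "v = (%j s. u1 s (X1 s y) $ j - u2 s (X2 s y) $ j)"
  have c1: "\<bar>u1 s x $ j\<bar> <= M" and c2: "\<bar>u2 s x $ j\<bar> <= M" for s x j
    using order_trans[OF component_le_norm_cart F1.ub] order_trans[OF component_le_norm_cart F2.ub] by auto
  have m1: "(%s. u1 s (X1 s y) $ j) : bmb" "(%s. u2 s (X2 s y) $ j) : bmb" for j
    by (rule F1.u_along[OF F1.X_time], rule F2.u_along[OF F2.X_time])
  have vm: "v j : bmb" for j unfolding v_def by (intro borel_measurable_diff m1)
  have dlm: "dl j : bmb" for j
    unfolding dl_def by (intro borel_measurable_diff measurable_compose[OF F1.X_time borel_measurable_continuous_onI] measurable_compose[OF F2.X_time borel_measurable_continuous_onI] linear_continuous_on bounded_linear_vec_nth)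
  have vb: "\<bar>v j s\<bar> <= 2 * M" for j s unfolding v_def using c1[of s "X1 s y" j] c2[of s "X2 s y" j] by linarith
  have inc: "dl j b - dl j a = (LBINT s. ind {a..b} s * v j s)" if ab: "0 <= a" "a <= b" "b <= T" for a b j
  proof -
    have i: "integrable lborel (%s. ind {a..b} s * u1 s (X1 s y) $ j)" "integrable lborel (%s. ind {a..b} s * u2 s (X2 s y) $ j)"
      by (rule indicator_Icc_bounded_integrable[where B = M], rule m1, rule c1, rule indicator_Icc_bounded_integrable[where B = M], rule m1, rule c2)
    have "dl j b - dl j a = (X1 b y $ j - X1 a y $ j) - (X2 b y $ j - X2 a y $ j)" by (simp add: dl_def)
    also have "... = (LBINT s. ind {a..b} s * u1 s (X1 s y) $ j) - (LBINT s. ind {a..b} s * u2 s (X2 s y) $ j)"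
      using F1.X_increment[of y a b j] F2.X_increment[of y a b j] y ab by simp
    also have "... = (LBINT s. ind {a..b} s * u1 s (X1 s y) $ j - ind {a..b} s * u2 s (X2 s y) $ j)"
      by (rule Bochner_Integration.integral_diff[OF i, symmetric])
    finally show ?thesis by (simp add: v_def right_diff_distrib)
  qed
  have dl0: "dl j 0 = 0" for j using F1.X_0[of y] F2.X_0[of y] y by (simp add: dl_def)
  have dlr: "\<bar>dl j s\<bar> <= Rm" if "s : {0..T}" for j s
    using component_le_norm_cart[of "X1 s y - X2 s y" j] r_bound[OF y that] by (simp add: dl_def r_def)
  have M0: "0 <= M" by (rule F1.M)
  have ii: "integrable lborel (%s. ind {0..t} s * (2 * (dl j s * v j s)))" for j
  proof (rule indicator_Icc_bounded_integrable[where B = "2 * (Rm * (2 * M))"])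
    show "(%s. 2 * (dl j s * v j s)) : bmb" by (intro borel_measurable_times borel_measurable_const dlm vm)
    fix s assume "s : {0..t}"
    then have "s : {0..T}" using t by auto
    then have "\<bar>dl j s\<bar> * \<bar>v j s\<bar> <= Rm * (2 * M)" using dlr[of s j] vb[of j s] M0 by (intro mult_mono) auto
    then show "\<bar>2 * (dl j s * v j s)\<bar> <= 2 * (Rm * (2 * M))" by (simp add: abs_mult algebra_simps)
  qed
  have "(r t y)\<^sup>2 = (SUM j:UNIV. (dl j t)\<^sup>2)"
    unfolding r_def power2_norm_eq_inner inner_vec_def dl_def by (simp add: power2_eq_square)
  also have "... = (SUM j:UNIV. \<integral>s. ind {0..t} s * (2 * (dl j s * v j s)) \<partial>lborel)"
    by (intro sum.cong refl square_integral[OF dlm vm vb inc dl0 t])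
  also have "... = (LBINT s. (SUM j:UNIV. ind {0..t} s * (2 * (dl j s * v j s))))"
    by (rule Bochner_Integration.integral_sum[symmetric]) (rule ii)
  also have "... <= (LBINT s. ind {0..t} s * G s y)"
  proof (rule integral_mono)
    show "integrable lborel (%s. SUM j:UNIV. ind {0..t} s * (2 * (dl j s * v j s)))" by (intro Bochner_Integration.integrable_sum ii)
    show "integrable lborel (%s. ind {0..t} s * G s y)" by (rule G_time_integrable[OF y t])
    fix s
    let ?dX = "X1 s y - X2 s y" and ?V = "u1 s (X1 s y) - u2 s (X2 s y)"
    have r0: "0 <= r s y" by (simp add: r_def)
    have "?V = (u1 s (X1 s y) - u2 s (X1 s y)) + (u2 s (X1 s y) - u2 s (X2 s y))" by simp
    then have "norm ?V <= nw s (X1 s y) + norm (u2 s (X1 s y) - u2 s (X2 s y))" unfolding nw_def by (metis norm_triangle_ineq)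
    then have nV: "norm ?V <= nw s (X1 s y) + C * ll (r s y)" using F2.ul[of s "X1 s y" "X2 s y"] by (simp add: r_def)
    have "?dX \<bullet> ?V <= r s y * norm ?V" using norm_cauchy_schwarz[of ?dX ?V] by (simp add: r_def)
    also have "... <= r s y * (nw s (X1 s y) + C * ll (r s y))" using nV r0 by (rule mult_left_mono)
    finally have a: "2 * (?dX \<bullet> ?V) <= 2 * (r s y * nw s (X1 s y)) + 2 * C * (r s y * ll (r s y))" by (simp add: algebra_simps)
    have "0 <= (r s y - nw s (X1 s y))\<^sup>2" by simp
    then have "2 * (r s y * nw s (X1 s y)) <= (r s y)\<^sup>2 + (nw s (X1 s y))\<^sup>2" by (simp add: power2_diff)
    moreover have "2 * C * (r s y * ll (r s y)) <= 2 * C * (2 * ll ((r s y)\<^sup>2))" using F1.C by (intro mult_left_mono mult_ll_le r0) auto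
    ultimately have "2 * (?dX \<bullet> ?V) <= G s y" using a by (simp add: G_def)
    moreover have "(SUM j:UNIV. 2 * (dl j s * v j s)) = 2 * (?dX \<bullet> ?V)"
      by (simp add: inner_vec_def dl_def v_def sum_distrib_left)
    ultimately have "(SUM j:UNIV. 2 * (dl j s * v j s)) <= G s y" by simp
    then show "(SUM j:UNIV. ind {0..t} s * (2 * (dl j s * v j s))) <= ind {0..t} s * G s y"
      by (cases "s : {0..t}") auto
  qed
  finally show ?thesis .
qed

text \<open>Trajectories are Lipschitz in time with a constant independent of the starting point, so
  \<open>E\<close> is Lipschitz; Osgood's lemma is stated for continuous functions.\<close>

lemma E_continuous: "continuous_on {0..T} E"
proof -
  let ?c = "2 * (real CARD('d) * M) * (2 * Rm)"
  have Rm0: "0 <= Rm" using F1.M F1.T by (simp add: Rm_def)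
  have le: "\<bar>E b - E a\<bar> <= ?c * (b - a)" if ab: "0 <= a" "a <= b" "b <= T" for a b
  proof -
    have aT: "a : {0..T}" and bT: "b : {0..T}" using ab by auto
    have i: "integrable lborel (%y. ind hq y * (r b y)\<^sup>2 - ind hq y * (r a y)\<^sup>2)"
      by (intro Bochner_Integration.integrable_diff r2_integrable aT bT)
    have "E b - E a = (LBINT y. ind hq y * (r b y)\<^sup>2 - ind hq y * (r a y)\<^sup>2)"
      unfolding E_def by (rule Bochner_Integration.integral_diff[OF r2_integrable[OF bT] r2_integrable[OF aT], symmetric])
    also have "\<bar>...\<bar> <= (LBINT y. \<bar>ind hq y * (r b y)\<^sup>2 - ind hq y * (r a y)\<^sup>2\<bar>)" by (rule integral_abs_bound)
    also have "... <= (LBINT y. ind (hq :: (real^'d) set) y * (?c * (b - a)))"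
    proof (rule integral_mono_AE[OF integrable_abs[OF i]])
      show "integrable lborel (%y::real^'d. ind hq y * (?c * (b - a)))" by (rule hq_integrable) auto
      show "AE y in lborel. \<bar>ind hq y * (r b y)\<^sup>2 - ind hq y * (r a y)\<^sup>2\<bar> <= ind hq y * (?c * (b - a))"
        using AE_good2
      proof eventually_elim
        case (elim y)
        have "\<bar>(r b y)\<^sup>2 - (r a y)\<^sup>2\<bar> = \<bar>r b y - r a y\<bar> * \<bar>r b y + r a y\<bar>" by (simp add: power2_eq_square square_diff_square_factored abs_mult mult.commute)
        also have "... <= 2 * (real CARD('d) * (M * (b - a))) * (2 * Rm)"
          using r_lip[OF elim ab] r_bound[OF elim aT] r_bound[OF elim bT] F1.M ab by (intro mult_mono) auto
        finally have "\<bar>(r b y)\<^sup>2 - (r a y)\<^sup>2\<bar> <= ?c * (b - a)" by (simp add: ac_simps)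
        then show ?case by (cases "y : hq") auto
      qed
    qed
    also have "... = ?c * (b - a)" by (rule hq_integral_const)
    finally show ?thesis .
  qed
  show ?thesis
  proof (rule lipschitz_on_continuous_on[where L = ?c], rule lipschitz_onI)
    fix a b assume ab: "a : {0..T}" "b : {0..T}"
    show "dist (E a) (E b) <= ?c * dist a b"
    proof (cases "a <= b")
      case True
      then show ?thesis using le[of a b] ab by (simp add: dist_real_def abs_minus_commute)
    next
      case False
      then show ?thesis using le[of b a] ab by (simp add: dist_real_def abs_minus_commute)
    qed
  next
    show "0 <= ?c" using F1.M Rm0 by simp
  qed
qed

text \<open>Integrate the pointwise growth bound over the cell and exchange the integrals. With
  nonnegative integrals the exchange rests on joint measurability alone, and the energy estimate may
  be used for almost every time.\<close>

lemma E_growth: "EX K>=0. ALL t:{0..T}. E t <= K * integral {0..t} (%s. ll (E s))"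
proof -
  obtain K where K: "0 <= K" and en: "AE s in lborel. s : {0..T} --> W2 s <= K * ll (E s)" using energy_estimate by blast
  define e where "e = exp (M * T)"
  define K2 where "K2 = 1 + e * K + 4 * C"
  have K2: "0 <= K2" using K F1.C by (simp add: K2_def e_def)
  have "E t <= K2 * integral {0..t} (%s. ll (E s))" if t: "t : {0..T}" for t
  proof -
    have lc: "continuous_on {0..t} (%s. ll (E s))"
      by (rule continuous_on_compose2[OF continuous_on_ll continuous_on_subset[OF E_continuous]]) (use t E_nonneg in auto)
    note li = Icc_integral_continuous[OF lc]
    have l0: "0 <= ll (E s)" for s by (rule ll_nonneg[OF E_nonneg])
    let ?f = "%s y. ennreal (ind {0..t} s * (ind hq y * G s y))"
    have "ennreal (E t) = (NN y. ennreal (ind hq y * (r t y)\<^sup>2))"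
      unfolding E_def by (rule nn_integral_eq_integral[OF r2_integrable[OF t], symmetric]) simp
    also have "... <= (NN y. (NN s. ?f s y))"
    proof (rule nn_integral_mono_AE)
      show "AE y in lborel. ennreal (ind hq y * (r t y)\<^sup>2) <= (NN s. ?f s y)"
        using AE_good2
      proof eventually_elim
        case (elim y)
        have "ind hq y * (r t y)\<^sup>2 <= ind hq y * (LBINT s. ind {0..t} s * G s y)"
          using r2_growth[OF elim t] by (intro mult_left_mono) auto
        also have "... = (LBINT s. ind hq y * (ind {0..t} s * G s y))" by simp
        finally have "ennreal (ind hq y * (r t y)\<^sup>2) <= ennreal (LBINT s. ind hq y * (ind {0..t} s * G s y))" by (rule ennreal_leI)
        also have "... = (NN s. ennreal (ind hq y * (ind {0..t} s * G s y)))"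
          by (rule nn_integral_eq_integral[OF integrable_mult_right[OF G_time_integrable[OF elim t]], symmetric]) (simp add: G_nonneg)
        also have "... = (NN s. ?f s y)" by (simp only: mult.left_commute)
        finally show ?case .
      qed
    qed
    also have "... = (NN s. (NN y. ?f s y))"
    proof (rule lborel_pair.Fubini')
      have "(%z. ?f (fst z) (snd z)) : borel_measurable bxb" by measurable
      then show "case_prod ?f : borel_measurable plb"
        unfolding case_prod_unfold by (subst measurable_cong_sets[OF sets_pair_measure_cong[OF sets_lborel sets_lborel] refl])
    qed
    also have "... <= (NN s. ennreal (K2 * (ind {0..t} s * ll (E s))))"
    proof (rule nn_integral_mono_AE)
      show "AE s in lborel. (NN y. ?f s y) <= ennreal (K2 * (ind {0..t} s * ll (E s)))"
        using en
      proof eventually_elim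
        case (elim s)
        show ?case
        proof (cases "s : {0..t}")
          case True
          then have s: "s : {0..T}" using t by auto
          have eq: "(%y. ind hq y * G s y) = (%y. ind hq y * (r s y)\<^sup>2 + ind hq y * (nw s (X1 s y))\<^sup>2 + 4 * C * (ind hq y * ll ((r s y)\<^sup>2)))"
            by (simp add: G_def algebra_simps)
          have i1: "integrable lborel (%y. ind hq y * (r s y)\<^sup>2 + ind hq y * (nw s (X1 s y))\<^sup>2)"
            by (rule Bochner_Integration.integrable_add[OF r2_integrable[OF s] nw2_integrable(1)])
          have i: "integrable lborel (%y. ind hq y * G s y)" unfolding eq
            by (rule Bochner_Integration.integrable_add[OF i1 integrable_mult_right[OF ll_r2(1)[OF s]]])
          have "(LBINT y. ind hq y * G s y) = E s + (LBINT y. ind hq y * (nw s (X1 s y))\<^sup>2) + 4 * C * (LBINT y. ind hq y * ll ((r s y)\<^sup>2))"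
            unfolding eq E_def Bochner_Integration.integral_add[OF i1 integrable_mult_right[OF ll_r2(1)[OF s]]] Bochner_Integration.integral_add[OF r2_integrable[OF s] nw2_integrable(1)]
            by (simp only: integral_mult_right_zero)
          also have "... <= ll (E s) + e * (K * ll (E s)) + 4 * C * ll (E s)"
          proof (intro add_mono)
            show "E s <= ll (E s)" by (rule ll_ge_self[OF E_nonneg])
            have "(LBINT y. ind hq y * (nw s (X1 s y))\<^sup>2) <= e * W2 s" unfolding e_def by (rule nw_X1_integral[OF s])
            also have "... <= e * (K * ll (E s))" using elim s by (intro mult_left_mono) (auto simp: e_def)
            finally show "(LBINT y. ind hq y * (nw s (X1 s y))\<^sup>2) <= e * (K * ll (E s))" .
            show "4 * C * (LBINT y. ind hq y * ll ((r s y)\<^sup>2)) <= 4 * C * ll (E s)" using F1.C by (intro mult_left_mono ll_r2(2)[OF s]) auto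
          qed
          also have "... = K2 * ll (E s)" by (simp add: K2_def algebra_simps)
          finally have le: "(LBINT y. ind hq y * G s y) <= K2 * ll (E s)" .
          have "(NN y. ?f s y) = (NN y. ennreal (ind hq y * G s y))" using True by simp
          also have "... = ennreal (LBINT y. ind hq y * G s y)" by (rule nn_integral_eq_integral[OF i]) (simp add: G_nonneg)
          also have "... <= ennreal (K2 * (ind {0..t} s * ll (E s)))" using le True by (intro ennreal_leI) simp
          finally show ?thesis .
        next
          case False
          then have z: "ind {0..t} s = (0::real)" by (rule indicator_simps(2))
          show ?thesis unfolding z by simp
        qed
      qed
    qed
    also have "... = ennreal (LBINT s. K2 * (ind {0..t} s * ll (E s)))"
      by (rule nn_integral_eq_integral[OF integrable_mult_right[OF li(1)]]) (use K2 l0 in simp)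
    also have "(LBINT s. K2 * (ind {0..t} s * ll (E s))) = K2 * integral {0..t} (%s. ll (E s))" by (simp add: li(2))
    finally have "ennreal (E t) <= ennreal (K2 * integral {0..t} (%s. ll (E s)))" .
    moreover have "0 <= K2 * integral {0..t} (%s. ll (E s))"
      using K2 l0 by (intro mult_nonneg_nonneg integral_nonneg integrable_continuous_interval lc) auto
    ultimately show ?thesis by (simp add: ennreal_le_iff)
  qed
  then show ?thesis using K2 by blast
qed

theorem velocities_agree: "AE s in lborel. s : {0..T} --> (AE x in lborel. x : hq --> u1 s x = u2 s x)"
proof -
  obtain K where K: "0 <= K" and gr: "!!t. t : {0..T} ==> E t <= K * integral {0..t} (%s. ll (E s))" using E_growth by blast
  have E0: "E t = 0" if "t : {0..T}" for t
    by (rule osgood_continuous[OF E_continuous E_nonneg K gr that])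
  obtain K' where "AE s in lborel. s : {0..T} --> W2 s <= K' * ll (E s)" using energy_estimate by blast
  then show ?thesis
  proof eventually_elim
    case (elim s)
    show ?case
    proof
      assume s: "s : {0..T}"
      have "W2 s <= 0" using elim s E0[OF s] by simp
      moreover have "0 <= W2 s" unfolding W2_def by (rule integral_nonneg_AE) simp
      ultimately have "W2 s = 0" by simp
      then have "(LBINT x. ind hq x * (nw s x)\<^sup>2) = 0" unfolding W2_def .
      then have "AE x in lborel. ind hq x * (nw s x)\<^sup>2 = 0"
        using integral_nonneg_eq_0_iff_AE[OF nw2_integrable(2)] by simp
      then show "AE x in lborel. x : hq --> u1 s x = u2 s x" by eventually_elim (auto simp: nw_def)
    qed
  qed
qed

end

section \<open>Borel representatives of fields and flows\<close>

lemma pair_lborel_measurable: "(f : borel_measurable plb) \<longleftrightarrow> (f : borel_measurable bxb)"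
  by (simp only: measurable_cong_sets[OF sets_pair_measure_cong[OF sets_lborel sets_lborel] refl])

lemma pair_lborel_sets: "sets plb = sets bxb"
  by (rule sets_pair_measure_cong[OF sets_lborel sets_lborel])

lemma vec_nth_borel: "(%v::real^'d. v $ j) : bmb"
  by (intro borel_measurable_continuous_onI continuous_intros)

lemma borel_measurable_vec_lambda:
  fixes h :: "'d::finite => 'a => real"
  assumes "!!j. h j : borel_measurable M"
  shows "(%x. \<chi> j. h j x) : borel_measurable M"
proof (rule borel_measurable_euclidean_space[THEN iffD2], rule ballI)
  fix b :: "real^'d" assume "b : Basis"
  then obtain i where b: "b = axis i 1" by (auto simp: Basis_vec_def)
  have "(%x. (\<chi> j. h j x) \<bullet> b) = h i" by (simp add: b inner_axis)
  then show "(%x. (\<chi> j. h j x) \<bullet> b) : borel_measurable M" using assms by simp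
qed

lemma completion_borel_version_vec:
  fixes g :: "'a => real^'d"
  assumes g: "g : borel_measurable (completion M)"
  shows "EX g':borel_measurable M. AE x in M. g x = g' x"
proof -
  have "EX h. h : borel_measurable M & (AE x in M. g x $ j = h x)" for j
    using completion_ex_borel_measurable_real[OF measurable_compose[OF g vec_nth_borel[of j]]] by blast
  then have "ALL j. EX h. h : borel_measurable M & (AE x in M. g x $ j = h x)" by blast
  from choice[OF this] obtain h where h: "!!j. h j : borel_measurable M" "!!j. AE x in M. g x $ j = h j x" by blast
  have "AE x in M. ALL j:UNIV. g x $ j = h j x" by (rule AE_finite_allI) (auto simp: h)
  then have "AE x in M. g x = (\<chi> j. h j x)" by eventually_elim (simp add: vec_eq_iff)
  from this borel_measurable_vec_lambda[of h M, OF h(1)] show ?thesis by (rule bexI)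
qed

lemma AE_pair_swap:
  fixes P :: "real => real^'d => bool"
  assumes P: "AE z in plb. P (fst z) (snd z)"
  shows "AE y in lborel. AE s in lborel. P s y"
proof -
  obtain N where N: "{z : space plb. ~ P (fst z) (snd z)} \<subseteq> N" "emeasure plb N = 0" "N : sets plb"
    using AE_E[OF P] by blast
  have "AE z in plb. z ~: N" using N by (intro AE_not_in) auto
  from lborel_pair.AE_pair[OF this] have a: "AE s in lborel. AE y in lborel. (s, y) ~: N" .
  have "{z : space plb. (fst z, snd z) ~: N} = space plb - N" by auto
  with sets.compl_sets[OF N(3)] have "{z : space plb. (fst z, snd z) ~: N} : sets plb" by (simp only:)
  from lborel_pair.AE_commute[OF this] a have "AE y in lborel. AE s in lborel. (s, y) ~: N" by simp
  then show ?thesis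
  proof eventually_elim
    case (elim y)
    then show ?case
    proof eventually_elim
      case (elim s)
      have "(s, y) : space plb" by (simp add: space_pair_measure)
      then show ?case using elim N(1) by auto
    qed
  qed
qed

text \<open>At each time the preimage of a null slice under \<open>Y\<close> is null by bounded
  compression. The exceptional set is first enlarged to a measurable null set, so that the slices
  can be put together again by Fubini.\<close>

lemma AE_compressible_compose:
  fixes Y :: "real => real^'d => real^'d"
  assumes Ym: "(%z. Y (fst z) (snd z)) : borel_measurable bxb"
    and YL: "!!t A. t : {0..T} ==> A : sets borel ==> emeasure lborel {y. Y t y : A} <= ennreal L * emeasure lborel A"
    and P: "AE z in plb. fst z : {0..T} --> P (fst z) (snd z)"
  shows "AE z in plb. fst z : {0..T} --> P (fst z) (Y (fst z) (snd z))"
proof -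
  obtain N where N: "{z : space plb. ~ (fst z : {0..T} --> P (fst z) (snd z))} \<subseteq> N" "emeasure plb N = 0" "N : sets plb"
    using AE_E[OF P] by blast
  have Nb [measurable]: "N : sets bxb" using N(3) unfolding pair_lborel_sets .
  have NP: "P s x" if "(s, x) ~: N" "s : {0..T}" for s x
  proof (rule ccontr)
    assume "~ P s x"
    then have "(s, x) : {z : space plb. ~ (fst z : {0..T} --> P (fst z) (snd z))}"
      using that(2) by (simp add: space_pair_measure)
    then show False using N(1) that(1) by blast
  qed
  have "AE z in plb. z ~: N" using N by (intro AE_not_in) auto
  from lborel_pair.AE_pair[OF this] have a: "AE s in lborel. AE x in lborel. (s, x) ~: N" .
  have mp: "(%z. (fst z, Y (fst z) (snd z))) : bxb \<rightarrow>\<^sub>M bxb" using Ym by measurable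
  have "(%z. (fst z, Y (fst z) (snd z))) -` N \<inter> space bxb : sets bxb" by (rule measurable_sets[OF mp Nb])
  then have [measurable]: "{z. (fst z, Y (fst z) (snd z)) : N} : sets bxb" by (simp add: vimage_def space_pair_measure)
  have S: "{z : space plb. fst z : {0..T} --> (fst z, Y (fst z) (snd z)) ~: N} : sets plb"
  proof -
    have "{z : space bxb. fst z : {0..T} --> z ~: {z. (fst z, Y (fst z) (snd z)) : N}} : sets bxb" by measurable
    then show ?thesis unfolding pair_lborel_sets by (simp add: space_pair_measure)
  qed
  have "AE z in plb. fst z : {0..T} --> (fst z, Y (fst z) (snd z)) ~: N"
  proof (rule lborel_pair.AE_pair_measure[OF S])
    show "AE s in lborel. AE y in lborel. fst (s, y) : {0..T} --> (fst (s, y), Y (fst (s, y)) (snd (s, y))) ~: N"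
      using a
    proof eventually_elim
      case (elim s)
      show ?case
      proof (cases "s : {0..T}")
        case True
        define A where "A = {x. (s, x) : N}"
        have "(%x. (s, x)) : borel \<rightarrow>\<^sub>M bxb" by measurable
        from measurable_sets[OF this Nb] have A: "A : sets borel" by (simp add: A_def vimage_def)
        have "AE x in lborel. x ~: A" using elim by (simp add: A_def)
        then have A0: "emeasure lborel A = 0" using A AE_iff_measurable[of A lborel "%x. x ~: A"] by simp
        have sl: "(%y. (s, y)) : borel \<rightarrow>\<^sub>M bxb" by measurable
        have Ys: "Y s : bmb" using measurable_compose[OF sl Ym] by simp
        have YA: "{y. Y s y : A} : sets borel" using measurable_sets[OF Ys A] by (simp add: vimage_def)
        have "emeasure lborel {y. Y s y : A} = 0" using YL[OF True A] A0 by simp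
        then have "AE y in lborel. y ~: {y. Y s y : A}" using YA by (intro AE_not_in) auto
        then show ?thesis by eventually_elim (simp add: A_def)
      next
        case False
        then show ?thesis by (intro AE_I2 impI) (metis fst_conv)
      qed
    qed
  qed
  then show ?thesis by eventually_elim (use NP in blast)
qed

lemma abs_cont_on_continuous:
  assumes f: "abs_cont_on a b f"
  shows "continuous_on {a..b} f"
  unfolding continuous_on_iff
proof (intro ballI allI impI)
  fix x and e :: real assume x: "x : {a..b}" and e: "0 < e"
  from f[unfolded abs_cont_on_def, THEN spec, THEN mp, OF e]
  obtain d where d: "0 < d" and ac: "ALL (n::nat) (s::nat => real) t. (ALL i<n. a <= s i & s i <= t i & t i <= b) &
      (ALL i<n. ALL j<n. i ~= j --> t i <= s j | t j <= s i) & (\<Sum>i<n. t i - s i) < d --> (\<Sum>i<n. norm (f (t i) - f (s i))) < e"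
    by (elim exE conjE) (rule that)
  have "dist (f y) (f x) < e" if y: "y : {a..b}" and yx: "dist y x < d" for y
  proof -
    have "max x y - min x y < d" using yx by (simp add: dist_real_def)
    then have "(\<Sum>i<(1::nat). norm (f (max x y) - f (min x y))) < e" using x y by (intro ac[rule_format]) auto
    then show ?thesis by (cases "x <= y") (auto simp: dist_norm norm_minus_commute max_def min_def)
  qed
  then show "EX d>0. ALL y:{a..b}. dist y x < d --> dist (f y) (f x) < e" using d by blast
qed

lemma abs_cont_on_subinterval:
  assumes f: "abs_cont_on a b f" and cb: "c <= b"
  shows "abs_cont_on a c f"
  unfolding abs_cont_on_def
proof (intro allI impI)
  fix e :: real assume e: "0 < e"
  from f[unfolded abs_cont_on_def, THEN spec, THEN mp, OF e]
  obtain d where d: "0 < d" and ac: "ALL (n::nat) (s::nat => real) t. (ALL i<n. a <= s i & s i <= t i & t i <= b) &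
      (ALL i<n. ALL j<n. i ~= j --> t i <= s j | t j <= s i) & (\<Sum>i<n. t i - s i) < d --> (\<Sum>i<n. norm (f (t i) - f (s i))) < e"
    by (elim exE conjE) (rule that)
  show "EX dl>0. ALL (n::nat) (s::nat => real) t. (ALL i<n. a <= s i & s i <= t i & t i <= c) &
      (ALL i<n. ALL j<n. i ~= j --> t i <= s j | t j <= s i) & (\<Sum>i<n. t i - s i) < dl --> (\<Sum>i<n. norm (f (t i) - f (s i))) < e"
  proof (rule exI[of _ d], intro conjI allI impI d)
    fix n :: nat and s t :: "nat => real"
    assume A: "(ALL i<n. a <= s i & s i <= t i & t i <= c) & (ALL i<n. ALL j<n. i ~= j --> t i <= s j | t j <= s i) & (\<Sum>i<n. t i - s i) < d"
    then have "ALL i<n. a <= s i & s i <= t i & t i <= b" using cb by fastforce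
    with A show "(\<Sum>i<n. norm (f (t i) - f (s i))) < e" using ac by blast
  qed
qed

text \<open>A Borel version of \<open>X\<close> on the product would agree with it for almost every
  pair only, hence possibly not at a prescribed time, whereas compression and the integrated ODE
  concern every time. So Borel versions are taken at countably many dyadic times, and continuity in
  time supplies the other values.\<close>

lemma RLF_borel_version:
  fixes X :: "real => real^'d => real^'d"
  assumes R: "RLF T b X" and T: "0 < T"
  shows "EX Y L. 0 <= L & (%z. Y (fst z) (snd z)) : borel_measurable bxb & (AE y in lborel. ALL t:{0..T}. Y t y = X t y) &
    (ALL t:{0..T}. ALL A:sets borel. emeasure lborel {y. Y t y : A} <= ennreal L * emeasure lborel A)"
proof -
  have Xm: "X t : borel_measurable lebesgue" if "t : {0..T}" for t using R that unfolding RLF_def by blast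
  have Xac: "AE y in lborel. continuous_on {0..T} (%t. X t y)"
  proof -
    have "AE y in lborel. abs_cont_on 0 T (%t. X t y) &
        (AE t in lborel. t : {0..T} --> ((%s. X s y) has_vector_derivative b t (X t y)) (at t within {0..T}))" using R unfolding RLF_def by blast
    then show ?thesis by eventually_elim (use abs_cont_on_continuous in blast)
  qed
  obtain L0 where L0: "!!t A. t : {0..T} ==> A : sets lborel ==> emeasure lebesgue {y. X t y : A} <= ennreal L0 * emeasure lborel A"
    using R unfolding RLF_def by blast
  have "EX g. g : bmb & (q : {0..T} --> (AE y in lborel. X q y = g y))" for q
  proof (cases "q : {0..T}")
    case True
    then show ?thesis using completion_borel_version_vec[OF Xm[OF True]] by auto
  next
    case False
    then show ?thesis by (intro exI[of _ "%_. 0"]) auto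
  qed
  then have "ALL q. EX g. g : bmb & (q : {0..T} --> (AE y in lborel. X q y = g y))" by blast
  from choice[OF this] obtain V where V: "!!q. V q : bmb" "!!q. q : {0..T} ==> AE y in lborel. X q y = V q y" by blast
  \<comment> \<open>Dyadic approximation from below, so that the times stay in [0, T]. For each n
    only countably many values occur, which gives joint measurability.\<close>
  define q where "q = (%(n::nat) (t::real). real_of_int \<lfloor>t * 2 ^ n\<rfloor> / 2 ^ n)"
  define Y where "Y = (%t y. lim (%n. V (q n t) y))"
  have Zm: "(%z::real \<times> (real^'d). V (q n (fst z)) (snd z)) : borel_measurable bxb" for n
  proof -
    have 1: "(%z::real \<times> (real^'d). V (real_of_int i / 2 ^ n) (snd z)) : borel_measurable bxb" for i
      by (rule measurable_compose[OF measurable_snd V(1)])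
    have 2: "(%z::real \<times> (real^'d). \<lfloor>fst z * 2 ^ n\<rfloor>) : measurable bxb (count_space UNIV)" by measurable
    show ?thesis unfolding q_def by (rule measurable_compose_countable[OF 1 2])
  qed
  have Ym: "(%z. Y (fst z) (snd z)) : borel_measurable bxb"
    unfolding Y_def by (rule borel_measurable_lim_metric[OF Zm])
  have qT: "q n t : {0..T}" if "t : {0..T}" for n t
  proof -
    have "0 <= real_of_int \<lfloor>t * 2 ^ n\<rfloor>" using that by simp
    moreover have "real_of_int \<lfloor>t * 2 ^ n\<rfloor> / 2 ^ n <= t" by (simp add: divide_le_eq)
    ultimately show ?thesis using that by (auto simp: q_def)
  qed
  have qlim: "(%n. q n t) \<longlonglongrightarrow> t" for t
  proof (rule LIM_zero_cancel, rule Lim_null_comparison[where g = "%n. (1/2)^n"])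
    show "(%n. (1/2::real)^n) \<longlonglongrightarrow> 0" by (rule LIMSEQ_realpow_zero) auto
    have "norm (q n t - t) <= (1/2)^n" for n
    proof -
      have "q n t - t = (real_of_int \<lfloor>t * 2 ^ n\<rfloor> - t * 2 ^ n) / 2 ^ n" by (simp add: q_def field_simps)
      also have "\<bar>...\<bar> <= 1 / 2 ^ n" unfolding abs_divide by (intro frac_le) (auto, linarith)
      finally show ?thesis by (simp add: power_one_over)
    qed
    then show "\<forall>\<^sub>F n in sequentially. norm (q n t - t) <= (1/2)^n" by (rule always_eventually[OF allI])
  qed
  have YX: "AE y in lborel. ALL t:{0..T}. Y t y = X t y"
  proof -
    have "AE y in lborel. ALL n. ALL i::int. real_of_int i / 2 ^ n : {0..T} --> X (real_of_int i / 2 ^ n) y = V (real_of_int i / 2 ^ n) y"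
      unfolding AE_all_countable
    proof (intro allI)
      fix n :: nat and i :: int
      show "AE y in lborel. real_of_int i / 2 ^ n : {0..T} --> X (real_of_int i / 2 ^ n) y = V (real_of_int i / 2 ^ n) y"
        using V(2)[of "real_of_int i / 2 ^ n"] by (cases "real_of_int i / 2 ^ n : {0..T}") auto
    qed
    with Xac show ?thesis
    proof eventually_elim
      case (elim y)
      show ?case
      proof
        fix t assume t: "t : {0..T}"
        have "(%n. X (q n t) y) \<longlonglongrightarrow> X t y"
          by (rule continuous_on_tendsto_compose[OF elim(1) qlim t]) (use qT[OF t] in auto)
        moreover have "X (q n t) y = V (q n t) y" for n using elim(2) qT[OF t, of n] unfolding q_def by blast
        ultimately have "(%n. V (q n t) y) \<longlonglongrightarrow> X t y" by simp
        then show "Y t y = X t y" unfolding Y_def by (rule limI)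
      qed
    qed
  qed
  have L: "emeasure lborel {y. Y t y : A} <= ennreal (max L0 0) * emeasure lborel A" if t: "t : {0..T}" and A: "A : sets borel" for t A
  proof -
    have sl: "(%y. (t, y)) : borel \<rightarrow>\<^sub>M bxb" by measurable
    have Yt: "Y t : bmb" using measurable_compose[OF sl Ym] by simp
    have YA: "{y. Y t y : A} : sets lborel" using measurable_sets[OF Yt A] by (simp add: vimage_def)
    have XA: "{y. X t y : A} : sets lebesgue" using measurable_sets[OF Xm[OF t] A] by (simp add: vimage_def)
    have YA': "{y. Y t y : A} : sets lebesgue" using YA by (rule sets_completionI_sets)
    have "emeasure lborel {y. Y t y : A} = emeasure lebesgue {y. Y t y : A}" using YA YA' by (simp add: emeasure_completion)
    also have "... = emeasure lebesgue {y. X t y : A}"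
    proof (rule emeasure_eq_AE[OF AE_completion YA' XA])
      show "AE y in lborel. y : {y. Y t y : A} \<longleftrightarrow> y : {y. X t y : A}" using YX by eventually_elim (use t in auto)
    qed
    also have "... <= ennreal L0 * emeasure lborel A" by (rule L0[OF t]) (use A in simp)
    also have "... <= ennreal (max L0 0) * emeasure lborel A" by (intro mult_right_mono ennreal_leI) auto
    finally show ?thesis .
  qed
  show ?thesis
    by (rule exI[of _ Y], rule exI[of _ "max L0 0"]) (use Ym YX L in simp)
qed

text \<open>Turns essential bounds into bounds at every point without changing the functions almost
  everywhere.\<close>

definition trunc :: "real => real => real" where "trunc M x = max (- M) (min M x)"

lemma trunc_bound: "0 <= M ==> \<bar>trunc M x\<bar> <= M" by (auto simp: trunc_def)

lemma trunc_id: "\<bar>x\<bar> <= M ==> trunc M x = x" by (auto simp: trunc_def)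

lemma trunc_diff: "\<bar>trunc M x - trunc M y\<bar> <= \<bar>x - y\<bar>" by (auto simp: trunc_def)

lemma trunc_measurable [measurable]: "trunc M : bmb"
  unfolding trunc_def[abs_def] by measurable

section \<open>Representatives of the field and of its divergence\<close>

lemma crep_joint:
  fixes F :: "real => real^'d => real"
  assumes F: "(%z. F (fst z) (snd z)) : borel_measurable bxb"
  shows "(%z. crep (F (fst z)) (snd z)) : borel_measurable bxb"
  unfolding crep_def
proof (rule borel_measurable_lim_metric)
  fix k :: nat
  have cu [measurable]: "(cu ((1/2)^k) :: (real^'d) set) : sets borel" by (simp add: cu_def)
  have a: "(%w. (fst (fst w), snd w + snd (fst w))) : bxb \<Otimes>\<^sub>M lborel \<rightarrow>\<^sub>M (borel :: real measure) \<Otimes>\<^sub>M (borel :: (real^'d) measure)" by measurable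
  have [measurable]: "(%w. F (fst (fst w)) (snd w + snd (fst w))) : borel_measurable (bxb \<Otimes>\<^sub>M lborel)"
    using measurable_compose[OF a F] by simp
  have "(%z. \<integral>p. ind (cu ((1/2)^k)) p * F (fst z) (p + snd z) \<partial>lborel) : borel_measurable bxb"
    by (rule lborel.borel_measurable_lebesgue_integral) (simp add: case_prod_unfold)
  then show "(%z. cavg ((1/2)^k) (F (fst z)) (snd z)) : borel_measurable bxb"
    unfolding cavg_def by (rule borel_measurable_divide) simp
qed

lemma AE_pair_of_slices:
  fixes U V :: "real \<times> (real^'d) => 'b::euclidean_space"
  assumes [measurable]: "U : borel_measurable bxb" "V : borel_measurable bxb" "S : sets borel"
    and a: "AE s in lborel. s : {0..T} --> (AE x in lborel. x : S --> U (s, x) = V (s, x))"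
  shows "AE z in plb. fst z : {0..T} --> snd z : S --> U z = V z"
proof -
  have "{z : space bxb. fst z : {0..T} --> snd z : S --> norm (U z - V z) = 0} : sets bxb" by measurable
  then have S: "{z : space plb. fst z : {0..T} --> snd z : S --> U z = V z} : sets plb"
    unfolding pair_lborel_sets by (simp add: space_pair_measure)
  show ?thesis
  proof (rule lborel_pair.AE_pair_measure[OF S])
    show "AE s in lborel. AE x in lborel. fst (s, x) : {0..T} --> snd (s, x) : S --> U (s, x) = V (s, x)"
      using a
    proof eventually_elim
      case (elim s)
      then show ?case by (cases "s : {0..T}") auto
    qed
  qed
qed

lemma bmo_gradient_cdini:
  fixes u :: "real^'d => real^'d"
  assumes J: "weak_jac u G" and b: "!!j. bmo_le (%x. G x $ i $ j) C"
    and f: "f : bmb" and fM: "!!x. \<bar>f x\<bar> <= M" and uf: "AE x in lborel. u x $ i = f x"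
  shows "cdini (real CARD('d) * (M + 2 * (C * 4 ^ CARD('d)))) f"
proof -
  have fl: "lloc f" using fM by (intro lloc_bounded f) blast
  have w: "weak_partial (%x. u x $ i) j (%x. G x $ i $ j)" for j using J unfolding weak_jac_def by blast
  have "ALL j. EX g. lloc g & (AE x in lborel. G x $ i $ j = g x)"
    using loc_int_borel_version w unfolding weak_partial_def by blast
  from choice[OF this] obtain g where g: "!!j. lloc (g j)" "!!j. AE x in lborel. G x $ i $ j = g j x" by blast
  show ?thesis
    by (rule bmo_cdini[OF fl g(1) bweak_of_weak_partial[OF w fl uf g] fM bmo_bound_of_bmo_le[OF b g]])
qed

text \<open>At almost every time the components are bounded with BMO gradient, and
  \<open>crep\<close> supplies log-Lipschitz representatives. At the exceptional times field and
  divergence are set to 0, so that every pointwise requirement survives; joint measurability holds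
  because \<open>crep\<close> is a limit of integrals depending on parameters.\<close>

lemma field_representative:
  fixes u :: "real => real^'d => real^'d" and D :: "real => real^'d => real"
  assumes per: "!!t. periodic (u t)" and lu: "linf T UNIV u" and lD: "linf T UNIV D"
    and dv: "AE t in lborel. t : {0..T} --> weak_div (u t) (D t)"
    and jac: "AE t in lborel. t : {0..T} --> weak_jac (u t) (G t)"
    and bmo: "AE t in lborel. t : {0..T} --> (ALL i j. bmo_le (%x. G t x $ i $ j) Cb)"
  shows "EX M C u' D'. 0 <= M & 0 <= C & (%z. u' (fst z) (snd z)) : borel_measurable bxb & (ALL s x. norm (u' s x) <= M) &
    (ALL s x y. norm (u' s x - u' s y) <= C * ll (norm (x - y))) & (%z. D' (fst z) (snd z)) : borel_measurable bxb &
    (ALL s x. \<bar>D' s x\<bar> <= M) & (ALL s. bdiv (u' s) (D' s)) & (ALL s x n. u' s (x + lat n) = u' s x) &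
    (AE z in plb. fst z : {0..T} --> u (fst z) (snd z) = u' (fst z) (snd z)) &
    (AE z in plb. fst z : {0..T} --> D (fst z) (snd z) = D' (fst z) (snd z))"
proof -
  let ?d = "real CARD('d)"
  obtain M1 where M1: "AE z in plb. fst z : {0..T} & snd z : UNIV --> norm (u (fst z) (snd z)) <= M1" using lu unfolding linf_def by blast
  obtain M2 where M2: "AE z in plb. fst z : {0..T} & snd z : UNIV --> norm (D (fst z) (snd z)) <= M2" using lD unfolding linf_def by blast
  have umc: "(%z. u (fst z) (snd z)) : borel_measurable (completion plb)" using lu unfolding linf_def by blast
  have Dmc: "(%z. D (fst z) (snd z)) : borel_measurable (completion plb)" using lD unfolding linf_def by blast
  obtain U where "U : borel_measurable plb" and uU: "AE z in plb. u (fst z) (snd z) = U z" using completion_borel_version_vec[OF umc] by blast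
  then have Um [measurable]: "U : borel_measurable bxb" by (simp add: pair_lborel_measurable)
  obtain V where "V : borel_measurable plb" and DV: "AE z in plb. D (fst z) (snd z) = V z" using completion_ex_borel_measurable_real[OF Dmc] by blast
  then have Vm [measurable]: "V : borel_measurable bxb" by (simp add: pair_lborel_measurable)
  define M where "M = Max {0, M1, M2}"
  have M0: "0 <= M" "M1 <= M" "M2 <= M" by (auto simp: M_def)
  define f where "f = (%i t x. trunc M (U (t, x) $ i))"
  define d where "d = (%t x. trunc M (V (t, x)))"
  have fj: "(%z. f i (fst z) (snd z)) : borel_measurable bxb" for i
    using measurable_compose[OF measurable_compose[OF Um vec_nth_borel[of i]] trunc_measurable[of M]] by (simp add: f_def)
  have dj: "(%z. d (fst z) (snd z)) : borel_measurable bxb"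
    using measurable_compose[OF Vm trunc_measurable[of M]] by (simp add: d_def)
  have sl: "(%x::real^'d. (t, x)) : borel \<rightarrow>\<^sub>M bxb" for t :: real by measurable
  have fs: "f i t : bmb" for i t using measurable_compose[OF sl fj] by simp
  have ds: "d t : bmb" for t using measurable_compose[OF sl dj] by simp
  have fM: "\<bar>f i t x\<bar> <= M" for i t x unfolding f_def by (rule trunc_bound[OF M0(1)])
  have dM: "\<bar>d t x\<bar> <= M" for t x unfolding d_def by (rule trunc_bound[OF M0(1)])
  have su: "AE t in lborel. AE x in lborel. t : {0..T} --> (ALL i. u t x $ i = f i t x & u t x $ i = U (t, x) $ i)"
  proof -
    have "AE z in plb. fst z : {0..T} --> (ALL i. u (fst z) (snd z) $ i = f i (fst z) (snd z) & u (fst z) (snd z) $ i = U z $ i)"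
      using M1 uU
    proof eventually_elim
      case (elim z)
      show ?case
      proof (intro impI allI)
        fix i assume "fst z : {0..T}"
        then have "\<bar>U z $ i\<bar> <= M" using elim component_le_norm_cart[of "U z" i] M0(2) by simp
        then show "u (fst z) (snd z) $ i = f i (fst z) (snd z) & u (fst z) (snd z) $ i = U z $ i"
          using elim(2) trunc_id[of "U z $ i" M] by (simp add: f_def)
      qed
    qed
    from lborel_pair.AE_pair[OF this] show ?thesis by simp
  qed
  have sD: "AE t in lborel. AE x in lborel. t : {0..T} --> D t x = d t x & D t x = V (t, x)"
  proof -
    have "AE z in plb. fst z : {0..T} --> D (fst z) (snd z) = d (fst z) (snd z) & D (fst z) (snd z) = V z"
      using M2 DV
    proof eventually_elim
      case (elim z)
      show ?case
      proof
        assume "fst z : {0..T}"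
        then have "\<bar>V z\<bar> <= M" using elim M0(3) by simp
        then show "D (fst z) (snd z) = d (fst z) (snd z) & D (fst z) (snd z) = V z" using elim(2) trunc_id[of "V z" M] by (simp add: d_def)
      qed
    qed
    from lborel_pair.AE_pair[OF this] show ?thesis by simp
  qed
  let ?P = "%t. t : {0..T} --> (AE x in lborel. ALL i. u t x $ i = f i t x & u t x $ i = U (t, x) $ i) & (AE x in lborel. D t x = d t x & D t x = V (t, x)) &
     weak_div (u t) (D t) & weak_jac (u t) (G t) & (ALL i j. bmo_le (%x. G t x $ i $ j) Cb)"
  have "AE t in lborel. ?P t" using su sD dv jac bmo by eventually_elim auto
  then obtain N where N: "!!t. t : space lborel - N ==> ?P t" "N : null_sets lborel" by (rule AE_E3) blast
  \<comment> \<open>The times at which all hypotheses hold; the removed set \<open>N\<close> is a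
    Borel null set, so \<open>S\<close> is Borel.\<close>
  define S where "S = {0..T} - N"
  have Sb [measurable]: "S : sets borel" using N(2) by (auto simp: S_def null_sets_def)
  have SP: "(AE x in lborel. ALL i. u t x $ i = f i t x & u t x $ i = U (t, x) $ i)" "(AE x in lborel. D t x = d t x & D t x = V (t, x))"
     "weak_div (u t) (D t)" "weak_jac (u t) (G t)" "!!i j. bmo_le (%x. G t x $ i $ j) Cb" if "t : S" for t
    using N(1)[of t] that by (auto simp: S_def)
  have NS: "AE t in lborel. t : {0..T} --> t : S" using AE_not_in[OF N(2)] by eventually_elim (simp add: S_def)
  define c where "c = ?d * (M + 2 * (Cb * 4 ^ CARD('d)))"
  have uf: "AE x in lborel. u t x $ i = f i t x" if "t : S" for t i using SP(1)[OF that] by eventually_elim simp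
  have cd: "cdini c (f i t)" if t: "t : S" for i t
    unfolding c_def by (rule bmo_gradient_cdini[OF SP(4)[OF t] SP(5)[OF t] fs fM uf[OF t]])
  \<comment> \<open>\<open>crep\<close> equals the bounded function only almost everywhere;
    truncating once more gives the bound at every point.\<close>
  define v where "v = (%i t x. if t : S then trunc M (crep (f i t) x) else 0)"
  define u' where "u' = (%t x. \<chi> i. v i t x)"
  define D' where "D' = (%t x. if t : S then d t x else 0)"
  have vj: "(%z. v i (fst z) (snd z)) : borel_measurable bxb" for i
  proof -
    have [measurable]: "(%z. trunc M (crep (f i (fst z)) (snd z))) : borel_measurable bxb"
      using measurable_compose[OF crep_joint[OF fj] trunc_measurable[of M]] by simp
    show ?thesis unfolding v_def by measurable
  qed
  have u'm: "(%z. u' (fst z) (snd z)) : borel_measurable bxb" unfolding u'_def by (rule borel_measurable_vec_lambda[OF vj])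
  have D'm: "(%z. D' (fst z) (snd z)) : borel_measurable bxb"
  proof -
    note [measurable] = dj
    show ?thesis unfolding D'_def by measurable
  qed
  have vM: "\<bar>v i t x\<bar> <= M" for i t x using trunc_bound[OF M0(1)] M0(1) by (simp add: v_def)
  have u'M: "norm (u' t x) <= ?d * M" for t x by (rule norm_le_card_sup) (simp add: u'_def vM)
  have D'M: "\<bar>D' t x\<bar> <= ?d * M" for t x
  proof -
    have "1 * M <= ?d * M" using M0(1) by (intro mult_right_mono) (auto simp: Suc_le_eq)
    moreover have "\<bar>D' t x\<bar> <= M" using dM[of t x] M0(1) by (simp add: D'_def)
    ultimately show ?thesis by simp
  qed
  \<comment> \<open>The first term serves distances up to 1, the second larger ones, where
    \<open>ll\<close> is at least 1 and the oscillation at most 2 M. The maximum with 0 covers a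
    negative \<open>c\<close>.\<close>
  define K where "K = 100 * max c 0 + 2 * M"
  have K0: "0 <= K" using M0(1) by (simp add: K_def)
  have vl: "\<bar>v i t x - v i t y\<bar> <= K * ll (norm (x - y))" for i t x y
  proof (cases "t : S")
    case True
    have l0: "0 <= ll (norm (x - y))" by (rule ll_nonneg) simp
    show ?thesis
    proof (cases "norm (x - y) <= 1")
      case le: True
      have "\<bar>v i t x - v i t y\<bar> <= \<bar>crep (f i t) x - crep (f i t) y\<bar>" using True trunc_diff by (simp add: v_def)
      also have "... <= 100 * c * ll (norm (x - y))" using crep_modulus[OF cd[OF True] le, of i y] by simp
      also have "... <= K * ll (norm (x - y))" using l0 M0(1) by (intro mult_right_mono) (auto simp: K_def)
      finally show ?thesis .
    next
      case False
      have "1 <= ll (norm (x - y))" using ll_ge_self[of "norm (x - y)"] False by simp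
      then have "K * 1 <= K * ll (norm (x - y))" using K0 by (rule mult_left_mono)
      moreover have "\<bar>v i t x - v i t y\<bar> <= 2 * M" using vM[of i t x] vM[of i t y] by linarith
      ultimately show ?thesis by (simp add: K_def)
    qed
  next
    case False
    then show ?thesis using K0 ll_nonneg[of "norm (x - y)"] by (simp add: v_def)
  qed
  have u'l: "norm (u' t x - u' t y) <= ?d * K * ll (norm (x - y))" for t x y
  proof -
    have "norm (u' t x - u' t y) <= ?d * (K * ll (norm (x - y)))" by (rule norm_le_card_sup) (simp add: u'_def vl)
    then show ?thesis by (simp add: mult.assoc)
  qed
  have uu': "AE x in lborel. u t x = u' t x" if t: "t : S" for t
  proof -
    have "AE x in lborel. ALL i:UNIV. crep (f i t) x = f i t x" by (rule AE_finite_allI) (auto intro: crep_AE[OF cd[OF t]])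
    with SP(1)[OF t] show ?thesis
    proof eventually_elim
      case (elim x)
      have "v i t x = u t x $ i" for i
      proof -
        have "v i t x = trunc M (f i t x)" using elim(2) t by (simp add: v_def)
        also have "... = f i t x" by (rule trunc_id[OF fM])
        finally show ?thesis using elim(1) by simp
      qed
      then show ?case by (simp add: u'_def vec_eq_iff)
    qed
  qed
  have u'p: "u' t (x + lat n) = u' t x" for t x n
  proof -
    have "v i t (x + lat n) = v i t x" for i
    proof (cases "t : S")
      case True
      have ulat: "u t (x + lat n) = u t x" for x
        using per[of t] lat_in[of n] unfolding periodic_def Lat_def by blast
      have "AE x in lborel. f i t (x + lat n) = f i t x"
        using uf[OF True, of i] AE_lborel_translate[OF uf[OF True, of i], of "lat n"] by eventually_elim (simp add: ulat)
      from crep_periodic[OF fs this] show ?thesis by (simp add: v_def)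
    next
      case False
      then show ?thesis by (simp add: v_def)
    qed
    then show ?thesis by (simp add: u'_def)
  qed
  have vs: "v i t : bmb" for i t using measurable_compose[OF sl vj] by simp
  have D's: "D' t : bmb" for t using measurable_compose[OF sl D'm] by simp
  have dv': "bdiv (u' t) (D' t)" for t
  proof (cases "t : S")
    case True
    have l1: "lloc (%x. u' t x $ j)" for j using vM by (simp add: u'_def) (intro lloc_bounded[OF vs], blast)
    have l2: "lloc (D' t)" using D'M by (intro lloc_bounded[OF D's]) blast
    have "AE x in lborel. D t x = D' t x" using SP(2)[OF True] by eventually_elim (use True in \<open>simp add: D'_def\<close>)
    from bdiv_of_weak_div[OF SP(3)[OF True] l1 uu'[OF True] l2 this] show ?thesis .
  next
    case False
    then show ?thesis by (simp add: bdiv_def u'_def v_def D'_def)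
  qed
  have r1: "AE z in plb. fst z : {0..T} --> u (fst z) (snd z) = u' (fst z) (snd z)"
  proof -
    have "AE s in lborel. s : {0..T} --> (AE x in lborel. x : UNIV --> U (s, x) = u' (fst (s, x)) (snd (s, x)))"
      using NS
    proof eventually_elim
      case (elim s)
      show ?case
      proof
        assume "s : {0..T}"
        then have s: "s : S" using elim by simp
        show "AE x in lborel. x : UNIV --> U (s, x) = u' (fst (s, x)) (snd (s, x))"
          using SP(1)[OF s] uu'[OF s]
        proof eventually_elim
          case (elim x)
          then have "U (s, x) = u s x" by (metis vec_eq_iff)
          then show ?case using elim by simp
        qed
      qed
    qed
    from AE_pair_of_slices[OF Um u'm _ this] have "AE z in plb. fst z : {0..T} --> snd z : UNIV --> U z = u' (fst z) (snd z)" by simp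
    with uU show ?thesis by eventually_elim simp
  qed
  have r2: "AE z in plb. fst z : {0..T} --> D (fst z) (snd z) = D' (fst z) (snd z)"
  proof -
    have "AE s in lborel. s : {0..T} --> (AE x in lborel. x : UNIV --> V (s, x) = D' (fst (s, x)) (snd (s, x)))"
      using NS
    proof eventually_elim
      case (elim s)
      show ?case
      proof
        assume "s : {0..T}"
        then have s: "s : S" using elim by simp
        show "AE x in lborel. x : UNIV --> V (s, x) = D' (fst (s, x)) (snd (s, x))"
          using SP(2)[OF s] by eventually_elim (use s in \<open>simp add: D'_def\<close>)
      qed
    qed
    from AE_pair_of_slices[OF Vm D'm _ this] have "AE z in plb. fst z : {0..T} --> snd z : UNIV --> V z = D' (fst z) (snd z)" by simp
    with DV show ?thesis by eventually_elim simp
  qed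
  have dM0: "0 <= ?d * M" and dK0: "0 <= ?d * K" using M0(1) K0 by auto
  show ?thesis
    by (rule exI[of _ "?d * M"], rule exI[of _ "?d * K"], rule exI[of _ u'], rule exI[of _ D'])
       (intro conjI allI dM0 dK0 u'm u'M u'l D'm D'M dv' u'p r1 r2)
qed

lemma pflow_exists:
  fixes u X :: "real => real^'d => real^'d" and D :: "real => real^'d => real"
  assumes T: "0 < T" and per: "!!t. periodic (u t)" and lu: "linf T UNIV u" and lD: "linf T UNIV D"
    and dv: "AE t in lborel. t : {0..T} --> weak_div (u t) (D t)"
    and jac: "AE t in lborel. t : {0..T} --> weak_jac (u t) (G t)"
    and bmo: "EX C. AE t in lborel. t : {0..T} --> (ALL i j. bmo_le (%x. G t x $ i $ j) C)"
    and R: "RLF T u X"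
  shows "EX M C L u' D' Y. (ALL M' C' L'. M <= M' --> C <= C' --> L <= L' --> pflow T M' C' L' u' D' Y) &
    (AE z in plb. fst z : {0..T} --> u (fst z) (snd z) = u' (fst z) (snd z)) &
    (AE z in plb. fst z : {0..T} --> D (fst z) (X (fst z) (snd z)) = D' (fst z) (Y (fst z) (snd z)))"
proof -
  obtain Cb where Cb: "AE t in lborel. t : {0..T} --> (ALL i j. bmo_le (%x. G t x $ i $ j) Cb)" using bmo by blast
  obtain M C u' D' where M: "0 <= M" and C: "0 <= C" and um: "(%z. u' (fst z) (snd z)) : borel_measurable bxb" and ub: "ALL s x. norm (u' s x) <= M"
    and ul: "ALL s x y. norm (u' s x - u' s y) <= C * ll (norm (x - y))" and Dm: "(%z. D' (fst z) (snd z)) : borel_measurable bxb"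
    and Db: "ALL s x. \<bar>D' s x\<bar> <= M" and bd: "ALL s. bdiv (u' s) (D' s)" and up: "ALL s x n. u' s (x + lat n) = u' s x"
    and uu: "AE z in plb. fst z : {0..T} --> u (fst z) (snd z) = u' (fst z) (snd z)"
    and DD: "AE z in plb. fst z : {0..T} --> D (fst z) (snd z) = D' (fst z) (snd z)"
    using field_representative[OF per lu lD dv jac Cb] by (elim exE conjE) (rule that)
  obtain Y L where L: "0 <= L" and Ym: "(%z. Y (fst z) (snd z)) : borel_measurable bxb" and YX: "AE y in lborel. ALL t:{0..T}. Y t y = X t y"
    and YL: "ALL t:{0..T}. ALL A:sets borel. emeasure lborel {y. Y t y : A} <= ennreal L * emeasure lborel A"
    using RLF_borel_version[OF R T] by (elim exE conjE) (rule that)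
  have YL': "emeasure lborel {y. Y t y : A} <= ennreal L * emeasure lborel A" if "t : {0..T}" "A : sets borel" for t A using YL that by blast
  have cmp: "AE z in plb. fst z : {0..T} --> P (fst z) (Y (fst z) (snd z))"
    if "AE z in plb. fst z : {0..T} --> P (fst z) (snd z)" for P :: "real => real^'d => bool"
    by (rule AE_compressible_compose[OF Ym _ that, where L = L]) (rule YL')
  have ub': "\<bar>u' s x $ j\<bar> <= M" for s x j using component_le_norm_cart[of "u' s x" j] ub by (meson order_trans)
  have ts: "(%s. (s, y)) : borel \<rightarrow>\<^sub>M bxb" for y :: "real^'d" by measurable
  have Yt: "(%s. Y s y) : bmb" for y using measurable_compose[OF ts Ym] by simp
  have uY: "(%s. u' s (Y s y) $ j) : bmb" for y j
  proof -
    have "(%s. (s, Y s y)) : borel \<rightarrow>\<^sub>M bxb" using Yt by measurable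
    from measurable_compose[OF measurable_compose[OF this um] vec_nth_borel[of j]] show ?thesis by simp
  qed
  have X0: "X 0 y = y" for y using R unfolding RLF_def by blast
  have Xac: "AE y in lborel. abs_cont_on 0 T (%t. X t y) &
        (AE t in lborel. t : {0..T} --> ((%s. X s y) has_vector_derivative u t (X t y)) (at t within {0..T}))" using R unfolding RLF_def by blast
  have ode: "AE y in lborel. ALL t:{0..T}. ALL j. Y t y $ j = y $ j + (LBINT s. ind {0..t} s * u' s (Y s y) $ j)"
    using Xac YX AE_pair_swap[of "%s y. s : {0..T} --> u s (Y s y) = u' s (Y s y)", OF cmp[of "%s x. u s x = u' s x", OF uu]]
  proof eventually_elim
    case (elim y)
    have "AE s in lborel. s : {0..T} --> ((%s. X s y) has_vector_derivative u' s (Y s y)) (at s within {0..T})"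
      using elim(1)[THEN conjunct2] elim(3)
    proof eventually_elim
      case (elim s)
      then show ?case using \<open>ALL t:{0..T}. Y t y = X t y\<close> by simp
    qed
    from AE_lborel_negligible[OF this] have neg: "negligible {s. ~ (s : {0..T} --> ((%s. X s y) has_vector_derivative u' s (Y s y)) (at s within {0..T}))}" .
    show ?case
    proof (intro ballI allI)
      fix t j assume t: "t : {0..T}"
      have t0: "0 <= t" "t <= T" using t by auto
      have "((%s. u' s (Y s y)) has_integral X t y - X 0 y) {0..t}"
      proof (rule abs_cont_on_has_integral[OF abs_cont_on_subinterval[OF elim(1)[THEN conjunct1] t0(2)] t0(1) neg])
        fix s assume s: "s : {0..t} - {s. ~ (s : {0..T} --> ((%s. X s y) has_vector_derivative u' s (Y s y)) (at s within {0..T}))}"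
        then have "((%s. X s y) has_vector_derivative u' s (Y s y)) (at s within {0..T})" using t0 by auto
        then show "((%s. X s y) has_vector_derivative u' s (Y s y)) (at s within {0..t})"
          by (rule has_vector_derivative_within_subset) (use t0 in auto)
      qed
      from has_integral_linear[OF this bounded_linear_vec_nth[of j]]
      have hi: "((%s. u' s (Y s y) $ j) has_integral X t y $ j - y $ j) {0..t}" by (simp add: o_def X0)
      have "set_integrable lborel {0..t} (%s. u' s (Y s y) $ j)"
        unfolding set_integrable_def real_scaleR_def by (rule indicator_Icc_bounded_integrable[OF uY ub'])
      from set_borel_integral_eq_integral(2)[OF this]
      have "(LBINT s. ind {0..t} s * u' s (Y s y) $ j) = integral {0..t} (%s. u' s (Y s y) $ j)" by (simp add: set_lebesgue_integral_def)
      also have "... = X t y $ j - y $ j" by (rule integral_unique[OF hi])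
      finally show "Y t y $ j = y $ j + (LBINT s. ind {0..t} s * u' s (Y s y) $ j)" using elim(2) t by simp
    qed
  qed
  have pf: "pflow T M' C' L' u' D' Y" if M': "M <= M'" and C': "C <= C'" and L': "L <= L'" for M' C' L'
  proof unfold_locales
    show "0 <= T" "0 <= M'" "0 <= C'" "0 <= L'" using T M C L that by auto
    show "norm (u' s x) <= M'" "\<bar>D' s x\<bar> <= M'" for s x using ub Db M' by (meson order_trans)+
    show "norm (u' s x - u' s y) <= C' * ll (norm (x - y))" for s x y
    proof -
      have "C * ll (norm (x - y)) <= C' * ll (norm (x - y))" using C' ll_nonneg[of "norm (x - y)"] by (intro mult_right_mono) auto
      then show ?thesis using ul by (meson order_trans)
    qed
    show "emeasure lborel {y. Y t y : A} <= ennreal L' * emeasure lborel A" if "t : {0..T}" "A : sets borel" for t A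
      by (rule order_trans[OF YL'[OF that]]) (intro mult_right_mono ennreal_leI L', simp)
  qed (use um Dm bd Ym ode up in auto)
  have "AE z in plb. fst z : {0..T} --> D (fst z) (X (fst z) (snd z)) = D' (fst z) (Y (fst z) (snd z))"
  proof -
    obtain N where N: "!!y. y : space lborel - N ==> ALL t:{0..T}. Y t y = X t y" "N : null_sets lborel" using YX by (rule AE_E3) blast
    have "AE z in (lborel :: real measure) \<Otimes>\<^sub>M lborel. snd z ~: N"
    proof (rule lborel_pair.AE_pair_measure)
      have [measurable]: "N : sets borel" using N(2) by (auto simp: null_sets_def)
      have "{z : space ((borel :: real measure) \<Otimes>\<^sub>M borel). snd z ~: N} : sets bxb" by measurable
      then show "{z : space ((lborel :: real measure) \<Otimes>\<^sub>M lborel). snd z ~: N} : sets plb"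
        unfolding pair_lborel_sets by (simp add: space_pair_measure)
      show "AE s in (lborel :: real measure). AE y in lborel. snd (s, y) ~: N" using AE_not_in[OF N(2)] by simp
    qed
    with cmp[of "%s x. D s x = D' s x", OF DD] show ?thesis
    proof eventually_elim
      case (elim z)
      have "ALL t:{0..T}. Y t (snd z) = X t (snd z)" using N(1) elim(2) by simp
      then show ?case using elim(1) by auto
    qed
  qed
  then show ?thesis using pf uu by blast
qed

section \<open>Periodic potentials and the conclusion\<close>

lemma bweak_diff:
  assumes f: "lloc f1" "lloc f2" and g: "lloc g1" "lloc g2" and w: "bweak f1 j g1" "bweak f2 j g2"
  shows "bweak (%x. f1 x - f2 x) j (%x. g1 x - g2 x)"
  unfolding bweak_def
proof (intro allI impI)
  fix psi :: "real^'a => real" assume psi: "test_fun psi"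
  have i: "integrable lborel (%x. f x * dpart psi j x)" "integrable lborel (%x. f x * psi x)" if "lloc f" for f
    using conv_integrable_dpart[OF that psi, of j 0] conv_integrable_test[OF that psi, of 0] by auto
  show "(LBINT x. (f1 x - f2 x) * dpart psi j x) = - (LBINT x. (g1 x - g2 x) * psi x)"
    using w psi i(1)[OF f(1)] i(1)[OF f(2)] i(2)[OF g(1)] i(2)[OF g(2)] unfolding bweak_def by (simp add: left_diff_distrib)
qed

lemma weak_grad_borel_potential:
  fixes U :: "real^'d => real^'d"
  assumes p: "periodic phi" and w: "weak_grad phi U" and U': "!!j. lloc (%x. U' x $ j)" "AE x in lborel. U x = U' x"
  shows "EX phi'. lloc phi' & (ALL n. AE x in lborel. phi' (x + lat n) = phi' x) & (ALL j. bweak phi' j (%x. U' x $ j))"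
proof -
  have wj: "weak_partial phi j (%x. U x $ j)" for j using w unfolding weak_grad_def by blast
  obtain phi' where phi': "lloc phi'" "AE x in lborel. phi x = phi' x" using loc_int_borel_version wj unfolding weak_partial_def by blast
  have "AE x in lborel. phi' (x + lat n) = phi' x" for n
    using phi'(2) AE_lborel_translate[OF phi'(2), of "lat n"]
  proof eventually_elim
    case (elim x)
    have "phi (x + lat n) = phi x" using p lat_in[of n] unfolding periodic_def Lat_def by blast
    then show ?case using elim by simp
  qed
  moreover have "bweak phi' j (%x. U' x $ j)" for j
  proof (rule bweak_of_weak_partial[OF wj phi' U'(1)])
    show "AE x in lborel. U x $ j = U' x $ j" using U'(2) by eventually_elim simp
  qed
  ultimately show ?thesis using phi'(1) by blast
qed

theorem mainTheorem7:
  fixes T :: real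
    and \<sigma> :: "real \<Rightarrow> real^'d \<Rightarrow> real"
    and u1 u2 X1 X2 :: "real \<Rightarrow> real^'d \<Rightarrow> real^'d"
  assumes "T > 0"
    and "linf T (cbox 0 One) \<sigma>"
    and "\<And>t. periodic (u1 t)" and "\<And>t. periodic (u2 t)"
    and "AE t in lborel. t \<in> {0..T} \<longrightarrow> (\<exists>\<phi>. periodic \<phi> \<and> weak_grad \<phi> (u1 t))"
    and "AE t in lborel. t \<in> {0..T} \<longrightarrow> (\<exists>\<phi>. periodic \<phi> \<and> weak_grad \<phi> (u2 t))"
    and "AE t in lborel. t \<in> {0..T} \<longrightarrow> integral (cbox 0 One) (u1 t) = 0"
    and "AE t in lborel. t \<in> {0..T} \<longrightarrow> integral (cbox 0 One) (u2 t) = 0"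
    and "linf T UNIV u1" and "linf T UNIV u2"
    and "linf T UNIV D1" and "AE t in lborel. t \<in> {0..T} \<longrightarrow> weak_div (u1 t) (D1 t)"
    and "linf T UNIV D2" and "AE t in lborel. t \<in> {0..T} \<longrightarrow> weak_div (u2 t) (D2 t)"
    and "(\<lambda>z. G1 (fst z) (snd z)) \<in> borel_measurable (completion (lborel \<Otimes>\<^sub>M lborel))"
    and "AE t in lborel. t \<in> {0..T} \<longrightarrow> weak_jac (u1 t) (G1 t)"
    and "\<exists>C. AE t in lborel. t \<in> {0..T} \<longrightarrow> (\<forall>i j. bmo_le (\<lambda>x. G1 t x $ i $ j) C)"
    and "(\<lambda>z. G2 (fst z) (snd z)) \<in> borel_measurable (completion (lborel \<Otimes>\<^sub>M lborel))"
    and "AE t in lborel. t \<in> {0..T} \<longrightarrow> weak_jac (u2 t) (G2 t)"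
    and "\<exists>C. AE t in lborel. t \<in> {0..T} \<longrightarrow> (\<forall>i j. bmo_le (\<lambda>x. G2 t x $ i $ j) C)"
    and "RLF T u1 X1" and "RLF T u2 X2"
    and "AE z in lborel \<Otimes>\<^sub>M lborel. fst z \<in> {0..T} \<and> snd z \<in> cbox 0 One \<longrightarrow>
           D1 (fst z) (X1 (fst z) (snd z)) = \<sigma> (fst z) (snd z)"
    and "AE z in lborel \<Otimes>\<^sub>M lborel. fst z \<in> {0..T} \<and> snd z \<in> cbox 0 One \<longrightarrow>
           D2 (fst z) (X2 (fst z) (snd z)) = \<sigma> (fst z) (snd z)"
  shows "AE z in lborel \<Otimes>\<^sub>M lborel. fst z \<in> {0..T} \<and> snd z \<in> cbox 0 One \<longrightarrow>
           u1 (fst z) (snd z) = u2 (fst z) (snd z)"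
proof -
  obtain M1 C1 L1 v1 E1 Y1 where p1: "ALL M' C' L'. M1 <= M' --> C1 <= C' --> L1 <= L' --> pflow T M' C' L' v1 E1 Y1"
    and uv1: "AE z in plb. fst z : {0..T} --> u1 (fst z) (snd z) = v1 (fst z) (snd z)"
    and DE1: "AE z in plb. fst z : {0..T} --> D1 (fst z) (X1 (fst z) (snd z)) = E1 (fst z) (Y1 (fst z) (snd z))"
    using pflow_exists[OF assms(1,3,9,11,12,16,17,21)] by (elim exE conjE) (rule that)
  obtain M2 C2 L2 v2 E2 Y2 where p2: "ALL M' C' L'. M2 <= M' --> C2 <= C' --> L2 <= L' --> pflow T M' C' L' v2 E2 Y2"
    and uv2: "AE z in plb. fst z : {0..T} --> u2 (fst z) (snd z) = v2 (fst z) (snd z)"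
    and DE2: "AE z in plb. fst z : {0..T} --> D2 (fst z) (X2 (fst z) (snd z)) = E2 (fst z) (Y2 (fst z) (snd z))"
    using pflow_exists[OF assms(1,4,10,13,14,19,20,22)] by (elim exE conjE) (rule that)
  interpret F1: pflow T "max M1 M2" "max C1 C2" "max L1 L2" v1 E1 Y1 using p1 by simp
  interpret F2: pflow T "max M1 M2" "max C1 C2" "max L1 L2" v2 E2 Y2 using p2 by simp
  have s1: "AE s in lborel. s : {0..T} --> (AE x in lborel. u1 s x = v1 s x)"
    using lborel_pair.AE_pair[OF uv1]
  proof eventually_elim
    case (elim s) then show ?case by (cases "s : {0..T}") auto
  qed
  have s2: "AE s in lborel. s : {0..T} --> (AE x in lborel. u2 s x = v2 s x)"
    using lborel_pair.AE_pair[OF uv2]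
  proof eventually_elim
    case (elim s) then show ?case by (cases "s : {0..T}") auto
  qed
  interpret flow_pair T "max M1 M2" "max C1 C2" "max L1 L2" v1 v2 E1 E2 Y1 Y2
  proof unfold_locales
    have "AE z in plb. fst z : {0..T} --> snd z : cbox 0 One --> E1 (fst z) (Y1 (fst z) (snd z)) = E2 (fst z) (Y2 (fst z) (snd z))"
      using DE1 DE2 assms(23,24) by eventually_elim auto
    from lborel_pair.AE_pair[OF this]
    show "AE s in lborel. AE y in lborel. s : {0..T} --> y : hq --> E1 s (Y1 s y) = E2 s (Y2 s y)"
    proof eventually_elim
      case (elim s)
      then show ?case using AE_hq_cbox by eventually_elim auto
    qed
    show "AE s in lborel. s : {0..T} --> (EX phi. lloc phi & (ALL n. AE x in lborel. phi (x + lat n) = phi x) & (ALL j. bweak phi j (%x. (v1 s x - v2 s x) $ j)))"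
      using s1 s2 assms(5,6)
    proof eventually_elim
      case (elim s)
      show ?case
      proof
        assume s: "s : {0..T}"
        have l1: "lloc (%x. v1 s x $ j)" for j by (rule lloc_bounded[OF F1.u_slice]) (use F1.ubj in blast)
        have l2: "lloc (%x. v2 s x $ j)" for j by (rule lloc_bounded[OF F2.u_slice]) (use F2.ubj in blast)
        obtain phi1 where "periodic phi1" "weak_grad phi1 (u1 s)" using elim(3) s by blast
        then obtain f1 where f1: "lloc f1" "!!n. AE x in lborel. f1 (x + lat n) = f1 x" "!!j. bweak f1 j (%x. v1 s x $ j)"
          using weak_grad_borel_potential[OF _ _ l1] elim(1) s by blast
        obtain phi2 where "periodic phi2" "weak_grad phi2 (u2 s)" using elim(4) s by blast
        then obtain f2 where f2: "lloc f2" "!!n. AE x in lborel. f2 (x + lat n) = f2 x" "!!j. bweak f2 j (%x. v2 s x $ j)"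
          using weak_grad_borel_potential[OF _ _ l2] elim(2) s by blast
        have "AE x in lborel. f1 (x + lat n) - f2 (x + lat n) = f1 x - f2 x" for n using f1(2)[of n] f2(2)[of n] by eventually_elim simp
        moreover have "bweak (%x. f1 x - f2 x) j (%x. (v1 s x - v2 s x) $ j)" for j
          using bweak_diff[OF f1(1) f2(1) l1 l2 f1(3) f2(3)] by simp
        ultimately show "EX phi. lloc phi & (ALL n. AE x in lborel. phi (x + lat n) = phi x) & (ALL j. bweak phi j (%x. (v1 s x - v2 s x) $ j))"
          using lloc_diff[OF f1(1) f2(1)] by (intro exI[of _ "%x. f1 x - f2 x"]) blast
      qed
    qed
  qed
  \<comment> \<open>The closed cube of the statement and the half-open cell differ by a null
    set.\<close>
  have "AE s in lborel. s : {0..T} --> (AE x in lborel. x : cbox 0 One --> v1 (fst (s, x)) (snd (s, x)) = v2 (fst (s, x)) (snd (s, x)))"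
    using velocities_agree
  proof eventually_elim
    case (elim s)
    show ?case
    proof
      assume "s : {0..T}"
      with elim have "AE x in lborel. x : hq --> v1 s x = v2 s x" by blast
      then show "AE x in lborel. x : cbox 0 One --> v1 (fst (s, x)) (snd (s, x)) = v2 (fst (s, x)) (snd (s, x))"
        using AE_hq_cbox by eventually_elim auto
    qed
  qed
  from AE_pair_of_slices[OF F1.um F2.um _ this]
  have "AE z in plb. fst z : {0..T} --> snd z : cbox 0 One --> v1 (fst z) (snd z) = v2 (fst z) (snd z)" by simp
  with uv1 uv2 show ?thesis by eventually_elim auto
qed

end
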